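(* Let $p$ be a prime and $n\in\mathbb{Z}_{\ge 0}$. Let $V=\mathbb{Z}_p^{2n}$ with the quadratic form $Q(x_1,\dots,x_n,y_1,\dots,y_n)=\sum_{i=1}^n x_iy_i$, and let $\mathrm{OGr}_V(\mathbb{Z}_p)$ be the set of maximal isotropic direct summands of $V$, equipped with its natural probability measure. Choose $Z,W\in\mathrm{OGr}_V(\mathbb{Z}_p)$ independently at random, and form $$R=(Z\cap W)\otimes\tfrac{\mathbb{Q}_p}{\mathbb{Z}_p},\qquad S=\Big(Z\otimes\tfrac{\mathbb{Q}_p}{\mathbb{Z}_p}\Big)\cap\Big(W\otimes\tfrac{\mathbb{Q}_p}{\mathbb{Z}_p}\Big)\subseteq V\otimes\tfrac{\mathbb{Q}_p}{\mathbb{Z}_p},\qquad T=S/R,$$ giving a short exact sequence $0\to R\to S\to T\to 0$ of $\mathbb{Z}_p$-modules. (a) For each $n$, the isomorphism class of the sequence $0\to R\to S\to T\to 0$ defines a discrete probability distribution $\mathscr{Q}_{2n}$ on the set of isomorphism classes of short exact sequences of co-finite type $\mathbb{Z}_p$-modules. (b) As $n\to\infty$, the distributions $\mathscr{Q}_{2n}$ converge to a discrete probability distribution $\mathscr{Q}$ (i.e., for each isomorphism class the $\mathscr{Q}_{2n}$-probabilities converge, and the limits form a probability distribution).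
   Context: A $\mathbb{Z}_p$-submodule $Z\subseteq V$ is isotropic if $Q|_Z=0$; a maximal isotropic direct summand of $V$ is an isotropic direct summand (these are free of rank $n$). The natural probability measure on $\mathrm{OGr}_V(\mathbb{Z}_p)$ is the unique Borel probability measure (for the $p$-adic topology) such that for every $e\ge 0$, the image $Z/p^eZ\subseteq V/p^eV$ of a random $Z$ is uniformly distributed among all possible such images. The tensor products are over $\mathbb{Z}_p$ and $Z\otimes\mathbb{Q}_p/\mathbb{Z}_p$, $W\otimes \mathbb{Q}_p/\mathbb{Z}_p$ are viewed as submodules of $V\otimes\mathbb{Q}_p/\mathbb{Z}_p$. A $\mathbb{Z}_p$-module is of co-finite type if it is isomorphic to $(\mathbb{Q}_p/\mathbb{Z}_p)^s\oplus F$ for some $s\ge0$ and finite abelian $p$-group $F$. A discrete probability distribution on a set of isomorphism classes means that the event of lying in each class is measurable and these (countably many) probabilities sum to $1$. *)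

theory Defs
  imports "HOL-Probability.Probability" "HOL-Algebra.AbelCoset" "HOL-Algebra.Module"
begin

section \<open>Modules over a commutative ring\<close>

text \<open>A module is a record over a ring record; its ring multiplication and unit play no role, and
  are left unspecified where there is no natural choice.\<close>

definition power_mod :: "('r, 'm) module \<Rightarrow> nat \<Rightarrow> ('r, nat \<Rightarrow> 'm) module"
  where "power_mod M s =
    \<lparr>carrier = {..<s} \<rightarrow>\<^sub>E carrier M, mult = undefined, one = undefined,
     zero = (\<lambda>i\<in>{..<s}. \<zero>\<^bsub>M\<^esub>),
     add = (\<lambda>f g. \<lambda>i\<in>{..<s}. f i \<oplus>\<^bsub>M\<^esub> g i),
     smult = (\<lambda>a f. \<lambda>i\<in>{..<s}. a \<odot>\<^bsub>M\<^esub> f i)\<rparr>"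

definition sum_mod :: "('r, 'a) module \<Rightarrow> ('r, 'b) module \<Rightarrow> ('r, 'a \<times> 'b) module"
  where "sum_mod M N =
    \<lparr>carrier = carrier M \<times> carrier N, mult = undefined, one = undefined,
     zero = (\<zero>\<^bsub>M\<^esub>, \<zero>\<^bsub>N\<^esub>),
     add = (\<lambda>x y. (fst x \<oplus>\<^bsub>M\<^esub> fst y, snd x \<oplus>\<^bsub>N\<^esub> snd y)),
     smult = (\<lambda>a x. (a \<odot>\<^bsub>M\<^esub> fst x, a \<odot>\<^bsub>N\<^esub> snd x))\<rparr>"

definition quot_mod :: "('r, 'm) module \<Rightarrow> 'm set \<Rightarrow> ('r, 'm set) module"
  where "quot_mod M N =
    \<lparr>carrier = a_rcosets\<^bsub>M\<^esub> N, mult = undefined, one = undefined,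
     zero = N,
     add = set_add M,
     smult = (\<lambda>a C. \<Union>x\<in>C. N +>\<^bsub>M\<^esub> (a \<odot>\<^bsub>M\<^esub> x))\<rparr>"

definition mod_span :: "('r, 'x) ring_scheme \<Rightarrow> ('r, 'm) module \<Rightarrow> 'm set \<Rightarrow> 'm set"
  where "mod_span R M A = \<Inter>{N. submodule N R M \<and> A \<subseteq> N}"

definition mod_hom ::
    "('r, 'x) ring_scheme \<Rightarrow> ('r, 'a) module \<Rightarrow> ('r, 'b) module \<Rightarrow> ('a \<Rightarrow> 'b) set"
  where "mod_hom R M N = {h \<in> carrier M \<rightarrow> carrier N.
    (\<forall>x\<in>carrier M. \<forall>y\<in>carrier M. h (x \<oplus>\<^bsub>M\<^esub> y) = h x \<oplus>\<^bsub>N\<^esub> h y) \<and>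
    (\<forall>a\<in>carrier R. \<forall>x\<in>carrier M. h (a \<odot>\<^bsub>M\<^esub> x) = a \<odot>\<^bsub>N\<^esub> h x)}"

definition mod_iso ::
    "('r, 'x) ring_scheme \<Rightarrow> ('r, 'a) module \<Rightarrow> ('r, 'b) module \<Rightarrow> ('a \<Rightarrow> 'b) set"
  where "mod_iso R M N = {h \<in> mod_hom R M N. bij_betw h (carrier M) (carrier N)}"

definition free_mod :: "('r, 'x) ring_scheme \<Rightarrow> 'a set \<Rightarrow> ('r, 'a \<Rightarrow> 'r) module"
  where "free_mod R X =
    \<lparr>carrier = {f. (\<forall>x. f x \<in> carrier R) \<and> (\<forall>x. x \<notin> X \<longrightarrow> f x = \<zero>\<^bsub>R\<^esub>) \<and> finite {x. f x \<noteq> \<zero>\<^bsub>R\<^esub>}},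
     mult = undefined, one = undefined,
     zero = (\<lambda>_. \<zero>\<^bsub>R\<^esub>),
     add = (\<lambda>f g x. f x \<oplus>\<^bsub>R\<^esub> g x),
     smult = (\<lambda>a f x. a \<otimes>\<^bsub>R\<^esub> f x)\<rparr>"

definition free_gen :: "('r, 'x) ring_scheme \<Rightarrow> 'a \<Rightarrow> 'a \<Rightarrow> 'r"
  where "free_gen R x = (\<lambda>y. if y = x then \<one>\<^bsub>R\<^esub> else \<zero>\<^bsub>R\<^esub>)"


subsection \<open>Tensor products\<close>

definition tensor_rels ::
    "('r, 'x) ring_scheme \<Rightarrow> ('r, 'a) module \<Rightarrow> ('r, 'b) module \<Rightarrow> ('a \<times> 'b \<Rightarrow> 'r) set"
  where "tensor_rels R M N = (let F = free_mod R (carrier M \<times> carrier N); g = free_gen R in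
    mod_span R F
     ({g (x \<oplus>\<^bsub>M\<^esub> x', y) \<ominus>\<^bsub>F\<^esub> (g (x, y) \<oplus>\<^bsub>F\<^esub> g (x', y)) | x x' y.
         x \<in> carrier M \<and> x' \<in> carrier M \<and> y \<in> carrier N} \<union>
      {g (x, y \<oplus>\<^bsub>N\<^esub> y') \<ominus>\<^bsub>F\<^esub> (g (x, y) \<oplus>\<^bsub>F\<^esub> g (x, y')) | x y y'.
         x \<in> carrier M \<and> y \<in> carrier N \<and> y' \<in> carrier N} \<union>
      {g (a \<odot>\<^bsub>M\<^esub> x, y) \<ominus>\<^bsub>F\<^esub> (a \<odot>\<^bsub>F\<^esub> g (x, y)) | a x y.
         a \<in> carrier R \<and> x \<in> carrier M \<and> y \<in> carrier N} \<union>
      {g (x, a \<odot>\<^bsub>N\<^esub> y) \<ominus>\<^bsub>F\<^esub> (a \<odot>\<^bsub>F\<^esub> g (x, y)) | a x y.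
         a \<in> carrier R \<and> x \<in> carrier M \<and> y \<in> carrier N}))"

definition tensor_mod ::
    "('r, 'x) ring_scheme \<Rightarrow> ('r, 'a) module \<Rightarrow> ('r, 'b) module \<Rightarrow> ('r, ('a \<times> 'b \<Rightarrow> 'r) set) module"
  where "tensor_mod R M N =
    quot_mod (free_mod R (carrier M \<times> carrier N)) (tensor_rels R M N)"

definition pure_tensor ::
    "('r, 'x) ring_scheme \<Rightarrow> ('r, 'a) module \<Rightarrow> ('r, 'b) module \<Rightarrow> 'a \<Rightarrow> 'b \<Rightarrow> ('a \<times> 'b \<Rightarrow> 'r) set"
  where "pure_tensor R M N x y =
    tensor_rels R M N +>\<^bsub>free_mod R (carrier M \<times> carrier N)\<^esub> free_gen R (x, y)"

text \<open>For a submodule \<open>Z\<close> of \<open>M\<close>: the image of the natural map from \<open>Z \<otimes> N\<close> to \<open>M \<otimes> N\<close>.  When \<open>Z\<close> is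
  a direct summand of \<open>M\<close> that map is injective, and this is \<open>Z \<otimes> N\<close> viewed inside \<open>M \<otimes> N\<close>.\<close>

definition tensor_sub ::
    "('r, 'x) ring_scheme \<Rightarrow> ('r, 'a) module \<Rightarrow> ('r, 'b) module \<Rightarrow> 'a set \<Rightarrow> ('a \<times> 'b \<Rightarrow> 'r) set set"
  where "tensor_sub R M N Z = mod_span R (tensor_mod R M N)
    {pure_tensor R M N z y | z y. z \<in> Z \<and> y \<in> carrier N}"


subsection \<open>The fraction field of a domain, as a module over the domain\<close>

definition frac_rel :: "('r, 'x) ring_scheme \<Rightarrow> (('r \<times> 'r) \<times> ('r \<times> 'r)) set"
  where "frac_rel R = {((a, b), (c, d)) | a b c d.
    a \<in> carrier R \<and> c \<in> carrier R \<and> b \<in> carrier R - {\<zero>\<^bsub>R\<^esub>} \<and> d \<in> carrier R - {\<zero>\<^bsub>R\<^esub>} \<and>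
    a \<otimes>\<^bsub>R\<^esub> d = c \<otimes>\<^bsub>R\<^esub> b}"

definition frac_elt :: "('r, 'x) ring_scheme \<Rightarrow> 'r \<Rightarrow> 'r \<Rightarrow> ('r \<times> 'r) set"
  where "frac_elt R a b = frac_rel R `` {(a, b)}"

definition frac_mod :: "('r, 'x) ring_scheme \<Rightarrow> ('r, ('r \<times> 'r) set) module"
  where "frac_mod R =
    \<lparr>carrier = (carrier R \<times> (carrier R - {\<zero>\<^bsub>R\<^esub>})) // frac_rel R,
     mult = (\<lambda>X Y. \<Union>(a, b)\<in>X. \<Union>(c, d)\<in>Y. frac_elt R (a \<otimes>\<^bsub>R\<^esub> c) (b \<otimes>\<^bsub>R\<^esub> d)),
     one = frac_elt R \<one>\<^bsub>R\<^esub> \<one>\<^bsub>R\<^esub>,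
     zero = frac_elt R \<zero>\<^bsub>R\<^esub> \<one>\<^bsub>R\<^esub>,
     add = (\<lambda>X Y. \<Union>(a, b)\<in>X. \<Union>(c, d)\<in>Y.
       frac_elt R ((a \<otimes>\<^bsub>R\<^esub> d) \<oplus>\<^bsub>R\<^esub> (c \<otimes>\<^bsub>R\<^esub> b)) (b \<otimes>\<^bsub>R\<^esub> d)),
     smult = (\<lambda>r X. \<Union>(a, b)\<in>X. frac_elt R (r \<otimes>\<^bsub>R\<^esub> a) b)\<rparr>"


subsection \<open>Short exact sequences\<close>

record ('r, 'a, 'b, 'c) mod_seq =
  left_mod :: "('r, 'a) module"
  mid_mod :: "('r, 'b) module"
  right_mod :: "('r, 'c) module"
  left_map :: "'a \<Rightarrow> 'b"
  right_map :: "'b \<Rightarrow> 'c"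

definition short_exact :: "('r, 'x) ring_scheme \<Rightarrow> ('r, 'a, 'b, 'c) mod_seq \<Rightarrow> bool"
  where "short_exact R E \<longleftrightarrow>
    Module.module R (left_mod E) \<and> Module.module R (mid_mod E) \<and> Module.module R (right_mod E) \<and>
    left_map E \<in> mod_hom R (left_mod E) (mid_mod E) \<and>
    right_map E \<in> mod_hom R (mid_mod E) (right_mod E) \<and>
    inj_on (left_map E) (carrier (left_mod E)) \<and>
    left_map E ` carrier (left_mod E) = a_kernel (mid_mod E) (right_mod E) (right_map E) \<and>
    right_map E ` carrier (mid_mod E) = carrier (right_mod E)"

definition seq_iso ::
    "('r, 'x) ring_scheme \<Rightarrow> ('r, 'a, 'b, 'c) mod_seq \<Rightarrow> ('r, 'd, 'e, 'f) mod_seq \<Rightarrow> bool"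
  where "seq_iso R E E' \<longleftrightarrow>
    (\<exists>f\<in>mod_iso R (left_mod E) (left_mod E').
     \<exists>g\<in>mod_iso R (mid_mod E) (mid_mod E').
     \<exists>h\<in>mod_iso R (right_mod E) (right_mod E').
       (\<forall>x\<in>carrier (left_mod E). g (left_map E x) = left_map E' (f x)) \<and>
       (\<forall>x\<in>carrier (mid_mod E). h (right_map E x) = right_map E' (g x)))"


section \<open>The \<open>p\<close>-adic integers, and modules of co-finite type\<close>

text \<open>The inverse limit of the rings of integers modulo \<open>p\<close> to the \<open>e\<close>: the \<open>e\<close>-th term of the
  sequence is the least nonnegative residue at level \<open>e\<close>.\<close>

type_synonym padic = "nat \<Rightarrow> int"

definition Zp :: "nat \<Rightarrow> padic ring"
  where "Zp p =
    \<lparr>carrier = {x. \<forall>e. x e \<in> {0..<int p ^ e} \<and> x (Suc e) mod int p ^ e = x e},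
     mult = (\<lambda>x y e. (x e * y e) mod int p ^ e),
     one = (\<lambda>e. 1 mod int p ^ e),
     zero = (\<lambda>e. 0),
     add = (\<lambda>x y e. (x e + y e) mod int p ^ e)\<rparr>"

definition Zp_mod :: "nat \<Rightarrow> (padic, padic) module"
  where "Zp_mod p =
    \<lparr>carrier = carrier (Zp p), mult = mult (Zp p), one = one (Zp p),
     zero = zero (Zp p), add = add (Zp p), smult = mult (Zp p)\<rparr>"

definition Qp_mod_Zp :: "nat \<Rightarrow> (padic, (padic \<times> padic) set set) module"
  where "Qp_mod_Zp p =
    quot_mod (frac_mod (Zp p)) ((\<lambda>x. frac_elt (Zp p) x \<one>\<^bsub>Zp p\<^esub>) ` carrier (Zp p))"

text \<open>A finite summand has a copy with carrier consisting of natural numbers, so that fixing the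
  element type of \<open>F\<close> is no restriction.\<close>

definition cofinite_type :: "nat \<Rightarrow> (padic, 'm) module \<Rightarrow> bool"
  where "cofinite_type p M \<longleftrightarrow> Module.module (Zp p) M \<and>
    (\<exists>s. \<exists>F :: (padic, nat) module. Module.module (Zp p) F \<and> (\<exists>k. card (carrier F) = p ^ k) \<and>
       mod_iso (Zp p) M (sum_mod (power_mod (Qp_mod_Zp p) s) F) \<noteq> {})"

definition cofinite_ses :: "nat \<Rightarrow> (padic, 'a, 'b, 'c) mod_seq set"
  where "cofinite_ses p = {E. short_exact (Zp p) E \<and>
    cofinite_type p (left_mod E) \<and> cofinite_type p (mid_mod E) \<and> cofinite_type p (right_mod E)}"

text \<open>Modules of co-finite type are countable, so every short exact sequence of them has an
  isomorphic copy with carriers in any given infinite types: for infinite types \<open>'a\<close>, \<open>'b\<close>, \<open>'c\<close> the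
  set below represents all isomorphism classes.\<close>

definition ses_classes :: "nat \<Rightarrow> (padic, 'a, 'b, 'c) mod_seq set set"
  where "ses_classes p = cofinite_ses p //
    {(E, E'). E \<in> cofinite_ses p \<and> E' \<in> cofinite_ses p \<and> seq_iso (Zp p) E E'}"


section \<open>Maximal isotropic direct summands\<close>

text \<open>The coordinate \<open>x\<^sub>i\<close> of the hyperbolic space has index \<open>i - 1\<close>, and \<open>y\<^sub>i\<close> has index \<open>n + i - 1\<close>.\<close>

definition hyp_mod :: "nat \<Rightarrow> nat \<Rightarrow> (padic, nat \<Rightarrow> padic) module"
  where "hyp_mod p n = power_mod (Zp_mod p) (2 * n)"

definition hyp_form :: "nat \<Rightarrow> nat \<Rightarrow> (nat \<Rightarrow> padic) \<Rightarrow> padic"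
  where "hyp_form p n v = (\<Oplus>\<^bsub>Zp p\<^esub>i\<in>{..<n}. v i \<otimes>\<^bsub>Zp p\<^esub> v (n + i))"

definition direct_summand :: "('r, 'x) ring_scheme \<Rightarrow> ('r, 'm) module \<Rightarrow> 'm set \<Rightarrow> bool"
  where "direct_summand R M Z \<longleftrightarrow> submodule Z R M \<and>
    (\<exists>Z'. submodule Z' R M \<and> Z \<inter> Z' = {\<zero>\<^bsub>M\<^esub>} \<and> Z <+>\<^bsub>M\<^esub> Z' = carrier M)"

definition isotropic_summand :: "nat \<Rightarrow> nat \<Rightarrow> (nat \<Rightarrow> padic) set \<Rightarrow> bool"
  where "isotropic_summand p n Z \<longleftrightarrow>
    direct_summand (Zp p) (hyp_mod p n) Z \<and> (\<forall>z\<in>Z. hyp_form p n z = \<zero>\<^bsub>Zp p\<^esub>)"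

definition OGr :: "nat \<Rightarrow> nat \<Rightarrow> (nat \<Rightarrow> padic) set set"
  where "OGr p n = {Z. isotropic_summand p n Z \<and>
    (\<forall>Z'. isotropic_summand p n Z' \<and> Z \<subseteq> Z' \<longrightarrow> Z' = Z)}"


subsection \<open>The natural probability measure\<close>

text \<open>The image of \<open>Z\<close> in \<open>V\<close> modulo \<open>p\<^sup>eV\<close>, as a set of cosets.\<close>

definition reduction :: "nat \<Rightarrow> nat \<Rightarrow> nat \<Rightarrow> (nat \<Rightarrow> padic) set \<Rightarrow> (nat \<Rightarrow> padic) set set"
  where "reduction p n e Z = (let V = hyp_mod p n;
       peV = {add_pow V (p ^ e) v | v. v \<in> carrier V} in
    (\<lambda>z. peV +>\<^bsub>V\<^esub> z) ` Z)"

text \<open>In the \<open>p\<close>-adic topology a basis of neighbourhoods of \<open>Z\<close> is given by the sets of all \<open>Z'\<close>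
  having the same image as \<open>Z\<close> modulo a given power of \<open>p\<close>.\<close>

definition OGr_topology :: "nat \<Rightarrow> nat \<Rightarrow> (nat \<Rightarrow> padic) set topology"
  where "OGr_topology p n = topology_generated_by
    {{Z' \<in> OGr p n. reduction p n e Z' = reduction p n e Z} | e Z. Z \<in> OGr p n}"

definition is_natural_measure :: "nat \<Rightarrow> nat \<Rightarrow> (nat \<Rightarrow> padic) set measure \<Rightarrow> bool"
  where "is_natural_measure p n M \<longleftrightarrow> prob_space M \<and>
    space M = OGr p n \<and> sets M = sigma_sets (OGr p n) {U. openin (OGr_topology p n) U} \<and>
    (\<forall>e. distr M (count_space (reduction p n e ` OGr p n)) (reduction p n e) =
         uniform_count_measure (reduction p n e ` OGr p n))"

definition natural_measure :: "nat \<Rightarrow> nat \<Rightarrow> (nat \<Rightarrow> padic) set measure"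
  where "natural_measure p n = (THE M. is_natural_measure p n M)"


section \<open>The random short exact sequence\<close>

type_synonym tensor_elt = "((nat \<Rightarrow> padic) \<times> (padic \<times> padic) set set \<Rightarrow> padic) set"

definition tensor_QZ :: "nat \<Rightarrow> nat \<Rightarrow> (padic, tensor_elt) module"
  where "tensor_QZ p n = tensor_mod (Zp p) (hyp_mod p n) (Qp_mod_Zp p)"

definition sub_QZ :: "nat \<Rightarrow> nat \<Rightarrow> (nat \<Rightarrow> padic) set \<Rightarrow> tensor_elt set"
  where "sub_QZ p n Z = tensor_sub (Zp p) (hyp_mod p n) (Qp_mod_Zp p) Z"

definition R_mod where
  "R_mod p n Z W = (tensor_QZ p n)\<lparr>carrier := sub_QZ p n (Z \<inter> W)\<rparr>"

definition S_mod where
  "S_mod p n Z W = (tensor_QZ p n)\<lparr>carrier := sub_QZ p n Z \<inter> sub_QZ p n W\<rparr>"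

definition T_mod where
  "T_mod p n Z W = quot_mod (S_mod p n Z W) (carrier (R_mod p n Z W))"

definition RST_seq ::
    "nat \<Rightarrow> nat \<Rightarrow> (nat \<Rightarrow> padic) set \<Rightarrow> (nat \<Rightarrow> padic) set \<Rightarrow>
      (padic, tensor_elt, tensor_elt, tensor_elt set) mod_seq"
  where "RST_seq p n Z W =
    \<lparr>left_mod = R_mod p n Z W, mid_mod = S_mod p n Z W, right_mod = T_mod p n Z W,
     left_map = (\<lambda>x. x),
     right_map = (\<lambda>x. carrier (R_mod p n Z W) +>\<^bsub>S_mod p n Z W\<^esub> x)\<rparr>"

text \<open>Two independent random choices are modelled by the product measure.\<close>

definition pair_measure_OGr ::
    "nat \<Rightarrow> nat \<Rightarrow> ((nat \<Rightarrow> padic) set \<times> (nat \<Rightarrow> padic) set) measure"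
  where "pair_measure_OGr p n = natural_measure p n \<Otimes>\<^sub>M natural_measure p n"

definition class_event ::
    "nat \<Rightarrow> nat \<Rightarrow> (padic, tensor_elt, tensor_elt, tensor_elt set) mod_seq set \<Rightarrow>
      ((nat \<Rightarrow> padic) set \<times> (nat \<Rightarrow> padic) set) set"
  where "class_event p n C = {(Z, W). Z \<in> OGr p n \<and> W \<in> OGr p n \<and> RST_seq p n Z W \<in> C}"

definition Q_dist ::
    "nat \<Rightarrow> nat \<Rightarrow> (padic, tensor_elt, tensor_elt, tensor_elt set) mod_seq set \<Rightarrow> real"
  where "Q_dist p n C = measure (pair_measure_OGr p n) (class_event p n C)"

definition discrete_distribution :: "'c set \<Rightarrow> ('c \<Rightarrow> real) \<Rightarrow> bool"
  where "discrete_distribution A P \<longleftrightarrow> (\<forall>c\<in>A. 0 \<le> P c) \<and> (P has_sum 1) A"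

end

theory Submission
  imports Defs "HOL-Library.Function_Algebras" "HOL-Number_Theory.Number_Theory"
begin

text \<open>All pairings are computed with integer sequences representing coherent residues, and \<open>OGr\<close> becomes the set of
  Lagrangian submodules, on which the orthogonal group acts transitively (reflections move any primitive isotropic
  vector to any other).  The natural measure is the uniform measure on the limit of the finite sets of reductions.

  By elementary divisors of the pairing of \<open>Z\<close> and \<open>W\<close>, the isomorphism class of the sequence is determined by the
  function \<open>s\<close> that sends \<open>e\<close> to the size of the intersection of the reductions of \<open>Z\<close> and \<open>W\<close> modulo \<open>p ^ e\<close>; it takes
  countably many values, which gives (a).

  For (b), fix \<open>Z\<close> and an isotropic line modulo \<open>p\<close> in \<open>Z\<close>.  Conditionally on \<open>W\<close> avoiding it, which has probability
  \<open>beta n\<close> at least \<open>1 - p / p ^ n\<close>, the Lagrangian that \<open>W\<close> induces on the hyperbolic space of rank \<open>n\<close> is again uniform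
  and leads to the same \<open>s\<close>.  Averaging over the lines gives
  \<open>(p ^ (n + 1) - s 1) P\<^sub>n\<^sub>+\<^sub>1(s) = (p ^ (n + 1) - 1) beta n P\<^sub>n(s)\<close>, so that \<open>P\<^sub>n(s)\<close> converges for each \<open>s\<close>, and a bound
  of the mean of \<open>s 1\<close> rules out an escape of mass.\<close>

section \<open>Integer sequences and \<open>p\<close>-adic arithmetic\<close>

text \<open>Sequences stay unreduced, so that identities hold in a \<open>comm_ring_1\<close> and
  only \<open>null\<close>, \<open>near\<close> and \<open>eqv\<close> carry the passage to Z_p. A
  reflection \<open>x - B(x,u)/Q(u) u\<close> needs Q(u) to be a unit but never divides by 2, so p =
  2 is treated like any other prime; for the same reason isotropy is stated through
  \<open>qf\<close>. Uniformity is never computed: it is enough that the cells of one level have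
  equal mass, which a transitive group of symmetries provides. The recursion counts in two ways, for
  fixed Z of rank n + 1, the nonzero vectors of Z modulo p outside W: each W contributes
  \<open>p ^ (n + 1) - s 1\<close>, and each of the \<open>p ^ (n + 1) - 1\<close> vectors is
  avoided, jointly with the value s, with probability \<open>beta n\<close> times P_n(s). The same
  count for vectors inside W bounds the mean of \<open>s 1 - 1\<close> by
  \<open>(p ^ (n + 1) - 1) (1 - beta n)\<close>, hence by \<open>p ^ 2\<close> for every n. For
  bounded \<open>s 1\<close> the recursion changes P_n(s) by a relative error of order p^(-n),
  uniformly in s, which gives both the limits and the domination behind tightness.\<close>

typedef intseq = "UNIV :: (nat \<Rightarrow> int) set" morphisms lev Seq by simp

setup_lifting type_definition_intseq

instantiation intseq :: comm_ring_1
begin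
lift_definition zero_intseq :: intseq is "\<lambda>_. 0" .
lift_definition one_intseq :: intseq is "\<lambda>_. 1" .
lift_definition plus_intseq :: "intseq \<Rightarrow> intseq \<Rightarrow> intseq" is "\<lambda>x y e. x e + y e" .
lift_definition minus_intseq :: "intseq \<Rightarrow> intseq \<Rightarrow> intseq" is "\<lambda>x y e. x e - y e" .
lift_definition uminus_intseq :: "intseq \<Rightarrow> intseq" is "\<lambda>x e. - x e" .
lift_definition times_intseq :: "intseq \<Rightarrow> intseq \<Rightarrow> intseq" is "\<lambda>x y e. x e * y e" .
instance by (standard; transfer; auto simp: algebra_simps fun_eq_iff)
end

lemma lev_simps [simp]:
  "lev 0 e = 0" "lev 1 e = 1" "lev (x + y) e = lev x e + lev y e"
  "lev (x - y) e = lev x e - lev y e" "lev (- x) e = - lev x e" "lev (x * y) e = lev x e * lev y e"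
  by (transfer; simp)+

lemma lev_Seq [simp]: "lev (Seq f) = f"
  by (simp add: Seq_inverse)

lemma lev_of_nat [simp]: "lev (of_nat k) e = int k"
  by (induction k) auto

lemma lev_of_int [simp]: "lev (of_int k) e = k"
  by (cases k rule: int_cases2) auto

lemma lev_numeral [simp]: "lev (numeral k) e = numeral k"
  by (metis lev_of_int of_int_numeral)

lemma lev_power [simp]: "lev (x ^ k) e = lev x e ^ k"
  by (induction k) auto

lemma lev_sum [simp]: "lev (sum f A) e = (\<Sum>i\<in>A. lev (f i) e)"
  by (induction A rule: infinite_finite_induct) auto

lemma intseq_eqI: "(\<And>e. lev x e = lev y e) \<Longrightarrow> x = y"
  by (metis ext lev_inverse)

type_synonym vec = "nat \<Rightarrow> intseq"

definition smul :: "'a::times \<Rightarrow> (nat \<Rightarrow> 'a) \<Rightarrow> nat \<Rightarrow> 'a" (infixr "\<triangleright>" 75)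
  where "c \<triangleright> u = (\<lambda>i. c * u i)"

lemma smul_apply [simp]: "(c \<triangleright> u) i = c * u i"
  by (simp add: smul_def)

lemma sum_fun_app [simp]: "(sum f A) i = (\<Sum>j\<in>A. f j i)"
  for f :: "'b \<Rightarrow> 'c \<Rightarrow> 'a::comm_monoid_add"
  by (induction A rule: infinite_finite_induct) auto

text \<open>Vectors of the hyperbolic space are indexed with \<open>x\<^sub>i\<close> at \<open>2i - 2\<close> and \<open>y\<^sub>i\<close> at \<open>2i - 1\<close>, so that
  each space is contained in the next.\<close>

definition bf :: "nat \<Rightarrow> (nat \<Rightarrow> 'a::comm_ring_1) \<Rightarrow> (nat \<Rightarrow> 'a) \<Rightarrow> 'a"
  where "bf n u v = (\<Sum>i<n. u (2*i) * v (2*i+1) + u (2*i+1) * v (2*i))"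

definition qf :: "nat \<Rightarrow> (nat \<Rightarrow> 'a::comm_ring_1) \<Rightarrow> 'a"
  where "qf n u = (\<Sum>i<n. u (2*i) * u (2*i+1))"

lemma bf_add_left: "bf n (u + u') v = bf n u v + bf n u' v"
  by (simp add: bf_def algebra_simps sum.distrib)

lemma bf_add_right: "bf n v (u + u') = bf n v u + bf n v u'"
  by (simp add: bf_def algebra_simps sum.distrib)

lemma bf_diff_left: "bf n (u - u') v = bf n u v - bf n u' v"
  by (simp add: bf_def algebra_simps sum.distrib sum_subtractf)

lemma bf_diff_right: "bf n v (u - u') = bf n v u - bf n v u'"
  by (simp add: bf_def algebra_simps sum.distrib sum_subtractf)

lemma bf_smul_left: "bf n (c \<triangleright> u) v = c * bf n u v"
  by (simp add: bf_def algebra_simps sum_distrib_left)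

lemma bf_smul_right: "bf n v (c \<triangleright> u) = c * bf n v u"
  by (simp add: bf_def algebra_simps sum_distrib_left)

lemma bf_zero [simp]: "bf n 0 v = 0" "bf n v 0 = 0"
  by (simp_all add: bf_def)

lemmas bf_simps = bf_add_left bf_add_right bf_diff_left bf_diff_right bf_smul_left bf_smul_right

lemma bf_commute: "bf n u v = bf n v u"
  by (simp add: bf_def algebra_simps)

lemma qf_add: "qf n (u + v) = qf n u + qf n v + bf n u v"
  by (simp add: qf_def bf_def algebra_simps sum.distrib)

lemma qf_smul: "qf n (c \<triangleright> u) = c * c * qf n u"
  by (simp add: qf_def algebra_simps sum_distrib_left)

lemma qf_zero [simp]: "qf n 0 = 0"
  by (simp add: qf_def)

lemma bf_self: "bf n u u = 2 * qf n u"
  by (simp add: qf_def bf_def algebra_simps sum_distrib_left)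

lemma qf_diff: "qf n (u - v) = qf n u + qf n v - bf n u v"
  by (simp add: qf_def bf_def algebra_simps sum.distrib sum_subtractf)

lemma bf_Suc: "bf (Suc n) u v = bf n u v + (u (2*n) * v (2*n+1) + u (2*n+1) * v (2*n))"
  by (simp add: bf_def)

lemma qf_Suc: "qf (Suc n) u = qf n u + u (2*n) * u (2*n+1)"
  by (simp add: qf_def)

definition bas :: "nat \<Rightarrow> nat \<Rightarrow> 'a::comm_ring_1"
  where "bas i = (\<lambda>j. if j = i then 1 else 0)"

lemma bas_apply: "bas i j = (if j = i then 1 else 0)"
  by (simp add: bas_def)

lemma bf_bas_even: "k < n \<Longrightarrow> bf n v (bas (2*k)) = v (2*k+1)"
proof -
  have "2 * i \<noteq> 2 * k + 1" "2 * i + 1 \<noteq> 2 * k" for i by presburger+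
  then show "k < n \<Longrightarrow> ?thesis" unfolding bf_def bas_def by (simp add: if_distrib[of "(*) _"] sum.delta' cong: if_cong)
qed

lemma bf_bas_odd: "k < n \<Longrightarrow> bf n v (bas (2*k+1)) = v (2*k)"
proof -
  have "2 * i \<noteq> 2 * k + 1" "2 * i + 1 \<noteq> 2 * k" "2 * i + 1 = 2 * k + 1 \<longleftrightarrow> i = k" for i by presburger+
  then show "k < n \<Longrightarrow> ?thesis" unfolding bf_def bas_def by (simp add: if_distrib[of "(*) _"] sum.delta' cong: if_cong)
qed

lemma qf_bas [simp]: "qf n (bas k) = 0"
  unfolding qf_def bas_def by (rule sum.neutral) auto

definition lv :: "nat \<Rightarrow> vec \<Rightarrow> nat \<Rightarrow> int"
  where "lv e u = (\<lambda>i. lev (u i) e)"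

lemma lv_apply [simp]: "lv e u i = lev (u i) e"
  by (simp add: lv_def)

lemma lev_bf: "lev (bf n u v) e = bf n (lv e u) (lv e v)"
  by (simp add: bf_def)

lemma dvd_bf: "(\<And>i. m dvd u i) \<Longrightarrow> m dvd bf n u v"
  unfolding bf_def by (rule dvd_sum) auto

section \<open>Arithmetic of Z_p through coherent sequences modulo null sequences\<close>

locale padic =
  fixes p :: nat
  assumes prime_p: "prime p"
begin

abbreviation P :: "nat \<Rightarrow> int" where "P e \<equiv> int p ^ e"

lemma p_gt_1: "p > 1" and P_pos [simp]: "P e > 0" and P_nz [simp]: "int p \<noteq> 0" "p \<noteq> 0" "p > 0" "P e \<ge> 0" "p \<noteq> Suc 0"
  using prime_gt_1_nat[OF prime_p] by auto

lemma prime_intp: "prime (int p)"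
  using prime_p by simp

lemma P_dvd: "e \<le> f \<Longrightarrow> P e dvd P f"
  by (rule le_imp_power_dvd)

text \<open>Coherent sequences are those that define a point of the inverse limit of the rings
  Z/p^e; two of them define the same point exactly if their difference is
  \<open>null\<close>.\<close>

definition coh :: "intseq \<Rightarrow> bool"
  where "coh x \<longleftrightarrow> (\<forall>e. P e dvd lev x (Suc e) - lev x e)"

definition null :: "intseq \<Rightarrow> bool"
  where "null x \<longleftrightarrow> (\<forall>e. P e dvd lev x e)"

lemma coh_add [simp, intro]: "coh x \<Longrightarrow> coh y \<Longrightarrow> coh (x + y)"
  by (simp add: coh_def) (metis add_diff_add dvd_add)

lemma coh_uminus [simp, intro]: "coh x \<Longrightarrow> coh (- x)"
  by (simp add: coh_def) (metis dvd_minus_iff minus_diff_eq uminus_add_conv_diff)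

lemma coh_diff [simp, intro]: "coh x \<Longrightarrow> coh y \<Longrightarrow> coh (x - y)"
  using coh_add[of x "- y"] by simp

lemma coh_mult [simp, intro]: assumes "coh x" "coh y" shows "coh (x * y)"
  unfolding coh_def
proof
  fix e
  have "lev (x * y) (Suc e) - lev (x * y) e =
      (lev x (Suc e) - lev x e) * lev y (Suc e) + lev x e * (lev y (Suc e) - lev y e)"
    by (simp add: algebra_simps)
  then show "P e dvd lev (x * y) (Suc e) - lev (x * y) e"
    using assms by (simp add: coh_def)
qed

lemma coh_const [simp]: "coh 0" "coh 1" "coh (of_nat k)" "coh (of_int z)"
  by (simp_all add: coh_def)

lemma coh_power [simp, intro]: "coh x \<Longrightarrow> coh (x ^ k)"
  by (induction k) auto

lemma coh_sum [intro]: "(\<And>i. i \<in> A \<Longrightarrow> coh (f i)) \<Longrightarrow> coh (sum f A)"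
  by (induction A rule: infinite_finite_induct) auto

lemma coh_le:
  assumes "coh x" "e \<le> f" shows "P e dvd lev x f - lev x e"
  using assms(2)
proof (induction f rule: dec_induct)
  case (step f)
  have "P e dvd lev x (Suc f) - lev x f"
    using assms(1) P_dvd[OF step(1)] unfolding coh_def by (meson dvd_trans)
  from dvd_add[OF this step(3)] show ?case by simp
qed simp

lemma coh_dvd_iff: "coh x \<Longrightarrow> e \<le> f \<Longrightarrow> P e dvd lev x f \<longleftrightarrow> P e dvd lev x e"
  using coh_le[of x e f] by (metis dvd_add_right_iff diff_add_cancel)

lemma null_add [simp, intro]: "null x \<Longrightarrow> null y \<Longrightarrow> null (x + y)"
  by (simp add: null_def)

lemma null_diff [simp, intro]: "null x \<Longrightarrow> null y \<Longrightarrow> null (x - y)"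
  by (simp add: null_def)

lemma null_uminus [simp]: "null (- x) \<longleftrightarrow> null x"
  by (simp add: null_def)

lemma null_zero [simp]: "null 0"
  by (simp add: null_def)

lemma null_mult [simp, intro]: "null x \<Longrightarrow> null (x * y)" "null x \<Longrightarrow> null (y * x)"
  by (simp_all add: null_def)

lemma null_sum [intro]: "(\<And>i. i \<in> A \<Longrightarrow> null (f i)) \<Longrightarrow> null (sum f A)"
  by (induction A rule: infinite_finite_induct) auto

lemma null_diff_commute: "null (x - y) \<longleftrightarrow> null (y - x)"
  using null_uminus[of "x - y"] by simp

lemma null_cong: "null (x - y) \<Longrightarrow> null x \<longleftrightarrow> null y"
  by (metis null_add null_diff add_diff_cancel diff_add_cancel null_diff_commute)

lemma null_not_unit: "null x \<Longrightarrow> int p dvd lev x 1"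
  unfolding null_def by (metis power_one_right)

lemma coprime_P: "\<not> int p dvd z \<Longrightarrow> coprime z (P e)"
  using prime_imp_coprime[OF prime_intp, of z] by (simp add: coprime_commute)

lemma coh_unit_iff: "coh x \<Longrightarrow> e \<ge> 1 \<Longrightarrow> int p dvd lev x e \<longleftrightarrow> int p dvd lev x 1"
  using coh_dvd_iff[of x 1 e] by simp

text \<open>A unit modulo p is invertible at every level, and inverses modulo p^e are unique, so
  inverses chosen level by level are automatically coherent.\<close>

lemma coh_inverse:
  assumes "coh x" "\<not> int p dvd lev x 1"
  obtains y where "coh y" "null (x * y - 1)"
proof -
  have cop: "coprime (lev x e) (P e)" for e
  proof (cases "e = 0")
    case False
    then show ?thesis using coh_unit_iff[OF assms(1), of e] assms(2) coprime_P[of "lev x e" e] by linarith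
  qed simp
  then have "\<forall>e. \<exists>y. [lev x e * y = 1] (mod P e)"
    using cong_solve_coprime_int by blast
  then obtain y where y: "\<And>e. [lev x e * y e = 1] (mod P e)" by metis
  have d: "P e dvd lev x e * y e - 1" for e
    using y[of e] by (simp add: cong_iff_dvd_diff)
  have "P e dvd y (Suc e) - y e" for e
  proof -
    have "P e dvd lev x (Suc e) * y (Suc e) - 1" using d[of "Suc e"] P_dvd[of e "Suc e"]
      by (meson dvd_trans le_SucI order_refl)
    moreover have "P e dvd lev x (Suc e) - lev x e" using assms(1) by (simp add: coh_def)
    ultimately have "P e dvd (lev x (Suc e) * y (Suc e) - 1) - (lev x (Suc e) - lev x e) * y (Suc e)
        - (lev x e * y e - 1)"
      using d[of e] by (meson dvd_diff dvd_mult2)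
    then have "P e dvd lev x e * (y (Suc e) - y e)" by (simp add: algebra_simps)
    then show ?thesis using cop[of e] by (simp add: coprime_commute coprime_dvd_mult_right_iff)
  qed
  then have "coh (Seq y)" by (simp add: coh_def)
  moreover have "null (x * Seq y - 1)" using d by (simp add: null_def)
  ultimately show ?thesis using that by blast
qed

abbreviation pp :: "nat \<Rightarrow> intseq" where "pp a \<equiv> of_nat (p ^ a)"

lemma lev_pp: "lev (pp a) e = P a"
  by simp

text \<open>Torsion-freeness of Z_p: divisibility of \<open>p ^ a x\<close> at level
  \<open>a + e\<close> gives divisibility of x by p^e at that level, and coherence transports it
  down to level e.\<close>

lemma null_pp_mult_iff: "coh x \<Longrightarrow> null (pp a * x) \<longleftrightarrow> null x"
proof
  assume c: "coh x" and a: "null (pp a * x)"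
  show "null x" unfolding null_def
  proof
    fix e
    have "P (a + e) dvd P a * lev x (a + e)" using a unfolding null_def by (metis lev_pp lev_simps(6))
    then have "P e dvd lev x (a + e)" by (simp add: power_add)
    then show "P e dvd lev x e" using coh_dvd_iff[OF c, of e "a + e"] by simp
  qed
qed auto

lemma coh_divide:
  assumes "coh x" "P a dvd lev x a"
  obtains y where "coh y" "null (x - pp a * y)"
proof -
  \<comment> \<open>Dividing by p^a costs a digits, so the quotient at level e is read off at level
    \<open>a + e\<close>.\<close>
  define y where "y = Seq (\<lambda>e. lev x (a + e) div P a)"
  have d: "P a dvd lev x (a + e)" for e using coh_dvd_iff[OF assms(1), of a "a + e"] assms(2) by simp
  have e: "P a * lev y e = lev x (a + e)" for e using d[of e] by (simp add: y_def)
  have "coh y" unfolding coh_def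
  proof
    fix f
    have "P (a + f) dvd lev x (a + Suc f) - lev x (a + f)" using assms(1) by (simp add: coh_def)
    then have "P a * P f dvd P a * (lev y (Suc f) - lev y f)"
      using e by (simp add: power_add right_diff_distrib)
    then show "P f dvd lev y (Suc f) - lev y f" by simp
  qed
  moreover have "null (x - pp a * y)"
    unfolding null_def using coh_le[OF assms(1)] e by (simp add: dvd_diff_commute)
  ultimately show ?thesis using that by blast
qed

lemma coh_valuation:
  assumes "coh x" "\<not> null x"
  obtains a y where "coh y" "null (x - pp a * y)" "\<not> int p dvd lev y 1"
proof -
  define b where "b = (LEAST e. \<not> P e dvd lev x e)"
  have b: "\<not> P b dvd lev x b" and lt: "\<And>e. e < b \<Longrightarrow> P e dvd lev x e"
    using assms(2) LeastI_ex[of "\<lambda>e. \<not> P e dvd lev x e"] not_less_Least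
    by (auto simp: b_def null_def)
  then obtain a where a: "b = Suc a" by (cases b) auto
  obtain y where y: "coh y" "null (x - pp a * y)" using coh_divide[OF assms(1), of a] lt a by auto
  have "\<not> int p dvd lev y 1"
  proof
    assume "int p dvd lev y 1"
    then have "int p dvd lev y b" using coh_unit_iff[OF y(1), of b] a by simp
    then have "P b dvd P a * lev y b" by (simp add: a)
    moreover have "P b dvd lev x b - P a * lev y b" using y(2) unfolding null_def
      by (metis lev_pp lev_simps(4,6))
    ultimately show False using b by (metis diff_add_cancel dvd_add)
  qed
  with y show ?thesis using that by blast
qed

lemma P_dvd_prod_unit: "coh x \<Longrightarrow> \<not> int p dvd lev x 1 \<Longrightarrow> P e dvd lev x e * z \<longleftrightarrow> P e dvd z"
proof (cases "e = 0")
  case False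
  assume "coh x" "\<not> int p dvd lev x 1"
  then have "coprime (lev x e) (P e)" using coh_unit_iff[of x e] False coprime_P[of "lev x e" e] by linarith
  then show ?thesis by (simp add: coprime_commute coprime_dvd_mult_right_iff)
qed simp

lemma null_unit_mult: "coh x \<Longrightarrow> \<not> int p dvd lev x 1 \<Longrightarrow> null (x * y) \<longleftrightarrow> null y"
  by (simp add: null_def P_dvd_prod_unit)

text \<open>Z_p is a domain: x splits into a power of p and a unit, and neither factor affects
  whether a product is null.\<close>

lemma null_mult_iff:
  assumes "coh x" "coh y" shows "null (x * y) \<longleftrightarrow> null x \<or> null y"
proof (cases "null x")
  case False
  then obtain a z where z: "coh z" "null (x - pp a * z)" "\<not> int p dvd lev z 1"
    using coh_valuation[OF assms(1)] by metis
  have "null (x * y - pp a * (z * y))" using null_mult(1)[OF z(2), of y] by (simp add: algebra_simps)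
  then show ?thesis using False null_cong null_pp_mult_iff[of "z * y" a] null_unit_mult[OF z(1,3), of y] z(1) assms(2)
    by blast
qed auto

end

section \<open>Isometries and isotropic submodules\<close>

context padic begin

text \<open>Coordinates from index \<open>2 * n\<close> on are 0 and not merely \<open>null\<close>;
  hence \<open>V n\<close> is a subset of \<open>V (Suc n)\<close>, and congruences can range over
  all indices.\<close>

definition V :: "nat \<Rightarrow> vec set"
  where "V n = {u. (\<forall>i. coh (u i)) \<and> (\<forall>i\<ge>2*n. u i = 0)}"

text \<open>On \<open>V n\<close> this is congruence modulo p^e. It inspects level e alone;
  coherence carries it to the lower levels (\<open>near_mono\<close>).\<close>

definition near :: "nat \<Rightarrow> vec \<Rightarrow> vec \<Rightarrow> bool"
  where "near e u v \<longleftrightarrow> (\<forall>i. P e dvd lev (u i) e - lev (v i) e)"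

definition eqv :: "vec \<Rightarrow> vec \<Rightarrow> bool"
  where "eqv u v \<longleftrightarrow> (\<forall>i. null (u i - v i))"

lemma eqv_iff_near: "eqv u v \<longleftrightarrow> (\<forall>e. near e u v)"
  unfolding eqv_def near_def null_def by auto

lemma eqv_near: "eqv u v \<Longrightarrow> near e u v"
  by (simp add: eqv_iff_near)

lemma near_refl [simp]: "near e u u"
  by (simp add: near_def)

lemma near_sym: "near e u v \<Longrightarrow> near e v u"
  unfolding near_def by (simp add: dvd_diff_commute)

lemma near_trans [trans]: "near e u v \<Longrightarrow> near e v w \<Longrightarrow> near e u w"
proof -
  have "P e dvd a - c" if "P e dvd a - b" "P e dvd b - c" for a b c
    using dvd_add[OF that] by simp
  then show "near e u v \<Longrightarrow> near e v w \<Longrightarrow> ?thesis" unfolding near_def by blast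
qed

lemma eqv_refl [simp]: "eqv u u" and eqv_sym: "eqv u v \<Longrightarrow> eqv v u"
  and eqv_trans [trans]: "eqv u v \<Longrightarrow> eqv v w \<Longrightarrow> eqv u w"
  unfolding eqv_iff_near using near_sym near_trans by (simp, blast, blast)

lemma near_add: "near e u v \<Longrightarrow> near e u' v' \<Longrightarrow> near e (u + u') (v + v')"
  unfolding near_def by (simp add: add_diff_add)

lemma near_smul: "near e u v \<Longrightarrow> near e (c \<triangleright> u) (c \<triangleright> v)"
  unfolding near_def by (auto simp: right_diff_distrib[symmetric])

lemma near_diff: "near e u v \<Longrightarrow> near e u' v' \<Longrightarrow> near e (u - u') (v - v')"
proof -
  have *: "lev (u i) e - lev (u' i) e - (lev (v i) e - lev (v' i) e) =
    (lev (u i) e - lev (v i) e) - (lev (u' i) e - lev (v' i) e)" for i by simp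
  show "near e u v \<Longrightarrow> near e u' v' \<Longrightarrow> ?thesis"
    unfolding near_def by (simp add: *)
qed

lemma eqv_add: "eqv u v \<Longrightarrow> eqv u' v' \<Longrightarrow> eqv (u + u') (v + v')"
  and eqv_diff: "eqv u v \<Longrightarrow> eqv u' v' \<Longrightarrow> eqv (u - u') (v - v')"
  and eqv_smul: "eqv u v \<Longrightarrow> eqv (c \<triangleright> u) (c \<triangleright> v)"
  unfolding eqv_iff_near using near_add near_diff near_smul by blast+

lemma near_mono: "u \<in> V n \<Longrightarrow> v \<in> V n \<Longrightarrow> e \<le> f \<Longrightarrow> near f u v \<Longrightarrow> near e u v"
  unfolding near_def
proof
  fix i assume a: "u \<in> V n" "v \<in> V n" "e \<le> f" "\<forall>i. P f dvd lev (u i) f - lev (v i) f"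
  have "coh (u i - v i)" using a by (simp add: V_def)
  from coh_dvd_iff[OF this a(3)] a(4) P_dvd[OF a(3)] show "P e dvd lev (u i) e - lev (v i) e"
    by (simp, metis dvd_trans)
qed

lemma near_bf: "near e u u' \<Longrightarrow> near e v v' \<Longrightarrow> P e dvd lev (bf n u v) e - lev (bf n u' v') e"
proof -
  assume a: "near e u u'" "near e v v'"
  have "bf n (lv e u) (lv e v) - bf n (lv e u') (lv e v') = bf n (lv e u - lv e u') (lv e v) + bf n (lv e v - lv e v') (lv e u')"
    by (simp add: bf_simps bf_commute[of n "lv e u'"])
  moreover have "P e dvd bf n (lv e u - lv e u') (lv e v)" "P e dvd bf n (lv e v - lv e v') (lv e u')"
    using a by (auto intro!: dvd_bf simp: near_def)
  ultimately show ?thesis by (simp add: lev_bf)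
qed

lemma near_qf: "near e u u' \<Longrightarrow> P e dvd lev (qf n u) e - lev (qf n u') e"
proof -
  assume a: "near e u u'"
  have "P e dvd lev (u i) e * lev (u j) e - lev (u' i) e * lev (u' j) e" for i j
  proof -
    have "lev (u i) e * lev (u j) e - lev (u' i) e * lev (u' j) e =
      (lev (u i) e - lev (u' i) e) * lev (u j) e + lev (u' i) e * (lev (u j) e - lev (u' j) e)"
      by (simp add: algebra_simps)
    then show ?thesis using a by (simp add: near_def)
  qed
  then show ?thesis by (auto simp: qf_def sum_subtractf[symmetric] intro!: dvd_sum)
qed

lemma eqv_bf: "eqv u u' \<Longrightarrow> eqv v v' \<Longrightarrow> null (bf n u v - bf n u' v')"
  using near_bf by (simp add: null_def eqv_iff_near)

lemma eqv_qf: "eqv u u' \<Longrightarrow> null (qf n u - qf n u')"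
  using near_qf by (simp add: null_def eqv_iff_near)

lemma V_zero [simp, intro]: "0 \<in> V n"
  and V_add [simp, intro]: "u \<in> V n \<Longrightarrow> v \<in> V n \<Longrightarrow> u + v \<in> V n"
  and V_diff [simp, intro]: "u \<in> V n \<Longrightarrow> v \<in> V n \<Longrightarrow> u - v \<in> V n"
  and V_smul [simp, intro]: "coh c \<Longrightarrow> u \<in> V n \<Longrightarrow> c \<triangleright> u \<in> V n"
  and V_bas: "i < 2 * n \<Longrightarrow> bas i \<in> V n"
  and V_Suc: "u \<in> V n \<Longrightarrow> u \<in> V (Suc n)"
  and V_coh: "u \<in> V n \<Longrightarrow> coh (u i)"
  and V_out: "u \<in> V n \<Longrightarrow> i \<ge> 2 * n \<Longrightarrow> u i = 0"
  by (auto simp: V_def bas_def)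

lemma coh_bf: "u \<in> V m \<Longrightarrow> v \<in> V m \<Longrightarrow> coh (bf n u v)"
  unfolding bf_def V_def by (auto intro!: coh_sum)

lemma coh_qf: "u \<in> V m \<Longrightarrow> coh (qf n u)"
  unfolding qf_def V_def by (auto intro!: coh_sum)

lemma V_divide:
  assumes "u \<in> V n" "near a u 0"
  obtains w where "w \<in> V n" "eqv u (pp a \<triangleright> w)"
proof -
  have "\<exists>w. coh w \<and> null (u i - pp a * w) \<and> (i \<ge> 2*n \<longrightarrow> w = 0)" for i
  proof (cases "i \<ge> 2*n")
    case True
    then show ?thesis using V_out[OF assms(1)] by (intro exI[of _ 0]) simp
  next
    case False
    have "P a dvd lev (u i) a" using assms(2) by (simp add: near_def)
    from coh_divide[OF V_coh[OF assms(1)] this] show ?thesis using False by auto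
  qed
  then obtain w where "\<And>i. coh (w i) \<and> null (u i - pp a * w i) \<and> (i \<ge> 2*n \<longrightarrow> w i = 0)" by metis
  then have "w \<in> V n" "eqv u (pp a \<triangleright> w)" by (auto simp: V_def eqv_def)
  then show ?thesis using that by blast
qed

text \<open>Maps act on representatives, so compatibility with \<open>near\<close> is demanded
  separately: it makes \<open>g\<close> act on V modulo every p^e and thereby on classes of
  \<open>eqv\<close>.\<close>

definition isom1 :: "nat \<Rightarrow> (vec \<Rightarrow> vec) \<Rightarrow> bool"
  where "isom1 n g \<longleftrightarrow> (\<forall>u\<in>V n. g u \<in> V n) \<and> (\<forall>u\<in>V n. \<forall>v\<in>V n. g (u + v) = g u + g v) \<and>
    (\<forall>c u. coh c \<longrightarrow> u \<in> V n \<longrightarrow> g (c \<triangleright> u) = c \<triangleright> g u) \<and>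
    (\<forall>e. \<forall>u\<in>V n. \<forall>v\<in>V n. near e u v \<longrightarrow> near e (g u) (g v)) \<and>
    (\<forall>u\<in>V n. null (qf n (g u) - qf n u))"

text \<open>Inverses exist only up to \<open>eqv\<close>, so an isometry \<open>g\<close> is carried
  around together with a chosen inverse \<open>h\<close>.\<close>

definition isop :: "nat \<Rightarrow> (vec \<Rightarrow> vec) \<Rightarrow> (vec \<Rightarrow> vec) \<Rightarrow> bool"
  where "isop n g h \<longleftrightarrow> isom1 n g \<and> isom1 n h \<and> (\<forall>u\<in>V n. eqv (h (g u)) u) \<and> (\<forall>u\<in>V n. eqv (g (h u)) u)"

lemma isom1D:
  assumes "isom1 n g"
  shows "u \<in> V n \<Longrightarrow> g u \<in> V n" "u \<in> V n \<Longrightarrow> v \<in> V n \<Longrightarrow> g (u + v) = g u + g v"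
    "coh c \<Longrightarrow> u \<in> V n \<Longrightarrow> g (c \<triangleright> u) = c \<triangleright> g u"
    "u \<in> V n \<Longrightarrow> v \<in> V n \<Longrightarrow> near e u v \<Longrightarrow> near e (g u) (g v)"
    "u \<in> V n \<Longrightarrow> v \<in> V n \<Longrightarrow> eqv u v \<Longrightarrow> eqv (g u) (g v)"
    "u \<in> V n \<Longrightarrow> null (qf n (g u) - qf n u)"
  using assms by (auto simp: isom1_def eqv_iff_near)

lemma isom1_zero: "isom1 n g \<Longrightarrow> g 0 = 0"
  using isom1D(2)[of n g 0 0] by simp

lemma isom1_bf: "isom1 n g \<Longrightarrow> u \<in> V n \<Longrightarrow> v \<in> V n \<Longrightarrow> null (bf n (g u) (g v) - bf n u v)"
proof -
  assume a: "isom1 n g" "u \<in> V n" "v \<in> V n"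
  have "null ((qf n (g (u + v)) - qf n (u + v)) - (qf n (g u) - qf n u) - (qf n (g v) - qf n v))"
    by (rule null_diff[OF null_diff[OF isom1D(6)[OF a(1) V_add[OF a(2,3)]] isom1D(6)[OF a(1,2)]] isom1D(6)[OF a(1,3)]])
  then show ?thesis using isom1D(2)[OF a] by (simp add: qf_add algebra_simps)
qed

lemma isopD: assumes "isop n g h"
  shows "isom1 n g" "isom1 n h" "u \<in> V n \<Longrightarrow> eqv (h (g u)) u" "u \<in> V n \<Longrightarrow> eqv (g (h u)) u"
  using assms by (auto simp: isop_def)

lemma isop_sym: "isop n g h \<Longrightarrow> isop n h g"
  by (auto simp: isop_def)

lemma isop_id: "isop n (\<lambda>u. u) (\<lambda>u. u)"
  by (auto simp: isop_def isom1_def)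

lemma isom1_comp: "isom1 n g \<Longrightarrow> isom1 n g' \<Longrightarrow> isom1 n (g' \<circ> g)"
proof -
  assume a: "isom1 n g" "isom1 n g'"
  have "null (qf n (g' (g u)) - qf n u)" if "u \<in> V n" for u
    using null_add[OF isom1D(6)[OF a(1) that] isom1D(6)[OF a(2), of "g u"]] isom1D(1)[OF a(1) that] by simp
  then show ?thesis using isom1D[OF a(1)] isom1D[OF a(2)] by (simp add: isom1_def)
qed

lemma isop_comp:
  assumes a: "isop n g h" "isop n g' h'" shows "isop n (g' \<circ> g) (h \<circ> h')"
proof -
  have "eqv (h (h' (g' (g u)))) u" "eqv (g' (g (h (h' u)))) u" if "u \<in> V n" for u
  proof -
    have "eqv (h (h' (g' (g u)))) (h (g u))"
      using isom1D[OF isopD(1)[OF a(1)]] isom1D[OF isopD(1)[OF a(2)]] isom1D[OF isopD(2)[OF a(2)]]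
      by (intro isom1D(5)[OF isopD(2)[OF a(1)]] isopD(3)[OF a(2)]) (auto simp: that)
    then show "eqv (h (h' (g' (g u)))) u" using isopD(3)[OF a(1) that] eqv_trans by blast
    have "eqv (g' (g (h (h' u)))) (g' (h' u))"
      using isom1D[OF isopD(1)[OF a(1)]] isom1D[OF isopD(2)[OF a(1)]] isom1D[OF isopD(2)[OF a(2)]]
      by (intro isom1D(5)[OF isopD(1)[OF a(2)]] isopD(4)[OF a(1)]) (auto simp: that)
    then show "eqv (g' (g (h (h' u)))) u" using isopD(4)[OF a(2) that] eqv_trans by blast
  qed
  then show ?thesis using isom1_comp isopD(1,2)[OF a(1)] isopD(1,2)[OF a(2)] by (simp add: isop_def)
qed

text \<open>Here c stands for 1/Q(u). Since B(u,u) = 2 Q(u), the map is an involution and preserves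
  Q, both up to multiples of the null sequence \<open>c * qf n u - 1\<close>; no division by 2
  occurs.\<close>

lemma reflection:
  assumes u: "u \<in> V n" and c: "coh c" "null (c * qf n u - 1)"
  defines "g \<equiv> \<lambda>x. x - (c * bf n x u) \<triangleright> u"
  shows "isop n g g"
proof -
  have g: "g x \<in> V n" if "x \<in> V n" for x
    using that u c by (auto simp: g_def coh_bf)
  have ga: "g (x + y) = g x + g y" for x y
    unfolding g_def by (rule ext) (simp add: bf_simps algebra_simps)
  have gs: "g (d \<triangleright> x) = d \<triangleright> g x" for d x
    unfolding g_def by (rule ext) (simp add: bf_simps algebra_simps)
  have gn: "near e (g x) (g y)" if n: "near e x y" for e x y
    unfolding near_def
  proof
    fix i
    have "P e dvd lev (bf n x u) e - lev (bf n y u) e" using near_bf[OF n near_refl] .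
    then have "P e dvd (lev (x i) e - lev (y i) e) - lev c e * (lev (bf n x u) e - lev (bf n y u) e) * lev (u i) e"
      using n by (intro dvd_diff[OF _ dvd_mult2[OF dvd_mult]]) (simp add: near_def)
    then show "P e dvd lev (g x i) e - lev (g y i) e" unfolding g_def by (simp add: algebra_simps)
  qed
  have gq: "null (qf n (g x) - qf n x)" for x
  proof -
    have "qf n (g x) - qf n x = (c * qf n u - 1) * (c * bf n x u * bf n x u)"
      by (simp add: g_def qf_diff qf_smul bf_simps algebra_simps)
    then show ?thesis using c by simp
  qed
  have gg: "eqv (g (g x)) x" for x
  proof -
    have "g (g x) i - x i = (c * qf n u - 1) * (2 * c * bf n x u * u i)" for i
      unfolding g_def by (simp add: bf_simps bf_self algebra_simps)
    then show ?thesis using c by (simp add: eqv_def)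
  qed
  show ?thesis using g ga gs gn gq gg by (simp add: isop_def isom1_def)
qed

text \<open>The reflection in \<open>v - w\<close> exchanges \<open>v\<close> and \<open>w\<close>.\<close>
lemma isop_move:
  assumes v: "v \<in> V n" "null (qf n v)" and w: "w \<in> V n" "null (qf n w)"
    and B: "\<not> int p dvd lev (bf n v w) 1"
  obtains g where "isop n g g" "eqv (g v) w"
proof -
  define u where "u = v - w"
  have u: "u \<in> V n" using v w by (simp add: u_def)
  \<comment> \<open>For isotropic v and w one has Q(v - w) = - B(v,w), so the unit hypothesis on B
    makes the reflection in v - w available.\<close>
  have q: "null (qf n u + bf n v w)" using null_add[OF v(2) w(2)] by (simp add: u_def qf_diff)
  have "int p dvd lev (qf n u + bf n v w) 1" using null_not_unit[OF q] .
  then have "\<not> int p dvd lev (qf n u) 1" using B dvd_add_right_iff[of "int p" "lev (qf n u) 1" "lev (bf n v w) 1"] by auto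
  then obtain c where c: "coh c" "null (qf n u * c - 1)" using coh_inverse coh_qf[OF u] by metis
  then have c2: "null (c * qf n u - 1)" by (simp add: mult.commute)
  define g where "g = (\<lambda>x. x - (c * bf n x u) \<triangleright> u)"
  have "isop n g g" unfolding g_def by (rule reflection[OF u c(1) c2])
  moreover have "eqv (g v) w" unfolding eqv_def
  proof
    fix i
    have "g v i - w i = (qf n u + bf n v w) * (c * u i) - (c * qf n u - 1) * u i - qf n v * (2 * c * u i)"
      unfolding g_def by (simp add: u_def bf_simps bf_self algebra_simps)
    then show "null (g v i - w i)" using c2 q v(2)
      by (metis null_mult(1) null_diff)
  qed
  ultimately show ?thesis using that by blast
qed

text \<open>One reflection is enough if v pairs with the target \<open>bas (2*n)\<close> to a unit.
  Otherwise the way leads over an isotropic u that pairs to a unit with both v and the target: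
  \<open>bas (2*n+1)\<close> if the coordinate of v at \<open>2*n\<close> is a unit, and in the
  remaining case \<open>bas (2*n+1) + bas j\<close> with j the partner of i in an earlier
  plane.\<close>

lemma isop_move_bas:
  assumes v: "v \<in> V (Suc n)" "null (qf (Suc n) v)" and i: "\<not> int p dvd lev (v i) 1"
  obtains g h where "isop (Suc n) g h" "eqv (g v) (bas (2*n))"
 proof -
  note th = that
  note b = V_bas[of "2*n" "Suc n", simplified] V_bas[of "2*n+1" "Suc n", simplified]
  have two: thesis
    if u: "u \<in> V (Suc n)" "null (qf (Suc n) u)" "\<not> int p dvd lev (bf (Suc n) v u) 1"
      "\<not> int p dvd lev (u (2*n+1)) 1" for u
  proof -
    obtain g where g: "isop (Suc n) g g" "eqv (g v) u" using isop_move[OF v u(1-3)] .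
    obtain g' where g': "isop (Suc n) g' g'" "eqv (g' u) (bas (2*n))"
      using isop_move[OF u(1,2) b(1)] u(4) bf_bas_even[of n "Suc n" u] by auto
    have "eqv (g' (g v)) (g' u)"
      by (rule isom1D(5)[OF isopD(1)[OF g'(1)] isom1D(1)[OF isopD(1)[OF g(1)] v(1)] u(1) g(2)])
    then have "eqv ((g' \<circ> g) v) (bas (2*n))" using g'(2) eqv_trans by auto
    then show thesis using th isop_comp[OF g(1) g'(1)] by blast
  qed
  show thesis
  proof (cases "int p dvd lev (v (2*n+1)) 1")
    case False
    then show thesis using isop_move[OF v b(1)] bf_bas_even[of n "Suc n" v] that by auto
  next
    case T1: True
    show thesis
    proof (cases "int p dvd lev (v (2*n)) 1")
      case False
      then show thesis using two[of "bas (2*n+1)"] b bf_bas_odd[of n "Suc n" v] by (simp add: bas_apply)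
    next
      case T2: True
      have i2: "i < 2 * n"
      proof (rule ccontr)
        assume "\<not> i < 2 * n"
        then have "i = 2 * n \<or> i = 2 * n + 1 \<or> i \<ge> 2 * Suc n" by auto
        then show False using T1 T2 i V_out[OF v(1)] by auto
      qed
      define k where "k = i div 2"
      \<comment> \<open>The other index of the hyperbolic plane of i, so that pairing with
        \<open>bas j\<close> reads off the coordinate i.\<close>
      define j where "j = (if even i then 2*k+1 else 2*k)"
      have kn: "k < n" and ik: "i = (if even i then 2*k else 2*k+1)" using i2 by (auto simp: k_def)
      then have j: "j < 2 * n" by (auto simp: j_def)
      have bj: "bf (Suc n) w (bas j) = w i" for w :: vec
        using bf_bas_even[of k "Suc n" w] bf_bas_odd[of k "Suc n" w] kn ik by (cases "even i") (auto simp: j_def)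
      define u :: vec where "u = bas (2*n+1) + bas j"
      have "bas (2*n+1) i = (0::intseq)" using i2 by (simp add: bas_apply)
      then have "qf (Suc n) u = 0" unfolding u_def qf_add using bj[of "bas (2*n+1)"] by simp
      moreover have "u \<in> V (Suc n)" using b j V_bas[of j "Suc n"] by (simp add: u_def)
      moreover have "bf (Suc n) v u = v (2*n) + v i"
        using bj[of v] bf_bas_odd[of n "Suc n" v] by (simp add: u_def bf_simps)
      then have "\<not> int p dvd lev (bf (Suc n) v u) 1" using T2 i by (simp add: dvd_add_right_iff)
      moreover have "u (2*n+1) = 1" using j by (simp add: u_def bas_apply)
      ultimately show thesis using two[of u] prime_intp by auto
    qed
  qed
qed

section \<open>Extension of isometries by one hyperbolic plane\<close>

definition trunc :: "nat \<Rightarrow> vec \<Rightarrow> vec"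
  where "trunc n v = (\<lambda>i. if i < 2 * n then v i else 0)"

lemma trunc_V: "v \<in> V m \<Longrightarrow> trunc n v \<in> V n"
  by (auto simp: V_def trunc_def)

lemma trunc_id: "v \<in> V n \<Longrightarrow> trunc n v = v"
  by (rule ext) (auto simp: V_def trunc_def)

lemma trunc_add: "trunc n (u + v) = trunc n u + trunc n v"
  and trunc_smul: "trunc n (c \<triangleright> u) = c \<triangleright> trunc n u"
  by (rule ext, simp add: trunc_def)+

lemma near_trunc: "near e u v \<Longrightarrow> near e (trunc n u) (trunc n v)"
  by (simp add: near_def trunc_def)

text \<open>The orthogonal sum of \<open>g\<close> with the identity of the last hyperbolic
  plane.\<close>

definition lft :: "nat \<Rightarrow> (vec \<Rightarrow> vec) \<Rightarrow> vec \<Rightarrow> vec"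
  where "lft n g v = g (trunc n v) + (v - trunc n v)"

lemma qf_trunc: "qf n (trunc n v) = qf n v"
  by (simp add: qf_def trunc_def)

lemma isom1_lft: assumes "isom1 n g" shows "isom1 (Suc n) (lft n g)"
proof -
  note D = isom1D[OF assms]
  have T: "trunc n v \<in> V n" if "v \<in> V (Suc n)" for v using trunc_V that .
  have 1: "lft n g v \<in> V (Suc n)" if "v \<in> V (Suc n)" for v
    unfolding lft_def by (rule V_add[OF V_Suc[OF D(1)[OF T[OF that]]] V_diff[OF that V_Suc[OF T[OF that]]]])
  have 2: "lft n g (u + v) = lft n g u + lft n g v" if "u \<in> V (Suc n)" "v \<in> V (Suc n)" for u v
    using D(2)[OF T T] that by (simp add: lft_def trunc_add)
  have 3: "lft n g (c \<triangleright> u) = c \<triangleright> lft n g u" if "coh c" "u \<in> V (Suc n)" for c u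
    unfolding lft_def trunc_smul D(3)[OF that(1) T[OF that(2)]] by (rule ext) (simp add: algebra_simps)
  have 4: "near e (lft n g u) (lft n g v)" if "u \<in> V (Suc n)" "v \<in> V (Suc n)" "near e u v" for e u v
    unfolding lft_def using that by (intro near_add near_diff D(4) T near_trunc)
  have 5: "null (qf (Suc n) (lft n g v) - qf (Suc n) v)" if "v \<in> V (Suc n)" for v
  proof -
    have o: "g (trunc n v) i = 0" if "i \<ge> 2*n" for i using V_out[OF D(1)[OF T[OF \<open>v \<in> V (Suc n)\<close>]] that] .
    have "qf n (lft n g v) = qf n (g (trunc n v))" by (simp add: qf_def lft_def trunc_def)
    then have "qf (Suc n) (lft n g v) - qf (Suc n) v = qf n (g (trunc n v)) - qf n (trunc n v)"
      using o by (simp add: qf_Suc lft_def qf_trunc) (simp add: trunc_def)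
    then show ?thesis using D(6)[OF T[OF that]] by simp
  qed
  show ?thesis using 1 2 3 4 5 by (simp add: isom1_def)
qed

lemma trunc_lft: "isom1 n g \<Longrightarrow> v \<in> V (Suc n) \<Longrightarrow> trunc n (lft n g v) = g (trunc n v)"
proof -
  assume "isom1 n g" "v \<in> V (Suc n)"
  then have "g (trunc n v) \<in> V n" using isom1D(1) trunc_V by blast
  then have "i \<ge> 2*n \<Longrightarrow> g (trunc n v) i = 0" for i by (simp add: V_def)
  then show ?thesis by (intro ext) (auto simp: trunc_def lft_def)
qed

lemma isop_lft: assumes "isop n g h" shows "isop (Suc n) (lft n g) (lft n h)"
proof -
  have "eqv (lft n h (lft n g v)) v" if "isop n g h" "v \<in> V (Suc n)" for g h v
  proof -
    have T: "trunc n v \<in> V n" using trunc_V that(2) .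
    have "lft n h (lft n g v) = h (g (trunc n v)) + (v - trunc n v)"
      unfolding lft_def[of n h] trunc_lft[OF isopD(1)[OF that(1)] that(2)] by (simp add: lft_def)
    moreover have "eqv (h (g (trunc n v)) + (v - trunc n v)) (trunc n v + (v - trunc n v))"
      by (rule eqv_add[OF isopD(3)[OF that(1) T] eqv_refl])
    ultimately show ?thesis by simp
  qed
  from this[OF assms] this[OF isop_sym[OF assms]] isom1_lft isopD(1,2)[OF assms]
  show ?thesis by (simp add: isop_def)
qed

text \<open>Closure under \<open>eqv\<close> makes these sets of representatives correspond to the
  submodules of Z_p^(2n).\<close>

definition subm :: "nat \<Rightarrow> vec set \<Rightarrow> bool"
  where "subm n Z \<longleftrightarrow> Z \<subseteq> V n \<and> 0 \<in> Z \<and> (\<forall>u\<in>Z. \<forall>v\<in>Z. u + v \<in> Z) \<and>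
    (\<forall>c. \<forall>u\<in>Z. coh c \<longrightarrow> c \<triangleright> u \<in> Z) \<and> (\<forall>u\<in>V n. \<forall>v\<in>Z. eqv u v \<longrightarrow> u \<in> Z)"

lemma submD: assumes "subm n Z"
  shows "u \<in> Z \<Longrightarrow> u \<in> V n" "0 \<in> Z" "u \<in> Z \<Longrightarrow> v \<in> Z \<Longrightarrow> u + v \<in> Z"
    "u \<in> Z \<Longrightarrow> coh c \<Longrightarrow> c \<triangleright> u \<in> Z" "u \<in> V n \<Longrightarrow> v \<in> Z \<Longrightarrow> eqv u v \<Longrightarrow> u \<in> Z"
    "u \<in> Z \<Longrightarrow> v \<in> Z \<Longrightarrow> u - v \<in> Z"
proof -
  show "u - v \<in> Z" if "u \<in> Z" "v \<in> Z"
  proof -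
    have "(- 1) \<triangleright> v \<in> Z" using assms that unfolding subm_def by (metis coh_const(2) coh_uminus)
    moreover have "u - v = u + (- 1) \<triangleright> v" by (rule ext) simp
    ultimately show ?thesis using assms that unfolding subm_def by metis
  qed
qed (use assms in \<open>auto simp: subm_def\<close>)

lemma submI:
  assumes "\<And>u. u \<in> Z \<Longrightarrow> u \<in> V n" "0 \<in> Z" "\<And>u v. u \<in> Z \<Longrightarrow> v \<in> Z \<Longrightarrow> u + v \<in> Z"
    "\<And>u c. u \<in> Z \<Longrightarrow> coh c \<Longrightarrow> c \<triangleright> u \<in> Z" "\<And>u v. u \<in> V n \<Longrightarrow> v \<in> Z \<Longrightarrow> eqv u v \<Longrightarrow> u \<in> Z"
  shows "subm n Z"
  unfolding subm_def
  by (intro conjI subsetI ballI allI impI) (fact assms(1), fact assms(2), fact assms(3), rule assms(4), assumption+, rule assms(5), assumption+)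

lemma subm_eqv_iff: "subm n Z \<Longrightarrow> u \<in> V n \<Longrightarrow> v \<in> V n \<Longrightarrow> eqv u v \<Longrightarrow> u \<in> Z \<longleftrightarrow> v \<in> Z"
  using submD(5)[of n Z u v] submD(5)[of n Z v u] eqv_sym[of u v] by argo

text \<open>Saturation under division by p is the intrinsic form of being a direct summand of the
  free module V; it can be checked without exhibiting a complement.\<close>

definition iso_sat :: "nat \<Rightarrow> vec set \<Rightarrow> bool"
  where "iso_sat n Z \<longleftrightarrow> subm n Z \<and> (\<forall>u\<in>Z. null (qf n u)) \<and> (\<forall>u\<in>V n. of_nat p \<triangleright> u \<in> Z \<longrightarrow> u \<in> Z)"

lemma iso_satD: assumes "iso_sat n Z"
  shows "subm n Z" "u \<in> Z \<Longrightarrow> null (qf n u)" "u \<in> V n \<Longrightarrow> of_nat p \<triangleright> u \<in> Z \<Longrightarrow> u \<in> Z"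
  using assms by (auto simp: iso_sat_def)

lemma iso_satI:
  assumes "subm n Z" "\<And>u. u \<in> Z \<Longrightarrow> null (qf n u)" "\<And>u. u \<in> V n \<Longrightarrow> of_nat p \<triangleright> u \<in> Z \<Longrightarrow> u \<in> Z"
  shows "iso_sat n Z"
  unfolding iso_sat_def by (intro conjI ballI impI) (fact assms(1), fact assms(2), fact assms(3))

lemma iso_sat_bf: "iso_sat n Z \<Longrightarrow> u \<in> Z \<Longrightarrow> v \<in> Z \<Longrightarrow> null (bf n u v)"
proof -
  assume a: "iso_sat n Z" "u \<in> Z" "v \<in> Z"
  have "null (qf n (u + v) - qf n u - qf n v)"
    using a iso_satD(2)[OF a(1)] submD(3)[OF iso_satD(1)[OF a(1)]] by (intro null_diff) auto
  then show ?thesis by (simp add: qf_add)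
qed

lemma iso_sat_pp: "iso_sat n Z \<Longrightarrow> u \<in> V n \<Longrightarrow> pp a \<triangleright> u \<in> Z \<Longrightarrow> u \<in> Z"
proof (induction a)
  case 0
  have "(1::intseq) \<triangleright> u = u" by (rule ext) simp
  with 0 show ?case by simp
next
  case (Suc a)
  have "of_nat p \<triangleright> (pp a \<triangleright> u) = pp (Suc a) \<triangleright> u" by (rule ext) (simp add: algebra_simps)
  then have "of_nat p \<triangleright> (pp a \<triangleright> u) \<in> Z" using Suc.prems(3) by (simp only:)
  then have "pp a \<triangleright> u \<in> Z" by (rule iso_satD(3)[OF Suc.prems(1) V_smul[OF coh_const(3) Suc.prems(2)]])
  then show ?case using Suc by blast
qed

text \<open>The preimage under \<open>h\<close> stands in for the image under its inverse
  \<open>g\<close>: a preimage inherits closure under \<open>eqv\<close>, whereas an image of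
  representatives need not be closed.\<close>

definition img :: "nat \<Rightarrow> (vec \<Rightarrow> vec) \<Rightarrow> vec set \<Rightarrow> vec set"
  where "img n h Z = {v \<in> V n. h v \<in> Z}"

lemma iso_sat_img:
  assumes "isom1 n h" "iso_sat n Z" shows "iso_sat n (img n h Z)"
proof -
  note D = isom1D[OF assms(1)] and Z = submD[OF iso_satD(1)[OF assms(2)]]
  have 1: "null (qf n u)" if "u \<in> V n" "h u \<in> Z" for u
    using null_cong[OF D(6)[OF that(1)]] iso_satD(2)[OF assms(2) that(2)] by simp
  have 2: "h u \<in> Z" if "u \<in> V n" "h v \<in> Z" "v \<in> V n" "eqv u v" for u v
    by (rule Z(5)[OF D(1)[OF that(1)] that(2) D(5)[OF that(1,3,4)]])
  have 3: "h u \<in> Z" if "u \<in> V n" "h (of_nat p \<triangleright> u) \<in> Z" for u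
    using iso_satD(3)[OF assms(2) D(1)[OF that(1)]] that D(3)[OF coh_const(3) that(1)] by simp
  have 4: "h (u + v) \<in> Z" if "u \<in> V n" "h u \<in> Z" "v \<in> V n" "h v \<in> Z" for u v
    using D(2)[OF that(1,3)] Z(3)[OF that(2,4)] by simp
  have 5: "h (c \<triangleright> u) \<in> Z" if "u \<in> V n" "h u \<in> Z" "coh c" for u c
    using D(3)[OF that(3,1)] Z(4)[OF that(2,3)] by simp
  have 6: "h 0 \<in> Z" using isom1_zero[OF assms(1)] Z(2) by simp
  show ?thesis
  proof (intro iso_satI submI)
    show "u \<in> V n \<Longrightarrow> v \<in> img n h Z \<Longrightarrow> eqv u v \<Longrightarrow> u \<in> img n h Z" for u v
      unfolding img_def by (auto dest: 2)
    show "u \<in> V n \<Longrightarrow> of_nat p \<triangleright> u \<in> img n h Z \<Longrightarrow> u \<in> img n h Z" for u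
      unfolding img_def by (auto dest: 3)
  qed (simp_all add: img_def 1 4 5 6 V_smul)
qed

text \<open>The span of the last k of the n isotropic vectors \<open>bas 0\<close>,
  \<open>bas 2\<close>, and so on. The induction below splits off the last hyperbolic plane first,
  whence the condition \<open>2 * (n - k) \<le> i\<close>.\<close>

definition Ek :: "nat \<Rightarrow> nat \<Rightarrow> vec set"
  where "Ek n k = {u \<in> V n. \<forall>i. null (u i) \<or> even i \<and> 2 * (n - k) \<le> i}"

definition prim :: "vec \<Rightarrow> bool"
  where "prim v \<longleftrightarrow> (\<exists>i. \<not> int p dvd lev (v i) 1)"

text \<open>If p divides every vector of Z, saturation keeps the quotients in Z, so one can divide
  by p again without end; only 0 is infinitely divisible.\<close>

lemma iso_sat_no_prim:
  assumes Z: "iso_sat n Z" and np: "\<And>v. v \<in> Z \<Longrightarrow> \<not> prim v" and v: "v \<in> Z"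
  shows "eqv v 0"
proof -
  have vV: "v \<in> V n" using v submD(1)[OF iso_satD(1)[OF Z]] by blast
  have "near a v 0" for a
  proof (induction a)
    case (Suc a)
    then obtain w where w: "w \<in> V n" "eqv v (pp a \<triangleright> w)" by (rule V_divide[OF vV])
    have "pp a \<triangleright> w \<in> Z" using submD(5)[OF iso_satD(1)[OF Z] V_smul[OF coh_const(3) w(1)] v eqv_sym[OF w(2)]] .
    then have "w \<in> Z" by (rule iso_sat_pp[OF Z w(1)])
    then have "int p dvd lev (w i) 1" for i using np by (auto simp: prim_def)
    then have "P (Suc a) dvd lev ((pp a \<triangleright> w) i) (Suc a)" for i
      using coh_unit_iff[OF V_coh[OF w(1)], of "Suc a" i] by simp
    then have "near (Suc a) (pp a \<triangleright> w) 0" by (simp add: near_def)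
    then show ?case by (rule near_trans[OF eqv_near[OF w(2)]])
  qed (simp add: near_def)
  then show ?thesis by (simp add: eqv_iff_near)
qed

text \<open>A Witt-type normal form. A primitive vector of Z is moved to \<open>bas (2*n)\<close>;
  orthogonality to it kills the coordinate \<open>2*n+1\<close> on the moved submodule, which is
  therefore the line of \<open>bas (2*n)\<close> plus its trace on \<open>V n\<close>, and the
  induction hypothesis applies to that trace.\<close>

theorem iso_sat_elim:
  "iso_sat n Z \<Longrightarrow> \<exists>g h k. isop n g h \<and> k \<le> n \<and> (\<forall>v\<in>V n. v \<in> Z \<longleftrightarrow> g v \<in> Ek n k)"
proof (induction n arbitrary: Z)
  case 0
  have "V 0 = {0}" by (auto simp: V_def)
  then have "v \<in> Z \<longleftrightarrow> v \<in> Ek 0 0" if "v \<in> V 0" for v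
    using that submD(2)[OF iso_satD(1)[OF 0]] by (simp only:) (simp add: Ek_def)
  then show ?case using isop_id by blast
next
  case (Suc n)
  note Z = Suc.prems
  show ?case
  proof (cases "\<exists>v\<in>Z. prim v")
    case False
    then have e: "eqv v 0" if "v \<in> Z" for v using iso_sat_no_prim[OF Z, of v] that False by blast
    have "v \<in> Z \<longleftrightarrow> v \<in> Ek (Suc n) 0" if "v \<in> V (Suc n)" for v
    proof
      show "v \<in> Z \<Longrightarrow> v \<in> Ek (Suc n) 0" using e[of v] that by (simp add: Ek_def eqv_def)
      assume v: "v \<in> Ek (Suc n) 0"
      have "eqv v 0" unfolding eqv_def
      proof
        fix i
        show "null (v i - 0 i)" using v V_out[OF that, of i] by (cases "i \<ge> 2 * Suc n") (auto simp: Ek_def)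
      qed
      then show "v \<in> Z" by (rule submD(5)[OF iso_satD(1)[OF Z] that submD(2)[OF iso_satD(1)[OF Z]]])
    qed
    then show ?thesis using isop_id by blast
  next
    case True
    then obtain v where v: "v \<in> Z" "prim v" by blast
    have vV: "v \<in> V (Suc n)" using v submD(1)[OF iso_satD(1)[OF Z]] by blast
    obtain g h where g: "isop (Suc n) g h" "eqv (g v) (bas (2*n))"
      using isop_move_bas[OF vV iso_satD(2)[OF Z v(1)]] v(2) unfolding prim_def by metis
    define Z1 where "Z1 = img (Suc n) h Z"
    have Z1: "iso_sat (Suc n) Z1" unfolding Z1_def by (rule iso_sat_img[OF isopD(2)[OF g(1)] Z])
    note S1 = submD[OF iso_satD(1)[OF Z1]]
    note D = isom1D[OF isopD(1)[OF g(1)]] and D' = isom1D[OF isopD(2)[OF g(1)]]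
    let ?b = "bas (2*n) :: vec"
    have b: "?b \<in> V (Suc n)" by (rule V_bas) simp
    have gZ: "u \<in> Z \<longleftrightarrow> g u \<in> Z1" if "u \<in> V (Suc n)" for u
      using subm_eqv_iff[OF iso_satD(1)[OF Z] D'(1)[OF D(1)[OF that]] that isopD(3)[OF g(1) that]] D(1)[OF that]
      by (simp add: Z1_def img_def)
    have bZ: "?b \<in> Z1" by (rule S1(5)[OF b _ eqv_sym[OF g(2)]]) (use gZ[OF vV] v(1) in simp)
    define Z' where "Z' = Z1 \<inter> V n"
    have Z': "iso_sat n Z'"
    proof -
      have "qf (Suc n) u = qf n u" if "u \<in> V n" for u using V_out[OF that] by (simp add: qf_Suc)
      then have "null (qf n u)" if "u \<in> Z'" for u
        using iso_satD(2)[OF Z1, of u] that by (simp add: Z'_def)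
      moreover have "subm n Z'" unfolding Z'_def
      proof (intro submI)
        show "u \<in> V n \<Longrightarrow> v \<in> Z1 \<inter> V n \<Longrightarrow> eqv u v \<Longrightarrow> u \<in> Z1 \<inter> V n" for u v
          using S1(5)[OF V_Suc, of u v] by simp
      qed (simp_all add: S1(2,3,4))
      moreover have "u \<in> Z'" if "u \<in> V n" "of_nat p \<triangleright> u \<in> Z'" for u
        using iso_satD(3)[OF Z1 V_Suc[OF that(1)]] that by (simp add: Z'_def)
      ultimately show ?thesis by (intro iso_satI)
    qed
    have in1: "u \<in> Z1 \<longleftrightarrow> trunc n u \<in> Z' \<and> null (u (2*n+1))" if u: "u \<in> V (Suc n)" for u
    proof -
      have T: "trunc n u \<in> V n" using trunc_V u .
      have e: "eqv u (trunc n u + u (2*n) \<triangleright> ?b)" if "null (u (2*n+1))" unfolding eqv_def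
      proof
        fix i
        have "i < 2*n \<or> i = 2*n \<or> i = 2*n+1 \<or> i \<ge> 2 * Suc n" by auto
        then show "null (u i - (trunc n u + u (2*n) \<triangleright> ?b) i)"
          using that V_out[OF u, of i] by (auto simp: trunc_def bas_apply)
      qed
      have cb: "u (2*n) \<triangleright> ?b \<in> Z1" using S1(4)[OF bZ V_coh[OF u]] .
      show ?thesis
      proof
        assume a: "u \<in> Z1"
        have n: "null (u (2*n+1))" using iso_sat_bf[OF Z1 a bZ] bf_bas_even[of n "Suc n" u] by simp
        have "eqv (trunc n u) (u - u (2*n) \<triangleright> ?b)"
          using eqv_diff[OF e[OF n] eqv_refl[of "u (2*n) \<triangleright> ?b"]] eqv_sym by simp
        then have "trunc n u \<in> Z1" by (rule S1(5)[OF V_Suc[OF T] S1(6)[OF a cb]])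
        then show "trunc n u \<in> Z' \<and> null (u (2*n+1))" using T n by (simp add: Z'_def)
      next
        assume a: "trunc n u \<in> Z' \<and> null (u (2*n+1))"
        then have "trunc n u + u (2*n) \<triangleright> ?b \<in> Z1" using S1(3)[OF _ cb] by (simp add: Z'_def)
        then show "u \<in> Z1" using S1(5)[OF u _ e] a by simp
      qed
    qed
    obtain g' h' k where k: "isop n g' h'" "k \<le> n" "\<And>v. v \<in> V n \<Longrightarrow> v \<in> Z' \<longleftrightarrow> g' v \<in> Ek n k"
      using Suc.IH[OF Z'] by blast
    have L: "isop (Suc n) (lft n g') (lft n h')" by (rule isop_lft[OF k(1)])
    have "u \<in> Z1 \<longleftrightarrow> lft n g' u \<in> Ek (Suc n) (Suc k)" if u: "u \<in> V (Suc n)" for u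
    proof -
      have T: "trunc n u \<in> V n" using trunc_V u .
      have gV: "g' (trunc n u) \<in> V n" using isom1D(1)[OF isopD(1)[OF k(1)] T] .
      have lV: "lft n g' u \<in> V (Suc n)" using isom1D(1)[OF isopD(1)[OF L] u] .
      have lo: "lft n g' u i = g' (trunc n u) i" if "i < 2*n" for i
        using that by (simp add: lft_def trunc_def)
      have hi: "lft n g' u i = u i" if "i \<ge> 2*n" for i
        using that V_out[OF gV that] by (simp add: lft_def trunc_def)
      have "lft n g' u \<in> Ek (Suc n) (Suc k) \<longleftrightarrow> g' (trunc n u) \<in> Ek n k \<and> null (u (2*n+1))" (is "?l \<longleftrightarrow> ?r")
      proof
        assume ?l
        then have l: "null (lft n g' u i) \<or> even i \<and> 2 * (n - k) \<le> i" for i by (simp add: Ek_def)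
        have "null (g' (trunc n u) i) \<or> even i \<and> 2 * (n - k) \<le> i" for i
          using l[of i] lo[of i] V_out[OF gV, of i] by (cases "i < 2*n") auto
        then show ?r using gV l[of "2*n+1"] hi[of "2*n+1"] by (auto simp: Ek_def)
      next
        assume r: ?r
        have "null (lft n g' u i) \<or> even i \<and> 2 * (n - k) \<le> i" for i
        proof -
          have "i < 2*n \<or> i = 2*n \<or> i = 2*n+1 \<or> i \<ge> 2 * Suc n" by auto
          then consider "i < 2*n" | "i = 2*n" | "i = 2*n+1" | "i \<ge> 2 * Suc n" by metis
          then show ?thesis
            using r lo[of i] hi[of i] V_out[OF u, of i] by cases (auto simp: Ek_def)
        qed
        then show ?l using lV by (simp add: Ek_def)
      qed
      then show ?thesis using in1[OF u] k(3)[OF T] by simp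
    qed
    then have "\<forall>v\<in>V (Suc n). v \<in> Z \<longleftrightarrow> (lft n g' \<circ> g) v \<in> Ek (Suc n) (Suc k)"
      using gZ D(1) by simp
    then show ?thesis using isop_comp[OF g(1) L] k(2) by (metis Suc_le_mono)
  qed
qed

section \<open>Lagrangian submodules and the transitivity of isometries on them\<close>

definition E :: "nat \<Rightarrow> vec set"
  where "E n = {u \<in> V n. \<forall>i<n. null (u (2*i+1))}"

lemma E_eq_Ek: "E n = Ek n n"
proof -
  have "(\<forall>i<n. null (u (2*i+1))) \<longleftrightarrow> (\<forall>i. null (u i) \<or> even i)" if "u \<in> V n" for u
  proof
    assume a: "\<forall>i<n. null (u (2*i+1))"
    show "\<forall>i. null (u i) \<or> even i"
    proof
      fix i show "null (u i) \<or> even i"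
      proof (cases "i < 2 * n")
        case True
        then show ?thesis using a by (cases "even i") (auto elim!: oddE)
      next
        case False
        then show ?thesis using V_out[OF that, of i] by simp
      qed
    qed
  next
    assume a: "\<forall>i. null (u i) \<or> even i"
    show "\<forall>i<n. null (u (2*i+1))"
    proof (intro allI impI)
      fix i show "null (u (2*i+1))" using a[rule_format, of "2*i+1"] by simp
    qed
  qed
  then show ?thesis by (auto simp: E_def Ek_def)
qed

text \<open>Z is the isotropic part of its own orthogonal complement. This fixed-point form
  expresses maximality without rank or complement, and it is the form that can be verified for
  limits in \<open>Lag_complete\<close>.\<close>

definition Lag :: "nat \<Rightarrow> vec set \<Rightarrow> bool"
  where "Lag n Z \<longleftrightarrow> Z = {v \<in> V n. null (qf n v) \<and> (\<forall>z\<in>Z. null (bf n v z))}"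

lemma LagD:
  assumes "Lag n Z" shows "z \<in> Z \<Longrightarrow> z \<in> V n" "z \<in> Z \<Longrightarrow> null (qf n z)" "z \<in> Z \<Longrightarrow> w \<in> Z \<Longrightarrow> null (bf n z w)"
    "v \<in> V n \<Longrightarrow> null (qf n v) \<Longrightarrow> (\<And>z. z \<in> Z \<Longrightarrow> null (bf n v z)) \<Longrightarrow> v \<in> Z"
proof -
  note L = assms[unfolded Lag_def]
  show "z \<in> Z \<Longrightarrow> z \<in> V n" "z \<in> Z \<Longrightarrow> null (qf n z)" "z \<in> Z \<Longrightarrow> w \<in> Z \<Longrightarrow> null (bf n z w)"
    by (subst (asm) L, blast)+
  show "v \<in> V n \<Longrightarrow> null (qf n v) \<Longrightarrow> (\<And>z. z \<in> Z \<Longrightarrow> null (bf n v z)) \<Longrightarrow> v \<in> Z"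
    by (subst L) blast
qed

lemma Lag_iso_sat: assumes "Lag n Z" shows "iso_sat n Z"
proof -
  note L = LagD[OF assms]
  have 1: "u + v \<in> Z" if "u \<in> Z" "v \<in> Z" for u v
    using that L(1-3) by (intro L(4)) (auto simp: qf_add bf_simps)
  have 2: "c \<triangleright> u \<in> Z" if "u \<in> Z" "coh c" for u c
    using that L(1-3) by (intro L(4)) (auto simp: qf_smul bf_simps)
  have 3: "u \<in> Z" if "u \<in> V n" "v \<in> Z" "eqv u v" for u v
  proof (rule L(4)[OF that(1)])
    show "null (qf n u)" using null_cong[OF eqv_qf[OF that(3)]] L(2)[OF that(2)] by simp
    show "null (bf n u z)" if "z \<in> Z" for z
      using null_cong[OF eqv_bf[OF \<open>eqv u v\<close> eqv_refl[of z]]] L(3)[OF \<open>v \<in> Z\<close> that] by simp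
  qed
  have 4: "u \<in> Z" if "u \<in> V n" "of_nat p \<triangleright> u \<in> Z" for u
  proof (rule L(4)[OF that(1)])
    have "null (of_nat p * (of_nat p * qf n u))" using L(2)[OF that(2)] by (simp add: qf_smul mult.assoc)
    then show "null (qf n u)" using null_pp_mult_iff[of "qf n u" 1] null_pp_mult_iff[of "of_nat p * qf n u" 1]
        coh_qf[OF that(1)] by simp
    show "null (bf n u z)" if "z \<in> Z" for z
    proof -
      have "null (of_nat p * bf n u z)" using L(3)[OF \<open>of_nat p \<triangleright> u \<in> Z\<close> that] by (simp add: bf_simps)
      then show ?thesis using null_pp_mult_iff[of "bf n u z" 1] coh_bf[OF \<open>u \<in> V n\<close> L(1)[OF that]] by simp
    qed
  qed
  show ?thesis
  proof (intro iso_satI submI)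
    show "0 \<in> Z" by (rule L(4)) auto
  qed (fact L(1) 1 2 3 L(2) 4)+
qed

lemma isop_img_E_iff:
  assumes "isop n g h" "v \<in> V n" shows "v \<in> img n g (E n) \<longleftrightarrow> (\<forall>i<n. null (g v (2*i+1)))"
  using assms isom1D(1)[OF isopD(1)] by (auto simp: img_def E_def)

lemma E_forms: assumes "u \<in> E n" shows "null (qf n u)" "w \<in> E n \<Longrightarrow> null (bf n u w)"
  using assms by (auto simp: E_def qf_def bf_def)

text \<open>Maximality is tested on the vectors \<open>h (bas (2*i))\<close>: pairing v with them
  reads off the odd coordinates of \<open>g v\<close>.\<close>

lemma isop_Lag: assumes "isop n g h" shows "Lag n (img n g (E n))"
  unfolding Lag_def
proof (intro equalityI subsetI)
  let ?Z = "img n g (E n)"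
  note D = isom1D[OF isopD(1)[OF assms]] and D' = isom1D[OF isopD(2)[OF assms]]
  {
    fix v assume v: "v \<in> ?Z"
    then have vV: "v \<in> V n" "g v \<in> E n" by (auto simp: img_def)
    have "null (qf n v)" using null_cong[OF D(6)[OF vV(1)]] E_forms(1)[OF vV(2)] by simp
    moreover have "null (bf n v z)" if "z \<in> ?Z" for z
      using null_cong[OF isom1_bf[OF isopD(1)[OF assms] vV(1), of z]] that E_forms(2)[OF vV(2), of "g z"]
      by (simp add: img_def)
    ultimately show "v \<in> {v \<in> V n. null (qf n v) \<and> (\<forall>z\<in>?Z. null (bf n v z))}" using vV by blast
  }
  {
    fix v assume v: "v \<in> {v \<in> V n. null (qf n v) \<and> (\<forall>z\<in>?Z. null (bf n v z))}"
    then have vV: "v \<in> V n" by blast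
    have "null (g v (2*i+1))" if i: "i < n" for i
    proof -
      let ?b = "bas (2*i) :: vec"
      have b: "?b \<in> V n" using i by (intro V_bas) simp
      have gh: "eqv (g (h ?b)) ?b" using isopD(4)[OF assms b] .
      have "null (g (h ?b) (2*j+1))" for j
      proof -
        have "?b (2*j+1) = 0" by (simp add: bas_apply) presburger
        then show ?thesis using gh unfolding eqv_def by (metis diff_zero)
      qed
      then have "h ?b \<in> ?Z" using isop_img_E_iff[OF assms D'(1)[OF b]] by blast
      then have "null (bf n v (h ?b))" using v by blast
      then have "null (bf n (g v) (g (h ?b)))" using null_cong[OF isom1_bf[OF isopD(1)[OF assms] vV D'(1)[OF b]]] by simp
      then have "null (bf n (g v) ?b)" using null_cong[OF eqv_bf[OF eqv_refl gh, of n "g v"]] by simp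
      then show ?thesis using bf_bas_even[OF i] by metis
    qed
    then show "v \<in> ?Z" using isop_img_E_iff[OF assms vV] by blast
  }
qed

lemma iso_sat_maximal:
  assumes Z: "iso_sat n Z"
    and max: "\<And>v. v \<in> V n \<Longrightarrow> null (qf n v) \<Longrightarrow> (\<And>z. z \<in> Z \<Longrightarrow> null (bf n v z)) \<Longrightarrow> v \<in> Z"
  shows "\<exists>g h. isop n g h \<and> Z = img n g (E n)"
proof -
  obtain g h k where k: "isop n g h" "k \<le> n" "\<And>v. v \<in> V n \<Longrightarrow> v \<in> Z \<longleftrightarrow> g v \<in> Ek n k"
    using iso_sat_elim[OF Z] by blast
  note D' = isom1D[OF isopD(2)[OF k(1)]]
  have "k = n"
  proof (rule ccontr)
    assume "k \<noteq> n"
    \<comment> \<open>\<open>2*j\<close> is the largest even index below the range of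
      \<open>Ek n k\<close>. The vector \<open>bas (2*j)\<close> is isotropic and orthogonal to
      \<open>Ek n k\<close>, as pairing with it reads an odd coordinate, but lies outside,
      contradicting maximality.\<close>
    define j where "j = n - k - 1"
    have j: "j < n" "j < n - k" using k(2) \<open>k \<noteq> n\<close> by (auto simp: j_def)
    let ?b = "bas (2*j) :: vec"
    have b: "?b \<in> V n" using j by (intro V_bas) simp
    have gh: "eqv (g (h ?b)) ?b" using isopD(4)[OF k(1) b] .
    have "h ?b \<in> Z"
    proof (rule max)
      show "h ?b \<in> V n" using D'(1)[OF b] .
      show "null (qf n (h ?b))" using D'(6)[OF b] by simp
      fix z assume z: "z \<in> Z"
      have zV: "z \<in> V n" using submD(1)[OF iso_satD(1)[OF Z] z] .
      have "null (g z (2*j+1))" using k(3)[OF zV] z unfolding Ek_def by (metis (no_types, lifting) mem_Collect_eq even_plus_one_iff dvd_triv_left)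
      then have "null (bf n (g z) ?b)" using bf_bas_even[OF j(1)] by metis
      then have "null (bf n (g z) (g (h ?b)))" using null_cong[OF eqv_bf[OF eqv_refl gh, of n "g z"]] by simp
      then have "null (bf n z (h ?b))" using null_cong[OF isom1_bf[OF isopD(1)[OF k(1)] zV D'(1)[OF b]]] by simp
      then show "null (bf n (h ?b) z)" by (simp add: bf_commute)
    qed
    then have "g (h ?b) \<in> Ek n k" using k(3)[OF D'(1)[OF b]] by blast
    then have "null (g (h ?b) (2*j)) \<or> 2 * (n - k) \<le> 2 * j" unfolding Ek_def by blast
    then have "null (g (h ?b) (2*j))" using j by simp
    moreover have n1: "null (g (h ?b) (2*j) - 1)" using gh[unfolded eqv_def, rule_format, of "2*j"] by (simp add: bas_apply)
    ultimately have "null 1" using null_cong[OF n1] by simp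
    then show False using null_not_unit[of 1] p_gt_1 by simp
  qed
  have "Z \<subseteq> V n" using submD(1)[OF iso_satD(1)[OF Z]] by blast
  then have "Z = img n g (E n)" using k(3) \<open>k = n\<close> by (auto simp: img_def E_eq_Ek)
  then show ?thesis using k(1) by blast
qed

lemma Lag_isop: "Lag n Z \<Longrightarrow> \<exists>g h. isop n g h \<and> Z = img n g (E n)"
  by (rule iso_sat_maximal[OF Lag_iso_sat]) (blast intro: LagD(4))+

lemma img_img:
  assumes "isop n g h" "iso_sat n Z" shows "img n g (img n h Z) = Z"
proof -
  note D = isom1D[OF isopD(1)[OF assms(1)]] and D' = isom1D[OF isopD(2)[OF assms(1)]]
  have "h (g v) \<in> Z \<longleftrightarrow> v \<in> Z" if "v \<in> V n" for v
    by (rule subm_eqv_iff[OF iso_satD(1)[OF assms(2)] D'(1)[OF D(1)[OF that]] that isopD(3)[OF assms(1) that]])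
  then show ?thesis using D(1) submD(1)[OF iso_satD(1)[OF assms(2)]] by (auto simp: img_def)
qed

lemma Lag_img: assumes "isop n g h" "Lag n Z" shows "Lag n (img n h Z)"
proof -
  obtain g' h' where g: "isop n g' h'" "Z = img n g' (E n)" using Lag_isop[OF assms(2)] by blast
  have "img n h Z = img n (g' \<circ> h) (E n)" using isom1D(1)[OF isopD(2)[OF assms(1)]] by (auto simp: g img_def)
  then show ?thesis using isop_Lag[OF isop_comp[OF isop_sym[OF assms(1)] g(1)]] by simp
qed

lemma Lag_E: "Lag n (E n)"
proof -
  have "img n (\<lambda>u. u) (E n) = E n" by (auto simp: img_def E_def)
  then show ?thesis using isop_Lag[OF isop_id, of n] by simp
qed

lemma E_iso_sat: "iso_sat n (E n)"
  by (rule Lag_iso_sat[OF Lag_E])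

lemma Lag_transitive:
  assumes "Lag n Z" "Lag n Z'" shows "\<exists>g h. isop n g h \<and> Z' = img n h Z"
proof -
  obtain g1 h1 where 1: "isop n g1 h1" "Z = img n g1 (E n)" using Lag_isop[OF assms(1)] by blast
  obtain g2 h2 where 2: "isop n g2 h2" "Z' = img n g2 (E n)" using Lag_isop[OF assms(2)] by blast
  have "img n (h1 \<circ> g2) Z = img n g2 (img n h1 Z)"
    using isom1D(1)[OF isopD(1)[OF 2(1)]] by (auto simp: img_def)
  also have "\<dots> = Z'" unfolding 1(2) img_img[OF isop_sym[OF 1(1)] E_iso_sat] 2(2) by simp
  finally show ?thesis using isop_comp[OF 1(1) isop_sym[OF 2(1)]] isop_comp[OF 2(1) isop_sym[OF 1(1)]] isop_sym by metis
qed

end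

section \<open>Reductions of Lagrangians\<close>

context padic begin

definition red :: "nat \<Rightarrow> vec \<Rightarrow> nat \<Rightarrow> int"
  where "red e u = (\<lambda>i. lev (u i) e mod P e)"

lemma near_iff_red: "near e u v \<longleftrightarrow> red e u = red e v"
  by (simp add: near_def red_def fun_eq_iff mod_eq_dvd_iff)

lemma red_in_image: "red e u \<in> red e ` Z \<longleftrightarrow> (\<exists>z\<in>Z. near e u z)"
  by (auto simp: near_iff_red)

lemma finite_red: "finite (red e ` V n)"
proof (rule finite_subset)
  show "red e ` V n \<subseteq> {f. \<forall>i. (i \<in> {..<2*n} \<longrightarrow> f i \<in> {0..<P e}) \<and> (i \<notin> {..<2*n} \<longrightarrow> f i = 0)}"
    by (auto simp: red_def V_def)
qed (rule finite_set_of_finite_funs, auto)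

lemma Lag_subset: "Lag n Z \<Longrightarrow> Z \<subseteq> V n"
  using LagD(1) by blast

lemma finite_red_Lag: "Lag n Z \<Longrightarrow> finite (red e ` Z)"
  by (rule finite_subset[OF image_mono[OF Lag_subset] finite_red])

text \<open>Self-duality of the reductions. After moving Z to \<open>E n\<close>, the pairings with
  the vectors \<open>bas (2*k)\<close> show that the odd coordinates vanish modulo p^e, so deleting
  them gives the required vector of Z.\<close>

lemma Lag_level:
  assumes Z: "Lag n Z" and v: "v \<in> V n" and o: "\<And>z. z \<in> Z \<Longrightarrow> P e dvd lev (bf n v z) e"
  shows "\<exists>z\<in>Z. near e v z"
proof -
  obtain g h where g: "isop n g h" "Z = img n g (E n)" using Lag_isop[OF Z] by blast
  note D = isom1D[OF isopD(1)[OF g(1)]] and D' = isom1D[OF isopD(2)[OF g(1)]]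
  define x where "x = (\<lambda>i. if odd i then 0 else g v i)"
  have xV: "x \<in> V n" using D(1)[OF v] by (auto simp: x_def V_def)
  have xE: "x \<in> E n" using xV by (simp add: E_def x_def)
  have "near e (g v) x" unfolding near_def
  proof
    fix i show "P e dvd lev (g v i) e - lev (x i) e"
    proof (cases "odd i \<and> i < 2*n")
      case True
      then obtain k where k: "i = 2*k+1" by (elim conjE oddE)
      then have kn: "k < n" using True by simp
      let ?b = "bas (2*k) :: vec"
      have b: "?b \<in> V n" using kn by (intro V_bas) simp
      have "2 * i + 1 \<noteq> 2 * k" for i by presburger
      then have "?b \<in> E n" using b by (simp add: E_def bas_apply)
      then have gh: "g (h ?b) \<in> E n"
        by (rule submD(5)[OF iso_satD(1)[OF E_iso_sat] D(1)[OF D'(1)[OF b]] _ isopD(4)[OF g(1) b]])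
      then have hZ: "h ?b \<in> Z" using D'(1)[OF b] by (simp add: g(2) img_def)
      have "P e dvd lev (bf n v (h ?b)) e" using o[OF hZ] .
      moreover have "P e dvd lev (bf n (g v) (g (h ?b)) - bf n v (h ?b)) e"
        using isom1_bf[OF isopD(1)[OF g(1)] v D'(1)[OF b]] unfolding null_def by blast
      moreover have "P e dvd lev (bf n (g v) (g (h ?b)) - bf n (g v) ?b) e"
        using eqv_bf[OF eqv_refl isopD(4)[OF g(1) b], of n "g v"] unfolding null_def by blast
      ultimately have "P e dvd lev (bf n (g v) ?b) e"
        by (metis (no_types, lifting) dvd_diff_commute dvd_diffD dvd_add diff_add_cancel lev_simps(4))
      then show ?thesis using k bf_bas_even[OF kn, of "g v"] by (simp add: x_def)
    next
      case False
      then show ?thesis using V_out[OF D(1)[OF v], of i] by (auto simp: x_def)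
    qed
  qed
  then have "near e (h (g v)) (h x)" by (rule D'(4)[OF D(1)[OF v] xV])
  then have "near e v (h x)" using near_trans[OF near_sym[OF eqv_near[OF isopD(3)[OF g(1) v]]]] by blast
  moreover have "g (h x) \<in> E n"
    by (rule submD(5)[OF iso_satD(1)[OF E_iso_sat] D(1)[OF D'(1)[OF xV]] xE isopD(4)[OF g(1) xV]])
  then have "h x \<in> Z" using D'(1)[OF xV] by (simp add: g(2) img_def)
  ultimately show ?thesis by blast
qed

lemma red_img:
  assumes g: "isop n g h" and Z: "Z1 \<subseteq> V n" "iso_sat n Z2" and r: "red e ` Z1 \<subseteq> red e ` Z2"
  shows "red e ` img n h Z1 \<subseteq> red e ` img n h Z2"
proof
  note D = isom1D[OF isopD(1)[OF g(1)]] and D' = isom1D[OF isopD(2)[OF g(1)]]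
  fix x assume "x \<in> red e ` img n h Z1"
  then obtain v where v: "v \<in> V n" "h v \<in> Z1" "x = red e v" by (auto simp: img_def)
  then obtain z where z: "z \<in> Z2" "near e (h v) z" using r by (auto simp: near_iff_red)
  have zV: "z \<in> V n" using z(1) submD(1)[OF iso_satD(1)[OF Z(2)]] by blast
  have "near e (g (h v)) (g z)" by (rule D(4)[OF D'(1)[OF v(1)] zV z(2)])
  then have "near e v (g z)" using near_trans[OF near_sym[OF eqv_near[OF isopD(4)[OF g v(1)]]]] by blast
  moreover have "h (g z) \<in> Z2"
    by (rule submD(5)[OF iso_satD(1)[OF Z(2)] D'(1)[OF D(1)[OF zV]] z(1) isopD(3)[OF g zV]])
  then have "g z \<in> img n h Z2" using D(1)[OF zV] by (simp add: img_def)
  ultimately show "x \<in> red e ` img n h Z2" using v(3) by (auto simp: near_iff_red)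
qed

lemma red_nested:
  assumes "Z \<subseteq> V n" "Z' \<subseteq> V n" "red (Suc e) ` Z \<subseteq> red (Suc e) ` Z'" shows "red e ` Z \<subseteq> red e ` Z'"
proof
  fix x assume "x \<in> red e ` Z"
  then obtain u where u: "u \<in> Z" "x = red e u" by blast
  then obtain v where v: "v \<in> Z'" "near (Suc e) u v" using assms(3) by (auto simp: near_iff_red)
  then have "near e u v" using near_mono[of u n v e "Suc e"] u assms(1,2) by auto
  then show "x \<in> red e ` Z'" using u v by (auto simp: near_iff_red)
qed

lemma red_nested_le:
  assumes "Z \<subseteq> V n" "Z' \<subseteq> V n" "e \<le> f" "red f ` Z \<subseteq> red f ` Z'" shows "red e ` Z \<subseteq> red e ` Z'"
  using assms(3,4) by (induction f rule: dec_induct) (use red_nested[OF assms(1,2)] in blast)+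

text \<open>Completeness of the space of Lagrangians. The limit consists of the vectors whose
  reductions lie in all the given ones. Successive lifting approximates each element of
  \<open>Zs e\<close> modulo p^e by such a vector, and then \<open>Lag_level\<close> at every level
  gives maximality.\<close>

lemma Lag_complete:
  assumes Zs: "\<And>e. Lag n (Zs e)" and step: "\<And>e. red e ` Zs (Suc e) = red e ` Zs e"
  shows "\<exists>Z. Lag n Z \<and> (\<forall>e. red e ` Z = red e ` Zs e)"
proof -
  define Z where "Z = {v \<in> V n. \<forall>e. red e v \<in> red e ` Zs e}"
  have lift: "\<exists>v\<in>Z. near e v x" if x: "x \<in> Zs e" for e x
  proof -
    have "\<exists>z. \<forall>k. (z k \<in> Zs (e + k) \<and> (k = 0 \<longrightarrow> z k = x)) \<and> near (e + k) (z k) (z (Suc k))"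
    proof (rule dependent_nat_choice)
      show "\<exists>z. z \<in> Zs (e + 0) \<and> (0 = 0 \<longrightarrow> z = x)" using x by auto
      fix z k assume "z \<in> Zs (e + k) \<and> (k = 0 \<longrightarrow> z = x)"
      then have "red (e + k) z \<in> red (e + k) ` Zs (Suc (e + k))" using step by blast
      then show "\<exists>y. (y \<in> Zs (e + Suc k) \<and> (Suc k = 0 \<longrightarrow> y = x)) \<and> near (e + k) z y"
        by (auto simp: near_iff_red)
    qed
    then obtain z where z: "\<And>k. z k \<in> Zs (e + k)" "z 0 = x" "\<And>k. near (e + k) (z k) (z (Suc k))" by metis
    have zV: "z k \<in> V n" for k using z(1) LagD(1)[OF Zs] by blast
    \<comment> \<open>Truncated subtraction keeps \<open>y\<close> constantly equal to x below level
      e; from level e on it runs through the lifts.\<close>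
    define y where "y = (\<lambda>f. z (f - e))"
    have yV: "y f \<in> V n" for f using zV by (simp add: y_def)
    \<comment> \<open>The diagonal: level f of v is taken from the approximation number f.\<close>
    define v where "v = (\<lambda>i. Seq (\<lambda>f. lev (y f i) f))"
    have yS: "near f (y f) (y (Suc f))" for f
    proof (cases "e \<le> f")
      case True
      then show ?thesis using z(3)[of "f - e"] by (simp add: y_def Suc_diff_le)
    qed (simp add: y_def)
    have near_v: "near f v (y f)" for f by (simp add: near_def v_def)
    have "coh (v i)" for i unfolding coh_def
    proof
      fix f
      have "P f dvd lev (y (Suc f) i) (Suc f) - lev (y (Suc f) i) f" using V_coh[OF yV] by (simp add: coh_def)
      moreover have "P f dvd lev (y f i) f - lev (y (Suc f) i) f" using yS by (simp add: near_def)
      ultimately have "P f dvd (lev (y (Suc f) i) (Suc f) - lev (y (Suc f) i) f) - (lev (y f i) f - lev (y (Suc f) i) f)"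
        by (rule dvd_diff)
      then show "P f dvd lev (v i) (Suc f) - lev (v i) f" by (simp add: v_def)
    qed
    moreover have "v i = 0" if "2*n \<le> i" for i
      by (rule intseq_eqI) (simp add: v_def V_out[OF yV that])
    ultimately have vV: "v \<in> V n" by (simp add: V_def)
    have "red f v \<in> red f ` Zs f" for f
    proof (cases "e \<le> f")
      case True
      then have "y f \<in> Zs f" using z(1)[of "f - e"] by (simp add: y_def)
      then show ?thesis using near_v by (auto simp: near_iff_red)
    next
      case False
      have "near e v x" using near_v[of e] by (simp add: y_def z)
      then have "near f v x" using near_mono[OF vV _ _ _, of x f e] False zV[of 0] z(2) by simp
      moreover have "red f x \<in> red f ` Zs f"
      proof -
        have "red f ` Zs (f + k) \<subseteq> red f ` Zs f" for k
        proof (induction k)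
          case (Suc k)
          have "red f ` Zs (Suc (f + k)) \<subseteq> red f ` Zs (f + k)"
            using red_nested_le[OF Lag_subset[OF Zs] Lag_subset[OF Zs], of f "f + k" "Suc (f + k)" "f + k"] step[of "f + k"]
            by simp
          then show ?case using Suc by simp
        qed simp
        from this[of "e - f"] show ?thesis using False x by auto
      qed
      ultimately show ?thesis by (simp add: near_iff_red)
    qed
    then have "v \<in> Z" using vV by (simp add: Z_def)
    moreover have "near e v x" using near_v[of e] by (simp add: y_def z)
    ultimately show ?thesis by blast
  qed
  have Zn: "\<exists>x\<in>Zs e. near e v x" if "v \<in> Z" for v e
    using that red_in_image unfolding Z_def by blast
  have "Lag n Z" unfolding Lag_def
  proof (intro equalityI subsetI)
    fix v assume v: "v \<in> Z"
    have "null (qf n v)" unfolding null_def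
    proof
      fix e obtain x where x: "x \<in> Zs e" "near e v x" using Zn[OF v] by blast
      show "P e dvd lev (qf n v) e"
        using near_qf[OF x(2), of n] LagD(2)[OF Zs x(1)] unfolding null_def by (metis diff_add_cancel dvd_add)
    qed
    moreover have "null (bf n v w)" if w: "w \<in> Z" for w unfolding null_def
    proof
      fix e obtain x where x: "x \<in> Zs e" "near e v x" using Zn[OF v] by blast
      obtain y where y: "y \<in> Zs e" "near e w y" using Zn[OF w] by blast
      show "P e dvd lev (bf n v w) e"
        using near_bf[OF x(2) y(2), of n] LagD(3)[OF Zs x(1) y(1)] unfolding null_def
        by (metis diff_add_cancel dvd_add)
    qed
    ultimately show "v \<in> {v \<in> V n. null (qf n v) \<and> (\<forall>z\<in>Z. null (bf n v z))}" using v by (simp add: Z_def)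
  next
    fix v assume "v \<in> {v \<in> V n. null (qf n v) \<and> (\<forall>z\<in>Z. null (bf n v z))}"
    then have v: "v \<in> V n" "\<And>z. z \<in> Z \<Longrightarrow> null (bf n v z)" by blast+
    have "red e v \<in> red e ` Zs e" for e unfolding red_in_image
    proof (rule Lag_level[OF Zs v(1)])
      fix x assume "x \<in> Zs e"
      then obtain z where z: "z \<in> Z" "near e z x" using lift by blast
      have "P e dvd lev (bf n v z) e - lev (bf n v x) e" using near_bf[OF near_refl z(2)] .
      then show "P e dvd lev (bf n v x) e" using v(2)[OF z(1)] unfolding null_def
        by (metis dvd_diff_commute diff_add_cancel dvd_add)
    qed
    then show "v \<in> Z" using v(1) by (simp add: Z_def)
  qed
  moreover have "red e ` Z = red e ` Zs e" for e
  proof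
    show "red e ` Z \<subseteq> red e ` Zs e" by (auto simp: Z_def)
    show "red e ` Zs e \<subseteq> red e ` Z"
    proof
      fix y assume "y \<in> red e ` Zs e"
      then obtain x where x: "x \<in> Zs e" "y = red e x" by blast
      then show "y \<in> red e ` Z" using lift[OF x(1)] by (metis image_eqI near_iff_red)
    qed
  qed
  ultimately show ?thesis by blast
qed

lemma card_red_E: "card (red e ` E n) = p ^ (e * n)"
proof -
  let ?F = "{..<n} \<rightarrow>\<^sub>E {0..<P e}"
  define \<phi> where "\<phi> = (\<lambda>f. \<lambda>i. if even i \<and> i < 2*n then f (i div 2) else 0 :: int)"
  have "bij_betw \<phi> ?F (red e ` E n)"
  proof (rule bij_betw_imageI)
    show "inj_on \<phi> ?F"
    proof (rule inj_onI)
      fix f f' assume f: "f \<in> ?F" "f' \<in> ?F" "\<phi> f = \<phi> f'"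
      show "f = f'"
      proof (rule PiE_ext[OF f(1,2)])
        fix i assume "i \<in> {..<n}"
        then show "f i = f' i" using fun_cong[OF f(3), of "2*i"] by (simp add: \<phi>_def)
      qed
    qed
    show "\<phi> ` ?F = red e ` E n"
    proof (intro equalityI subsetI)
      fix x assume "x \<in> \<phi> ` ?F"
      then obtain f where f: "f \<in> ?F" "x = \<phi> f" by blast
      define u :: vec where "u = (\<lambda>i. of_int (x i))"
      have "u \<in> E n" by (auto simp: u_def E_def V_def f \<phi>_def)
      moreover have "red e u = x"
      proof
        fix i show "red e u i = x i"
        proof (cases "even i \<and> i < 2*n")
          case True
          then have "f (i div 2) \<in> {0..<P e}" using f(1) by (auto simp: PiE_iff)
          then show ?thesis using True by (simp add: red_def u_def f \<phi>_def)
        qed (auto simp: red_def u_def f \<phi>_def)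
      qed
      ultimately show "x \<in> red e ` E n" by blast
    next
      fix x assume "x \<in> red e ` E n"
      then obtain u where u: "u \<in> E n" "x = red e u" by blast
      define f where "f = (\<lambda>i\<in>{..<n}. x (2*i))"
      have "f \<in> ?F" by (auto simp: f_def u red_def)
      moreover have "x = \<phi> f"
      proof
        fix i
        have "null (u i)" if "\<not> (even i \<and> i < 2*n)"
          using that u(1) unfolding E_eq_Ek Ek_def by (cases "i < 2*n") (auto simp: V_out)
        then show "x i = \<phi> f i" by (auto simp: \<phi>_def f_def u red_def null_def)
      qed
      ultimately show "x \<in> \<phi> ` ?F" by blast
    qed
  qed
  then have "card (red e ` E n) = card ?F" by (simp add: bij_betw_same_card)
  also have "\<dots> = p ^ (e * n)" by (simp add: card_PiE power_mult nat_power_eq)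
  finally show ?thesis .
qed

lemma card_red_img:
  assumes g: "isop n g h" and Z: "iso_sat n Z" shows "card (red e ` img n h Z) = card (red e ` Z)"
proof -
  note D = isom1D[OF isopD(1)[OF g(1)]] and D' = isom1D[OF isopD(2)[OF g(1)]]
  note S = submD[OF iso_satD(1)[OF Z]]
  have gi: "g z \<in> img n h Z" if "z \<in> Z" for z
    using S(5)[OF D'(1)[OF D(1)[OF S(1)[OF that]]] that isopD(3)[OF g S(1)[OF that]]] D(1)[OF S(1)[OF that]]
    by (simp add: img_def)
  have sub: "img n h Z \<subseteq> V n" by (auto simp: img_def)
  define \<phi> where "\<phi> x = red e (g (SOME z. z \<in> Z \<and> red e z = x))" for x
  have \<phi>: "\<phi> (red e z) = red e (g z)" if z: "z \<in> Z" for z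
  proof -
    have "(SOME z'. z' \<in> Z \<and> red e z' = red e z) \<in> Z \<and> red e (SOME z'. z' \<in> Z \<and> red e z' = red e z) = red e z"
      by (rule someI[of _ z]) (use z in simp)
    then show ?thesis using D(4) S(1) z unfolding \<phi>_def near_iff_red[symmetric] by blast
  qed
  have "bij_betw \<phi> (red e ` Z) (red e ` img n h Z)"
  proof (rule bij_betw_imageI)
    show "inj_on \<phi> (red e ` Z)"
    proof (rule inj_onI, elim imageE)
      fix x y z w assume a: "\<phi> x = \<phi> y" "x = red e z" "z \<in> Z" "y = red e w" "w \<in> Z"
      then have "near e (g z) (g w)" using \<phi> by (simp add: near_iff_red)
      then have "near e (h (g z)) (h (g w))" by (intro D'(4) D(1) S(1) a)
      then have "near e z w" using eqv_near[OF isopD(3)[OF g S(1)]] a near_trans near_sym by metis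
      then show "x = y" using a by (simp add: near_iff_red)
    qed
    show "\<phi> ` red e ` Z = red e ` img n h Z"
    proof (intro equalityI subsetI)
      fix x assume "x \<in> \<phi> ` red e ` Z"
      then show "x \<in> red e ` img n h Z" using \<phi> gi by auto
    next
      fix x assume "x \<in> red e ` img n h Z"
      then obtain v where v: "v \<in> V n" "h v \<in> Z" "x = red e v" by (auto simp: img_def)
      have "red e (g (h v)) = x" using eqv_near[OF isopD(4)[OF g v(1)]] v(3) by (simp add: near_iff_red)
      then show "x \<in> \<phi> ` red e ` Z" using \<phi>[OF v(2)] v(2) by force
    qed
  qed
  then show ?thesis by (simp add: bij_betw_same_card)
qed

lemma card_red_Lag: "Lag n Z \<Longrightarrow> card (red e ` Z) = p ^ (e * n)"
  using Lag_transitive[OF Lag_E, of n Z] card_red_img[OF _ E_iso_sat] card_red_E by metis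

section \<open>Comparison with maximal isotropic direct summands\<close>

text \<open>Passage to least residues: on coherent sequences this is the map onto the carrier of
  \<open>Zp p\<close>, with the null sequences as kernel.\<close>

definition zc :: "intseq \<Rightarrow> padic"
  where "zc x = (\<lambda>e. lev x e mod P e)"

lemma zc_eq_iff: "zc x = zc y \<longleftrightarrow> null (x - y)"
  by (simp add: zc_def fun_eq_iff null_def mod_eq_dvd_iff)

lemma zc_carrier: "coh x \<Longrightarrow> zc x \<in> carrier (Zp p)"
  unfolding Zp_def zc_def coh_def
  by (auto simp: mod_eq_dvd_iff[symmetric]) (metis dvd_triv_right mod_mod_cancel mult.commute)

lemma Zp_zc: assumes "a \<in> carrier (Zp p)" shows "coh (Seq a)" "zc (Seq a) = a"
proof -
  have a: "a e \<in> {0..<P e}" "a (Suc e) mod P e = a e" for e using assms by (auto simp: Zp_def)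
  have "a (Suc e) mod P e = a e mod P e" for e using a by simp
  then show "coh (Seq a)" by (simp add: coh_def mod_eq_dvd_iff)
  show "zc (Seq a) = a" using a(1) by (simp add: zc_def fun_eq_iff)
qed

lemma Zp_E: assumes "a \<in> carrier (Zp p)" obtains x where "coh x" "a = zc x"
  using Zp_zc[OF assms] by metis

lemma zc_hom:
  "zc x \<oplus>\<^bsub>Zp p\<^esub> zc y = zc (x + y)" "zc x \<otimes>\<^bsub>Zp p\<^esub> zc y = zc (x * y)"
  "\<zero>\<^bsub>Zp p\<^esub> = zc 0" "\<one>\<^bsub>Zp p\<^esub> = zc 1"
  by (simp_all add: zc_def Zp_def mod_simps)

lemma zc_zero_iff: "zc x = \<zero>\<^bsub>Zp p\<^esub> \<longleftrightarrow> null x"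
  by (simp add: zc_hom zc_eq_iff)

lemma Zp_cring: "cring (Zp p)"
proof (rule cringI)
  show "abelian_group (Zp p)"
  proof (rule abelian_groupI)
    fix x assume "x \<in> carrier (Zp p)"
    then obtain a where a: "coh a" "x = zc a" by (rule Zp_E)
    then have "zc (- a) \<in> carrier (Zp p)" "zc (- a) \<oplus>\<^bsub>Zp p\<^esub> x = \<zero>\<^bsub>Zp p\<^esub>"
      using zc_carrier by (auto simp: zc_hom)
    then show "\<exists>y\<in>carrier (Zp p). y \<oplus>\<^bsub>Zp p\<^esub> x = \<zero>\<^bsub>Zp p\<^esub>" by blast
  qed (auto elim!: Zp_E simp: zc_hom zc_carrier algebra_simps)
  show "comm_monoid (Zp p)"
    by (rule comm_monoidI) (auto elim!: Zp_E simp: zc_hom zc_carrier algebra_simps)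
qed (auto elim!: Zp_E simp: zc_hom zc_carrier algebra_simps)

text \<open>Translates the convention of \<open>hyp_mod\<close> (all x coordinates, then all y
  coordinates) into the interleaved one of \<open>V n\<close>.\<close>

definition idx :: "nat \<Rightarrow> nat \<Rightarrow> nat"
  where "idx n j = (if j < n then 2 * j else 2 * (j - n) + 1)"

lemma idx_bij: "bij_betw (idx n) {..<2*n} {..<2*n}"
proof (rule bij_betw_byWitness[where f' = "\<lambda>i. if even i then i div 2 else n + i div 2"])
  show "\<forall>a\<in>{..<2*n}. (if even (idx n a) then idx n a div 2 else n + idx n a div 2) = a"
    by (auto simp: idx_def)
  show "\<forall>a'\<in>{..<2*n}. idx n (if even a' then a' div 2 else n + a' div 2) = a'"
    by (auto simp: idx_def)
qed (auto simp: idx_def)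

definition ofr :: "nat \<Rightarrow> vec \<Rightarrow> nat \<Rightarrow> padic"
  where "ofr n u = (\<lambda>j\<in>{..<2*n}. zc (u (idx n j)))"

lemma hyp_simps:
  "carrier (hyp_mod p n) = {..<2*n} \<rightarrow>\<^sub>E carrier (Zp p)"
  "x \<oplus>\<^bsub>hyp_mod p n\<^esub> y = (\<lambda>i\<in>{..<2*n}. x i \<oplus>\<^bsub>Zp p\<^esub> y i)"
  "a \<odot>\<^bsub>hyp_mod p n\<^esub> x = (\<lambda>i\<in>{..<2*n}. a \<otimes>\<^bsub>Zp p\<^esub> x i)"
  "\<zero>\<^bsub>hyp_mod p n\<^esub> = (\<lambda>i\<in>{..<2*n}. \<zero>\<^bsub>Zp p\<^esub>)"
  by (simp_all add: hyp_mod_def power_mod_def Zp_mod_def)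

lemma ofr_carrier: "u \<in> V n \<Longrightarrow> ofr n u \<in> carrier (hyp_mod p n)"
  by (auto simp: ofr_def hyp_simps zc_carrier V_coh)

lemma ofr_hom:
  "ofr n u \<oplus>\<^bsub>hyp_mod p n\<^esub> ofr n v = ofr n (u + v)"
  "zc c \<odot>\<^bsub>hyp_mod p n\<^esub> ofr n u = ofr n (c \<triangleright> u)"
  "\<zero>\<^bsub>hyp_mod p n\<^esub> = ofr n 0"
  by (auto simp: ofr_def hyp_simps zc_hom fun_eq_iff)

lemma ofr_eq_iff: assumes "u \<in> V n" "v \<in> V n" shows "ofr n u = ofr n v \<longleftrightarrow> eqv u v"
proof
  assume a: "ofr n u = ofr n v"
  show "eqv u v" unfolding eqv_def
  proof
    fix i show "null (u i - v i)"
    proof (cases "i < 2*n")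
      case True
      then obtain j where j: "j < 2*n" "i = idx n j" using idx_bij[of n] unfolding bij_betw_def by auto
      then show ?thesis using fun_cong[OF a, of j] by (simp add: ofr_def zc_eq_iff)
    next
      case False
      then show ?thesis using V_out[OF assms(1), of i] V_out[OF assms(2), of i] by simp
    qed
  qed
next
  assume "eqv u v"
  then have "zc (u i) = zc (v i)" for i by (simp add: zc_eq_iff eqv_def)
  then show "ofr n u = ofr n v" by (simp add: ofr_def)
qed

lemma ofr_surj: assumes "x \<in> carrier (hyp_mod p n)" obtains u where "u \<in> V n" "x = ofr n u"
proof -
  define u where "u = (\<lambda>i. if i < 2*n then Seq (x (if even i then i div 2 else n + i div 2)) else 0)"
  have x: "x j \<in> carrier (Zp p)" if "j < 2*n" for j using assms that by (auto simp: hyp_simps)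
  have "coh (u i)" for i
    using Zp_zc(1)[OF x, of "if even i then i div 2 else n + i div 2"] by (auto simp: u_def)
  then have "u \<in> V n" by (simp add: V_def u_def)
  moreover have "x = ofr n u"
  proof
    fix j show "x j = ofr n u j"
    proof (cases "j < 2*n")
      case True
      then have "idx n j < 2*n" "(if even (idx n j) then idx n j div 2 else n + idx n j div 2) = j"
        by (auto simp: idx_def)
      then have "u (idx n j) = Seq (x j)" by (simp add: u_def)
      then show ?thesis using True Zp_zc(2)[OF x[OF True]] by (simp add: ofr_def)
    next
      case False
      then show ?thesis using assms by (auto simp: ofr_def hyp_simps PiE_def extensional_def)
    qed
  qed
  ultimately show ?thesis using that by blast
qed

lemma smul_simps:
  "(c + d) \<triangleright> u = c \<triangleright> u + d \<triangleright> u" "c \<triangleright> (u + v) = c \<triangleright> u + c \<triangleright> v"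
  "(c * d) \<triangleright> u = c \<triangleright> d \<triangleright> u" "1 \<triangleright> u = u"
  for c d :: "'a::comm_ring_1"
  by (rule ext, simp add: algebra_simps)+

lemma hyp_module: "Module.module (Zp p) (hyp_mod p n)"
proof (rule moduleI[OF Zp_cring])
  show "abelian_group (hyp_mod p n)"
  proof (rule abelian_groupI)
    fix x assume "x \<in> carrier (hyp_mod p n)"
    then obtain u where u: "u \<in> V n" "x = ofr n u" by (rule ofr_surj)
    then have "ofr n (0 - u) \<in> carrier (hyp_mod p n)" "ofr n (0 - u) \<oplus>\<^bsub>hyp_mod p n\<^esub> x = \<zero>\<^bsub>hyp_mod p n\<^esub>"
      using ofr_carrier[OF V_diff[OF V_zero u(1)]] by (simp_all only: ofr_hom u(2) diff_add_cancel)
    then show "\<exists>y\<in>carrier (hyp_mod p n). y \<oplus>\<^bsub>hyp_mod p n\<^esub> x = \<zero>\<^bsub>hyp_mod p n\<^esub>" by blast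
  qed (auto elim!: ofr_surj simp: ofr_hom ofr_carrier algebra_simps)
  show "a \<odot>\<^bsub>hyp_mod p n\<^esub> x \<in> carrier (hyp_mod p n)"
    if "a \<in> carrier (Zp p)" "x \<in> carrier (hyp_mod p n)" for a x
    using that by (auto elim!: Zp_E ofr_surj simp: ofr_hom ofr_carrier V_smul)
qed ((elim Zp_E ofr_surj)?; simp only: zc_hom ofr_hom smul_simps)+

lemma finsum_zc:
  assumes "finite A" "\<And>i. i \<in> A \<Longrightarrow> coh (f i)"
  shows "(\<Oplus>\<^bsub>Zp p\<^esub>i\<in>A. zc (f i)) = zc (\<Sum>i\<in>A. f i)"
proof -
  interpret cring "Zp p" by (rule Zp_cring)
  show ?thesis using assms
  proof (induction A rule: finite_induct)
    case (insert x F)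
    have "(\<Oplus>\<^bsub>Zp p\<^esub>i\<in>insert x F. zc (f i)) = zc (f x) \<oplus>\<^bsub>Zp p\<^esub> (\<Oplus>\<^bsub>Zp p\<^esub>i\<in>F. zc (f i))"
      using insert by (intro finsum_insert) (auto intro: zc_carrier)
    then show ?case using insert by (simp add: zc_hom)
  qed (simp add: zc_hom)
qed

lemma hyp_form_ofr: assumes "u \<in> V n" shows "hyp_form p n (ofr n u) = zc (qf n u)"
proof -
  have "hyp_form p n (ofr n u) = (\<Oplus>\<^bsub>Zp p\<^esub>i\<in>{..<n}. zc (u (2*i) * u (2*i+1)))"
    unfolding hyp_form_def
    by (intro abelian_monoid.finsum_cong' cring.axioms Zp_cring)
      (auto simp: ofr_def idx_def zc_hom ring.is_abelian_group abelian_group.axioms cring.axioms Zp_cring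
        intro!: zc_carrier coh_mult V_coh[OF assms])
  also have "\<dots> = zc (qf n u)" unfolding qf_def by (rule finsum_zc) (auto intro!: V_coh[OF assms])
  finally show ?thesis .
qed

lemma hyp_form_zero_iff: "u \<in> V n \<Longrightarrow> hyp_form p n (ofr n u) = \<zero>\<^bsub>Zp p\<^esub> \<longleftrightarrow> null (qf n u)"
  by (simp add: hyp_form_ofr zc_zero_iff)

lemma submodule_iff:
  assumes "L \<subseteq> V n" "\<And>u v. u \<in> V n \<Longrightarrow> v \<in> L \<Longrightarrow> eqv u v \<Longrightarrow> u \<in> L"
  shows "submodule (ofr n ` L) (Zp p) (hyp_mod p n) \<longleftrightarrow> subm n L"
proof
  interpret M: Module.module "Zp p" "hyp_mod p n" by (rule hyp_module)
  have mem: "ofr n u \<in> ofr n ` L \<longleftrightarrow> u \<in> L" if "u \<in> V n" for u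
    using that assms ofr_eq_iff[OF that] eqv_sym by blast
  {
    assume s: "submodule (ofr n ` L) (Zp p) (hyp_mod p n)"
    note S = M.submoduleE[OF s] 
    show "subm n L"
    proof (rule submI)
      show "u \<in> V n" if "u \<in> L" for u using that assms(1) by blast
      show "0 \<in> L" using subgroup.one_closed[OF submodule.axioms(1)[OF s]] mem[of 0] by (simp add: ofr_hom)
      show "u + v \<in> L" if "u \<in> L" "v \<in> L" for u v
      proof -
        have "ofr n u \<oplus>\<^bsub>hyp_mod p n\<^esub> ofr n v \<in> ofr n ` L"
          using subgroup.m_closed[OF submodule.axioms(1)[OF s], of "ofr n u" "ofr n v"] that by simp
        then show ?thesis using mem[of "u + v"] that assms(1) by (auto simp: ofr_hom)
      qed
      show "c \<triangleright> u \<in> L" if "u \<in> L" "coh c" for u c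
      proof -
        have "zc c \<odot>\<^bsub>hyp_mod p n\<^esub> ofr n u \<in> ofr n ` L"
          using submodule.smult_closed[OF s zc_carrier[OF that(2)], of "ofr n u"] that by simp
        then show ?thesis using mem[OF V_smul[OF that(2), of u]] that assms(1) by (auto simp: ofr_hom)
      qed
    qed (fact assms(2))
  }
  assume s: "subm n L"
  show "submodule (ofr n ` L) (Zp p) (hyp_mod p n)"
  proof (rule M.submoduleI)
    show "ofr n ` L \<subseteq> carrier (hyp_mod p n)" using assms(1) ofr_carrier by blast
    show "\<zero>\<^bsub>hyp_mod p n\<^esub> \<in> ofr n ` L" using submD(2)[OF s] by (simp add: ofr_hom)
    show "x \<oplus>\<^bsub>hyp_mod p n\<^esub> y \<in> ofr n ` L" if "x \<in> ofr n ` L" "y \<in> ofr n ` L" for x y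
      using that submD(3)[OF s] by (auto simp: ofr_hom)
    show a: "a \<odot>\<^bsub>hyp_mod p n\<^esub> x \<in> ofr n ` L" if "a \<in> carrier (Zp p)" "x \<in> ofr n ` L" for a x
      using that submD(4)[OF s] by (auto simp: ofr_hom elim!: Zp_E)
    show "\<ominus>\<^bsub>hyp_mod p n\<^esub> x \<in> ofr n ` L" if "x \<in> ofr n ` L" for x
    proof -
      have x: "x \<in> carrier (hyp_mod p n)" using that assms(1) ofr_carrier by blast
      have "\<ominus>\<^bsub>hyp_mod p n\<^esub> x = (\<ominus>\<^bsub>Zp p\<^esub> \<one>\<^bsub>Zp p\<^esub>) \<odot>\<^bsub>hyp_mod p n\<^esub> x"
        using M.smult_l_minus[OF _ x, of "\<one>\<^bsub>Zp p\<^esub>"] x by simp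
      then show ?thesis using a[of "\<ominus>\<^bsub>Zp p\<^esub> \<one>\<^bsub>Zp p\<^esub>", OF _ that] by simp
    qed
  qed
qed

end

section \<open>Uniform measures on towers of finite sets\<close>

text \<open>\<open>rho e x\<close> is the image of x at level e, and finer levels determine coarser
  ones. The setting is applied both to Lagrangians and to \<open>OGr\<close>, whose uniform measures
  are compared later.\<close>

locale tower =
  fixes X :: "'a set" and rho :: "nat \<Rightarrow> 'a \<Rightarrow> 'b"
  assumes nonempty: "X \<noteq> {}"
    and finite_level: "finite (rho e ` X)"
    and nested: "x \<in> X \<Longrightarrow> y \<in> X \<Longrightarrow> rho (Suc e) x = rho (Suc e) y \<Longrightarrow> rho e x = rho e y"
begin

definition cell :: "nat \<Rightarrow> 'a \<Rightarrow> 'a set"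
  where "cell e x = {y \<in> X. rho e y = rho e x}"

definition cells :: "'a set set"
  where "cells = {cell e x | e x. x \<in> X}"

definition unif :: "'a measure \<Rightarrow> bool"
  where "unif N \<longleftrightarrow> prob_space N \<and> space N = X \<and> sets N = sigma_sets X cells \<and>
    (\<forall>e. \<forall>x\<in>X. measure N (cell e x) = 1 / card (rho e ` X))"

lemma nested_le: "e \<le> f \<Longrightarrow> x \<in> X \<Longrightarrow> y \<in> X \<Longrightarrow> rho f x = rho f y \<Longrightarrow> rho e x = rho e y"
  by (induction f rule: dec_induct) (auto dest: nested)

lemma cell_subset: "cell e x \<subseteq> X"
  by (auto simp: cell_def)

lemma cells_subset: "cells \<subseteq> Pow X"
  by (auto simp: cells_def cell_def)

lemma cell_in_cells: "x \<in> X \<Longrightarrow> cell e x \<in> cells"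
  by (auto simp: cells_def)

lemma countable_cells: "countable cells"
proof -
  have "cells = (\<Union>e. (\<lambda>b. {y \<in> X. rho e y = b}) ` (rho e ` X))"
    by (auto simp: cells_def cell_def)
  then show ?thesis using finite_level by (simp add: countable_finite)
qed

text \<open>Two cells with a common point are nested, since the finer level determines the coarser
  one.\<close>

lemma cell_Int:
  assumes "A \<in> cells" "B \<in> cells" "x \<in> A" "x \<in> B" shows "\<exists>C\<in>cells. x \<in> C \<and> C \<subseteq> A \<inter> B \<and> (C = A \<or> C = B)"
proof -
  obtain e y where A: "A = cell e y" "y \<in> X" using assms(1) by (auto simp: cells_def)
  obtain f z where B: "B = cell f z" "z \<in> X" using assms(2) by (auto simp: cells_def)
  have x: "x \<in> X" "rho e x = rho e y" "rho f x = rho f z" using assms(3,4) A B by (auto simp: cell_def)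
  have AB: "A = cell e x" "B = cell f x" using x by (simp_all add: A B cell_def)
  have "cell f x \<subseteq> cell e x" if "e \<le> f" for e f
  proof
    fix y assume "y \<in> cell f x"
    then show "y \<in> cell e x" using nested_le[OF that, of y x] x(1) by (simp add: cell_def)
  qed
  then have "A \<subseteq> B \<or> B \<subseteq> A" unfolding AB by (cases "e \<le> f") auto
  then show ?thesis
  proof
    assume "A \<subseteq> B"
    then show ?thesis using assms by (intro bexI[of _ A]) auto
  next
    assume "B \<subseteq> A"
    then show ?thesis using assms by (intro bexI[of _ B]) auto
  qed
qed

lemma Int_stable_cells: "Int_stable (insert {} cells)"
proof (rule Int_stableI)
  fix A B assume a: "A \<in> insert {} cells" "B \<in> insert {} cells"
  show "A \<inter> B \<in> insert {} cells"
  proof (cases "A \<inter> B = {}")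
    case False
    then obtain x where x: "x \<in> A" "x \<in> B" by blast
    then have "A \<in> cells" "B \<in> cells" using a by auto
    from cell_Int[OF this x] obtain C where "C \<in> cells" "C \<subseteq> A \<inter> B" "C = A \<or> C = B" by blast
    then have "A \<inter> B = C" by blast
    then show ?thesis using \<open>C \<in> cells\<close> by simp
  qed simp
qed

lemma sigma_sets_insert_cells: "sigma_sets X (insert {} cells) = sigma_sets X cells"
  by (intro equalityI sigma_sets_mono) (auto intro: sigma_sets.Empty sigma_sets.Basic)

text \<open>The cells form a countable base: an open set is the union of the cells inside it, hence
  a countable union of cells.\<close>

lemma open_in_sigma:
  "sigma_sets X {U. openin (topology_generated_by cells) U} = sigma_sets X cells"
proof (intro equalityI sigma_sets_mono subsetI)
  fix U assume "U \<in> {U. openin (topology_generated_by cells) U}"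
  then have "generate_topology_on cells U" by (simp add: openin_topology_generated_by_iff)
  then have "\<forall>x\<in>U. \<exists>B\<in>cells. x \<in> B \<and> B \<subseteq> U"
  proof induction
    case (Int a b)
    show ?case
    proof
      fix x assume "x \<in> a \<inter> b"
      then obtain A B where "A \<in> cells" "x \<in> A" "A \<subseteq> a" "B \<in> cells" "x \<in> B" "B \<subseteq> b" using Int by blast
      then show "\<exists>C\<in>cells. x \<in> C \<and> C \<subseteq> a \<inter> b" using cell_Int[of A B x] by blast
    qed
  next
    case (UN K)
    show ?case
    proof
      fix x assume "x \<in> \<Union>K"
      then obtain k where k: "k \<in> K" "x \<in> k" by blast
      obtain B where "B \<in> cells" "x \<in> B" "B \<subseteq> k" using UN.IH[OF k(1)] k(2) by blast
      then show "\<exists>B\<in>cells. x \<in> B \<and> B \<subseteq> \<Union>K" using k(1) by (intro bexI[of _ B]) auto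
    qed
  qed auto
  then have "U = \<Union>{B \<in> cells. B \<subseteq> U}" by blast
  moreover have "\<Union>{B \<in> cells. B \<subseteq> U} \<in> sigma_sets X cells"
  proof -
    interpret sigma_algebra X "sigma_sets X cells" by (rule sigma_algebra_sigma_sets[OF cells_subset])
    show ?thesis
      by (rule countable_Union) (auto intro: countable_subset[OF _ countable_cells] sigma_sets.Basic)
  qed
  ultimately show "U \<in> sigma_sets X cells" by simp
next
  fix U assume "U \<in> cells"
  then show "U \<in> sigma_sets X {U. openin (topology_generated_by cells) U}"
    by (intro sigma_sets.Basic) (auto simp: openin_topology_generated_by_iff intro: generate_topology_on.Basis)
qed

lemma unifD:
  assumes "unif N"
  shows "prob_space N" "space N = X" "sets N = sigma_sets X cells"
    "x \<in> X \<Longrightarrow> measure N (cell e x) = 1 / card (rho e ` X)"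
  using assms by (auto simp: unif_def)

lemma cell_sets: "sets N = sigma_sets X cells \<Longrightarrow> x \<in> X \<Longrightarrow> cell e x \<in> sets N"
  using cell_in_cells by (auto intro: sigma_sets.Basic)

text \<open>Together with the empty set the cells form a countable cover of X that is stable under
  intersection, so their masses determine the measure.\<close>

lemma unif_unique: assumes "unif N" "unif N'" shows "N = N'"
proof -
  note N = unifD[OF assms(1)] and N' = unifD[OF assms(2)]
  interpret N: prob_space N by (rule N)
  interpret N': prob_space N' by (rule N')
  show ?thesis
  proof (rule measure_eqI_generator_eq_countable[OF Int_stable_cells])
    show "insert {} cells \<subseteq> Pow X" using cells_subset by auto
    show "sets N = sigma_sets X (insert {} cells)" "sets N' = sigma_sets X (insert {} cells)"
      using N(3) N'(3) by (simp_all add: sigma_sets_insert_cells)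
    show "emeasure N A = emeasure N' A" if "A \<in> insert {} cells" for A
      using that N(4) N'(4) by (auto simp: cells_def N.emeasure_eq_measure N'.emeasure_eq_measure)
    show "\<Union>(insert {} cells) = X" using cells_subset cell_in_cells by (auto simp: cell_def) (metis (mono_tags) cell_def mem_Collect_eq)
    show "countable (insert {} cells)" using countable_cells by simp
  qed auto
qed

lemma measure_level_event:
  fixes c :: real
  assumes N: "finite_measure N" "sets N = sigma_sets X cells"
    and A: "A \<subseteq> X" "\<And>x y. x \<in> A \<Longrightarrow> y \<in> X \<Longrightarrow> rho e x = rho e y \<Longrightarrow> y \<in> A"
    and c: "\<And>x. x \<in> A \<Longrightarrow> measure N (cell e x) = (c::real)"
  shows "A \<in> sets N" "measure N A = real (card (rho e ` A)) * c"
proof -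
  interpret finite_measure N by (rule N(1))
  have fin: "finite (rho e ` A)" using finite_level[of e] A(1) by (meson finite_subset image_mono)
  define C where "C b = {y \<in> X. rho e y = b}" for b
  have Cc: "C (rho e x) = cell e x" for x by (simp add: C_def cell_def)
  have AC: "A = (\<Union>b\<in>rho e ` A. C b)" using A by (auto simp: C_def)
  have Cs: "C b \<in> sets N" if "b \<in> rho e ` A" for b using that A(1) cell_sets[OF N(2)] Cc by auto
  show "A \<in> sets N" by (subst AC, rule sets.finite_UN[OF fin Cs])
  have "measure N A = (\<Sum>b\<in>rho e ` A. measure N (C b))"
    by (subst AC, rule finite_measure_finite_Union) (use fin Cs in \<open>auto simp: disjoint_family_on_def C_def\<close>)
  also have "(\<Sum>b\<in>rho e ` A. measure N (C b)) = (\<Sum>b\<in>rho e ` A. c)" by (rule sum.cong) (auto simp: Cc c)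
  finally show "measure N A = real (card (rho e ` A)) * c" by simp
qed

lemma level_event_sets:
  assumes "sets N = sigma_sets X cells" "A \<subseteq> X" "\<And>x y. x \<in> A \<Longrightarrow> y \<in> X \<Longrightarrow> rho e x = rho e y \<Longrightarrow> y \<in> A"
  shows "A \<in> sets N"
proof -
  have "rho e ` A \<subseteq> rho e ` X" using assms(2) by blast
  then have fin: "finite (rho e ` A)" using finite_level[of e] finite_subset by blast
  have "A = (\<Union>b\<in>rho e ` A. {y \<in> X. rho e y = b})" using assms by auto
  moreover have "{y \<in> X. rho e y = b} \<in> sets N" if "b \<in> rho e ` A" for b
    using that assms(2) cell_sets[OF assms(1), of _ e] by (auto simp: cell_def)
  ultimately show ?thesis using fin by (metis (no_types, lifting) sets.finite_UN)
qed

text \<open>One level partitions X into finitely many cells, so a common mass has to be 1 divided by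
  their number. This is how invariance under a transitive group will prove uniformity.\<close>

lemma unifI:
  assumes N: "prob_space N" "space N = X" "sets N = sigma_sets X cells"
    and eq: "\<And>e x y. x \<in> X \<Longrightarrow> y \<in> X \<Longrightarrow> measure N (cell e x) = measure N (cell e y)"
  shows "unif N"
proof -
  interpret prob_space N by (rule N(1))
  have "measure N (cell e x) = 1 / card (rho e ` X)" if x: "x \<in> X" for e x
  proof -
    have "measure N X = card (rho e ` X) * measure N (cell e x)"
      by (rule measure_level_event(2)[where e = e, OF finite_measure_axioms N(3)]) (use x in \<open>auto intro: eq\<close>)
    then have "card (rho e ` X) * measure N (cell e x) = 1" using N(2) prob_space by simp
    then show ?thesis by (metis nonzero_mult_div_cancel_left mult_zero_left zero_neq_one)
  qed
  then show ?thesis using N by (simp add: unif_def)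
qed

lemma unif_pos: "unif N \<Longrightarrow> x \<in> X \<Longrightarrow> measure N (cell e x) > 0"
  using unifD(4)[of N x e] finite_level[of e] by (simp add: card_gt_0_iff) blast

text \<open>A measure on a finite discrete space is determined by its point masses, and the preimage
  of a point under \<open>rho e\<close> is a cell.\<close>

lemma distr_level_iff:
  assumes N: "prob_space N" "space N = X" "sets N = sigma_sets X cells"
  shows "distr N (count_space (rho e ` X)) (rho e) = uniform_count_measure (rho e ` X) \<longleftrightarrow>
    (\<forall>x\<in>X. measure N (cell e x) = 1 / card (rho e ` X))"
proof -
  interpret prob_space N by (rule N(1))
  let ?Y = "rho e ` X"
  have vim: "rho e -` {rho e x} \<inter> space N = cell e x" for x by (auto simp: cell_def N(2))
  have meas: "rho e \<in> measurable N (count_space ?Y)"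
    unfolding measurable_count_space_eq2[OF finite_level]
    using N(2) cell_sets[OF N(3)] vim by auto
  have e1: "emeasure (distr N (count_space ?Y) (rho e)) {rho e x} = ennreal (measure N (cell e x))" if "x \<in> X" for x
    using that by (simp add: emeasure_distr[OF meas] vim emeasure_eq_measure)
  have e2: "emeasure (uniform_count_measure ?Y) {rho e x} = ennreal (1 / card ?Y)" if "x \<in> X" for x
    using that finite_level[of e] by (simp add: emeasure_uniform_count_measure)
  show ?thesis
  proof
    assume "distr N (count_space ?Y) (rho e) = uniform_count_measure ?Y"
    then show "\<forall>x\<in>X. measure N (cell e x) = 1 / card ?Y" using e1 e2 by (metis ennreal_inj measure_nonneg divide_nonneg_nonneg of_nat_0_le_iff zero_le_one)
  next
    assume "\<forall>x\<in>X. measure N (cell e x) = 1 / card ?Y"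
    then show "distr N (count_space ?Y) (rho e) = uniform_count_measure ?Y"
      using e1 e2 finite_level[of e]
      by (intro measure_eqI_finite[of _ ?Y]) (auto simp: sets_uniform_count_measure)
  qed
qed

end

text \<open>\<open>complete\<close> provides a point for every compatible choice of level images,
  \<open>regular\<close> makes the fibres over one level equally large, and \<open>trivial\<close>
  gives a common starting point: the ingredients of the product construction below.\<close>

locale regular_tower = tower +
  assumes complete: "(\<And>e. xs e \<in> X) \<Longrightarrow> (\<And>e. rho e (xs (Suc e)) = rho e (xs e)) \<Longrightarrow>
      \<exists>x\<in>X. \<forall>e. rho e x = rho e (xs e)"
    and regular: "x \<in> X \<Longrightarrow> y \<in> X \<Longrightarrow> card (rho (Suc e) ` cell e x) = card (rho (Suc e) ` cell e y)"
    and trivial: "x \<in> X \<Longrightarrow> y \<in> X \<Longrightarrow> rho 0 x = rho 0 y"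
begin

text \<open>Numbering the fibres of each level over the previous one identifies the limit of the tower with a product
  of finite sets, up to points that no level distinguishes.\<close>
lemma unif_exists: "\<exists>N. unif N"
proof -
  obtain x0 where x0: "x0 \<in> X" using nonempty by blast
  define k where "k e = card (rho (Suc e) ` cell e x0)" for e
  have fincell: "finite (rho (Suc e) ` cell e x)" for e x
    by (rule finite_subset[OF image_mono[OF cell_subset] finite_level])
  have kc: "card (rho (Suc e) ` cell e x) = k e" if "x \<in> X" for e x
    using regular[OF that x0] by (simp add: k_def)
  have kpos: "k e > 0" for e
    using x0 fincell[of e x0] by (auto simp: k_def card_gt_0_iff cell_def)
  have "\<exists>f. bij_betw f {..<k e} (rho (Suc e) ` cell e x)" if "x \<in> X" for e x
    using ex_bij_betw_nat_finite[OF fincell[of e x]] kc[OF that] by (simp add: atLeast0LessThan)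
  then have ex: "x \<in> X \<Longrightarrow> \<exists>f. bij_betw f {..<k e} (rho (Suc e) ` cell e x)" for e x .
  define f where "f e x = (SOME f. bij_betw f {..<k e} (rho (Suc e) ` cell e x))" for e x
  have f: "\<And>e x. x \<in> X \<Longrightarrow> bij_betw (f e x) {..<k e} (rho (Suc e) ` cell e x)"
    unfolding f_def by (rule someI_ex[OF ex])
  have "\<exists>y. y \<in> cell e x \<and> rho (Suc e) y = f e x i" if "x \<in> X" "i < k e" for e x i
    using f[OF that(1), of e] that(2) unfolding bij_betw_def by (metis (no_types, lifting) image_eqI image_iff lessThan_iff)
  then have nex: "x \<in> X \<Longrightarrow> i < k e \<Longrightarrow> \<exists>y. y \<in> cell e x \<and> rho (Suc e) y = f e x i" for e x i .
  define nxt where "nxt e x i = (SOME y. y \<in> cell e x \<and> rho (Suc e) y = f e x i)" for e x i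
  have nxt: "\<And>e x i. x \<in> X \<Longrightarrow> i < k e \<Longrightarrow> nxt e x i \<in> cell e x \<and> rho (Suc e) (nxt e x i) = f e x i"
    unfolding nxt_def by (rule someI_ex[OF nex])
  \<comment> \<open>The digits \<open>a\<close> steer a path: from level e it moves on to the
    element numbered \<open>a e\<close> of the fibre.\<close>
  define xs where "xs a = rec_nat x0 (\<lambda>e x. nxt e x (a e))" for a
  have xs_simps: "xs a 0 = x0" "xs a (Suc e) = nxt e (xs a e) (a e)" for a e by (simp_all add: xs_def)
  define \<Omega> where "\<Omega> = {a. \<forall>e. a e < k e}"
  have xsX: "xs a e \<in> X" if "a \<in> \<Omega>" for a e
  proof (induction e)
    case (Suc e)
    have "nxt e (xs a e) (a e) \<in> cell e (xs a e)" using nxt[OF Suc] that by (simp add: \<Omega>_def)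
    then show ?case using cell_subset by (auto simp: xs_simps)
  qed (simp add: xs_simps x0)
  have xsn: "rho e (xs a (Suc e)) = rho e (xs a e)" if "a \<in> \<Omega>" for a e
    using nxt[OF xsX[OF that], of "a e" e e] that by (simp add: xs_simps \<Omega>_def cell_def)
  define F where "F a = (SOME x. x \<in> X \<and> (\<forall>e. rho e x = rho e (xs a e)))" for a
  have F: "F a \<in> X" "rho e (F a) = rho e (xs a e)" if "a \<in> \<Omega>" for a e
    using someI_ex[of "\<lambda>x. x \<in> X \<and> (\<forall>e. rho e x = rho e (xs a e))"] complete[of "xs a"] xsX[OF that] xsn[OF that]
    unfolding F_def by blast+
  have code: "\<exists>c\<in>\<Omega>. \<forall>e. rho e (xs c e) = rho e x" if x: "x \<in> X" for x
  proof -
    have "\<exists>i<k e. f e y i = rho (Suc e) x" if "y \<in> X" "rho e y = rho e x" for e y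
    proof -
      have "rho (Suc e) x \<in> rho (Suc e) ` cell e y" using x that by (auto simp: cell_def)
      then show ?thesis using f[OF that(1), of e] unfolding bij_betw_def by (metis (no_types, lifting) image_iff lessThan_iff)
    qed
    then have dex: "y \<in> X \<Longrightarrow> rho e y = rho e x \<Longrightarrow> \<exists>i. i < k e \<and> f e y i = rho (Suc e) x" for e y by blast
    define d where "d e y = (SOME i. i < k e \<and> f e y i = rho (Suc e) x)" for e y
    have d: "\<And>e y. y \<in> X \<Longrightarrow> rho e y = rho e x \<Longrightarrow> d e y < k e \<and> f e y (d e y) = rho (Suc e) x"
      unfolding d_def by (rule someI_ex[OF dex])
    \<comment> \<open>The digits of x are read off along the very path that they generate, because
      the numbering of a fibre depends on the representative reached so far.\<close>
    define ys where "ys = rec_nat x0 (\<lambda>e y. nxt e y (d e y))"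
    have ys_simps: "ys 0 = x0" "ys (Suc e) = nxt e (ys e) (d e (ys e))" for e by (simp_all add: ys_def)
    have ys: "ys e \<in> X \<and> rho e (ys e) = rho e x" for e
    proof (induction e)
      case 0
      then show ?case using x0 trivial[OF x0 x] by (simp add: ys_simps)
    next
      case (Suc e)
      then show ?case using nxt[of "ys e" "d e (ys e)" e] d[of "ys e" e] cell_subset[of e "ys e"]
        by (auto simp: ys_simps)
    qed
    define c where "c e = d e (ys e)" for e
    have "c \<in> \<Omega>" using d ys by (simp add: c_def \<Omega>_def)
    moreover have "xs c e = ys e" for e by (induction e) (simp_all add: xs_simps ys_simps c_def)
    ultimately show ?thesis using ys by (intro bexI[of _ c]) simp_all
  qed
  have cyl: "rho e (xs a e) = rho e (xs c e) \<longleftrightarrow> (\<forall>i<e. a i = c i)" if ac: "a \<in> \<Omega>" "c \<in> \<Omega>" for a c e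
  proof
    show "\<forall>i<e. a i = c i \<Longrightarrow> rho e (xs a e) = rho e (xs c e)"
    proof -
      assume "\<forall>i<e. a i = c i"
      then have "xs a e = xs c e" by (induction e) (simp_all add: xs_simps)
      then show ?thesis by simp
    qed
    show "rho e (xs a e) = rho e (xs c e) \<Longrightarrow> \<forall>i<e. a i = c i"
    proof (induction e)
      case (Suc e)
      have "rho e (xs a (Suc e)) = rho e (xs c (Suc e))" using nested[OF xsX[OF ac(1)] xsX[OF ac(2)] Suc(2)] .
      then have "rho e (xs a e) = rho e (xs c e)" using xsn ac by simp
      then have pre: "\<forall>i<e. a i = c i" by (rule Suc.IH)
      then have eq: "xs a e = xs c e" by (induction e) (simp_all add: xs_simps)
      have ak: "a e < k e" "c e < k e" using ac by (auto simp: \<Omega>_def)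
      have "f e (xs c e) (a e) = f e (xs c e) (c e)"
        using Suc(2) nxt[OF xsX[OF ac(2)] ak(1), of e] nxt[OF xsX[OF ac(2)] ak(2), of e] eq by (simp add: xs_simps)
      then have "a e = c e" using f[OF xsX[OF ac(2)], of e e] ak unfolding bij_betw_def by (auto dest: inj_onD)
      then show ?case using pre less_Suc_eq by auto
    qed simp
  qed
  define M where "M e = uniform_count_measure {..<k e}" for e
  have Mp: "prob_space (M e)" for e
    unfolding M_def by (rule prob_space_uniform_count_measure) (use kpos[of e] in auto)
  interpret Pr: product_prob_space M UNIV
    by (intro product_prob_spaceI Mp)
  let ?\<Omega> = "PiM UNIV M"
  have sp: "space ?\<Omega> = \<Omega>" by (auto simp: space_PiM M_def space_uniform_count_measure \<Omega>_def PiE_iff)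
  define N where "N = distr ?\<Omega> (sigma X cells) F"
  \<comment> \<open>Cells pull back to cylinders, whose mass is the product of the
    \<open>1 / k i\<close> and so depends on the level alone.\<close>
  have cylM: "F -` cell e (F c) \<inter> space ?\<Omega> = prod_emb UNIV M {..<e} (\<Pi>\<^sub>E i\<in>{..<e}. {c i})" if c: "c \<in> \<Omega>" for e c
  proof -
    have "F -` cell e (F c) \<inter> space ?\<Omega> = {a \<in> \<Omega>. \<forall>i<e. a i = c i}"
      unfolding sp using F[OF c] by (auto simp: cell_def F cyl[OF _ c])
    also have "\<dots> = prod_emb UNIV M {..<e} (\<Pi>\<^sub>E i\<in>{..<e}. {c i})"
      unfolding prod_emb_def using c
      by (auto simp: M_def space_uniform_count_measure \<Omega>_def PiE_iff restrict_def extensional_def)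
    finally show ?thesis .
  qed
  have csets: "{c i} \<in> sets (M i)" if "c \<in> \<Omega>" for c i
    using that by (auto simp: M_def sets_uniform_count_measure \<Omega>_def)
  have cellF: "\<exists>c\<in>\<Omega>. cell e x = cell e (F c)" if "x \<in> X" for e x
  proof -
    obtain c where c: "c \<in> \<Omega>" "\<forall>e. rho e (xs c e) = rho e x" using code[OF \<open>x \<in> X\<close>] by blast
    then show ?thesis by (intro bexI[of _ c]) (simp_all add: cell_def F)
  qed
  have meas: "F \<in> measurable ?\<Omega> (sigma X cells)"
  proof (rule measurable_measure_of[OF cells_subset])
    show "F \<in> space ?\<Omega> \<rightarrow> X" using F sp by auto
    fix A assume "A \<in> cells"
    then obtain e x where x: "x \<in> X" "A = cell e x" by (auto simp: cells_def)
    then obtain c where c: "c \<in> \<Omega>" "A = cell e (F c)" using cellF[OF x(1), of e] by blast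
    show "F -` A \<inter> space ?\<Omega> \<in> sets ?\<Omega>"
      unfolding c(2) cylM[OF c(1)] using csets[OF c(1)] by (intro sets_PiM_I) auto
  qed
  have "prob_space N" unfolding N_def by (rule Pr.prob_space_distr[OF meas])
  moreover have "space N = X" "sets N = sigma_sets X cells" using cells_subset by (auto simp: N_def)
  moreover have mN: "measure N (cell e x) = (\<Prod>i<e. 1 / k i)" if x: "x \<in> X" for e x
  proof -
    obtain c where c: "c \<in> \<Omega>" "cell e x = cell e (F c)" using cellF[OF x] by blast
    have "measure N (cell e x) = measure ?\<Omega> (F -` cell e (F c) \<inter> space ?\<Omega>)"
      unfolding N_def using cell_in_cells[OF F(1)[OF c(1)]] cells_subset
      by (subst measure_distr[OF meas]) (auto simp: c(2))
    also have "\<dots> = (\<Prod>i<e. measure (M i) {c i})"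
      unfolding cylM[OF c(1)] using csets[OF c(1)] by (intro Pr.measure_PiM_emb) auto
    also have "\<dots> = (\<Prod>i<e. 1 / k i)"
      using c(1) by (intro prod.cong) (auto simp: M_def measure_uniform_count_measure \<Omega>_def)
    finally show ?thesis .
  qed
  ultimately have "unif N" by (intro unifI) auto
  then show ?thesis by blast
qed

end

section \<open>The natural measure\<close>

context padic begin

definition rawz :: "nat \<Rightarrow> (nat \<Rightarrow> padic) set \<Rightarrow> vec set"
  where "rawz n Z = {u \<in> V n. ofr n u \<in> Z}"

lemma rawz_V: "u \<in> rawz n Z \<Longrightarrow> u \<in> V n"
  by (simp add: rawz_def)

lemma rawz_eqv: "u \<in> V n \<Longrightarrow> v \<in> rawz n Z \<Longrightarrow> eqv u v \<Longrightarrow> u \<in> rawz n Z"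
  using ofr_eq_iff[of u n v] by (simp add: rawz_def)

lemma ofr_rawz: "Z \<subseteq> carrier (hyp_mod p n) \<Longrightarrow> ofr n ` rawz n Z = Z"
proof (intro equalityI subsetI)
  fix x assume a: "Z \<subseteq> carrier (hyp_mod p n)" "x \<in> Z"
  then obtain u where "u \<in> V n" "x = ofr n u" using ofr_surj[of x n] by blast
  then show "x \<in> ofr n ` rawz n Z" using a(2) by (auto simp: rawz_def)
qed (auto simp: rawz_def)

lemma rawz_ofr: assumes "iso_sat n L" shows "rawz n (ofr n ` L) = L"
proof (intro equalityI subsetI)
  note S = submD[OF iso_satD(1)[OF assms]]
  fix u assume "u \<in> rawz n (ofr n ` L)"
  then obtain v where v: "u \<in> V n" "v \<in> L" "ofr n u = ofr n v" by (auto simp: rawz_def)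
  then have "eqv u v" using ofr_eq_iff[OF v(1) S(1)[OF v(2)]] by simp
  then show "u \<in> L" using S(5) v by blast
next
  fix u assume "u \<in> L"
  then show "u \<in> rawz n (ofr n ` L)" using submD(1)[OF iso_satD(1)[OF assms]] by (auto simp: rawz_def)
qed

lemma in_set_add: "x \<in> A <+>\<^bsub>G\<^esub> B \<longleftrightarrow> (\<exists>a\<in>A. \<exists>b\<in>B. x = a \<oplus>\<^bsub>G\<^esub> b)"
  by (auto simp: set_add_def set_mult_def)

lemma ofr_zero_iff: "u \<in> V n \<Longrightarrow> ofr n u = \<zero>\<^bsub>hyp_mod p n\<^esub> \<longleftrightarrow> eqv u 0"
  using ofr_eq_iff[of u n 0] by (simp add: ofr_hom)

lemma submodule_rawz:
  assumes "submodule Z (Zp p) (hyp_mod p n)"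
  shows "subm n (rawz n Z)" "Z \<subseteq> carrier (hyp_mod p n)"
proof -
  show Z: "Z \<subseteq> carrier (hyp_mod p n)"
    using subgroup.subset[OF submodule.axioms(1)[OF assms]] by simp
  have "submodule (ofr n ` rawz n Z) (Zp p) (hyp_mod p n) \<longleftrightarrow> subm n (rawz n Z)"
    by (rule submodule_iff) (auto dest: rawz_V rawz_eqv)
  then show "subm n (rawz n Z)" using assms ofr_rawz[OF Z] by simp
qed

text \<open>If \<open>p u\<close> lies in Z and u = a + b along a complement, then
  \<open>p b\<close> lies in both summands and vanishes, so b = 0 by torsion-freeness.\<close>

lemma isotropic_summand_iso_sat:
  assumes "isotropic_summand p n Z" shows "iso_sat n (rawz n Z)" "Z \<subseteq> carrier (hyp_mod p n)"
proof -
  obtain Z' where Z: "submodule Z (Zp p) (hyp_mod p n)" "\<And>z. z \<in> Z \<Longrightarrow> hyp_form p n z = \<zero>\<^bsub>Zp p\<^esub>"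
    and Z': "submodule Z' (Zp p) (hyp_mod p n)" "Z \<inter> Z' = {\<zero>\<^bsub>hyp_mod p n\<^esub>}" "Z <+>\<^bsub>hyp_mod p n\<^esub> Z' = carrier (hyp_mod p n)"
    using assms unfolding isotropic_summand_def direct_summand_def by blast
  note s = submodule_rawz[OF Z(1)] and s' = submodule_rawz[OF Z'(1)]
  show "Z \<subseteq> carrier (hyp_mod p n)" by (rule s(2))
  show "iso_sat n (rawz n Z)"
  proof (rule iso_satI[OF s(1)])
    show "null (qf n u)" if "u \<in> rawz n Z" for u
      using that Z(2)[of "ofr n u"] hyp_form_zero_iff[of u n] by (simp add: rawz_def)
    fix u assume u: "u \<in> V n" "of_nat p \<triangleright> u \<in> rawz n Z"
    have "ofr n u \<in> Z <+>\<^bsub>hyp_mod p n\<^esub> Z'" using ofr_carrier[OF u(1)] Z'(3) by simp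
    then obtain x y where xy: "x \<in> Z" "y \<in> Z'" "ofr n u = x \<oplus>\<^bsub>hyp_mod p n\<^esub> y"
      unfolding in_set_add by blast
    obtain a where a: "a \<in> rawz n Z" "x = ofr n a" using xy(1) ofr_rawz[OF s(2)] by blast
    obtain b where b: "b \<in> rawz n Z'" "y = ofr n b" using xy(2) ofr_rawz[OF s'(2)] by blast
    note aV = rawz_V[OF a(1)] and bV = rawz_V[OF b(1)]
    have e: "eqv u (a + b)" using xy(3) ofr_eq_iff[OF u(1) V_add[OF aV bV]] by (simp add: a b ofr_hom)
    let ?q = "of_nat p :: intseq"
    have "eqv (?q \<triangleright> b) (?q \<triangleright> u - ?q \<triangleright> a)"
    proof -
      have "eqv (?q \<triangleright> u - ?q \<triangleright> a) (?q \<triangleright> (a + b) - ?q \<triangleright> a)" by (intro eqv_diff eqv_smul e eqv_refl)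
      moreover have "?q \<triangleright> (a + b) - ?q \<triangleright> a = ?q \<triangleright> b" by (rule ext) (simp add: algebra_simps)
      ultimately show ?thesis using eqv_sym by simp
    qed
    moreover have "?q \<triangleright> u - ?q \<triangleright> a \<in> rawz n Z"
      by (rule submD(6)[OF s(1) u(2) submD(4)[OF s(1) a(1)]]) simp
    moreover have pb: "?q \<triangleright> b \<in> V n" by (simp add: bV)
    ultimately have "?q \<triangleright> b \<in> rawz n Z" using submD(5)[OF s(1)] by blast
    moreover have "?q \<triangleright> b \<in> rawz n Z'" by (rule submD(4)[OF s'(1) b(1)]) simp
    ultimately have "ofr n (?q \<triangleright> b) \<in> Z \<inter> Z'" by (simp add: rawz_def)
    then have "eqv (?q \<triangleright> b) 0" using Z'(2) ofr_zero_iff[OF pb] by simp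
    then have "null (?q * b i)" for i unfolding eqv_def by simp
    then have "null (b i)" for i using null_pp_mult_iff[OF V_coh[OF bV], of 1] by simp
    then have "eqv b 0" by (simp add: eqv_def)
    then have "eqv u a" using eqv_trans[OF e] eqv_add[OF eqv_refl, of b 0 a] by simp
    then show "u \<in> rawz n Z" using rawz_eqv[OF u(1) a(1)] by blast
  qed
qed

text \<open>The Lagrangian opposite to \<open>E n\<close>, spanned by the odd basis vectors. It
  serves as a complement of \<open>E n\<close> and later as an example of a Lagrangian that avoids a
  line.\<close>

definition F :: "nat \<Rightarrow> vec set"
  where "F n = {u \<in> V n. \<forall>i. odd i \<or> null (u i)}"

lemma F_iso_sat: "iso_sat n (F n)"
proof (intro iso_satI submI)
  show "u \<in> F n" if "u \<in> V n" "v \<in> F n" "eqv u v" for u v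
  proof -
    have "odd i \<or> null (u i)" for i
      using that null_cong[of "u i" "v i"] by (auto simp: F_def eqv_def)
    then show ?thesis using that by (simp add: F_def)
  qed
  show "u \<in> F n" if "u \<in> V n" "of_nat p \<triangleright> u \<in> F n" for u
  proof -
    have "odd i \<or> null (u i)" for i
      using that null_pp_mult_iff[OF V_coh[OF that(1)], of 1 i] by (auto simp: F_def)
    then show ?thesis using that by (simp add: F_def)
  qed
  show "null (qf n u)" if "u \<in> F n" for u
  proof -
    have "null (u (2*i))" for i using that unfolding F_def by (metis (no_types, lifting) mem_Collect_eq dvd_triv_left)
    then show ?thesis unfolding qf_def by (intro null_sum null_mult(1))
  qed
  show "u + v \<in> F n" if "u \<in> F n" "v \<in> F n" for u v
    using that unfolding F_def by (simp add: V_add)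
qed (auto simp: F_def V_smul)

text \<open>The complement is the corresponding copy of \<open>F n\<close>: split \<open>g v\<close>
  into its even and odd coordinates and apply \<open>h\<close>.\<close>

lemma isop_summand:
  assumes "isop n g h" shows "isotropic_summand p n (ofr n ` img n g (E n))"
proof -
  note D = isom1D[OF isopD(1)[OF assms]] and D' = isom1D[OF isopD(2)[OF assms]]
  let ?L = "img n g (E n)" and ?L' = "img n g (F n)"
  have L: "iso_sat n ?L" by (rule iso_sat_img[OF isopD(1)[OF assms] E_iso_sat])
  have L': "iso_sat n ?L'" by (rule iso_sat_img[OF isopD(1)[OF assms] F_iso_sat])
  have sub: "submodule (ofr n ` K) (Zp p) (hyp_mod p n)" if "iso_sat n K" for K
    using submodule_iff[of K n] submD(1,5)[OF iso_satD(1)[OF that]] iso_satD(1)[OF that] by blast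
  have inter: "ofr n ` ?L \<inter> ofr n ` ?L' = {\<zero>\<^bsub>hyp_mod p n\<^esub>}"
  proof (intro equalityI subsetI)
    fix x assume x: "x \<in> ofr n ` ?L \<inter> ofr n ` ?L'"
    then obtain u where u: "u \<in> ?L" "x = ofr n u" by blast
    then have uV: "u \<in> V n" by (simp add: img_def)
    have "u \<in> rawz n (ofr n ` ?L')" using x u uV by (simp add: rawz_def)
    then have "g u \<in> E n \<inter> F n" using u(1) rawz_ofr[OF L'] by (simp add: img_def)
    then have "null (g u i)" for i unfolding E_eq_Ek Ek_def F_def by blast
    then have "eqv (g u) 0" by (simp add: eqv_def)
    then have "eqv (h (g u)) (h 0)" using D'(5)[OF D(1)[OF uV] V_zero] by blast
    then have "eqv u 0" using isom1_zero[OF isopD(2)[OF assms]] eqv_trans[OF eqv_sym[OF isopD(3)[OF assms uV]]] by metis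
    then show "x \<in> {\<zero>\<^bsub>hyp_mod p n\<^esub>}" using ofr_zero_iff[OF uV] u(2) by simp
  next
    fix x assume "x \<in> {\<zero>\<^bsub>hyp_mod p n\<^esub>}"
    then show "x \<in> ofr n ` ?L \<inter> ofr n ` ?L'"
      using submD(2)[OF iso_satD(1)[OF L]] submD(2)[OF iso_satD(1)[OF L']] by (simp add: ofr_hom)
  qed
  have sum: "ofr n ` ?L <+>\<^bsub>hyp_mod p n\<^esub> ofr n ` ?L' = carrier (hyp_mod p n)"
  proof (intro equalityI subsetI)
    fix x assume "x \<in> ofr n ` ?L <+>\<^bsub>hyp_mod p n\<^esub> ofr n ` ?L'"
    then obtain a b where ab: "a \<in> ?L" "b \<in> ?L'" "x = ofr n a \<oplus>\<^bsub>hyp_mod p n\<^esub> ofr n b" unfolding in_set_add by blast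
    then have "x = ofr n (a + b)" "a + b \<in> V n" by (simp_all add: ofr_hom img_def)
    then show "x \<in> carrier (hyp_mod p n)" using ofr_carrier by simp
  next
    fix x assume "x \<in> carrier (hyp_mod p n)"
    then obtain v where v: "v \<in> V n" "x = ofr n v" by (rule ofr_surj)
    define a where "a = (\<lambda>i. if odd i then 0 else g v i)"
    define b where "b = (\<lambda>i. if odd i then g v i else 0)"
    have aV: "a \<in> V n" and bV: "b \<in> V n" using D(1)[OF v(1)] by (auto simp: V_def a_def b_def)
    have aE: "a \<in> E n" using aV by (simp add: E_def a_def)
    have bF: "b \<in> F n" using bV by (simp add: F_def b_def)
    have ab: "g v = a + b" by (rule ext) (simp add: a_def b_def)
    have "eqv v (h a + h b)" using isopD(3)[OF assms v(1)] D'(2)[OF aV bV] eqv_sym by (simp add: ab)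
    then have "x = ofr n (h a) \<oplus>\<^bsub>hyp_mod p n\<^esub> ofr n (h b)"
      using ofr_eq_iff[OF v(1) V_add[OF D'(1)[OF aV] D'(1)[OF bV]]] v(2) by (simp add: ofr_hom)
    moreover have "h a \<in> ?L"
      using submD(5)[OF iso_satD(1)[OF E_iso_sat] D(1)[OF D'(1)[OF aV]] aE isopD(4)[OF assms aV]] D'(1)[OF aV]
      by (simp add: img_def)
    moreover have "h b \<in> ?L'"
      using submD(5)[OF iso_satD(1)[OF F_iso_sat] D(1)[OF D'(1)[OF bV]] bF isopD(4)[OF assms bV]] D'(1)[OF bV]
      by (simp add: img_def)
    ultimately show "x \<in> ofr n ` ?L <+>\<^bsub>hyp_mod p n\<^esub> ofr n ` ?L'" unfolding in_set_add by blast
  qed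
  have "hyp_form p n z = \<zero>\<^bsub>Zp p\<^esub>" if "z \<in> ofr n ` ?L" for z
  proof -
    obtain u where u: "u \<in> ?L" "z = ofr n u" using \<open>z \<in> ofr n ` ?L\<close> by blast
    then show ?thesis using hyp_form_zero_iff[of u n] iso_satD(2)[OF L u(1)] by (simp add: img_def)
  qed
  then show ?thesis unfolding isotropic_summand_def direct_summand_def
    using sub[OF L] sub[OF L'] inter sum by blast
qed

lemma Lag_OGr: assumes "Lag n L" shows "ofr n ` L \<in> OGr p n"
proof -
  obtain g h where g: "isop n g h" "L = img n g (E n)" using Lag_isop[OF assms] by blast
  have s: "isotropic_summand p n (ofr n ` L)" using isop_summand[OF g(1)] g(2) by simp
  have "Z' = ofr n ` L" if Z': "isotropic_summand p n Z'" "ofr n ` L \<subseteq> Z'" for Z'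
  proof -
    note i = isotropic_summand_iso_sat[OF Z'(1)]
    have L: "L \<subseteq> rawz n Z'" using Z'(2) Lag_subset[OF assms] by (auto simp: rawz_def)
    have "rawz n Z' \<subseteq> L"
    proof
      fix v assume v: "v \<in> rawz n Z'"
      show "v \<in> L"
        by (rule LagD(4)[OF assms rawz_V[OF v] iso_satD(2)[OF i(1) v]]) (use iso_sat_bf[OF i(1) v] L in blast)
    qed
    then show ?thesis using L ofr_rawz[OF i(2)] by blast
  qed
  then show ?thesis using s by (auto simp: OGr_def)
qed

text \<open>By the normal form, a saturated isotropic submodule lies in a Lagrangian, which is
  itself an isotropic summand; maximality forces equality.\<close>

lemma OGr_Lag: assumes "Z \<in> OGr p n" shows "Lag n (rawz n Z)" "ofr n ` rawz n Z = Z"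
proof -
  have s: "isotropic_summand p n Z" and max: "\<And>Z'. isotropic_summand p n Z' \<Longrightarrow> Z \<subseteq> Z' \<Longrightarrow> Z' = Z"
    using assms by (auto simp: OGr_def)
  note i = isotropic_summand_iso_sat[OF s]
  show e: "ofr n ` rawz n Z = Z" by (rule ofr_rawz[OF i(2)])
  obtain g h k where k: "isop n g h" "k \<le> n" "\<And>v. v \<in> V n \<Longrightarrow> v \<in> rawz n Z \<longleftrightarrow> g v \<in> Ek n k"
    using iso_sat_elim[OF i(1)] by blast
  have "Ek n k \<subseteq> E n" unfolding E_eq_Ek by (auto simp: Ek_def)
  then have "rawz n Z \<subseteq> img n g (E n)" using k(3) rawz_V unfolding img_def by blast
  then have "Z \<subseteq> ofr n ` img n g (E n)" using e by blast
  then have "ofr n ` img n g (E n) = Z" by (rule max[OF isop_summand[OF k(1)]])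
  then have "rawz n Z = img n g (E n)" using rawz_ofr[OF iso_sat_img[OF isopD(1)[OF k(1)] E_iso_sat]] by blast
  then show "Lag n (rawz n Z)" using isop_Lag[OF k(1)] by simp
qed

lemma rawz_Lag: "Lag n L \<Longrightarrow> rawz n (ofr n ` L) = L"
  by (rule rawz_ofr[OF Lag_iso_sat])

lemma add_pow_ofr: "add_pow (hyp_mod p n) (k::nat) (ofr n u) = ofr n (of_nat k \<triangleright> u)"
proof (induction k)
  case 0
  have "(of_nat 0 :: intseq) \<triangleright> u = 0" by (rule ext) simp
  then show ?case by (simp add: add_pow_def nat_pow_def ofr_hom zero_fun_def)
next
  case (Suc k)
  have "add_pow (hyp_mod p n) (Suc k) (ofr n u) = add_pow (hyp_mod p n) k (ofr n u) \<oplus>\<^bsub>hyp_mod p n\<^esub> ofr n u"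
    by (simp add: add_pow_def nat_pow_def)
  also have "\<dots> = ofr n (of_nat (Suc k) \<triangleright> u)"
    unfolding Suc ofr_hom by (rule arg_cong[where f = "ofr n"], rule ext) (simp add: algebra_simps)
  finally show ?case .
qed

lemma image_eq_transfer:
  assumes "L \<subseteq> A" "L' \<subseteq> A" "\<And>u v. u \<in> A \<Longrightarrow> v \<in> A \<Longrightarrow> f u = f v \<longleftrightarrow> g u = g v"
  shows "f ` L = f ` L' \<longleftrightarrow> g ` L = g ` L'"
proof -
  have 1: "f x = f y \<longleftrightarrow> g x = g y" if "x \<in> L" "y \<in> L'" for x y
    using assms(1,2) that by (intro assms(3)) auto
  have 2: "f x = f y \<longleftrightarrow> g x = g y" if "x \<in> L'" "y \<in> L" for x y
    using assms(1,2) that by (intro assms(3)) auto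
  show ?thesis
    by (simp add: set_eq_subset image_subset_iff image_iff 1 2 cong: ball_cong bex_cong)
qed

text \<open>A coset of p^e V and the residues \<open>red e\<close> of its members determine each
  other; this matches the levels of \<open>OGr\<close> with those of the Lagrangians.\<close>

lemma reduction_eq_iff:
  assumes "L \<subseteq> V n" "L' \<subseteq> V n"
  shows "reduction p n e (ofr n ` L) = reduction p n e (ofr n ` L') \<longleftrightarrow> red e ` L = red e ` L'"
proof -
  define peV where "peV = {add_pow (hyp_mod p n) (p ^ e) v | v. v \<in> carrier (hyp_mod p n)}"
  have pe: "peV = (\<lambda>w. ofr n (pp e \<triangleright> w)) ` V n"
  proof (intro equalityI subsetI)
    fix x assume "x \<in> peV"
    then obtain v where v: "v \<in> carrier (hyp_mod p n)" "x = add_pow (hyp_mod p n) (p ^ e) v" unfolding peV_def by blast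
    obtain w where w: "w \<in> V n" "v = ofr n w" using v(1) by (rule ofr_surj)
    show "x \<in> (\<lambda>w. ofr n (pp e \<triangleright> w)) ` V n" unfolding v(2) w(2) add_pow_ofr using w(1) by (rule imageI)
  next
    fix x assume "x \<in> (\<lambda>w. ofr n (pp e \<triangleright> w)) ` V n"
    then obtain w where w: "w \<in> V n" "x = ofr n (pp e \<triangleright> w)" by blast
    then show "x \<in> peV" unfolding peV_def add_pow_ofr[symmetric] using ofr_carrier by blast
  qed
  define cs where "cs u = peV +>\<^bsub>hyp_mod p n\<^esub> ofr n u" for u
  have cs: "cs u = (\<lambda>w. ofr n (pp e \<triangleright> w + u)) ` V n" for u
    unfolding cs_def a_r_coset_def r_coset_def pe by (auto simp: ofr_hom simp del: of_nat_power)
  have ppz: "near e (pp e \<triangleright> w) 0" for w by (simp add: near_def)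
  have "cs u = cs v \<longleftrightarrow> red e u = red e v" if uv: "u \<in> V n" "v \<in> V n" for u v
  proof
    assume a: "cs u = cs v"
    have "pp e \<triangleright> 0 + u = u" by (rule ext) simp
    then have "ofr n u \<in> cs u" unfolding cs by (intro image_eqI[of _ _ 0]) (simp_all only: V_zero)
    then have "ofr n u \<in> cs v" by (simp only: a)
    then obtain w where w: "w \<in> V n" "ofr n u = ofr n (pp e \<triangleright> w + v)" unfolding cs by (rule imageE)
    have "eqv u (pp e \<triangleright> w + v)" by (rule ofr_eq_iff[THEN iffD1, OF uv(1) V_add[OF V_smul[OF coh_const(3) w(1)] uv(2)] w(2)])
    then have "near e u (pp e \<triangleright> w + v)" by (rule eqv_near)
    moreover have "near e (pp e \<triangleright> w + v) (0 + v)" by (intro near_add ppz near_refl)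
    ultimately show "red e u = red e v" using near_trans near_iff_red by simp
  next
    have sub: "cs u \<subseteq> cs v" if uv: "u \<in> V n" "v \<in> V n" "red e u = red e v" for u v
    proof
      have "near e (u - v) (v - v)" using uv(3) by (intro near_diff) (simp_all add: near_iff_red)
      then obtain w where w: "w \<in> V n" "eqv (u - v) (pp e \<triangleright> w)" using V_divide[OF V_diff[OF uv(1,2)], of e] by auto
      fix x assume "x \<in> cs u"
      then obtain y where y: "y \<in> V n" "x = ofr n (pp e \<triangleright> y + u)" unfolding cs by blast
      have "eqv (pp e \<triangleright> y + (u - v) + v) (pp e \<triangleright> y + pp e \<triangleright> w + v)"
        by (intro eqv_add eqv_refl w)
      moreover have "pp e \<triangleright> y + (u - v) + v = pp e \<triangleright> y + u" "pp e \<triangleright> y + pp e \<triangleright> w + v = pp e \<triangleright> (y + w) + v"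
        by (rule ext, simp add: algebra_simps)+
      ultimately have "eqv (pp e \<triangleright> y + u) (pp e \<triangleright> (y + w) + v)" by simp
      moreover have m: "pp e \<triangleright> y + u \<in> V n" "pp e \<triangleright> (y + w) + v \<in> V n"
        by (intro V_add V_smul coh_const(3) y uv w)+
      ultimately have "x = ofr n (pp e \<triangleright> (y + w) + v)" unfolding y(2) using ofr_eq_iff[OF m] by blast
      then show "x \<in> cs v" unfolding cs using V_add[OF y(1) w(1)] by blast
    qed
    assume "red e u = red e v"
    then show "cs u = cs v" by (intro equalityI sub uv) simp_all
  qed
  then have "cs ` L = cs ` L' \<longleftrightarrow> red e ` L = red e ` L'" by (rule image_eq_transfer[OF assms])
  moreover have "reduction p n e (ofr n ` L) = cs ` L" for L
    unfolding reduction_def Let_def peV_def[symmetric] cs_def by (simp add: image_image)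
  ultimately show ?thesis by simp
qed

section \<open>The tower of Lagrangians, its uniform measure and the natural measure\<close>

abbreviation Lags :: "nat \<Rightarrow> vec set set"
  where "Lags n \<equiv> {L. Lag n L}"

lemma finite_levels: "finite ((\<lambda>Z. red e ` Z) ` Lags n)"
  by (rule finite_subset[of _ "Pow (red e ` V n)"]) (auto intro!: image_eqI simp: finite_red dest: LagD(1))

lemma img_in_level_iff:
  assumes "isop n g h" "Lag n Z" "Lag n Z'"
  shows "red e ` img n h Z = red e ` img n h Z' \<longleftrightarrow> red e ` Z = red e ` Z'"
proof -
  have *: "red e ` img n h Z = red e ` img n h Z'" if "isop n g h" "Lag n Z" "Lag n Z'" "red e ` Z = red e ` Z'" for g h Z Z'
    using red_img[OF that(1) Lag_subset[OF that(2)] Lag_iso_sat[OF that(3)], of e]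
      red_img[OF that(1) Lag_subset[OF that(3)] Lag_iso_sat[OF that(2)], of e] that(4) by auto
  show ?thesis
  proof
    assume "red e ` img n h Z = red e ` img n h Z'"
    from *[OF isop_sym[OF assms(1)] Lag_img[OF assms(1,2)] Lag_img[OF assms(1,3)] this]
    show "red e ` Z = red e ` Z'"
      unfolding img_img[OF assms(1) Lag_iso_sat[OF assms(2)]] img_img[OF assms(1) Lag_iso_sat[OF assms(3)]] .
  qed (rule *[OF assms])
qed

sublocale LT: tower "Lags n" "\<lambda>e Z. red e ` Z" for n
proof
  show "Lags n \<noteq> {}" using Lag_E by blast
  show "finite ((\<lambda>Z. red e ` Z) ` Lags n)" for e by (rule finite_levels)
  fix e x y assume "x \<in> Lags n" "y \<in> Lags n" "red (Suc e) ` x = red (Suc e) ` y"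
  then show "red e ` x = red e ` y" using red_nested[of x n y e] red_nested[of y n x e] Lag_subset by blast
qed

lemma Lag_cell_img:
  assumes "isop n g h" "Lag n Z"
  shows "LT.cell n e (img n h Z) = img n h ` LT.cell n e Z"
proof (intro equalityI subsetI)
  fix Y assume Y: "Y \<in> LT.cell n e (img n h Z)"
  then have YL: "Lag n Y" "red e ` Y = red e ` img n h Z" by (auto simp: LT.cell_def)
  have YY: "img n h (img n g Y) = Y" by (rule img_img[OF isop_sym[OF assms(1)] Lag_iso_sat[OF YL(1)]])
  have L: "Lag n (img n g Y)" by (rule Lag_img[OF isop_sym[OF assms(1)] YL(1)])
  have "red e ` img n g Y = red e ` Z" using img_in_level_iff[OF assms(1) L assms(2), of e] YY YL(2) by simp
  then have "img n g Y \<in> LT.cell n e Z" using L by (simp add: LT.cell_def)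
  then show "Y \<in> img n h ` LT.cell n e Z" using YY by force
next
  fix Y assume "Y \<in> img n h ` LT.cell n e Z"
  then obtain Y' where Y: "Lag n Y'" "red e ` Y' = red e ` Z" "Y = img n h Y'" by (auto simp: LT.cell_def)
  then show "Y \<in> LT.cell n e (img n h Z)"
    using Lag_img[OF assms(1) Y(1)] img_in_level_iff[OF assms(1) Y(1) assms(2), of e] by (simp add: LT.cell_def)
qed

text \<open>Regularity comes from transitivity: an isometry taking x to y carries the cell of x to
  that of y and induces a bijection \<psi> of their images one level further.\<close>

sublocale LR: regular_tower "Lags n" "\<lambda>e Z. red e ` Z" for n
proof
  show "\<exists>x\<in>Lags n. \<forall>e. red e ` x = red e ` xs e"
    if "\<And>e. xs e \<in> Lags n" "\<And>e. red e ` xs (Suc e) = red e ` xs e" for xs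
    using Lag_complete[of n xs] that by auto
  show "red 0 ` x = red 0 ` y" if "x \<in> Lags n" "y \<in> Lags n" for x y
  proof -
    have "red 0 ` z = {\<lambda>_. 0}" if "Lag n z" for z
      using submD(2)[OF iso_satD(1)[OF Lag_iso_sat[OF that]]] by (auto simp: red_def)
    then show ?thesis using that by simp
  qed
  fix x y e assume "x \<in> Lags n" "y \<in> Lags n"
  then obtain g h where g: "isop n g h" "y = img n h x" using Lag_transitive by blast
  have x: "Lag n x" using \<open>x \<in> Lags n\<close> by simp
  define \<psi> where "\<psi> b = red (Suc e) ` img n h (SOME Z. Z \<in> LT.cell n e x \<and> red (Suc e) ` Z = b)" for b
  have \<psi>: "\<psi> (red (Suc e) ` Z) = red (Suc e) ` img n h Z" if "Z \<in> LT.cell n e x" for Z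
  proof -
    have "(SOME Z'. Z' \<in> LT.cell n e x \<and> red (Suc e) ` Z' = red (Suc e) ` Z) \<in> LT.cell n e x \<and>
      red (Suc e) ` (SOME Z'. Z' \<in> LT.cell n e x \<and> red (Suc e) ` Z' = red (Suc e) ` Z) = red (Suc e) ` Z"
      by (rule someI[of _ Z]) (use that in simp)
    then show ?thesis unfolding \<psi>_def using that img_in_level_iff[OF g(1)] by (simp add: LT.cell_def)
  qed
  have "bij_betw \<psi> ((\<lambda>Z. red (Suc e) ` Z) ` LT.cell n e x) ((\<lambda>Z. red (Suc e) ` Z) ` LT.cell n e y)"
  proof (rule bij_betw_imageI)
    show "inj_on \<psi> ((\<lambda>Z. red (Suc e) ` Z) ` LT.cell n e x)"
    proof (rule inj_onI, elim imageE)
      fix a b Z Z' assume "\<psi> a = \<psi> b" "a = red (Suc e) ` Z" "Z \<in> LT.cell n e x" "b = red (Suc e) ` Z'" "Z' \<in> LT.cell n e x"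
      then show "a = b" using \<psi> img_in_level_iff[OF g(1), of Z Z' "Suc e"] by (simp add: LT.cell_def)
    qed
    show "\<psi> ` (\<lambda>Z. red (Suc e) ` Z) ` LT.cell n e x = (\<lambda>Z. red (Suc e) ` Z) ` LT.cell n e y"
      unfolding g(2) Lag_cell_img[OF g(1) x] image_image by (rule image_cong) (auto simp: \<psi>)
  qed
  then show "card ((\<lambda>Z. red (Suc e) ` Z) ` LT.cell n e x) = card ((\<lambda>Z. red (Suc e) ` Z) ` LT.cell n e y)"
    by (rule bij_betw_same_card)
qed

definition mu :: "nat \<Rightarrow> vec set measure"
  where "mu n = (THE M. LT.unif n M)"

lemma mu_unif: "LT.unif n (mu n)"
  unfolding mu_def by (rule theI') (use LR.unif_exists LT.unif_unique in blast)

lemmas mu_D = LT.unifD[OF mu_unif]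

lemma mu_eqI: "LT.unif n M \<Longrightarrow> M = mu n"
  by (rule LT.unif_unique[OF _ mu_unif])

sublocale muP: prob_space "mu n" for n
  by (rule mu_D(1))

sublocale OT: tower "OGr p n" "\<lambda>e. reduction p n e" for n
proof
  show "OGr p n \<noteq> {}" using Lag_OGr[OF Lag_E] by blast
  have req: "reduction p n e Z = reduction p n e Z' \<longleftrightarrow> red e ` rawz n Z = red e ` rawz n Z'"
    if "Z \<in> OGr p n" "Z' \<in> OGr p n" for Z Z' e
    using reduction_eq_iff[OF Lag_subset[OF OGr_Lag(1)[OF that(1)]] Lag_subset[OF OGr_Lag(1)[OF that(2)]], of e]
      OGr_Lag(2)[OF that(1)] OGr_Lag(2)[OF that(2)] by simp
  show "reduction p n e x = reduction p n e y"
    if "x \<in> OGr p n" "y \<in> OGr p n" "reduction p n (Suc e) x = reduction p n (Suc e) y" for e x y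
    using that LT.nested[of "rawz n x" n "rawz n y" e] OGr_Lag(1) by (simp add: req)
  show "finite (reduction p n e ` OGr p n)" for e
  proof -
    \<comment> \<open>Finiteness is inherited from the Lagrangians by choosing one element of
      \<open>OGr\<close> for each of their reductions.\<close>
    have "finite ((\<lambda>b. reduction p n e (SOME Z. Z \<in> OGr p n \<and> red e ` rawz n Z = b)) ` ((\<lambda>Z. red e ` Z) ` Lags n))"
      (is "finite ?B") using finite_levels by blast
    moreover have "reduction p n e ` OGr p n \<subseteq> ?B"
    proof
      fix x assume "x \<in> reduction p n e ` OGr p n"
      then obtain Z where Z: "Z \<in> OGr p n" "x = reduction p n e Z" by blast
      let ?Y = "SOME Y. Y \<in> OGr p n \<and> red e ` rawz n Y = red e ` rawz n Z"
      have "?Y \<in> OGr p n \<and> red e ` rawz n ?Y = red e ` rawz n Z" by (rule someI[of _ Z]) (use Z in simp)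
      then have "x = reduction p n e ?Y" using req[of ?Y Z e] Z by simp
      then show "x \<in> ?B" using OGr_Lag(1)[OF Z(1)] by blast
    qed
    ultimately show ?thesis by (rule finite_subset[rotated])
  qed
qed

lemma natural_iff: "is_natural_measure p n M \<longleftrightarrow> OT.unif n M"
proof -
  have "{{Z' \<in> OGr p n. reduction p n e Z' = reduction p n e Z} | e Z. Z \<in> OGr p n} = OT.cells n"
    by (simp add: OT.cells_def OT.cell_def)
  then have "sigma_sets (OGr p n) {U. openin (OGr_topology p n) U} = sigma_sets (OGr p n) (OT.cells n)"
    unfolding OGr_topology_def by (simp add: OT.open_in_sigma)
  then show ?thesis
    unfolding is_natural_measure_def OT.unif_def using OT.distr_level_iff[of M n] by blast
qed

lemma ofr_image_measurable:
  "(\<lambda>L. ofr n ` L) \<in> measurable (mu n) (sigma (OGr p n) (OT.cells n))"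
  "Lag n L \<Longrightarrow> (\<lambda>L. ofr n ` L) -` OT.cell n e (ofr n ` L) \<inter> space (mu n) = LT.cell n e L"
proof -
  show *: "(\<lambda>L. ofr n ` L) -` OT.cell n e (ofr n ` L) \<inter> space (mu n) = LT.cell n e L" if "Lag n L" for L e
  proof (rule Set.set_eqI)
    fix L'
    show "L' \<in> (\<lambda>L. ofr n ` L) -` OT.cell n e (ofr n ` L) \<inter> space (mu n) \<longleftrightarrow> L' \<in> LT.cell n e L"
      using reduction_eq_iff[OF Lag_subset Lag_subset[OF that], of L' e] Lag_OGr[of n L']
      by (cases "Lag n L'") (simp_all add: mu_D(2) OT.cell_def LT.cell_def)
  qed
  show "(\<lambda>L. ofr n ` L) \<in> measurable (mu n) (sigma (OGr p n) (OT.cells n))"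
  proof (rule measurable_measure_of[OF OT.cells_subset])
    show "(\<lambda>L. ofr n ` L) \<in> space (mu n) \<rightarrow> OGr p n" using Lag_OGr by (auto simp: mu_D(2))
    fix A assume "A \<in> OT.cells n"
    then obtain e x where x: "x \<in> OGr p n" "A = OT.cell n e x" unfolding OT.cells_def by blast
    then obtain L where "Lag n L" "A = OT.cell n e (ofr n ` L)" using OGr_Lag[OF x(1)] by metis
    then show "(\<lambda>L. ofr n ` L) -` A \<inter> space (mu n) \<in> sets (mu n)"
      using * LT.cell_sets[OF mu_D(3), of L n e] by simp
  qed
qed

text \<open>The image of \<open>mu n\<close> under \<open>ofr\<close> gives equal mass to all cells
  of a level, because these pull back to cells of Lagrangians.\<close>

lemma natural_measure_eq:
  "natural_measure p n = distr (mu n) (sigma (OGr p n) (OT.cells n)) (\<lambda>L. ofr n ` L)" (is "_ = ?N")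
  and natural_measure_unif: "OT.unif n (natural_measure p n)"
proof -
  have u: "OT.unif n ?N"
  proof (rule OT.unifI)
    show "prob_space ?N" by (rule muP.prob_space_distr[OF ofr_image_measurable(1)])
    show "space ?N = OGr p n" "sets ?N = sigma_sets (OGr p n) (OT.cells n)" using OT.cells_subset by auto
    have "measure ?N (OT.cell n e (ofr n ` L)) = 1 / card ((\<lambda>Z. red e ` Z) ` Lags n)" if "Lag n L" for L e
      using OT.cell_in_cells[OF Lag_OGr[OF that]] OT.cells_subset mu_D(4)[of L n e] that
      by (subst measure_distr[OF ofr_image_measurable(1)]) (auto simp: ofr_image_measurable(2)[OF that])
    from this[OF OGr_Lag(1)] have "measure ?N (OT.cell n e x) = 1 / card ((\<lambda>Z. red e ` Z) ` Lags n)" if "x \<in> OGr p n" for e x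
      using that by (simp add: OGr_Lag(2))
    then show "measure ?N (OT.cell n e x) = measure ?N (OT.cell n e y)" if "x \<in> OGr p n" "y \<in> OGr p n" for e x y
      using that by simp
  qed
  have "natural_measure p n = ?N" unfolding natural_measure_def natural_iff
    by (rule the_equality[where P = "OT.unif n", OF u]) (rule OT.unif_unique[OF _ u])
  then show "natural_measure p n = ?N" "OT.unif n (natural_measure p n)" using u by simp_all
qed

end

section \<open>The law of the sizes of the reduced intersections\<close>

text \<open>Double counting: the sum of the probabilities is the integral over A of the number of x
  in T with w in \<open>D x\<close>.\<close>

lemma (in prob_space) sum_measure_count:
  fixes k :: real
  assumes "finite T" "A \<in> sets M" "\<And>x. x \<in> T \<Longrightarrow> D x \<in> sets M"
  shows "(\<And>w. w \<in> A \<Longrightarrow> real (card {x\<in>T. w \<in> D x}) = k) \<Longrightarrow> (\<Sum>x\<in>T. prob (A \<inter> D x)) = k * prob A"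
    and "(\<And>w. w \<in> A \<Longrightarrow> k \<le> real (card {x\<in>T. w \<in> D x})) \<Longrightarrow> k * prob A \<le> (\<Sum>x\<in>T. prob (A \<inter> D x))"
proof -
  have m: "A \<inter> D x \<in> sets M" if "x \<in> T" for x using assms that by auto
  have ii: "integrable M (indicat_real B)" if "B \<in> sets M" for B
    by (rule integrable_real_indicator[OF that]) (simp add: emeasure_eq_measure)
  have i: "integrable M (\<lambda>w. \<Sum>x\<in>T. indicat_real (A \<inter> D x) w)" "integrable M (\<lambda>w. k * indicat_real A w)"
    using m assms(2) by (auto intro!: Bochner_Integration.integrable_sum ii integrable_mult_right)
  have 1: "(\<Sum>x\<in>T. prob (A \<inter> D x)) = (\<integral>w. (\<Sum>x\<in>T. indicat_real (A \<inter> D x) w) \<partial>M)"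
    using m by (subst Bochner_Integration.integral_sum) (auto intro: ii)
  have 2: "k * prob A = (\<integral>w. k * indicat_real A w \<partial>M)"
    using assms(2) by simp
  have 3: "(\<Sum>x\<in>T. indicat_real (A \<inter> D x) w) = (if w \<in> A then real (card {x\<in>T. w \<in> D x}) else 0)" for w
  proof (cases "w \<in> A")
    case True
    then have "(\<Sum>x\<in>T. indicat_real (A \<inter> D x) w) = (\<Sum>x\<in>T. if w \<in> D x then 1 else 0)"
      by (intro sum.cong) (auto simp: indicator_def)
    also have "\<dots> = real (card {x\<in>T. w \<in> D x})"
      by (subst sum.inter_filter[OF assms(1), symmetric]) simp
    finally show ?thesis using True by simp
  qed simp
  show "(\<Sum>x\<in>T. prob (A \<inter> D x)) = k * prob A" if "\<And>w. w \<in> A \<Longrightarrow> real (card {x\<in>T. w \<in> D x}) = k"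
    unfolding 1 2 3 using that by (intro Bochner_Integration.integral_cong) (auto simp: indicator_def)
  show "k * prob A \<le> (\<Sum>x\<in>T. prob (A \<inter> D x))" if "\<And>w. w \<in> A \<Longrightarrow> k \<le> real (card {x\<in>T. w \<in> D x})"
    unfolding 1 2
  proof (rule integral_mono[OF i(2,1)])
    show "k * indicat_real A w \<le> (\<Sum>x\<in>T. indicat_real (A \<inter> D x) w)" for w
      unfolding 3 using that[of w] by simp
  qed
qed

context padic begin

definition sg :: "vec set \<Rightarrow> vec set \<Rightarrow> nat \<Rightarrow> nat"
  where "sg Z W = (\<lambda>e. card (red e ` Z \<inter> red e ` W))"

lemma level_event: "{W. Lag n W \<and> \<Phi> (red e ` W)} \<in> sets (mu n)"
  by (rule LT.level_event_sets[OF mu_D(3), of _ n e]) auto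

lemma sg_event: "{W. Lag n W \<and> sg Z W = s} \<in> sets (mu n)"
proof -
  have "{W \<in> space (mu n). \<forall>e. card (red e ` Z \<inter> red e ` W) = s e} \<in> sets (mu n)"
    by (rule sets.sets_Collect_countable_All) (use level_event in \<open>simp add: mu_D(2)\<close>)
  then show ?thesis by (simp add: mu_D(2) sg_def fun_eq_iff)
qed

text \<open>An isometry permutes the cells of each level, so the image of \<open>mu n\<close> is
  again uniform, and the uniform measure is unique.\<close>

lemma img_measurable: assumes "isop n g h"
  shows "img n h \<in> measurable (mu n) (mu n)" "distr (mu n) (mu n) (img n h) = mu n"
proof -
  have pre: "img n h -` LT.cell n e Y \<inter> space (mu n) = LT.cell n e (img n g Y)" if Y: "Lag n Y" for e Y
  proof (rule Set.set_eqI)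
    fix Z
    have L: "Lag n (img n g Y)" by (rule Lag_img[OF isop_sym[OF assms] Y])
    have YY: "img n h (img n g Y) = Y" by (rule img_img[OF isop_sym[OF assms] Lag_iso_sat[OF Y]])
    show "Z \<in> img n h -` LT.cell n e Y \<inter> space (mu n) \<longleftrightarrow> Z \<in> LT.cell n e (img n g Y)"
      using img_in_level_iff[OF assms _ L, of Z e] YY Lag_img[OF assms, of Z]
      by (cases "Lag n Z") (simp_all add: mu_D(2) LT.cell_def)
  qed
  have "img n h \<in> measurable (mu n) (sigma (Lags n) (LT.cells n))"
  proof (rule measurable_measure_of[OF LT.cells_subset])
    show "img n h \<in> space (mu n) \<rightarrow> Lags n" using Lag_img[OF assms] by (auto simp: mu_D(2))
    fix A assume "A \<in> LT.cells n"
    then obtain e Y where Y: "Lag n Y" "A = LT.cell n e Y" unfolding LT.cells_def by blast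
    show "img n h -` A \<inter> space (mu n) \<in> sets (mu n)"
      unfolding Y(2) pre[OF Y(1)] using LT.cell_sets[OF mu_D(3)] Lag_img[OF isop_sym[OF assms] Y(1)] by blast
  qed
  moreover have "sets (sigma (Lags n) (LT.cells n)) = sets (mu n)" using LT.cells_subset by (simp add: mu_D(3))
  ultimately show m: "img n h \<in> measurable (mu n) (mu n)" using measurable_cong_sets by blast
  show "distr (mu n) (mu n) (img n h) = mu n"
  proof (rule mu_eqI, rule LT.unifI)
    show "prob_space (distr (mu n) (mu n) (img n h))" by (rule muP.prob_space_distr[OF m])
    have "measure (distr (mu n) (mu n) (img n h)) (LT.cell n e x) = 1 / card ((\<lambda>Z. red e ` Z) ` Lags n)"
      if "x \<in> Lags n" for e x
      using that Lag_img[OF isop_sym[OF assms]] mu_D(4)[of "img n g x" n e]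
      by (subst measure_distr[OF m]) (auto simp: pre intro!: LT.cell_sets[OF mu_D(3)])
    then show "measure (distr (mu n) (mu n) (img n h)) (LT.cell n e x) = measure (distr (mu n) (mu n) (img n h)) (LT.cell n e y)"
      if "x \<in> Lags n" "y \<in> Lags n" for e x y using that by simp
  qed (simp_all add: mu_D)
qed

lemma measure_img:
  assumes "isop n g h" "{W. Lag n W \<and> \<Phi> W} \<in> sets (mu n)"
  shows "measure (mu n) {W. Lag n W \<and> \<Phi> W} = measure (mu n) {W. Lag n W \<and> \<Phi> (img n h W)}"
proof -
  have "measure (mu n) {W. Lag n W \<and> \<Phi> W} = measure (distr (mu n) (mu n) (img n h)) {W. Lag n W \<and> \<Phi> W}"
    by (simp add: img_measurable(2)[OF assms(1)])
  also have "\<dots> = measure (mu n) (img n h -` {W. Lag n W \<and> \<Phi> W} \<inter> space (mu n))"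
    by (rule measure_distr[OF img_measurable(1)[OF assms(1)] assms(2)])
  also have "img n h -` {W. Lag n W \<and> \<Phi> W} \<inter> space (mu n) = {W. Lag n W \<and> \<Phi> (img n h W)}"
    using Lag_img[OF assms(1)] by (auto simp: mu_D(2))
  finally show ?thesis .
qed

text \<open>\<phi> is the action of the isometry on V modulo p^e, defined through chosen
  representatives; compatibility with \<open>near\<close> makes the choice immaterial.\<close>

lemma level_action:
  assumes "isop n g h"
  obtains \<phi> where "inj_on \<phi> (red e ` V n)" "\<And>v. v \<in> V n \<Longrightarrow> \<phi> (red e v) = red e (g v)"
    "\<And>Z. iso_sat n Z \<Longrightarrow> red e ` img n h Z = \<phi> ` red e ` Z"
proof -
  note D = isom1D[OF isopD(1)[OF assms]] and D' = isom1D[OF isopD(2)[OF assms]]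
  define \<phi> where "\<phi> x = red e (g (SOME z. z \<in> V n \<and> red e z = x))" for x
  have \<phi>: "\<phi> (red e z) = red e (g z)" if z: "z \<in> V n" for z
  proof -
    have "(SOME z'. z' \<in> V n \<and> red e z' = red e z) \<in> V n \<and> red e (SOME z'. z' \<in> V n \<and> red e z' = red e z) = red e z"
      by (rule someI[of _ z]) (use z in simp)
    then show ?thesis using D(4)[of "SOME z'. z' \<in> V n \<and> red e z' = red e z" z e] z
      unfolding \<phi>_def near_iff_red by blast
  qed
  have "inj_on \<phi> (red e ` V n)"
  proof (rule inj_onI, elim imageE)
    fix x y z w assume a: "\<phi> x = \<phi> y" "x = red e z" "z \<in> V n" "y = red e w" "w \<in> V n"
    then have "near e (g z) (g w)" using \<phi> by (simp add: near_iff_red)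
    then have "near e (h (g z)) (h (g w))" by (intro D'(4) D(1) a)
    then have "near e z w"
      using eqv_near[OF isopD(3)[OF assms a(3)], of e] eqv_near[OF isopD(3)[OF assms a(5)], of e] near_trans near_sym by blast
    then show "x = y" using a by (simp add: near_iff_red)
  qed
  moreover have "red e ` img n h Z = \<phi> ` red e ` Z" if Z: "iso_sat n Z" for Z
  proof (intro equalityI subsetI)
    note S = submD[OF iso_satD(1)[OF Z]]
    fix x assume "x \<in> \<phi> ` red e ` Z"
    then obtain z where z: "z \<in> Z" "x = red e (g z)" using \<phi> S(1) by auto
    have "h (g z) \<in> Z" by (rule S(5)[OF D'(1)[OF D(1)[OF S(1)[OF z(1)]]] z(1) isopD(3)[OF assms S(1)[OF z(1)]]])
    then have "g z \<in> img n h Z" using D(1)[OF S(1)[OF z(1)]] by (simp add: img_def)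
    then show "x \<in> red e ` img n h Z" using z(2) by blast
  next
    fix x assume "x \<in> red e ` img n h Z"
    then obtain v where v: "v \<in> V n" "h v \<in> Z" "x = red e v" by (auto simp: img_def)
    have "red e (g (h v)) = x" using eqv_near[OF isopD(4)[OF assms v(1)], of e] v(3) by (simp add: near_iff_red)
    then show "x \<in> \<phi> ` red e ` Z" using \<phi>[OF D'(1)[OF v(1)]] v(2) by force
  qed
  ultimately show ?thesis using that \<phi> by blast
qed

lemma sg_img:
  assumes "isop n g h" "Lag n Z" "Lag n W" shows "sg (img n h Z) (img n h W) = sg Z W"
proof
  fix e
  obtain \<phi> where f: "inj_on \<phi> (red e ` V n)" "\<And>v. v \<in> V n \<Longrightarrow> \<phi> (red e v) = red e (g v)"
    "\<And>Z. iso_sat n Z \<Longrightarrow> red e ` img n h Z = \<phi> ` red e ` Z" using level_action[OF assms(1), of e] by metis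
  have sub: "red e ` Z \<subseteq> red e ` V n" "red e ` W \<subseteq> red e ` V n" using Lag_subset assms by (meson image_mono)+
  have "\<phi> ` red e ` Z \<inter> \<phi> ` red e ` W = \<phi> ` (red e ` Z \<inter> red e ` W)"
    by (rule inj_on_image_Int[OF f(1) sub, symmetric])
  moreover have "inj_on \<phi> (red e ` Z \<inter> red e ` W)" using f(1) sub by (meson inf.coboundedI1 inj_on_subset)
  ultimately show "sg (img n h Z) (img n h W) e = sg Z W e"
    using f(3)[OF Lag_iso_sat[OF assms(2)]] f(3)[OF Lag_iso_sat[OF assms(3)]] by (simp add: sg_def card_image)
qed

lemma red_mem_img:
  assumes "isop n g h" "Lag n W" "v \<in> V n"
  shows "red e (g v) \<in> red e ` img n h W \<longleftrightarrow> red e v \<in> red e ` W"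
proof -
  obtain \<phi> where f: "inj_on \<phi> (red e ` V n)" "\<And>v. v \<in> V n \<Longrightarrow> \<phi> (red e v) = red e (g v)"
    "\<And>Z. iso_sat n Z \<Longrightarrow> red e ` img n h Z = \<phi> ` red e ` Z" using level_action[OF assms(1), of e] by metis
  show ?thesis
    unfolding f(3)[OF Lag_iso_sat[OF assms(2)]] f(2)[OF assms(3), symmetric]
    by (rule inj_on_image_mem_iff[OF f(1)]) (use assms(3) Lag_subset[OF assms(2)] in auto)
qed

definition Law :: "nat \<Rightarrow> (nat \<Rightarrow> nat) \<Rightarrow> real"
  where "Law n s = measure (mu n) {W. Lag n W \<and> sg (E n) W = s}"

text \<open>An isometry from \<open>E n\<close> to Z preserves both \<open>mu n\<close> and
  \<open>sg\<close>. Hence one may fix Z and let W alone be random.\<close>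

lemma Law_any: assumes "Lag n Z" shows "measure (mu n) {W. Lag n W \<and> sg Z W = s} = Law n s"
proof -
  obtain g h where g: "isop n g h" "Z = img n h (E n)" using Lag_transitive[OF Lag_E assms] by blast
  have "measure (mu n) {W. Lag n W \<and> sg Z W = s} = measure (mu n) {W. Lag n W \<and> sg Z (img n h W) = s}"
    by (rule measure_img[OF g(1) sg_event])
  also have "{W. Lag n W \<and> sg Z (img n h W) = s} = {W. Lag n W \<and> sg (E n) W = s}"
    using sg_img[OF g(1) Lag_E] by (auto simp: g(2))
  finally show ?thesis by (simp add: Law_def)
qed

section \<open>Reduction of Lagrangians along the isotropic line of \<open>eb n\<close>\<close>

abbreviation eb :: "nat \<Rightarrow> vec" where "eb n \<equiv> bas (2*n)"

lemma eb_V: "eb n \<in> V (Suc n)"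
  by (rule V_bas) simp

lemma bf_eb: "bf (Suc n) v (eb n) = v (2*n+1)"
  by (rule bf_bas_even) simp

lemma trunc_decomp:
  assumes "u \<in> V (Suc n)" "null (u (2*n+1))" shows "eqv u (trunc n u + u (2*n) \<triangleright> eb n)"
  unfolding eqv_def
proof
  fix i
  have "i < 2*n \<or> i = 2*n \<or> i = 2*n+1 \<or> i \<ge> 2 * Suc n" by auto
  then show "null (u i - (trunc n u + u (2*n) \<triangleright> eb n) i)"
    using assms(2) V_out[OF assms(1), of i] by (auto simp: trunc_def bas_apply)
qed

lemma decomp_V: "u \<in> V (Suc n) \<Longrightarrow> trunc n u + u (2*n) \<triangleright> eb n \<in> V (Suc n)"
  by (rule V_add[OF V_Suc[OF trunc_V] V_smul[OF V_coh eb_V]])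

lemma bf_Suc_V: "v \<in> V n \<Longrightarrow> bf (Suc n) v z = bf n v (trunc n z)"
  by (simp add: bf_Suc V_out) (simp add: bf_def trunc_def)

lemma qf_Suc_V: "v \<in> V n \<Longrightarrow> qf (Suc n) v = qf n v"
  by (simp add: qf_Suc V_out)

text \<open>Orthogonality to \<open>eb n\<close> removes the last coordinate; what remains splits
  into the line of \<open>eb n\<close> and the trace on \<open>V n\<close>.\<close>

lemma Lag_section:
  assumes Z: "Lag (Suc n) Z" and b: "eb n \<in> Z"
  shows "z \<in> Z \<Longrightarrow> null (z (2*n+1))" "z \<in> Z \<Longrightarrow> trunc n z \<in> Z \<inter> V n" "Lag n (Z \<inter> V n)"
proof -
  note S = submD[OF iso_satD(1)[OF Lag_iso_sat[OF Z]]]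
  show n1: "null (z (2*n+1))" if "z \<in> Z" for z using LagD(3)[OF Z that b] bf_eb[of n z] by simp
  show tr: "trunc n z \<in> Z \<inter> V n" if z: "z \<in> Z" for z
  proof -
    have "eqv (z - z (2*n) \<triangleright> eb n) (trunc n z + z (2*n) \<triangleright> eb n - z (2*n) \<triangleright> eb n)"
      by (rule eqv_diff[OF trunc_decomp[OF S(1)[OF z] n1[OF z]] eqv_refl])
    then have "eqv (trunc n z) (z - z (2*n) \<triangleright> eb n)" using eqv_sym by simp
    moreover have "z - z (2*n) \<triangleright> eb n \<in> Z" by (rule S(6)[OF z S(4)[OF b V_coh[OF S(1)[OF z]]]])
    ultimately have "trunc n z \<in> Z" using S(5)[OF V_Suc[OF trunc_V[OF S(1)[OF z]]]] by blast
    then show ?thesis using trunc_V[OF S(1)[OF z]] by simp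
  qed
  show "Lag n (Z \<inter> V n)" unfolding Lag_def
  proof (intro equalityI subsetI)
    fix v assume v: "v \<in> Z \<inter> V n"
    then have "null (qf n v)" using LagD(2)[OF Z, of v] qf_Suc_V by simp
    moreover have "null (bf n v z)" if "z \<in> Z \<inter> V n" for z
      using LagD(3)[OF Z, of v z] v that bf_Suc_V[of v n z] trunc_id[of z n] by simp
    ultimately show "v \<in> {v \<in> V n. null (qf n v) \<and> (\<forall>z\<in>Z \<inter> V n. null (bf n v z))}" using v by blast
  next
    fix v assume v: "v \<in> {v \<in> V n. null (qf n v) \<and> (\<forall>z\<in>Z \<inter> V n. null (bf n v z))}"
    then have vV: "v \<in> V n" by blast
    have "v \<in> Z"
    proof (rule LagD(4)[OF Z V_Suc[OF vV]])
      show "null (qf (Suc n) v)" using v qf_Suc_V by simp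
      show "null (bf (Suc n) v z)" if "z \<in> Z" for z using v tr[OF that] bf_Suc_V[OF vV] by simp
    qed
    then show "v \<in> Z \<inter> V n" using vV by blast
  qed
qed

definition avoid :: "nat \<Rightarrow> vec set set"
  where "avoid n = {W. Lag (Suc n) W \<and> red 1 (eb n) \<notin> red 1 ` W}"

text \<open>Isotropic reduction: \<open>V n\<close> models the orthogonal complement of
  \<open>eb n\<close> modulo its line, and \<open>rd n W\<close> is the image there of the part of W
  orthogonal to \<open>eb n\<close>.\<close>

definition rd :: "nat \<Rightarrow> vec set \<Rightarrow> vec set"
  where "rd n W = {u \<in> V n. \<exists>c. coh c \<and> u + c \<triangleright> eb n \<in> W}"

text \<open>By self-duality of the reduction modulo p, missing \<open>eb n\<close> there means that
  some vector of W pairs with it to a unit; scaling turns the unit into 1.\<close>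

lemma avoid_unit:
  assumes "W \<in> avoid n" obtains w0 where "w0 \<in> W" "null (w0 (2*n+1) - 1)"
proof -
  have W: "Lag (Suc n) W" "red 1 (eb n) \<notin> red 1 ` W" using assms by (auto simp: avoid_def)
  then obtain z where z: "z \<in> W" "\<not> P 1 dvd lev (bf (Suc n) (eb n) z) 1"
    using Lag_level[OF W(1) eb_V, of 1] red_in_image by blast
  have "bf (Suc n) (eb n) z = z (2*n+1)" using bf_eb bf_commute by metis
  then have "\<not> int p dvd lev (z (2*n+1)) 1" using z(2) by simp
  then obtain c where c: "coh c" "null (z (2*n+1) * c - 1)"
    using coh_inverse[OF V_coh[OF LagD(1)[OF W(1) z(1)]]] by metis
  have "c \<triangleright> z \<in> W" by (rule submD(4)[OF iso_satD(1)[OF Lag_iso_sat[OF W(1)]] z(1) c(1)])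
  then show ?thesis using that[of "c \<triangleright> z"] c(2) by (simp add: mult.commute)
qed

text \<open>Subtracting \<open>w (2*n+1)\<close> times the vector w0 of \<open>avoid_unit\<close>
  makes w orthogonal to \<open>eb n\<close> without changing it modulo p^e.\<close>

lemma avoid_near:
  assumes W: "W \<in> avoid n" and w: "w \<in> W" "P e dvd lev (w (2*n+1)) e"
  shows "\<exists>w'\<in>W. near e w w' \<and> null (w' (2*n+1)) \<and> trunc n w' \<in> rd n W"
proof -
  have L: "Lag (Suc n) W" using W by (simp add: avoid_def)
  note S = submD[OF iso_satD(1)[OF Lag_iso_sat[OF L]]]
  obtain w0 where w0: "w0 \<in> W" "null (w0 (2*n+1) - 1)" using avoid_unit[OF W] .
  define w' where "w' = w - w (2*n+1) \<triangleright> w0"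
  have w': "w' \<in> W" unfolding w'_def by (rule S(6)[OF w(1) S(4)[OF w0(1) V_coh[OF S(1)[OF w(1)]]]])
  have "near e w w'" using w(2) by (simp add: near_def w'_def)
  moreover have nw': "null (w' (2*n+1))"
  proof -
    have "w' (2*n+1) = - (w (2*n+1) * (w0 (2*n+1) - 1))" by (simp add: w'_def algebra_simps)
    then show ?thesis using w0(2) by (simp add: null_mult(2))
  qed
  moreover have "trunc n w' \<in> rd n W"
  proof -
    have V: "trunc n w' \<in> V n" "trunc n w' + w' (2*n) \<triangleright> eb n \<in> V (Suc n)"
      using trunc_V[OF S(1)[OF w']] decomp_V[OF S(1)[OF w']] by blast+
    have "trunc n w' + w' (2*n) \<triangleright> eb n \<in> W"
      by (rule S(5)[OF V(2) w' eqv_sym[OF trunc_decomp[OF S(1)[OF w'] nw']]])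
    then show ?thesis using V(1) V_coh[OF S(1)[OF w']] by (auto simp: rd_def)
  qed
  ultimately show ?thesis using w' by blast
qed

text \<open>Pairing with the vector w0 of \<open>avoid_unit\<close> returns the coefficient c. So
  the line of \<open>eb n\<close> meets W trivially modulo every p^e, not only modulo p, which makes
  truncation injective in \<open>sg_rd\<close>.\<close>

lemma avoid_eb_mult:
  assumes W: "W \<in> avoid n" and c: "coh c" "w \<in> W" "near e (c \<triangleright> eb n) w" shows "P e dvd lev c e"
proof -
  have L: "Lag (Suc n) W" using W by (simp add: avoid_def)
  obtain w0 where w0: "w0 \<in> W" "null (w0 (2*n+1) - 1)" using avoid_unit[OF W] .
  have "P e dvd lev (bf (Suc n) w0 (c \<triangleright> eb n)) e - lev (bf (Suc n) w0 w) e" by (rule near_bf[OF near_refl c(3)])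
  moreover have "P e dvd lev (bf (Suc n) w0 w) e" using LagD(3)[OF L w0(1) c(2)] by (simp add: null_def)
  ultimately have "P e dvd lev (bf (Suc n) w0 (c \<triangleright> eb n)) e" by (metis diff_add_cancel dvd_add)
  then have "P e dvd lev c e * lev (w0 (2*n+1)) e" by (simp add: bf_smul_right bf_eb del: One_nat_def)
  moreover have "P e dvd lev c e * (lev (w0 (2*n+1)) e - 1)" using w0(2) by (simp add: null_def)
  ultimately have "P e dvd lev c e * lev (w0 (2*n+1)) e - lev c e * (lev (w0 (2*n+1)) e - 1)" by (rule dvd_diff)
  then show ?thesis by (simp add: algebra_simps)
qed

lemma Lag_rd: assumes W: "W \<in> avoid n" shows "Lag n (rd n W)"
  unfolding Lag_def
proof (intro equalityI subsetI)
  have L: "Lag (Suc n) W" using W by (simp add: avoid_def)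
  note S = submD[OF iso_satD(1)[OF Lag_iso_sat[OF L]]]
  have qc: "qf (Suc n) (u + c \<triangleright> eb n) = qf n u" if "u \<in> V n" for u c
    using bf_eb[of n u] V_out[OF that, of "2*n+1"] by (simp add: qf_add qf_smul bf_smul_right qf_Suc_V[OF that])
  have bc: "bf (Suc n) (u + c \<triangleright> eb n) (v + d \<triangleright> eb n) = bf n u v" if "u \<in> V n" "v \<in> V n" for u v c d
    using bf_eb[of n u] bf_eb[of n v] bf_eb[of n "eb n"] V_out[OF that(1), of "2*n+1"] V_out[OF that(2), of "2*n+1"]
      bf_commute[of "Suc n" "eb n" v] bf_Suc_V[OF that(1), of v] trunc_id[OF that(2)]
    by (simp add: bf_simps bas_apply)
  {
    fix u assume "u \<in> rd n W"
    then obtain c where u: "u \<in> V n" "coh c" "u + c \<triangleright> eb n \<in> W" by (auto simp: rd_def)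
    have "null (qf n u)" using LagD(2)[OF L u(3)] qc[OF u(1)] by simp
    moreover have "null (bf n u v)" if "v \<in> rd n W" for v
    proof -
      obtain d where v: "v \<in> V n" "coh d" "v + d \<triangleright> eb n \<in> W" using \<open>v \<in> rd n W\<close> by (auto simp: rd_def)
      show ?thesis using LagD(3)[OF L u(3) v(3)] bc[OF u(1) v(1)] by simp
    qed
    ultimately show "u \<in> {v \<in> V n. null (qf n v) \<and> (\<forall>z\<in>rd n W. null (bf n v z))}" using u(1) by blast
  }
  fix u assume "u \<in> {v \<in> V n. null (qf n v) \<and> (\<forall>z\<in>rd n W. null (bf n v z))}"
  then have u: "u \<in> V n" "null (qf n u)" "\<And>z. z \<in> rd n W \<Longrightarrow> null (bf n u z)" by blast+
  obtain w0 where w0: "w0 \<in> W" "null (w0 (2*n+1) - 1)" using avoid_unit[OF W] .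
  have w0V: "w0 \<in> V (Suc n)" by (rule S(1)[OF w0(1)])
  \<comment> \<open>This choice makes \<open>u + c \<triangleright> eb n\<close> orthogonal to w0.
    Every vector of W is a multiple of w0 plus a vector orthogonal to \<open>eb n\<close> up to null
    terms, and on the latter the hypothesis on u applies.\<close>
  define c where "c = - bf (Suc n) u w0"
  have c: "coh c" unfolding c_def by (intro coh_uminus coh_bf[OF V_Suc[OF u(1)] w0V])
  let ?x = "u + c \<triangleright> eb n"
  have xV: "?x \<in> V (Suc n)" using u c by (intro V_add V_smul V_Suc eb_V)
  have xw: "bf (Suc n) ?x w = bf (Suc n) u w + c * w (2*n+1)" for w
    using bf_eb[of n w] bf_commute[of "Suc n" "eb n" w] by (simp add: bf_simps)
  have x0: "null (bf (Suc n) ?x w0)"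
  proof -
    have "bf (Suc n) ?x w0 = c * (w0 (2*n+1) - 1)" unfolding xw by (simp add: c_def algebra_simps)
    then show ?thesis using w0(2) by (simp add: null_mult(2))
  qed
  have "?x \<in> W"
  proof (rule LagD(4)[OF L xV])
    show "null (qf (Suc n) ?x)" using qc[OF u(1)] u(2) by simp
    fix w assume w: "w \<in> W"
    define w' where "w' = w - w (2*n+1) \<triangleright> w0"
    have w': "w' \<in> W" unfolding w'_def by (rule S(6)[OF w S(4)[OF w0(1) V_coh[OF S(1)[OF w]]]])
    have nw': "null (w' (2*n+1))"
    proof -
      have "w' (2*n+1) = - (w (2*n+1) * (w0 (2*n+1) - 1))" by (simp add: w'_def algebra_simps)
      then show ?thesis using w0(2) by (simp add: null_mult(2))
    qed
    have "trunc n w' \<in> rd n W"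
    proof -
      have V: "trunc n w' \<in> V n" "trunc n w' + w' (2*n) \<triangleright> eb n \<in> V (Suc n)"
        using trunc_V[OF S(1)[OF w']] decomp_V[OF S(1)[OF w']] by blast+
      have "trunc n w' + w' (2*n) \<triangleright> eb n \<in> W"
        by (rule S(5)[OF V(2) w' eqv_sym[OF trunc_decomp[OF S(1)[OF w'] nw']]])
      then show ?thesis using V(1) V_coh[OF S(1)[OF w']] by (auto simp: rd_def)
    qed
    then have "null (bf (Suc n) u w')" using u(3) bf_Suc_V[OF u(1)] by simp
    then have "null (bf (Suc n) ?x w')" unfolding xw using nw' by (intro null_add null_mult(2))
    then have "null (bf (Suc n) ?x w' + w (2*n+1) * bf (Suc n) ?x w0)" using x0 by (intro null_add null_mult(2))
    moreover have "bf (Suc n) ?x w' + w (2*n+1) * bf (Suc n) ?x w0 = bf (Suc n) ?x w"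
      unfolding w'_def by (simp add: bf_diff_right bf_smul_right)
    ultimately show "null (bf (Suc n) ?x w)" by simp
  qed
  then show "u \<in> rd n W" using u(1) c by (auto simp: rd_def)
qed

lemma red_trunc: "red e (trunc n u) = (\<lambda>i. if i < 2*n then red e u i else 0)"
  by (auto simp: red_def trunc_def)

text \<open>Forgetting the last two coordinates is a bijection of the reduced intersections. Points
  with the same truncation differ by a multiple of \<open>eb n\<close> that lies in W modulo p^e,
  hence vanishes; conversely a point of \<open>rd n W\<close> lifts to W by adding a multiple of
  \<open>eb n\<close>, which lies in Z.\<close>

lemma sg_rd:
  assumes W: "W \<in> avoid n" and Z: "Lag (Suc n) Z" "eb n \<in> Z"
  shows "sg Z W = sg (Z \<inter> V n) (rd n W)"
proof
  fix e
  have L: "Lag (Suc n) W" using W by (simp add: avoid_def)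
  note SW = submD[OF iso_satD(1)[OF Lag_iso_sat[OF L]]] and SZ = submD[OF iso_satD(1)[OF Lag_iso_sat[OF Z(1)]]]
  define t where "t x = (\<lambda>i. if i < 2*n then x i else 0 :: int)" for x :: "nat \<Rightarrow> int"
  have rt: "t (red e u) = red e (trunc n u)" for u by (simp add: red_trunc t_def)
  let ?A = "red e ` Z \<inter> red e ` W" and ?B = "red e ` (Z \<inter> V n) \<inter> red e ` rd n W"
  have "bij_betw t ?A ?B"
  proof (rule bij_betw_imageI)
    show "inj_on t ?A"
    proof (rule inj_onI)
      fix x x' assume x: "x \<in> ?A" "x' \<in> ?A" "t x = t x'"
      then obtain z w z' w' where zw: "z \<in> Z" "x = red e z" "w \<in> W" "x = red e w"
        "z' \<in> Z" "x' = red e z'" "w' \<in> W" "x' = red e w'" by auto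
      define d where "d = z - z'"
      have dZ: "d \<in> Z" unfolding d_def by (rule SZ(6)[OF zw(1,5)])
      have "near e (trunc n z) (trunc n z')" using x(3) zw rt by (simp add: near_iff_red)
      then have "near e (trunc n z - trunc n z') (trunc n z' - trunc n z')" by (intro near_diff near_refl)
      moreover have "trunc n d = trunc n z - trunc n z'" by (rule ext) (simp add: d_def trunc_def)
      ultimately have "near e (trunc n d) 0" by simp
      then have "near e (trunc n d + d (2*n) \<triangleright> eb n) (0 + d (2*n) \<triangleright> eb n)" by (intro near_add near_refl)
      then have d1: "near e d (d (2*n) \<triangleright> eb n)"
        using near_trans[OF eqv_near[OF trunc_decomp[OF SZ(1)[OF dZ] Lag_section(1)[OF Z dZ]]]] by simp
      have d2: "near e d (w - w')" unfolding d_def using zw by (intro near_diff) (auto simp: near_iff_red)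
      have "w - w' \<in> W" by (rule SW(6)[OF zw(3,7)])
      from avoid_eb_mult[OF W V_coh[OF SZ(1)[OF dZ]] this near_trans[OF near_sym[OF d1] d2]]
      have "P e dvd lev (d (2*n)) e" .
      then have "near e (d (2*n) \<triangleright> eb n) 0" by (simp add: near_def)
      then have "near e d 0" using d1 near_trans by blast
      then have "near e z z'" by (simp add: near_def d_def)
      then show "x = x'" using zw by (simp add: near_iff_red)
    qed
    show "t ` ?A = ?B"
    proof (intro equalityI subsetI)
      fix y assume "y \<in> t ` ?A"
      then obtain z w where zw: "z \<in> Z" "w \<in> W" "red e z = red e w" "y = t (red e z)" by auto
      have "trunc n z \<in> Z \<inter> V n" by (rule Lag_section(2)[OF Z zw(1)])
      then have y1: "y \<in> red e ` (Z \<inter> V n)" using zw(4) rt by auto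
      have "near e z w" using zw(3) by (simp add: near_iff_red)
      then have "P e dvd lev (z (2*n+1)) e - lev (w (2*n+1)) e" unfolding near_def by blast
      moreover have "P e dvd lev (z (2*n+1)) e" using Lag_section(1)[OF Z zw(1)] by (simp add: null_def)
      ultimately have "P e dvd lev (w (2*n+1)) e" by (metis dvd_diff_right_iff dvd_diff_commute diff_diff_eq2 dvd_diff add_diff_cancel_left')
      then obtain w' where w': "w' \<in> W" "near e w w'" "trunc n w' \<in> rd n W" using avoid_near[OF W zw(2)] by blast
      have "y = red e (trunc n w')" using zw w'(2) near_trunc[of e w w' n] rt by (simp add: near_iff_red)
      then show "y \<in> ?B" using y1 w'(3) by blast
    next
      fix y assume "y \<in> ?B"
      then obtain z u where zu: "z \<in> Z" "z \<in> V n" "y = red e z" "u \<in> rd n W" "y = red e u" by auto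
      obtain c where c: "u \<in> V n" "coh c" "u + c \<triangleright> eb n \<in> W" using zu(4) by (auto simp: rd_def)
      have "z + c \<triangleright> eb n \<in> Z" by (rule SZ(3)[OF zu(1) SZ(4)[OF Z(2) c(2)]])
      moreover have "near e (z + c \<triangleright> eb n) (u + c \<triangleright> eb n)" using zu by (intro near_add) (simp_all add: near_iff_red)
      ultimately have "red e (z + c \<triangleright> eb n) \<in> ?A" using c(3) by (metis IntI image_eqI near_iff_red)
      moreover have "trunc n (z + c \<triangleright> eb n) = z"
        using V_out[OF zu(2)] by (auto simp: trunc_def bas_apply fun_eq_iff)
      then have "t (red e (z + c \<triangleright> eb n)) = y" using rt zu(3) by simp
      ultimately show "y \<in> t ` ?A" by blast
    qed
  qed
  then show "sg Z W e = sg (Z \<inter> V n) (rd n W) e" unfolding sg_def by (rule bij_betw_same_card)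
qed

end

section \<open>Conditioning on avoidance: the recursion and the estimates of \<open>beta\<close> and
  of the tail\<close>

context padic begin

lemma bf_F_null: "u \<in> F n \<Longrightarrow> v \<in> F n \<Longrightarrow> null (bf n u v)"
  by (rule iso_sat_bf[OF F_iso_sat])

lemma Lag_F: "Lag n (F n)"
  unfolding Lag_def
proof (intro equalityI subsetI)
  fix u assume "u \<in> F n"
  then show "u \<in> {v \<in> V n. null (qf n v) \<and> (\<forall>z\<in>F n. null (bf n v z))}"
    using iso_satD(2)[OF F_iso_sat] bf_F_null by (simp add: F_def)
next
  fix u assume u: "u \<in> {v \<in> V n. null (qf n v) \<and> (\<forall>z\<in>F n. null (bf n v z))}"
  have "odd i \<or> null (u i)" for i
  proof (cases "even i \<and> i < 2*n")
    case True
    then obtain k where k: "i = 2*k" by (elim conjE evenE)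
    then have kn: "k < n" using True by simp
    have "bas (2*k+1) j = (0::intseq)" if "even j" for j using that by (auto simp: bas_apply)
    then have "bas (2*k+1) \<in> F n" using V_bas[of "2*k+1" n] kn by (auto simp: F_def)
    then show ?thesis using u bf_bas_odd[OF kn, of u] k by auto
  next
    case False
    then show ?thesis using u V_out[of u n i] by auto
  qed
  then show "u \<in> F n" using u by (simp add: F_def)
qed

lemma avoid_sets: "avoid n \<in> sets (mu (Suc n))"
  unfolding avoid_def by (rule level_event)

definition beta :: "nat \<Rightarrow> real"
  where "beta n = measure (mu (Suc n)) (avoid n)"

lemma F_avoid: "F (Suc n) \<in> avoid n"
proof -
  have "\<not> near 1 (eb n) u" if "u \<in> F (Suc n)" for u
  proof
    assume "near 1 (eb n) u"
    then have "P 1 dvd lev (eb n (2*n)) 1 - lev (u (2*n)) 1" unfolding near_def by blast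
    moreover have "null (u (2*n))" using that unfolding F_def by (metis (no_types, lifting) mem_Collect_eq dvd_triv_left)
    then have "P 1 dvd lev (u (2*n)) 1" unfolding null_def by blast
    ultimately have "P 1 dvd lev (eb n (2*n)) 1" by (metis diff_add_cancel dvd_add)
    then show False using prime_intp by (simp add: bas_apply)
  qed
  then show ?thesis using Lag_F unfolding avoid_def red_in_image by blast
qed

text \<open>Avoidance is decided modulo p, so the event contains a whole cell, that of the opposite
  Lagrangian \<open>F (Suc n)\<close>.\<close>

lemma beta_pos: "beta n > 0"
proof -
  have "LT.cell (Suc n) 1 (F (Suc n)) \<subseteq> avoid n"
    using F_avoid[of n] by (auto simp: LT.cell_def avoid_def)
  then have "measure (mu (Suc n)) (LT.cell (Suc n) 1 (F (Suc n))) \<le> beta n"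
    unfolding beta_def by (rule muP.finite_measure_mono[OF _ avoid_sets])
  then show ?thesis using LT.unif_pos[OF mu_unif, of "F (Suc n)" "Suc n" 1] Lag_F by simp
qed

text \<open>A lift of u found in W' is corrected by \<open>avoid_near\<close> to one orthogonal to
  \<open>eb n\<close>. Hence the image of \<open>rd n W\<close> at level e depends only on that of
  W.\<close>

lemma rd_level:
  assumes "W \<in> avoid n" "W' \<in> avoid n" "red e ` W \<subseteq> red e ` W'" shows "red e ` rd n W \<subseteq> red e ` rd n W'"
proof
  fix y assume "y \<in> red e ` rd n W"
  then obtain u where u: "u \<in> rd n W" "y = red e u" by blast
  obtain c where c: "u \<in> V n" "coh c" "u + c \<triangleright> eb n \<in> W" using u(1) by (auto simp: rd_def)
  have "red e (u + c \<triangleright> eb n) \<in> red e ` W'" using assms(3) c(3) by blast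
  then obtain w where w: "w \<in> W'" "near e (u + c \<triangleright> eb n) w" unfolding red_in_image by blast
  have z: "(u + c \<triangleright> eb n) (2*n+1) = 0" using V_out[OF c(1), of "2*n+1"] by (simp add: bas_apply)
  have "P e dvd lev ((u + c \<triangleright> eb n) (2*n+1)) e - lev (w (2*n+1)) e" using w(2) unfolding near_def by blast
  then have "P e dvd lev (w (2*n+1)) e" unfolding z by simp
  then obtain w' where w': "w' \<in> W'" "near e w w'" "trunc n w' \<in> rd n W'" using avoid_near[OF assms(2) w(1)] by blast
  have "near e (trunc n (u + c \<triangleright> eb n)) (trunc n w')" by (rule near_trunc[OF near_trans[OF w(2) w'(2)]])
  moreover have "trunc n (u + c \<triangleright> eb n) = u"
    using V_out[OF c(1)] by (auto simp: trunc_def bas_apply fun_eq_iff)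
  ultimately show "y \<in> red e ` rd n W'" using w'(3) u(2) by (metis image_eqI near_iff_red)
qed

lemma lft_eb: assumes "isom1 n h" shows "lft n h (eb n) = eb n"
proof -
  have "trunc n (eb n) = 0" by (auto simp: trunc_def bas_apply fun_eq_iff)
  then show ?thesis using isom1_zero[OF assms] by (simp add: lft_def)
qed

lemma rd_img:
  assumes g: "isop n g h" shows "rd n (img (Suc n) (lft n h) W) = img n h (rd n W)"
proof -
  note D' = isom1D[OF isopD(2)[OF g]]
  have l: "lft n h (u + c \<triangleright> eb n) = h u + c \<triangleright> eb n" if "u \<in> V n" for u c
  proof -
    have "trunc n (u + c \<triangleright> eb n) = u"
      using V_out[OF that] by (auto simp: trunc_def bas_apply fun_eq_iff)
    then show ?thesis by (simp add: lft_def)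
  qed
  have "u \<in> rd n (img (Suc n) (lft n h) W) \<longleftrightarrow> u \<in> img n h (rd n W)" for u
  proof (cases "u \<in> V n")
    case True
    then have "u + c \<triangleright> eb n \<in> V (Suc n)" if "coh c" for c using that by (intro V_add V_smul V_Suc eb_V)
    then show ?thesis using D'(1)[OF True] True l[OF True] unfolding rd_def img_def by auto
  qed (simp add: rd_def img_def)
  then show ?thesis by blast
qed

lemma avoid_img:
  assumes g: "isop n g h" "Lag (Suc n) W" shows "img (Suc n) (lft n h) W \<in> avoid n \<longleftrightarrow> W \<in> avoid n"
  using red_mem_img[OF isop_lft[OF g(1)] g(2) eb_V, of 1] Lag_img[OF isop_lft[OF g(1)] g(2)] g(2)
  by (simp add: avoid_def lft_eb[OF isopD(1)[OF g(1)]])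

lemma rd_level_sets: "{W \<in> avoid n. \<Phi> (red e ` rd n W)} \<in> sets (mu (Suc n))"
\<comment> \<open>Level \<open>Suc e\<close> dominates both levels involved: level 1 decides
  avoidance, level e the reduction of \<open>rd n W\<close>.\<close>
proof (rule LT.level_event_sets[OF mu_D(3), of _ "Suc n" "Suc e"])
  show "{W \<in> avoid n. \<Phi> (red e ` rd n W)} \<subseteq> Lags (Suc n)" by (auto simp: avoid_def)
  fix x y assume a: "x \<in> {W \<in> avoid n. \<Phi> (red e ` rd n W)}" "y \<in> Lags (Suc n)" "red (Suc e) ` x = red (Suc e) ` y"
  have x: "x \<in> Lags (Suc n)" using a(1) by (simp add: avoid_def)
  have "red 1 ` x = red 1 ` y" by (rule LT.nested_le[OF _ x a(2,3)]) simp
  then have y: "y \<in> avoid n" using a(1,2) by (simp add: avoid_def)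
  have "red e ` x = red e ` y" by (rule LT.nested_le[OF _ x a(2,3)]) simp
  then have "red e ` rd n x = red e ` rd n y" using rd_level[of x n y e] rd_level[of y n x e] a(1) y by blast
  then show "y \<in> {W \<in> avoid n. \<Phi> (red e ` rd n W)}" using a(1) y by simp
qed

text \<open>Conditionally on avoiding a fixed isotropic line modulo \<open>p\<close>, the induced Lagrangian of the smaller hyperbolic space
  is uniformly distributed, because its distribution is invariant under all isometries.\<close>
lemma measure_rd:
  assumes "{Y. Lag n Y \<and> \<Phi> Y} \<in> sets (mu n)"
  shows "measure (mu (Suc n)) {W \<in> avoid n. \<Phi> (rd n W)} = beta n * measure (mu n) {Y. Lag n Y \<and> \<Phi> Y}"
proof -
  let ?m = "mu (Suc n)"
  define U where "U = uniform_measure ?m (avoid n)"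
  \<comment> \<open>Outside \<open>avoid n\<close> the value \<open>E n\<close> is a filler;
    \<open>U\<close> gives no mass to that set.\<close>
  define r where "r W = (if W \<in> avoid n then rd n W else E n)" for W
  have em: "emeasure ?m (avoid n) \<noteq> 0" "emeasure ?m (avoid n) \<noteq> \<infinity>"
    using beta_pos[of n] by (auto simp: beta_def muP.emeasure_eq_measure)
  interpret U: prob_space U unfolding U_def by (rule prob_space_uniform_measure[OF em])
  have mU: "measure U A = measure ?m (avoid n \<inter> A) / beta n" if "A \<in> sets ?m" for A
    unfolding U_def beta_def by (rule measure_uniform_measure[OF em that])
  have sU: "sets U = sets ?m" "space U = Lags (Suc n)" by (simp_all add: U_def mu_D(2))
  have rL: "r W \<in> Lags n" for W using Lag_rd[of W n] Lag_E by (simp add: r_def)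
  have pre: "r -` LT.cell n e Y \<inter> space U \<in> sets U"
    "avoid n \<inter> (r -` LT.cell n e Y \<inter> space U) = {W \<in> avoid n. red e ` rd n W = red e ` Y}" for e Y
  proof -
    show "avoid n \<inter> (r -` LT.cell n e Y \<inter> space U) = {W \<in> avoid n. red e ` rd n W = red e ` Y}"
      using Lag_rd by (auto simp: r_def LT.cell_def sU avoid_def)
    have "r -` LT.cell n e Y \<inter> space U = {W \<in> avoid n. red e ` rd n W = red e ` Y} \<union>
       (if red e ` E n = red e ` Y then space ?m - avoid n else {})"
      using Lag_rd Lag_E by (auto simp: r_def LT.cell_def sU avoid_def mu_D(2) split: if_splits)
    moreover have "\<dots> \<in> sets U" unfolding sU using rd_level_sets[of n "\<lambda>x. x = red e ` Y" e] avoid_sets by auto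
    ultimately show "r -` LT.cell n e Y \<inter> space U \<in> sets U" by simp
  qed
  have "r \<in> measurable U (sigma (Lags n) (LT.cells n))"
  proof (rule measurable_measure_of[OF LT.cells_subset])
    show "r \<in> space U \<rightarrow> Lags n" using rL by blast
    fix A assume "A \<in> LT.cells n"
    then show "r -` A \<inter> space U \<in> sets U" using pre(1) unfolding LT.cells_def by blast
  qed
  moreover have "sets (sigma (Lags n) (LT.cells n)) = sets (mu n)" using LT.cells_subset by (simp add: mu_D(3))
  ultimately have rm: "r \<in> measurable U (mu n)" using measurable_cong_sets by blast
  have N: "distr U (mu n) r = mu n"
  proof (rule mu_eqI, rule LT.unifI)
    show "prob_space (distr U (mu n) r)" by (rule U.prob_space_distr[OF rm])
    fix e Y Y' assume Y: "Y \<in> Lags n" "Y' \<in> Lags n"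
    have mc: "measure (distr U (mu n) r) (LT.cell n e y) = measure ?m {W \<in> avoid n. red e ` rd n W = red e ` y} / beta n"
      if "y \<in> Lags n" for y
      using LT.cell_sets[OF mu_D(3) that, of e] pre(1)[of e y]
      by (subst measure_distr[OF rm]) (auto simp: mU sU(1) pre(2)[of e y])
    obtain g h where g: "isop n g h" "Y' = img n h Y" using Lag_transitive Y by blast
    let ?\<Psi> = "\<lambda>y W. W \<in> avoid n \<and> red e ` rd n W = red e ` y"
    have s: "{W. Lag (Suc n) W \<and> ?\<Psi> y W} = {W \<in> avoid n. red e ` rd n W = red e ` y}" for y by (auto simp: avoid_def)
    have sm: "{W. Lag (Suc n) W \<and> ?\<Psi> Y' W} \<in> sets ?m" unfolding s using rd_level_sets[of n "\<lambda>x. x = red e ` Y'" e] .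
    \<comment> \<open>The lifted isometry fixes \<open>eb n\<close>, so it preserves
      \<open>avoid n\<close> and induces the given isometry on the reductions
      \<open>rd n W\<close>.\<close>
    have "measure ?m {W. Lag (Suc n) W \<and> ?\<Psi> Y' W} = measure ?m {W. Lag (Suc n) W \<and> ?\<Psi> Y' (img (Suc n) (lft n h) W)}"
      by (rule measure_img[OF isop_lft[OF g(1)] sm])
    also have "{W. Lag (Suc n) W \<and> ?\<Psi> Y' (img (Suc n) (lft n h) W)} = {W. Lag (Suc n) W \<and> ?\<Psi> Y W}"
    proof (rule Collect_cong)
      fix W
      show "Lag (Suc n) W \<and> ?\<Psi> Y' (img (Suc n) (lft n h) W) \<longleftrightarrow> Lag (Suc n) W \<and> ?\<Psi> Y W"
      proof (cases "Lag (Suc n) W \<and> W \<in> avoid n")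
        case True
        then show ?thesis
          using avoid_img[OF g(1), of W] rd_img[OF g(1), of W] img_in_level_iff[OF g(1) Lag_rd, of W Y e] Y g(2) by simp
      next
        case False
        then show ?thesis using avoid_img[OF g(1), of W] by blast
      qed
    qed
    finally show "measure (distr U (mu n) r) (LT.cell n e Y) = measure (distr U (mu n) r) (LT.cell n e Y')"
      unfolding s mc[OF Y(1)] mc[OF Y(2)] by simp
  qed (simp_all add: mu_D)
  let ?A = "{Y. Lag n Y \<and> \<Phi> Y}"
  have "measure (mu n) ?A = measure U (r -` ?A \<inter> space U)"
    using measure_distr[OF rm assms] by (simp add: N)
  also have "\<dots> = measure ?m (avoid n \<inter> (r -` ?A \<inter> space U)) / beta n"
    using measurable_sets[OF rm assms] by (intro mU) (simp add: sU)
  also have "avoid n \<inter> (r -` ?A \<inter> space U) = {W \<in> avoid n. \<Phi> (rd n W)}"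
    using Lag_rd by (auto simp: r_def sU avoid_def)
  finally show ?thesis using beta_pos[of n] by simp
qed

lemma prim_move:
  assumes "v \<in> V (Suc n)" "null (qf (Suc n) v)" "prim v"
  obtains g h where "isop (Suc n) g h" "eqv (g v) (eb n)"
  using isop_move_bas[OF assms(1,2)] assms(3) unfolding prim_def by metis

lemma red_img_move:
  assumes "isop (Suc n) g h" "eqv (g v) (eb n)" "v \<in> V (Suc n)" "Lag (Suc n) W"
  shows "red 1 (eb n) \<in> red 1 ` img (Suc n) h W \<longleftrightarrow> red 1 v \<in> red 1 ` W"
  using red_mem_img[OF assms(1,4,3), of 1] eqv_near[OF assms(2), of 1] by (simp add: near_iff_red)

text \<open>Move v to \<open>eb n\<close>. Then \<open>sg_rd\<close> replaces the pair by one of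
  rank n, and \<open>measure_rd\<close> with \<open>Law_any\<close> evaluates the probability, the
  same for all choices of v and Z.\<close>

lemma avoid_law:
  assumes Z: "Lag (Suc n) Z" and v: "v \<in> Z" "prim v"
  shows "measure (mu (Suc n)) {W. Lag (Suc n) W \<and> red 1 v \<notin> red 1 ` W \<and> sg Z W = s} = beta n * Law n s"
proof -
  have vV: "v \<in> V (Suc n)" using LagD(1)[OF Z v(1)] .
  obtain g h where g: "isop (Suc n) g h" "eqv (g v) (eb n)" using prim_move[OF vV LagD(2)[OF Z v(1)] v(2)] .
  note D = isom1D[OF isopD(1)[OF g(1)]] and D' = isom1D[OF isopD(2)[OF g(1)]]
  define Z' where "Z' = img (Suc n) h Z"
  have Z': "Lag (Suc n) Z'" unfolding Z'_def by (rule Lag_img[OF g(1) Z])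
  have "eqv (h (eb n)) v"
    using D'(5)[OF eb_V D(1)[OF vV] eqv_sym[OF g(2)]] isopD(3)[OF g(1) vV] eqv_trans by blast
  then have "h (eb n) \<in> Z" using submD(5)[OF iso_satD(1)[OF Lag_iso_sat[OF Z]] D'(1)[OF eb_V] v(1)] by blast
  then have eZ: "eb n \<in> Z'" by (simp add: Z'_def img_def eb_V)
  let ?\<Psi> = "\<lambda>W. red 1 (eb n) \<notin> red 1 ` W \<and> sg Z' W = s"
  have eq: "{W. Lag (Suc n) W \<and> ?\<Psi> W} = avoid n \<inter> {W. Lag (Suc n) W \<and> sg Z' W = s}" by (auto simp: avoid_def)
  have "measure (mu (Suc n)) {W. Lag (Suc n) W \<and> ?\<Psi> W} = measure (mu (Suc n)) {W. Lag (Suc n) W \<and> ?\<Psi> (img (Suc n) h W)}"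
    by (rule measure_img[OF g(1)]) (unfold eq, intro sets.Int avoid_sets sg_event)
  also have "{W. Lag (Suc n) W \<and> ?\<Psi> (img (Suc n) h W)} = {W. Lag (Suc n) W \<and> red 1 v \<notin> red 1 ` W \<and> sg Z W = s}"
    using red_img_move[OF g vV] sg_img[OF g(1) Z] by (auto simp: Z'_def)
  finally have "measure (mu (Suc n)) {W. Lag (Suc n) W \<and> red 1 v \<notin> red 1 ` W \<and> sg Z W = s} =
    measure (mu (Suc n)) {W. Lag (Suc n) W \<and> ?\<Psi> W}" by simp
  also have "{W. Lag (Suc n) W \<and> ?\<Psi> W} = {W \<in> avoid n. sg (Z' \<inter> V n) (rd n W) = s}"
    using sg_rd[OF _ Z' eZ] by (auto simp: avoid_def)
  also have "measure (mu (Suc n)) \<dots> = beta n * measure (mu n) {Y. Lag n Y \<and> sg (Z' \<inter> V n) Y = s}"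
    by (rule measure_rd[OF sg_event])
  also have "measure (mu n) {Y. Lag n Y \<and> sg (Z' \<inter> V n) Y = s} = Law n s"
    by (rule Law_any[OF Lag_section(3)[OF Z' eZ]])
  finally show ?thesis .
qed

lemma meet_prob:
  assumes v: "v \<in> V (Suc n)" "null (qf (Suc n) v)" "prim v"
  shows "measure (mu (Suc n)) {W. Lag (Suc n) W \<and> red 1 v \<in> red 1 ` W} = 1 - beta n"
proof -
  obtain g h where g: "isop (Suc n) g h" "eqv (g v) (eb n)" using prim_move[OF v] .
  have "measure (mu (Suc n)) {W. Lag (Suc n) W \<and> red 1 (eb n) \<in> red 1 ` W} =
    measure (mu (Suc n)) {W. Lag (Suc n) W \<and> red 1 (eb n) \<in> red 1 ` img (Suc n) h W}"
    by (rule measure_img[OF g(1) level_event])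
  also have "{W. Lag (Suc n) W \<and> red 1 (eb n) \<in> red 1 ` img (Suc n) h W} = {W. Lag (Suc n) W \<and> red 1 v \<in> red 1 ` W}"
    using red_img_move[OF g v(1)] by auto
  finally have "measure (mu (Suc n)) {W. Lag (Suc n) W \<and> red 1 v \<in> red 1 ` W} =
    measure (mu (Suc n)) {W. Lag (Suc n) W \<and> red 1 (eb n) \<in> red 1 ` W}" by simp
  also have "{W. Lag (Suc n) W \<and> red 1 (eb n) \<in> red 1 ` W} = space (mu (Suc n)) - avoid n"
    by (auto simp: mu_D(2) avoid_def)
  also have "measure (mu (Suc n)) \<dots> = 1 - beta n"
    using muP.prob_compl[OF avoid_sets] by (simp add: beta_def)
  finally show ?thesis .
qed

lemma prim_iff_red: "prim v \<longleftrightarrow> red 1 v \<noteq> (\<lambda>_. 0)"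
  by (auto simp: prim_def red_def fun_eq_iff dvd_eq_mod_eq_0)

lemma zero_in_red: "Lag n Z \<Longrightarrow> (\<lambda>_. 0) \<in> red e ` Z"
  using submD(2)[OF iso_satD(1)[OF Lag_iso_sat]] by (force simp: red_def)

lemma card_nonzero_red:
  "Lag n Z \<Longrightarrow> finite (red 1 ` Z - {\<lambda>_. 0})" "Lag n Z \<Longrightarrow> card (red 1 ` Z - {\<lambda>_. 0}) = p ^ n - 1"
  using zero_in_red[of n Z 1] card_red_Lag[of n Z 1] finite_red_Lag[of n Z 1] by (simp_all add: card_Diff_singleton)

text \<open>Sum \<open>avoid_law\<close> over the nonzero vectors of \<open>E (Suc n)\<close> modulo
  p: a W with value s contains \<open>s 1 - 1\<close> of these \<open>p ^ Suc n - 1\<close>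
  vectors.\<close>

lemma law_rec:
  "(real p ^ Suc n - s 1) * Law (Suc n) s = (real p ^ Suc n - 1) * beta n * Law n s"
proof -
  let ?m = "mu (Suc n)" and ?Z = "E (Suc n)"
  let ?T = "red 1 ` ?Z - {\<lambda>_. 0}" and ?A = "{W. Lag (Suc n) W \<and> sg ?Z W = s}"
  define D where "D x = {W. Lag (Suc n) W \<and> x \<notin> red 1 ` W}" for x
  note fin = card_nonzero_red[OF Lag_E, of "Suc n"]
  have "(\<Sum>x\<in>?T. measure ?m (?A \<inter> D x)) = (real p ^ Suc n - s 1) * measure ?m ?A"
  proof (rule muP.sum_measure_count(1)[OF fin(1) sg_event])
    show "D x \<in> sets ?m" for x unfolding D_def by (rule level_event)
    fix W assume W: "W \<in> ?A"
    then have L: "Lag (Suc n) W" by blast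
    have "{x \<in> ?T. W \<in> D x} = red 1 ` ?Z - red 1 ` ?Z \<inter> red 1 ` W"
      using L zero_in_red[OF L, of 1] by (auto simp: D_def)
    moreover have "card (red 1 ` ?Z - red 1 ` ?Z \<inter> red 1 ` W) = p ^ Suc n - s 1"
      using W finite_red_Lag[OF Lag_E, of 1 "Suc n"] card_red_Lag[OF Lag_E, of 1 "Suc n"]
      by (subst card_Diff_subset) (auto simp: sg_def)
    moreover have "s 1 \<le> p ^ Suc n"
    proof -
      have "card (red 1 ` ?Z \<inter> red 1 ` W) \<le> card (red 1 ` ?Z)" by (intro card_mono finite_red_Lag[OF Lag_E]) auto
      then show ?thesis using W card_red_Lag[OF Lag_E, of 1 "Suc n"] by (auto simp: sg_def)
    qed
    ultimately show "real (card {x \<in> ?T. W \<in> D x}) = real p ^ Suc n - real (s 1)" by (simp add: of_nat_diff)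
  qed
  moreover have "measure ?m (?A \<inter> D x) = beta n * Law n s" if "x \<in> ?T" for x
  proof -
    obtain v where v: "v \<in> ?Z" "x = red 1 v" "prim v" using \<open>x \<in> ?T\<close> prim_iff_red by auto
    have "?A \<inter> D x = {W. Lag (Suc n) W \<and> red 1 v \<notin> red 1 ` W \<and> sg ?Z W = s}" by (auto simp: D_def v(2))
    then show ?thesis using avoid_law[OF Lag_E v(1,3)] by simp
  qed
  ultimately show ?thesis using fin(2) p_gt_1
    by (simp add: Law_def of_nat_diff)
qed

text \<open>All primitive isotropic vectors have the same chance \<open>1 - beta n\<close> of being
  met modulo p, and every W meets exactly \<open>p ^ Suc n - 1\<close> of their reductions. So a
  supply of \<open>p ^ (2 * n)\<close> such reductions gives the bound.\<close>

lemma beta_bound: "1 - beta n \<le> real p / real p ^ n"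
proof -
  let ?m = "mu (Suc n)" and ?I = "{v \<in> V (Suc n). null (qf (Suc n) v) \<and> prim v}"
  let ?T = "red 1 ` ?I"
  define D where "D x = {W. Lag (Suc n) W \<and> x \<in> red 1 ` W}" for x
  have fin: "finite ?T" by (rule finite_subset[OF _ finite_red[of 1 "Suc n"]]) auto
  have "(\<Sum>x\<in>?T. measure ?m (Lags (Suc n) \<inter> D x)) = (real p ^ Suc n - 1) * measure ?m (Lags (Suc n))"
  proof (rule muP.sum_measure_count(1)[OF fin])
    show "Lags (Suc n) \<in> sets ?m" using sets.top[of ?m] by (simp add: mu_D(2))
    show "D x \<in> sets ?m" for x unfolding D_def by (rule level_event)
    fix W assume "W \<in> Lags (Suc n)"
    then have L: "Lag (Suc n) W" by simp
    have "{x \<in> ?T. W \<in> D x} = red 1 ` W - {\<lambda>_. 0}"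
      using L LagD(1,2)[OF L] prim_iff_red by (auto simp: D_def)
    then show "real (card {x \<in> ?T. W \<in> D x}) = real p ^ Suc n - 1"
      using card_nonzero_red(2)[OF L] p_gt_1 by (simp add: of_nat_diff)
  qed
  moreover have "measure ?m (Lags (Suc n) \<inter> D x) = 1 - beta n" if "x \<in> ?T" for x
  proof -
    obtain v where v: "v \<in> V (Suc n)" "null (qf (Suc n) v)" "prim v" "x = red 1 v" using \<open>x \<in> ?T\<close> by blast
    have "Lags (Suc n) \<inter> D x = {W. Lag (Suc n) W \<and> red 1 v \<in> red 1 ` W}" by (auto simp: D_def v(4))
    then show ?thesis using meet_prob[OF v(1-3)] by simp
  qed
  moreover have "measure ?m (Lags (Suc n)) = 1" using muP.prob_space[of "Suc n"] by (simp add: mu_D(2))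
  ultimately have sum: "real (card ?T) * (1 - beta n) = real p ^ Suc n - 1" by simp
  have "p ^ (2 * n) \<le> card ?T"
  proof -
    let ?F = "{..<2*n} \<rightarrow>\<^sub>E {0..<int p}"
    define w where "w f = (\<lambda>i. if i < 2*n then of_int (f i) else 0 :: intseq)" for f :: "nat \<Rightarrow> int"
    \<comment> \<open>Any vector w of rank n is completed to a primitive isotropic one by the last
      two coordinates 1 and - Q(w).\<close>
    define v where "v f = w f + bas (2*n) - qf n (w f) \<triangleright> bas (2*n+1)" for f
    have wV: "w f \<in> V n" for f by (auto simp: w_def V_def)
    have vlo: "v f i = w f i" if "i < 2*n" for f i using that by (simp add: v_def bas_apply)
    have v1: "v f (2*n) = 1" "v f (2*n+1) = - qf n (w f)" for f by (simp_all add: v_def bas_apply w_def)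
    have vV: "v f \<in> V (Suc n)" for f
      unfolding v_def
      by (rule V_diff[OF V_add[OF V_Suc[OF wV] V_bas] V_smul[OF coh_qf[OF wV] V_bas]]) simp_all
    have "qf n (v f) = qf n (w f)" for f unfolding qf_def by (rule sum.cong) (auto simp: vlo)
    then have "qf (Suc n) (v f) = 0" for f using v1[of f] by (simp add: qf_Suc)
    moreover have "prim (v f)" for f unfolding prim_def using v1(1)[of f] prime_intp by (intro exI[of _ "2*n"]) simp
    ultimately have vI: "v f \<in> ?I" for f using vV[of f] null_zero by (metis (mono_tags, lifting) mem_Collect_eq)
    have "inj_on (\<lambda>f. red 1 (v f)) ?F"
    proof (rule inj_onI)
      fix f f' assume f: "f \<in> ?F" "f' \<in> ?F" "red 1 (v f) = red 1 (v f')"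
      show "f = f'"
      proof (rule PiE_ext[OF f(1,2)])
        fix i assume i: "i \<in> {..<2*n}"
        then have "f i mod int p = f' i mod int p" using fun_cong[OF f(3), of i] by (simp add: red_def vlo w_def)
        moreover have "f i \<in> {0..<int p}" "f' i \<in> {0..<int p}" using PiE_mem[OF f(1) i] PiE_mem[OF f(2) i] by blast+
        ultimately show "f i = f' i" by simp
      qed
    qed
    then have "card ?F = card ((\<lambda>f. red 1 (v f)) ` ?F)" by (simp add: card_image)
    also have "\<dots> \<le> card ?T" using vI by (intro card_mono fin image_subsetI imageI)
    finally show ?thesis by (simp add: card_PiE)
  qed
  then have "real (p ^ (2 * n)) \<le> real (card ?T)" by (rule of_nat_mono)
  then have "real p ^ (2 * n) \<le> real (card ?T)" unfolding of_nat_power .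
  moreover have "0 \<le> 1 - beta n" by (simp add: beta_def)
  ultimately have "real p ^ (2 * n) * (1 - beta n) \<le> real p ^ Suc n - 1"
    unfolding sum[symmetric] by (rule mult_right_mono)
  then have "real p ^ n * (1 - beta n) * real p ^ n \<le> real p * real p ^ n"
    unfolding mult_2 power_add by (simp add: algebra_simps)
  then have "real p ^ n * (1 - beta n) \<le> real p" using p_gt_1 by (simp add: mult.commute)
  then show ?thesis using p_gt_1 by (simp add: field_simps)
qed

lemma beta_le_1: "beta n \<le> 1"
  by (simp add: beta_def)

text \<open>Markov's inequality for \<open>s 1 - 1\<close>, the number of nonzero common vectors
  modulo p. Its mean is at most \<open>(p ^ Suc n - 1) (1 - beta n)\<close>, hence at most
  \<open>p ^ 2\<close> by \<open>beta_bound\<close>, whatever n is.\<close>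

lemma tail_bound:
  assumes "K > 1"
  shows "measure (mu (Suc n)) {W. Lag (Suc n) W \<and> K \<le> sg (E (Suc n)) W 1} \<le> real p ^ 2 / (real K - 1)"
proof -
  let ?m = "mu (Suc n)" and ?Z = "E (Suc n)"
  let ?T = "red 1 ` ?Z - {\<lambda>_. 0}" and ?A = "{W. Lag (Suc n) W \<and> K \<le> sg ?Z W 1}"
  define D where "D x = {W. Lag (Suc n) W \<and> x \<in> red 1 ` W}" for x
  note fin = card_nonzero_red[OF Lag_E, of "Suc n"]
  have Am: "?A \<in> sets ?m" unfolding sg_def by (rule level_event)
  have Dm: "D x \<in> sets ?m" for x unfolding D_def by (rule level_event)
  have "(real K - 1) * measure ?m ?A \<le> (\<Sum>x\<in>?T. measure ?m (?A \<inter> D x))"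
  proof (rule muP.sum_measure_count(2)[OF fin(1) Am Dm])
    fix W assume W: "W \<in> ?A"
    then have L: "Lag (Suc n) W" by blast
    have "{x \<in> ?T. W \<in> D x} = red 1 ` ?Z \<inter> red 1 ` W - {\<lambda>_. 0}" using L by (auto simp: D_def)
    moreover have "card (red 1 ` ?Z \<inter> red 1 ` W - {\<lambda>_. 0}) = sg ?Z W 1 - 1"
      using zero_in_red[OF L, of 1] zero_in_red[OF Lag_E, of 1 "Suc n"] by (subst card_Diff_singleton) (auto simp: sg_def)
    moreover have "K \<le> sg ?Z W 1" using W by blast
    ultimately show "real K - 1 \<le> real (card {x \<in> ?T. W \<in> D x})" using assms by (simp add: of_nat_diff)
  qed
  also have "\<dots> \<le> (\<Sum>x\<in>?T. 1 - beta n)"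
  proof (rule sum_mono)
    fix x assume "x \<in> ?T"
    then obtain v where v: "v \<in> ?Z" "x = red 1 v" "prim v" using prim_iff_red by auto
    have "measure ?m (?A \<inter> D x) \<le> measure ?m (D x)" by (intro muP.finite_measure_mono Dm) auto
    also have "\<dots> = 1 - beta n"
      using meet_prob[OF LagD(1)[OF Lag_E v(1)] LagD(2)[OF Lag_E v(1)] v(3)] by (simp add: D_def v(2))
    finally show "measure ?m (?A \<inter> D x) \<le> 1 - beta n" .
  qed
  also have "\<dots> = (real p ^ Suc n - 1) * (1 - beta n)" using fin(2) p_gt_1 by (simp add: of_nat_diff)
  also have "\<dots> \<le> real p ^ Suc n * (real p / real p ^ n)"
    using beta_bound[of n] beta_le_1[of n] p_gt_1 by (intro mult_mono) auto
  also have "\<dots> = real p ^ 2" using p_gt_1 by (simp add: power2_eq_square)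
  finally show ?thesis using assms by (simp add: field_simps)
qed

end

section \<open>Limits of discrete distributions\<close>

text \<open>Pointwise limits can lose mass at infinity; tightness confines all but \<epsilon> of it
  to one finite set for all large n, and on a finite set limits and sums commute. The same sandwich
  handles sums over an arbitrary B.\<close>

lemma tight_limit:
  fixes f :: "nat \<Rightarrow> 'a \<Rightarrow> real"
  assumes pos: "\<And>n s. 0 \<le> f n s" and one: "\<And>n. (f n has_sum 1) S"
    and lim: "\<And>s. s \<in> S \<Longrightarrow> (\<lambda>n. f n s) \<longlonglongrightarrow> F s"
    and tight: "\<And>\<epsilon>. \<epsilon> > 0 \<Longrightarrow> \<exists>A N. finite A \<and> A \<subseteq> S \<and> (\<forall>n\<ge>N. 1 - \<epsilon> \<le> sum (f n) A)"
  shows "(F has_sum 1) S" "B \<subseteq> S \<Longrightarrow> (\<lambda>n. infsum (f n) B) \<longlonglongrightarrow> infsum F B"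
proof -
  have Fpos: "0 \<le> F s" if "s \<in> S" for s
    using lim[OF that] pos by (intro LIMSEQ_le_const) auto
  have limA: "(\<lambda>n. sum (f n) A) \<longlonglongrightarrow> sum F A" if "A \<subseteq> S" for A
    using that lim by (intro tendsto_sum) auto
  have le1: "sum (f n) A \<le> 1" if "finite A" "A \<subseteq> S" for n A
    using finite_sum_le_has_sum[OF one that] pos by auto
  have Fle: "sum F A \<le> 1" if "finite A" "A \<subseteq> S" for A
    using limA[OF that(2)] le1[OF that] by (intro LIMSEQ_le_const2) auto
  have Fs: "F summable_on S"
    using Fpos Fle by (intro nonneg_bdd_above_summable_on) (auto simp: bdd_above_def)
  have fs: "f n summable_on S" for n using one has_sum_imp_summable by blast
  have tightF: "1 - \<epsilon> \<le> sum F A" if "\<forall>n\<ge>N. 1 - \<epsilon> \<le> sum (f n) A" "A \<subseteq> S" for \<epsilon> A N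
    using limA[OF that(2)] that(1) by (intro LIMSEQ_le_const) auto
  have "infsum F S = 1"
  proof (rule antisym)
    show "infsum F S \<le> 1" using Fle Fs by (intro infsum_le_finite_sums) auto
    show "1 \<le> infsum F S"
    proof (rule field_le_epsilon)
      fix \<epsilon> :: real assume "\<epsilon> > 0"
      from tight[OF this] obtain A N where A: "finite A" "A \<subseteq> S" "\<forall>n\<ge>N. 1 - \<epsilon> \<le> sum (f n) A" by blast
      have "1 - \<epsilon> \<le> sum F A" using tightF A by blast
      also have "\<dots> \<le> infsum F S" using A Fs Fpos by (intro finite_sum_le_infsum) auto
      finally show "1 \<le> infsum F S + \<epsilon>" by simp
    qed
  qed
  then show F1: "(F has_sum 1) S" using Fs has_sum_infsum by metis
  assume B: "B \<subseteq> S"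
  have bound: "infsum g B \<le> sum g (B \<inter> A) + \<epsilon>" "sum g (B \<inter> A) \<le> infsum g B"
    if g: "(g has_sum 1) S" "\<And>s. s \<in> S \<Longrightarrow> 0 \<le> g s" and A: "finite A" "A \<subseteq> S" "1 - \<epsilon> \<le> sum g A" for g A and \<epsilon> :: real
  proof -
    have gs: "g summable_on C" if "C \<subseteq> S" for C using g(1) that has_sum_imp_summable summable_on_subset_banach by blast
    show "sum g (B \<inter> A) \<le> infsum g B" using A B g(2) gs[OF B] by (intro finite_sum_le_infsum) auto
    have d: "infsum g C = sum g (C \<inter> A) + infsum g (C - A)" if C: "C \<subseteq> S" for C
    proof -
      have "infsum g C = infsum g ((C \<inter> A) \<union> (C - A))" by (simp add: Int_Diff_Un)
      also have "\<dots> = infsum g (C \<inter> A) + infsum g (C - A)" using C by (intro infsum_Un_disjoint gs) auto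
      finally show ?thesis using A(1) by simp
    qed
    have "infsum g (B - A) \<le> infsum g (S - A)" using B g(2) by (intro infsum_mono_neutral gs) auto
    also have "\<dots> = 1 - sum g A" using d[of S] infsumI[OF g(1)] A(2) by (simp add: Int_absorb1)
    finally have "infsum g (B - A) \<le> \<epsilon>" using A(3) by simp
    then show "infsum g B \<le> sum g (B \<inter> A) + \<epsilon>" using d[OF B] by simp
  qed
  show "(\<lambda>n. infsum (f n) B) \<longlonglongrightarrow> infsum F B"
  proof (rule LIMSEQ_I)
    fix r :: real assume "r > 0"
    define \<epsilon> where "\<epsilon> = r / 4"
    have e: "\<epsilon> > 0" using \<open>r > 0\<close> by (simp add: \<epsilon>_def)
    obtain A N where A: "finite A" "A \<subseteq> S" "\<forall>n\<ge>N. 1 - \<epsilon> \<le> sum (f n) A" using tight[OF e] by blast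
    have "(\<lambda>n. sum (f n) (B \<inter> A)) \<longlonglongrightarrow> sum F (B \<inter> A)" using B by (intro limA) auto
    from LIMSEQ_D[OF this e] obtain M where M: "\<And>n. n \<ge> M \<Longrightarrow> norm (sum (f n) (B \<inter> A) - sum F (B \<inter> A)) < \<epsilon>" by blast
    have "norm (infsum (f n) B - infsum F B) < r" if n: "n \<ge> max M N" for n
    proof -
      have "infsum (f n) B \<le> sum (f n) (B \<inter> A) + \<epsilon>" "sum (f n) (B \<inter> A) \<le> infsum (f n) B"
        using bound[OF one pos A(1,2), of \<epsilon> n] A(3) n by auto
      moreover have "infsum F B \<le> sum F (B \<inter> A) + \<epsilon>" "sum F (B \<inter> A) \<le> infsum F B"
        using bound[OF F1 Fpos A(1,2), of \<epsilon>] tightF[OF A(3,2)] by auto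
      ultimately show ?thesis using M[of n] n e unfolding \<epsilon>_def real_norm_def abs_less_iff by linarith
    qed
    then show "\<exists>no. \<forall>n\<ge>no. norm (infsum (f n) B - infsum F B) < r" by blast
  qed
qed

text \<open>The analytic content of the recursion, applied with q = p and \<open>w s\<close> =
  \<open>s 1\<close>. The bounds on \<open>b\<close> and the tail are what keeps the total mass of
  the limit equal to 1.\<close>

locale law_chain =
  fixes L :: "nat \<Rightarrow> 'a \<Rightarrow> real" and b :: "nat \<Rightarrow> real" and q :: real and w :: "'a \<Rightarrow> nat" and S :: "'a set"
  assumes q: "q \<ge> 2" and b: "0 \<le> b n" "b n \<le> 1" "1 - b n \<le> q / q ^ n"
    and pos: "0 \<le> L n s" and one: "(L n has_sum 1) S"
    and rec: "(q ^ Suc n - w s) * L (Suc n) s = (q ^ Suc n - 1) * b n * L n s"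
    and tail: "K > 1 \<Longrightarrow> infsum (L (Suc n)) {s \<in> S. K \<le> w s} \<le> q ^ 2 / (real K - 1)"
begin

lemma L_summable: "A \<subseteq> S \<Longrightarrow> L n summable_on A"
  using one has_sum_imp_summable summable_on_subset_banach by blast

lemma L_le_1: "s \<in> S \<Longrightarrow> L n s \<le> 1"
  using finite_sum_le_has_sum[OF one, of "{s}" n] pos by auto

text \<open>Chosen such that \<open>q * C K\<close> is at least \<open>2 * (q * q + 1 + K)\<close>,
  the numerator that arises in \<open>step\<close>.\<close>

definition C :: "nat \<Rightarrow> real" where "C K = 2 * q + 2 * (1 + K)"

lemma q_bounds: "q > 0" "q \<noteq> 0" "q ^ n > 0" "1 / q \<le> 1 / 2" "norm (1 / q) < 1"
  using q by (auto simp: field_simps)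

lemma step:
  assumes K: "w s \<le> K" "2 * real K \<le> q ^ Suc n"
  shows "\<bar>L (Suc n) s - L n s\<bar> \<le> C K * (1 / q) ^ n * L n s"
proof -
  let ?Q = "q ^ Suc n"
  \<comment> \<open>The coefficient of \<open>L (Suc n) s\<close> is at least half of
    \<open>q ^ Suc n\<close>, so dividing by it costs only a factor 2.\<close>
  have Q: "?Q > 0" "?Q / 2 \<le> ?Q - w s" "?Q - w s > 0" using K q_bounds(3)[of "Suc n"] by linarith+
  have "(?Q - w s) * (L (Suc n) s - L n s) = (real (w s) - 1 - (?Q - 1) * (1 - b n)) * L n s"
    using rec[of n s] by (simp add: algebra_simps)
  then have "(?Q - w s) * \<bar>L (Suc n) s - L n s\<bar> = \<bar>real (w s) - 1 - (?Q - 1) * (1 - b n)\<bar> * L n s"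
    using Q(3) pos by (metis abs_mult abs_of_nonneg abs_of_pos)
  also have "\<dots> \<le> (q * q + 1 + K) * L n s"
  proof (rule mult_right_mono[OF _ pos])
    have "(?Q - 1) * (1 - b n) \<le> ?Q * (q / q ^ n)" using b[of n] Q(1) by (intro mult_mono) auto
    also have "\<dots> = q * q" using q_bounds by simp
    finally have "(?Q - 1) * (1 - b n) \<le> q * q" .
    moreover have "0 \<le> (?Q - 1) * (1 - b n)" using b[of n] q by (intro mult_nonneg_nonneg) (auto simp: one_le_power simp del: power_Suc)
    ultimately show "\<bar>real (w s) - 1 - (?Q - 1) * (1 - b n)\<bar> \<le> q * q + 1 + K" using K(1) by linarith
  qed
  finally have "?Q / 2 * \<bar>L (Suc n) s - L n s\<bar> \<le> (q * q + 1 + K) * L n s"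
    using mult_right_mono[OF Q(2), of "\<bar>L (Suc n) s - L n s\<bar>"] by linarith
  then have "\<bar>L (Suc n) s - L n s\<bar> \<le> 2 * (q * q + 1 + K) / ?Q * L n s"
    using Q(1) by (simp add: field_simps)
  also have "\<dots> \<le> C K * (1 / q) ^ n * L n s"
  proof (rule mult_right_mono[OF _ pos])
    have "1 + real K \<le> q * (1 + real K)" using q mult_right_mono[of 1 q "1 + real K"] by simp
    then have "2 * (q * q + 1 + real K) \<le> q * C K" by (simp add: C_def algebra_simps)
    then have "2 * (q * q + 1 + real K) / ?Q \<le> q * C K / ?Q" using Q(1) by (intro divide_right_mono) auto
    also have "\<dots> = C K * (1 / q) ^ n" using q_bounds by (simp add: power_divide)
    finally show "2 * (q * q + 1 + real K) / ?Q \<le> C K * (1 / q) ^ n" .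
  qed
  finally show ?thesis .
qed

lemma large_exists: "\<exists>N. \<forall>n\<ge>N. 2 * real K \<le> q ^ Suc n"
proof -
  obtain N where N: "2 * real K < q ^ N" using real_arch_pow[of q "2 * real K"] q by auto
  have "2 * real K \<le> q ^ Suc n" if "n \<ge> N" for n
    using N power_increasing[of N "Suc n" q] that q by linarith
  then show ?thesis by blast
qed

text \<open>From some index on the increments are dominated by a geometric series of ratio
  1/q.\<close>

lemma L_convergent: "s \<in> S \<Longrightarrow> convergent (\<lambda>n. L n s)"
proof -
  assume s: "s \<in> S"
  obtain N where N: "\<And>n. n \<ge> N \<Longrightarrow> 2 * real (w s) \<le> q ^ Suc n" using large_exists by blast
  have "summable (\<lambda>n. L (Suc n) s - L n s)"
  proof (rule summable_comparison_test)
    have "norm (L (Suc n) s - L n s) \<le> C (w s) * (1 / q) ^ n" if "n \<ge> N" for n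
    proof -
      have "\<bar>L (Suc n) s - L n s\<bar> \<le> C (w s) * (1 / q) ^ n * L n s" by (rule step[OF _ N[OF that]]) simp
      also have "\<dots> \<le> C (w s) * (1 / q) ^ n * 1"
        using L_le_1[OF s] q by (intro mult_left_mono) (auto simp: C_def)
      finally show ?thesis by simp
    qed
    then show "\<exists>N. \<forall>n\<ge>N. norm (L (Suc n) s - L n s) \<le> C (w s) * (1 / q) ^ n" by blast
    show "summable (\<lambda>n. C (w s) * (1 / q) ^ n)" using q_bounds(5) by (intro summable_mult summable_geometric)
  qed
  then have "convergent (\<lambda>n. \<Sum>i<n. L (Suc i) s - L i s)" by (simp add: summable_iff_convergent)
  then have "convergent (\<lambda>n. (L n s - L 0 s) + L 0 s)"
    unfolding sum_lessThan_telescope[of "\<lambda>i. L i s"] by (rule convergent_add[OF _ convergent_const])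
  then show ?thesis by simp
qed

text \<open>Iterating \<open>step\<close> multiplies by factors
  \<open>1 + C K * (1 / q) ^ i\<close>, whose product is at most the exponential of a geometric sum,
  and \<open>1 / (1 - 1 / q) \<le> 2\<close>. The bound is uniform over all s with
  \<open>w s \<le> K\<close>.\<close>

lemma dominated:
  assumes "\<And>n. n \<ge> N \<Longrightarrow> 2 * real K \<le> q ^ Suc n" "w s \<le> K" "n \<ge> N"
  shows "L n s \<le> exp (2 * C K) * L N s"
proof -
  have C0: "0 \<le> C K" using q by (simp add: C_def)
  have "L (N + k) s \<le> exp (C K * (\<Sum>i<k. (1 / q) ^ i)) * L N s" for k
  proof (induction k)
    case (Suc k)
    have "L (Suc (N + k)) s \<le> (1 + C K * (1 / q) ^ (N + k)) * L (N + k) s"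
      using step[OF assms(2) assms(1)[of "N + k"]] by (simp add: algebra_simps)
    also have "\<dots> \<le> (1 + C K * (1 / q) ^ k) * L (N + k) s"
    proof (rule mult_right_mono[OF _ pos])
      have "(1 / q) ^ (N + k) \<le> (1 / q) ^ k" using q by (intro power_decreasing) auto
      then show "1 + C K * (1 / q) ^ (N + k) \<le> 1 + C K * (1 / q) ^ k" using C0 by (intro add_left_mono mult_left_mono)
    qed
    also have "\<dots> \<le> exp (C K * (1 / q) ^ k) * L (N + k) s" by (intro mult_right_mono pos exp_ge_add_one_self)
    also have "\<dots> \<le> exp (C K * (1 / q) ^ k) * (exp (C K * (\<Sum>i<k. (1 / q) ^ i)) * L N s)"
      by (intro mult_left_mono Suc) simp
    also have "\<dots> = exp (C K * (\<Sum>i<Suc k. (1 / q) ^ i)) * L N s"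
      by (simp add: exp_add[symmetric] algebra_simps)
    finally show ?case by simp
  qed simp
  from this[of "n - N"] have "L n s \<le> exp (C K * (\<Sum>i<n - N. (1 / q) ^ i)) * L N s" using assms(3) by simp
  also have "\<dots> \<le> exp (2 * C K) * L N s"
  proof (rule mult_right_mono[OF _ pos])
    have "(\<Sum>i<n - N. (1 / q) ^ i) \<le> (\<Sum>i. (1 / q) ^ i)"
      using q_bounds(5) q by (intro sum_le_suminf summable_geometric) auto
    also have "\<dots> = 1 / (1 - 1 / q)" using q_bounds(5) by (rule suminf_geometric)
    also have "\<dots> \<le> 2" using q by (simp add: field_simps)
    finally have "C K * (\<Sum>i<n - N. (1 / q) ^ i) \<le> C K * 2" using C0 by (intro mult_left_mono)
    then show "exp (C K * (\<Sum>i<n - N. (1 / q) ^ i)) \<le> exp (2 * C K)" by (simp add: mult.commute)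
  qed
  finally show ?thesis .
qed

text \<open>Mass with large w is controlled by the tail bound for all n at once. On the rest,
  \<open>dominated\<close> compares \<open>L n\<close> with \<open>L N\<close> for one fixed N, so a
  finite set that nearly exhausts \<open>L N\<close> there works for all later n.\<close>

lemma tight:
  assumes "\<epsilon> > 0" shows "\<exists>A N. finite A \<and> A \<subseteq> S \<and> (\<forall>n\<ge>N. 1 - \<epsilon> \<le> sum (L n) A)"
proof -
  obtain K :: nat where K: "real K > 1 + 2 * q ^ 2 / \<epsilon>" using reals_Archimedean2 by blast
  have "2 * q ^ 2 / \<epsilon> > 0" using assms q_bounds by simp
  then have K1: "K > 1" using K by linarith
  have "2 * q ^ 2 / \<epsilon> < real K - 1" using K by linarith
  then have Kt: "q ^ 2 / (real K - 1) \<le> \<epsilon> / 2" using assms K1 by (simp add: field_simps)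
  obtain N where N: "\<And>n. n \<ge> N \<Longrightarrow> 2 * real K \<le> q ^ Suc n" using large_exists by blast
  define T where "T = {s \<in> S. w s < K}"
  \<comment> \<open>The factor \<open>exp (2 * C K)\<close> lost to domination is compensated in
    advance; the other half of \<epsilon> is left to the tail.\<close>
  define \<delta> where "\<delta> = \<epsilon> / 2 / exp (2 * C K)"
  have d: "\<delta> > 0" using assms by (simp add: \<delta>_def)
  have sT: "L N summable_on T" by (rule L_summable) (auto simp: T_def)
  have "(L N has_sum infsum (L N) T) T" using sT by simp
  then have "\<forall>\<^sub>F A in finite_subsets_at_top T. dist (sum (L N) A) (infsum (L N) T) < \<delta>"
    unfolding has_sum_def using d by (rule tendstoD)
  then obtain A where A: "finite A" "A \<subseteq> T" "dist (sum (L N) A) (infsum (L N) T) < \<delta>"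
    unfolding eventually_finite_subsets_at_top by blast
  have split: "infsum (L n) C = infsum (L n) D + infsum (L n) (C - D)" if "D \<subseteq> C" "C \<subseteq> S" for n C D
  proof -
    have "infsum (L n) C = infsum (L n) (D \<union> (C - D))" using that by (simp add: Un_absorb1)
    also have "\<dots> = infsum (L n) D + infsum (L n) (C - D)" using that by (intro infsum_Un_disjoint L_summable) auto
    finally show ?thesis .
  qed
  have TS: "T \<subseteq> S" by (auto simp: T_def)
  have rest: "infsum (L N) (T - A) \<le> \<delta>" using split[OF A(2) TS, of N] A(1,3) by (simp add: dist_real_def)
  have "1 - \<epsilon> \<le> sum (L n) A" if n: "n \<ge> Suc N" for n
  proof -
    obtain m where m: "n = Suc m" using n by (cases n) auto
    have "1 = infsum (L n) S" using infsumI[OF one] by simp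
    also have "\<dots> = sum (L n) A + infsum (L n) (T - A) + infsum (L n) (S - T)"
      using split[OF TS, of n] split[OF A(2) TS, of n] A(1) by simp
    finally have 1: "1 = sum (L n) A + infsum (L n) (T - A) + infsum (L n) (S - T)" .
    have "infsum (L n) (T - A) \<le> infsum (\<lambda>s. exp (2 * C K) * L N s) (T - A)"
    proof (rule infsum_mono)
      show "L n summable_on T - A" using TS by (intro L_summable) auto
      have "L N summable_on T - A" using TS by (intro L_summable) auto
      then show "(\<lambda>s. exp (2 * C K) * L N s) summable_on T - A" by (rule summable_on_cmult_right)
      fix s assume "s \<in> T - A"
      then show "L n s \<le> exp (2 * C K) * L N s" using n by (intro dominated N) (auto simp: T_def)
    qed
    also have "\<dots> = exp (2 * C K) * infsum (L N) (T - A)" using TS by (intro infsum_cmult_right L_summable) auto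
    also have "\<dots> \<le> exp (2 * C K) * \<delta>" using rest by (intro mult_left_mono) auto
    also have "\<dots> = \<epsilon> / 2" by (simp add: \<delta>_def)
    finally have 2: "infsum (L n) (T - A) \<le> \<epsilon> / 2" .
    have "S - T = {s \<in> S. K \<le> w s}" by (auto simp: T_def)
    then have "infsum (L n) (S - T) \<le> \<epsilon> / 2" using order_trans[OF tail[OF K1, of m] Kt] m by simp
    then show ?thesis using 1 2 by linarith
  qed
  then show ?thesis using A TS by blast
qed

lemma limit_law:
  "((\<lambda>s. lim (\<lambda>n. L n s)) has_sum 1) S"
  "B \<subseteq> S \<Longrightarrow> (\<lambda>n. infsum (L n) B) \<longlonglongrightarrow> infsum (\<lambda>s. lim (\<lambda>n. L n s)) B"
proof -
  have l: "(\<lambda>n. L n s) \<longlonglongrightarrow> lim (\<lambda>n. L n s)" if "s \<in> S" for s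
    using L_convergent[OF that] by (simp add: convergent_LIMSEQ_iff)
  show "((\<lambda>s. lim (\<lambda>n. L n s)) has_sum 1) S" by (rule tight_limit(1)[OF pos one l tight])
  show "B \<subseteq> S \<Longrightarrow> (\<lambda>n. infsum (L n) B) \<longlonglongrightarrow> infsum (\<lambda>s. lim (\<lambda>n. L n s)) B"
    by (rule tight_limit(2)[OF pos one l tight])
qed

end

section \<open>Modules, quotients and tensor products\<close>

text \<open>The elements of both modules get names from one set I. If the two naming maps identify
  the same names and the operations agree on names, the correspondence is well defined and an
  isomorphism.\<close>

lemma mod_isoI_reps:
  assumes a: "a ` I = carrier M" and b: "b ` I = carrier N"
    and eq: "\<And>i j. i \<in> I \<Longrightarrow> j \<in> I \<Longrightarrow> a i = a j \<longleftrightarrow> b i = b j"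
    and add: "\<And>i j. i \<in> I \<Longrightarrow> j \<in> I \<Longrightarrow> \<exists>k\<in>I. a k = a i \<oplus>\<^bsub>M\<^esub> a j \<and> b k = b i \<oplus>\<^bsub>N\<^esub> b j"
    and smult: "\<And>r i. r \<in> carrier R \<Longrightarrow> i \<in> I \<Longrightarrow> \<exists>k\<in>I. a k = r \<odot>\<^bsub>M\<^esub> a i \<and> b k = r \<odot>\<^bsub>N\<^esub> b i"
  obtains h where "h \<in> mod_iso R M N" "\<And>i. i \<in> I \<Longrightarrow> h (a i) = b i"
proof -
  define h where "h x = b (SOME i. i \<in> I \<and> a i = x)" for x
  have h: "h (a i) = b i" if "i \<in> I" for i
  proof -
    have "(SOME j. j \<in> I \<and> a j = a i) \<in> I \<and> a (SOME j. j \<in> I \<and> a j = a i) = a i" by (rule someI[of _ i]) (use that in simp)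
    then show ?thesis using eq[OF _ that] unfolding h_def by blast
  qed
  have "h \<in> carrier M \<rightarrow> carrier N" unfolding a[symmetric] b[symmetric] using h by auto
  moreover have "h (x \<oplus>\<^bsub>M\<^esub> y) = h x \<oplus>\<^bsub>N\<^esub> h y" if xy: "x \<in> carrier M" "y \<in> carrier M" for x y
  proof -
    obtain i j where i: "i \<in> I" "x = a i" "j \<in> I" "y = a j" using xy unfolding a[symmetric] by blast
    obtain k where "k \<in> I" "a k = a i \<oplus>\<^bsub>M\<^esub> a j" "b k = b i \<oplus>\<^bsub>N\<^esub> b j" using add[OF i(1,3)] by blast
    then show ?thesis using h i by metis
  qed
  moreover have "h (r \<odot>\<^bsub>M\<^esub> x) = r \<odot>\<^bsub>N\<^esub> h x" if x: "r \<in> carrier R" "x \<in> carrier M" for r x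
  proof -
    obtain i where i: "i \<in> I" "x = a i" using x(2) unfolding a[symmetric] by blast
    obtain k where "k \<in> I" "a k = r \<odot>\<^bsub>M\<^esub> a i" "b k = r \<odot>\<^bsub>N\<^esub> b i" using smult[OF x(1) i(1)] by blast
    then show ?thesis using h i by metis
  qed
  moreover have "bij_betw h (carrier M) (carrier N)"
  proof (rule bij_betw_imageI)
    show "inj_on h (carrier M)" unfolding a[symmetric] by (rule inj_onI) (use h eq in auto)
    show "h ` carrier M = carrier N" unfolding a[symmetric] b[symmetric] image_image by (rule image_cong) (use h in auto)
  qed
  ultimately have "h \<in> mod_iso R M N" by (simp add: mod_iso_def mod_hom_def)
  then show ?thesis using that h by blast
qed

lemma mod_isoD:
  assumes "h \<in> mod_iso R M N"
  shows "x \<in> carrier M \<Longrightarrow> h x \<in> carrier N" "h ` carrier M = carrier N" "inj_on h (carrier M)"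
    "x \<in> carrier M \<Longrightarrow> y \<in> carrier M \<Longrightarrow> h (x \<oplus>\<^bsub>M\<^esub> y) = h x \<oplus>\<^bsub>N\<^esub> h y"
    "r \<in> carrier R \<Longrightarrow> x \<in> carrier M \<Longrightarrow> h (r \<odot>\<^bsub>M\<^esub> x) = r \<odot>\<^bsub>N\<^esub> h x"
  using assms by (auto simp: mod_iso_def mod_hom_def bij_betw_def)

lemma mod_iso_id: "(\<lambda>x. x) \<in> mod_iso R M M"
  by (auto simp: mod_iso_def mod_hom_def bij_betw_def)

lemma mod_iso_comp:
  assumes "f \<in> mod_iso R M N" "g \<in> mod_iso R N K" shows "g \<circ> f \<in> mod_iso R M K"
  using mod_isoD[OF assms(1)] mod_isoD[OF assms(2)] assms
  by (auto simp: mod_iso_def mod_hom_def intro: bij_betw_trans)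

lemma mod_iso_inv:
  assumes "f \<in> mod_iso R M N" "Module.module R M"
  obtains g where "g \<in> mod_iso R N M" "\<And>x. x \<in> carrier M \<Longrightarrow> g (f x) = x" "\<And>y. y \<in> carrier N \<Longrightarrow> f (g y) = y"
proof -
  note D = mod_isoD[OF assms(1)]
  interpret M: Module.module R M by (rule assms(2))
  obtain g where g: "g \<in> mod_iso R N M" "\<And>i. i \<in> carrier M \<Longrightarrow> g (f i) = i"
  proof (rule mod_isoI_reps[of f "carrier M" N "\<lambda>x. x" M R])
    show "f ` carrier M = carrier N" by (rule D(2))
    show "f i = f j \<longleftrightarrow> i = j" if "i \<in> carrier M" "j \<in> carrier M" for i j using D(3) that by (auto dest: inj_onD)
    show "\<exists>k\<in>carrier M. f k = f i \<oplus>\<^bsub>N\<^esub> f j \<and> k = i \<oplus>\<^bsub>M\<^esub> j" if "i \<in> carrier M" "j \<in> carrier M" for i j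
      using D(4)[OF that] that by blast
    show "\<exists>k\<in>carrier M. f k = r \<odot>\<^bsub>N\<^esub> f i \<and> k = r \<odot>\<^bsub>M\<^esub> i" if "r \<in> carrier R" "i \<in> carrier M" for r i
      using D(5)[OF that] that by blast
  qed auto
  moreover have "f (g y) = y" if "y \<in> carrier N" for y using that g(2) unfolding D(2)[symmetric] by auto
  ultimately show ?thesis using that by blast
qed

lemma seq_iso_refl: "seq_iso R E E"
  unfolding seq_iso_def by (intro bexI[OF _ mod_iso_id]) auto

lemma short_exactD:
  assumes "short_exact R E"
  shows "Module.module R (left_mod E)" "Module.module R (mid_mod E)" "Module.module R (right_mod E)"
    "left_map E \<in> carrier (left_mod E) \<rightarrow> carrier (mid_mod E)" "right_map E \<in> carrier (mid_mod E) \<rightarrow> carrier (right_mod E)"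
  using assms by (auto simp: short_exact_def mod_hom_def)

lemma seq_iso_sym:
  assumes "short_exact R E" "seq_iso R E E'" shows "seq_iso R E' E"
proof -
  note S = short_exactD[OF assms(1)]
  obtain f g h where f: "f \<in> mod_iso R (left_mod E) (left_mod E')" and g: "g \<in> mod_iso R (mid_mod E) (mid_mod E')"
    and h: "h \<in> mod_iso R (right_mod E) (right_mod E')"
    and l: "\<And>x. x \<in> carrier (left_mod E) \<Longrightarrow> g (left_map E x) = left_map E' (f x)"
    and r: "\<And>x. x \<in> carrier (mid_mod E) \<Longrightarrow> h (right_map E x) = right_map E' (g x)"
    using assms(2) unfolding seq_iso_def by blast
  obtain f' where f': "f' \<in> mod_iso R (left_mod E') (left_mod E)" "\<And>x. x \<in> carrier (left_mod E) \<Longrightarrow> f' (f x) = x"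
    "\<And>y. y \<in> carrier (left_mod E') \<Longrightarrow> f (f' y) = y" using mod_iso_inv[OF f S(1)] by metis
  obtain g' where g': "g' \<in> mod_iso R (mid_mod E') (mid_mod E)" "\<And>x. x \<in> carrier (mid_mod E) \<Longrightarrow> g' (g x) = x"
    "\<And>y. y \<in> carrier (mid_mod E') \<Longrightarrow> g (g' y) = y" using mod_iso_inv[OF g S(2)] by metis
  obtain h' where h': "h' \<in> mod_iso R (right_mod E') (right_mod E)" "\<And>x. x \<in> carrier (right_mod E) \<Longrightarrow> h' (h x) = x"
    "\<And>y. y \<in> carrier (right_mod E') \<Longrightarrow> h (h' y) = y" using mod_iso_inv[OF h S(3)] by metis
  have "g' (left_map E' x) = left_map E (f' x)" if x: "x \<in> carrier (left_mod E')" for x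
  proof -
    have y: "f' x \<in> carrier (left_mod E)" by (rule mod_isoD(1)[OF f'(1) x])
    have "left_map E' x = g (left_map E (f' x))" using l[OF y] f'(3)[OF x] by simp
    then show ?thesis using g'(2) S(4) y by auto
  qed
  moreover have "h' (right_map E' x) = right_map E (g' x)" if x: "x \<in> carrier (mid_mod E')" for x
  proof -
    have y: "g' x \<in> carrier (mid_mod E)" by (rule mod_isoD(1)[OF g'(1) x])
    have "right_map E' x = h (right_map E (g' x))" using r[OF y] g'(3)[OF x] by simp
    then show ?thesis using h'(2) S(5) y by auto
  qed
  ultimately show ?thesis unfolding seq_iso_def using f'(1) g'(1) h'(1) by blast
qed

lemma seq_iso_trans:
  assumes "seq_iso R E E'" "seq_iso R E' E''" shows "seq_iso R E E''"
proof -
  obtain f g h where f: "f \<in> mod_iso R (left_mod E) (left_mod E')" and g: "g \<in> mod_iso R (mid_mod E) (mid_mod E')"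
    and h: "h \<in> mod_iso R (right_mod E) (right_mod E')"
    and l: "\<And>x. x \<in> carrier (left_mod E) \<Longrightarrow> g (left_map E x) = left_map E' (f x)"
    and r: "\<And>x. x \<in> carrier (mid_mod E) \<Longrightarrow> h (right_map E x) = right_map E' (g x)"
    using assms(1) unfolding seq_iso_def by blast
  obtain f' g' h' where f': "f' \<in> mod_iso R (left_mod E') (left_mod E'')" and g': "g' \<in> mod_iso R (mid_mod E') (mid_mod E'')"
    and h': "h' \<in> mod_iso R (right_mod E') (right_mod E'')"
    and l': "\<And>x. x \<in> carrier (left_mod E') \<Longrightarrow> g' (left_map E' x) = left_map E'' (f' x)"
    and r': "\<And>x. x \<in> carrier (mid_mod E') \<Longrightarrow> h' (right_map E' x) = right_map E'' (g' x)"
    using assms(2) unfolding seq_iso_def by blast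
  show ?thesis unfolding seq_iso_def
  proof (intro bexI conjI ballI)
    show "(g' \<circ> g) (left_map E x) = left_map E'' ((f' \<circ> f) x)" if "x \<in> carrier (left_mod E)" for x
      using l[OF that] l'[OF mod_isoD(1)[OF f that]] by simp
    show "(h' \<circ> h) (right_map E x) = right_map E'' ((g' \<circ> g) x)" if "x \<in> carrier (mid_mod E)" for x
      using r[OF that] r'[OF mod_isoD(1)[OF g that]] by simp
  qed (rule mod_iso_comp[OF f f'] mod_iso_comp[OF g g'] mod_iso_comp[OF h h'])+
qed

text \<open>The record type is fixed to \<open>module\<close> without extension, as the quotient and
  tensor constructions demand.\<close>

locale rmodule = Module.module R M for R (structure) and M :: "('r, 'm) module" (structure)
begin

lemma submodule_subset: "submodule N R M \<Longrightarrow> N \<subseteq> carrier M"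
  by (rule submoduleE(1))

lemma submodule_facts:
  assumes "submodule N R M"
  shows "\<zero>\<^bsub>M\<^esub> \<in> N" "x \<in> N \<Longrightarrow> y \<in> N \<Longrightarrow> x \<oplus>\<^bsub>M\<^esub> y \<in> N" "a \<in> carrier R \<Longrightarrow> x \<in> N \<Longrightarrow> a \<odot>\<^bsub>M\<^esub> x \<in> N"
    "x \<in> N \<Longrightarrow> \<ominus>\<^bsub>M\<^esub> x \<in> N" "x \<in> N \<Longrightarrow> y \<in> N \<Longrightarrow> x \<ominus>\<^bsub>M\<^esub> y \<in> N" "x \<in> N \<Longrightarrow> x \<in> carrier M"
proof -
  note S = submoduleE[OF assms]
  show "\<zero>\<^bsub>M\<^esub> \<in> N" using subgroup.one_closed[OF submodule.axioms(1)[OF assms]] by simp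
  show "x \<in> N \<Longrightarrow> y \<in> N \<Longrightarrow> x \<oplus>\<^bsub>M\<^esub> y \<in> N" by (rule S(5))
  show "a \<in> carrier R \<Longrightarrow> x \<in> N \<Longrightarrow> a \<odot>\<^bsub>M\<^esub> x \<in> N" by (rule S(4))
  show "x \<in> N \<Longrightarrow> \<ominus>\<^bsub>M\<^esub> x \<in> N" by (rule S(3))
  show "x \<in> N \<Longrightarrow> y \<in> N \<Longrightarrow> x \<ominus>\<^bsub>M\<^esub> y \<in> N" unfolding a_minus_def by (intro S)
  show "x \<in> N \<Longrightarrow> x \<in> carrier M" using S(1) by blast
qed

lemma submodule_inter:
  assumes "\<And>N. N \<in> A \<Longrightarrow> submodule N R M" "A \<noteq> {}" shows "submodule (\<Inter>A) R M"
proof (rule submoduleI)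
  show "\<Inter>A \<subseteq> carrier M" using assms submodule_subset by blast
  show "\<zero>\<^bsub>M\<^esub> \<in> \<Inter>A" using assms(1) submodule_facts(1) by blast
  show "\<ominus>\<^bsub>M\<^esub> x \<in> \<Inter>A" if "x \<in> \<Inter>A" for x
    using that submodule_facts(4)[OF assms(1)] by blast
  show "x \<oplus>\<^bsub>M\<^esub> y \<in> \<Inter>A" if "x \<in> \<Inter>A" "y \<in> \<Inter>A" for x y
    using that submodule_facts(2)[OF assms(1)] by blast
  show "a \<odot>\<^bsub>M\<^esub> x \<in> \<Inter>A" if "a \<in> carrier R" "x \<in> \<Inter>A" for a x
    using that submodule_facts(3)[OF assms(1)] by blast
qed

lemma mod_span_submodule: "A \<subseteq> carrier M \<Longrightarrow> submodule (mod_span R M A) R M"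
  unfolding mod_span_def using carrier_is_submodule by (intro submodule_inter) auto

lemma mod_span_incl: "A \<subseteq> mod_span R M A"
  by (auto simp: mod_span_def)

lemma mod_span_least: "submodule N R M \<Longrightarrow> A \<subseteq> N \<Longrightarrow> mod_span R M A \<subseteq> N"
  by (auto simp: mod_span_def)

lemma submodule_abelian_subgroup: "submodule N R M \<Longrightarrow> abelian_subgroup N M"
  by (intro abelian_subgroupI3 additive_subgroup.intro submodule.axioms(1) M.abelian_group_axioms)

lemma coset_eq_iff:
  assumes N: "submodule N R M" and x: "x \<in> carrier M" "y \<in> carrier M"
  shows "N +>\<^bsub>M\<^esub> x = N +>\<^bsub>M\<^esub> y \<longleftrightarrow> x \<ominus>\<^bsub>M\<^esub> y \<in> N"
proof
  note F = submodule_facts[OF N]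
  assume a: "N +>\<^bsub>M\<^esub> x = N +>\<^bsub>M\<^esub> y"
  have "\<zero>\<^bsub>M\<^esub> \<oplus>\<^bsub>M\<^esub> x \<in> N +>\<^bsub>M\<^esub> x" by (rule M.a_rcosI[OF F(1) submodule_subset[OF N] x(1)])
  then have "x \<in> N +>\<^bsub>M\<^esub> y" using a x by simp
  then obtain h where h: "h \<in> N" "x = h \<oplus>\<^bsub>M\<^esub> y" by (auto simp: a_r_coset_def r_coset_def)
  have "x \<ominus>\<^bsub>M\<^esub> y = h" unfolding h(2) using F(6)[OF h(1)] x(2) by (simp add: a_minus_def M.a_assoc M.r_neg)
  then show "x \<ominus>\<^bsub>M\<^esub> y \<in> N" using h(1) by simp
next
  assume a: "x \<ominus>\<^bsub>M\<^esub> y \<in> N"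
  have "(x \<ominus>\<^bsub>M\<^esub> y) \<oplus>\<^bsub>M\<^esub> y \<in> N +>\<^bsub>M\<^esub> y" by (rule M.a_rcosI[OF a submodule_subset[OF N] x(2)])
  moreover have "(x \<ominus>\<^bsub>M\<^esub> y) \<oplus>\<^bsub>M\<^esub> y = x" using x by (simp add: a_minus_def M.a_assoc M.l_neg)
  ultimately show "N +>\<^bsub>M\<^esub> x = N +>\<^bsub>M\<^esub> y"
    using M.a_repr_independence[of x N y] x(2) submodule.axioms(1)[OF N] by simp
qed

lemma coset_zero: "submodule N R M \<Longrightarrow> N +>\<^bsub>M\<^esub> \<zero>\<^bsub>M\<^esub> = N"
  by (rule M.a_coset_join2) (auto intro: submodule_facts submodule.axioms(1))

lemma coset_zero_iff:
  assumes "submodule N R M" "x \<in> carrier M" shows "N +>\<^bsub>M\<^esub> x = N \<longleftrightarrow> x \<in> N"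
proof -
  have z: "\<ominus>\<^bsub>M\<^esub> \<zero>\<^bsub>M\<^esub> = \<zero>\<^bsub>M\<^esub>" using M.r_neg[OF M.zero_closed] by simp
  show ?thesis using coset_eq_iff[OF assms M.zero_closed] coset_zero[OF assms(1)] assms(2) unfolding a_minus_def z by simp
qed

lemma quot_simps:
  assumes N: "submodule N R M"
  shows "carrier (quot_mod M N) = (\<lambda>x. N +>\<^bsub>M\<^esub> x) ` carrier M"
    "x \<in> carrier M \<Longrightarrow> y \<in> carrier M \<Longrightarrow> (N +>\<^bsub>M\<^esub> x) \<oplus>\<^bsub>quot_mod M N\<^esub> (N +>\<^bsub>M\<^esub> y) = N +>\<^bsub>M\<^esub> (x \<oplus>\<^bsub>M\<^esub> y)"
    "a \<in> carrier R \<Longrightarrow> x \<in> carrier M \<Longrightarrow> a \<odot>\<^bsub>quot_mod M N\<^esub> (N +>\<^bsub>M\<^esub> x) = N +>\<^bsub>M\<^esub> (a \<odot>\<^bsub>M\<^esub> x)"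
    "\<zero>\<^bsub>quot_mod M N\<^esub> = N +>\<^bsub>M\<^esub> \<zero>\<^bsub>M\<^esub>"
proof -
  note F = submodule_facts[OF N]
  show "carrier (quot_mod M N) = (\<lambda>x. N +>\<^bsub>M\<^esub> x) ` carrier M"
    by (auto simp: quot_mod_def A_RCOSETS_def RCOSETS_def a_r_coset_def)
  show "x \<in> carrier M \<Longrightarrow> y \<in> carrier M \<Longrightarrow> (N +>\<^bsub>M\<^esub> x) \<oplus>\<^bsub>quot_mod M N\<^esub> (N +>\<^bsub>M\<^esub> y) = N +>\<^bsub>M\<^esub> (x \<oplus>\<^bsub>M\<^esub> y)"
    using abelian_subgroup.a_rcos_sum[OF submodule_abelian_subgroup[OF N]] by (simp add: quot_mod_def)
  show "\<zero>\<^bsub>quot_mod M N\<^esub> = N +>\<^bsub>M\<^esub> \<zero>\<^bsub>M\<^esub>" using coset_zero[OF N] by (simp add: quot_mod_def)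
  assume a: "a \<in> carrier R" and x: "x \<in> carrier M"
  \<comment> \<open>Scalar multiplication is defined as a union over the coset; it is the expected
    coset because all members contribute the same one.\<close>
  have const: "N +>\<^bsub>M\<^esub> (a \<odot>\<^bsub>M\<^esub> y) = N +>\<^bsub>M\<^esub> (a \<odot>\<^bsub>M\<^esub> x)" if y: "y \<in> N +>\<^bsub>M\<^esub> x" for y
  proof -
    obtain h where h: "h \<in> N" "y = h \<oplus>\<^bsub>M\<^esub> x" using y by (auto simp: a_r_coset_def r_coset_def)
    have hc: "h \<in> carrier M" by (rule F(6)[OF h(1)])
    have "a \<odot>\<^bsub>M\<^esub> y \<ominus>\<^bsub>M\<^esub> a \<odot>\<^bsub>M\<^esub> x = a \<odot>\<^bsub>M\<^esub> h"
      using a x hc by (simp add: h(2) smult_r_distr a_minus_def M.a_assoc M.r_neg)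
    then show ?thesis using coset_eq_iff[OF N, of "a \<odot>\<^bsub>M\<^esub> y" "a \<odot>\<^bsub>M\<^esub> x"] F(3)[OF a h(1)] a x hc h(2) by simp
  qed
  have "x \<in> N +>\<^bsub>M\<^esub> x" using M.a_rcosI[OF F(1) submodule_subset[OF N] x] x by simp
  then have "(\<Union>y\<in>N +>\<^bsub>M\<^esub> x. N +>\<^bsub>M\<^esub> (a \<odot>\<^bsub>M\<^esub> y)) = N +>\<^bsub>M\<^esub> (a \<odot>\<^bsub>M\<^esub> x)"
    by (rule UN_constant_eq) (use const in blast)
  then show "a \<odot>\<^bsub>quot_mod M N\<^esub> (N +>\<^bsub>M\<^esub> x) = N +>\<^bsub>M\<^esub> (a \<odot>\<^bsub>M\<^esub> x)"
    unfolding quot_mod_def by simp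
qed

lemma quot_module: assumes N: "submodule N R M" shows "Module.module R (quot_mod M N)"
proof -
  note Q = quot_simps[OF N]
  have el: "\<exists>x\<in>carrier M. X = N +>\<^bsub>M\<^esub> x" if "X \<in> carrier (quot_mod M N)" for X using that Q(1) by blast
  show ?thesis
  proof (rule moduleI[OF R.cring_axioms])
    show "abelian_group (quot_mod M N)"
    proof (rule abelian_groupI)
      show "\<exists>y\<in>carrier (quot_mod M N). y \<oplus>\<^bsub>quot_mod M N\<^esub> X = \<zero>\<^bsub>quot_mod M N\<^esub>" if "X \<in> carrier (quot_mod M N)" for X
      proof -
        obtain x where x: "x \<in> carrier M" "X = N +>\<^bsub>M\<^esub> x" using el \<open>X \<in> carrier (quot_mod M N)\<close> by blast
        have "(N +>\<^bsub>M\<^esub> (\<ominus>\<^bsub>M\<^esub> x)) \<oplus>\<^bsub>quot_mod M N\<^esub> X = \<zero>\<^bsub>quot_mod M N\<^esub>"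
          using x(1) by (simp add: x(2) Q(2,4) M.l_neg)
        then show ?thesis using x(1) Q(1) by auto
      qed
    qed (auto dest!: el simp: Q M.a_assoc M.a_comm M.a_lcomm intro: imageI)
  qed (auto dest!: el simp: Q smult_l_distr smult_r_distr smult_assoc1)
qed

end

lemma submodule_module: "Module.module R M \<Longrightarrow> submodule N R M \<Longrightarrow> Module.module R (M\<lparr>carrier := N\<rparr>)"
  by (rule submodule.submodule_is_module)

section \<open>Free modules and tensor products\<close>

lemma free_simps:
  "\<zero>\<^bsub>free_mod R X\<^esub> = (\<lambda>_. \<zero>\<^bsub>R\<^esub>)" "f \<oplus>\<^bsub>free_mod R X\<^esub> g = (\<lambda>x. f x \<oplus>\<^bsub>R\<^esub> g x)"
  "a \<odot>\<^bsub>free_mod R X\<^esub> f = (\<lambda>x. a \<otimes>\<^bsub>R\<^esub> f x)"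
  by (simp_all add: free_mod_def)

lemma free_carrierI:
  "(\<And>x. f x \<in> carrier R) \<Longrightarrow> (\<And>x. x \<notin> X \<Longrightarrow> f x = \<zero>\<^bsub>R\<^esub>) \<Longrightarrow> finite {x. f x \<noteq> \<zero>\<^bsub>R\<^esub>} \<Longrightarrow> f \<in> carrier (free_mod R X)"
  by (simp add: free_mod_def)

lemma free_carrierD:
  assumes "f \<in> carrier (free_mod R X)"
  shows "f x \<in> carrier R" "x \<notin> X \<Longrightarrow> f x = \<zero>\<^bsub>R\<^esub>" "finite {x. f x \<noteq> \<zero>\<^bsub>R\<^esub>}"
  using assms by (auto simp: free_mod_def)

context cring begin

lemma free_module: "Module.module R (free_mod R X)"
proof (rule moduleI[OF cring_axioms])
  note D = free_carrierD
  have add: "f \<oplus>\<^bsub>free_mod R X\<^esub> g \<in> carrier (free_mod R X)"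
    if fg: "f \<in> carrier (free_mod R X)" "g \<in> carrier (free_mod R X)" for f g
  proof (rule free_carrierI)
    show "finite {x. (f \<oplus>\<^bsub>free_mod R X\<^esub> g) x \<noteq> \<zero>}"
      by (rule finite_subset[OF _ finite_UnI[OF D(3)[OF fg(1)] D(3)[OF fg(2)]]]) (auto simp: free_simps)
  qed (use D[OF fg(1)] D[OF fg(2)] in \<open>auto simp: free_simps\<close>)
  show sm: "a \<odot>\<^bsub>free_mod R X\<^esub> f \<in> carrier (free_mod R X)"
    if f: "a \<in> carrier R" "f \<in> carrier (free_mod R X)" for a f
  proof (rule free_carrierI)
    show "finite {x. (a \<odot>\<^bsub>free_mod R X\<^esub> f) x \<noteq> \<zero>}"
      by (rule finite_subset[OF _ D(3)[OF f(2)]]) (auto simp: free_simps f)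
  qed (use D[OF f(2)] f(1) in \<open>auto simp: free_simps\<close>)
  show "abelian_group (free_mod R X)"
  proof (rule abelian_groupI)
    show "\<zero>\<^bsub>free_mod R X\<^esub> \<in> carrier (free_mod R X)" by (rule free_carrierI) (auto simp: free_simps)
    fix f assume f: "f \<in> carrier (free_mod R X)"
    have "(\<ominus> \<one>) \<odot>\<^bsub>free_mod R X\<^esub> f \<oplus>\<^bsub>free_mod R X\<^esub> f = \<zero>\<^bsub>free_mod R X\<^esub>"
      using D(1)[OF f] by (auto simp: free_simps l_minus l_neg)
    then show "\<exists>g\<in>carrier (free_mod R X). g \<oplus>\<^bsub>free_mod R X\<^esub> f = \<zero>\<^bsub>free_mod R X\<^esub>"
      using sm[of "\<ominus> \<one>", OF _ f] by auto
  qed (auto simp: free_simps add[unfolded free_simps] a_ac D(1))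
qed (auto simp: free_simps l_distr r_distr m_assoc free_carrierD(1))

lemma free_gen_carrier: "x \<in> X \<Longrightarrow> free_gen R x \<in> carrier (free_mod R X)"
  by (rule free_carrierI) (auto simp: free_gen_def)

end

locale tensor_setting = M: rmodule R M + N: rmodule R N for R (structure) and M and N
begin

abbreviation "FM \<equiv> free_mod R (carrier M \<times> carrier N)"
abbreviation "K \<equiv> tensor_rels R M N"
abbreviation "T \<equiv> tensor_mod R M N"
abbreviation "pt \<equiv> pure_tensor R M N"

sublocale F: rmodule R FM
  by (rule rmodule.intro[OF M.R.free_module])

definition "rel_gens =
     {free_gen R (x \<oplus>\<^bsub>M\<^esub> x', y) \<ominus>\<^bsub>FM\<^esub> (free_gen R (x, y) \<oplus>\<^bsub>FM\<^esub> free_gen R (x', y)) | x x' y.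
         x \<in> carrier M \<and> x' \<in> carrier M \<and> y \<in> carrier N} \<union>
      {free_gen R (x, y \<oplus>\<^bsub>N\<^esub> y') \<ominus>\<^bsub>FM\<^esub> (free_gen R (x, y) \<oplus>\<^bsub>FM\<^esub> free_gen R (x, y')) | x y y'.
         x \<in> carrier M \<and> y \<in> carrier N \<and> y' \<in> carrier N} \<union>
      {free_gen R (a \<odot>\<^bsub>M\<^esub> x, y) \<ominus>\<^bsub>FM\<^esub> (a \<odot>\<^bsub>FM\<^esub> free_gen R (x, y)) | a x y.
         a \<in> carrier R \<and> x \<in> carrier M \<and> y \<in> carrier N} \<union>
      {free_gen R (x, a \<odot>\<^bsub>N\<^esub> y) \<ominus>\<^bsub>FM\<^esub> (a \<odot>\<^bsub>FM\<^esub> free_gen R (x, y)) | a x y.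
         a \<in> carrier R \<and> x \<in> carrier M \<and> y \<in> carrier N}"

lemma K_eq: "K = mod_span R FM rel_gens"
  unfolding tensor_rels_def Let_def rel_gens_def ..

lemma gen_carrier: "x \<in> carrier M \<Longrightarrow> y \<in> carrier N \<Longrightarrow> free_gen R (x, y) \<in> carrier FM"
  by (rule M.R.free_gen_carrier) simp

lemma rel_gens_carrier: "rel_gens \<subseteq> carrier FM"
  unfolding rel_gens_def by (auto intro!: F.M.minus_closed F.M.add.m_closed gen_carrier F.smult_closed)

lemma K_sub: "submodule K R FM"
  unfolding K_eq by (rule F.mod_span_submodule[OF rel_gens_carrier])

lemma rel_K: "z \<in> rel_gens \<Longrightarrow> z \<in> K"
  unfolding K_eq using F.mod_span_incl by blast

sublocale T: rmodule R T
  unfolding tensor_mod_def by (rule rmodule.intro[OF F.quot_module[OF K_sub]])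

lemma pt_eq: "pt x y = K +>\<^bsub>FM\<^esub> free_gen R (x, y)"
  by (simp add: pure_tensor_def)

lemma pt_carrier: "x \<in> carrier M \<Longrightarrow> y \<in> carrier N \<Longrightarrow> pt x y \<in> carrier T"
  unfolding pt_eq tensor_mod_def F.quot_simps(1)[OF K_sub] using gen_carrier by blast

lemma pt_add_left:
  assumes "x \<in> carrier M" "x' \<in> carrier M" "y \<in> carrier N"
  shows "pt (x \<oplus>\<^bsub>M\<^esub> x') y = pt x y \<oplus>\<^bsub>T\<^esub> pt x' y"
proof -
  have "free_gen R (x \<oplus>\<^bsub>M\<^esub> x', y) \<ominus>\<^bsub>FM\<^esub> (free_gen R (x, y) \<oplus>\<^bsub>FM\<^esub> free_gen R (x', y)) \<in> K"
    by (rule rel_K, unfold rel_gens_def, rule UnI1, rule UnI1, rule UnI1) (use assms in blast)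
  then show ?thesis unfolding pt_eq tensor_mod_def
    using assms F.coset_eq_iff[OF K_sub] F.quot_simps(2)[OF K_sub] gen_carrier by simp
qed

lemma pt_smult_left:
  assumes "a \<in> carrier R" "x \<in> carrier M" "y \<in> carrier N"
  shows "pt (a \<odot>\<^bsub>M\<^esub> x) y = a \<odot>\<^bsub>T\<^esub> pt x y"
proof -
  have "free_gen R (a \<odot>\<^bsub>M\<^esub> x, y) \<ominus>\<^bsub>FM\<^esub> (a \<odot>\<^bsub>FM\<^esub> free_gen R (x, y)) \<in> K"
    by (rule rel_K, unfold rel_gens_def, rule UnI1, rule UnI2) (use assms in blast)
  then show ?thesis unfolding pt_eq tensor_mod_def
    using assms F.coset_eq_iff[OF K_sub] F.quot_simps(3)[OF K_sub] gen_carrier by simp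
qed

lemma pt_smult_right:
  assumes "a \<in> carrier R" "x \<in> carrier M" "y \<in> carrier N"
  shows "pt x (a \<odot>\<^bsub>N\<^esub> y) = a \<odot>\<^bsub>T\<^esub> pt x y"
proof -
  have "free_gen R (x, a \<odot>\<^bsub>N\<^esub> y) \<ominus>\<^bsub>FM\<^esub> (a \<odot>\<^bsub>FM\<^esub> free_gen R (x, y)) \<in> K"
    by (rule rel_K, unfold rel_gens_def, rule UnI2) (use assms in blast)
  then show ?thesis unfolding pt_eq tensor_mod_def
    using assms F.coset_eq_iff[OF K_sub] F.quot_simps(3)[OF K_sub] gen_carrier by simp
qed

text \<open>A bilinear map vanishes on every pure tensor that is zero, as it extends to the free module and the extension
  kills the defining relations.\<close>
lemma bilinear_vanish:
  assumes Pm: "Module.module R Q"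
    and \<beta>: "\<And>x y. x \<in> carrier M \<Longrightarrow> y \<in> carrier N \<Longrightarrow> \<beta> x y \<in> carrier Q"
    and add1: "\<And>x x' y. x \<in> carrier M \<Longrightarrow> x' \<in> carrier M \<Longrightarrow> y \<in> carrier N \<Longrightarrow> \<beta> (x \<oplus>\<^bsub>M\<^esub> x') y = \<beta> x y \<oplus>\<^bsub>Q\<^esub> \<beta> x' y"
    and add2: "\<And>x y y'. x \<in> carrier M \<Longrightarrow> y \<in> carrier N \<Longrightarrow> y' \<in> carrier N \<Longrightarrow> \<beta> x (y \<oplus>\<^bsub>N\<^esub> y') = \<beta> x y \<oplus>\<^bsub>Q\<^esub> \<beta> x y'"
    and sm1: "\<And>a x y. a \<in> carrier R \<Longrightarrow> x \<in> carrier M \<Longrightarrow> y \<in> carrier N \<Longrightarrow> \<beta> (a \<odot>\<^bsub>M\<^esub> x) y = a \<odot>\<^bsub>Q\<^esub> \<beta> x y"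
    and sm2: "\<And>a x y. a \<in> carrier R \<Longrightarrow> x \<in> carrier M \<Longrightarrow> y \<in> carrier N \<Longrightarrow> \<beta> x (a \<odot>\<^bsub>N\<^esub> y) = a \<odot>\<^bsub>Q\<^esub> \<beta> x y"
    and x: "x \<in> carrier M" "y \<in> carrier N" and z: "pt x y = \<zero>\<^bsub>T\<^esub>"
  shows "\<beta> x y = \<zero>\<^bsub>Q\<^esub>"
proof -
  interpret P: Module.module R Q by (rule Pm)
  \<comment> \<open>The extension \<Phi> sums over finite supports and wants a value at every pair;
    outside the carriers it is zero.\<close>
  define b where "b z = (if z \<in> carrier M \<times> carrier N then \<beta> (fst z) (snd z) else \<zero>\<^bsub>Q\<^esub>)" for z
  have bc: "b z \<in> carrier Q" for z using \<beta> by (auto simp: b_def)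
  define \<Phi> where "\<Phi> f = (\<Oplus>\<^bsub>Q\<^esub>z\<in>{z. f z \<noteq> \<zero>}. f z \<odot>\<^bsub>Q\<^esub> b z)" for f
  have \<Phi>: "\<Phi> f = (\<Oplus>\<^bsub>Q\<^esub>z\<in>A. f z \<odot>\<^bsub>Q\<^esub> b z)" if "f \<in> carrier FM" "finite A" "{z. f z \<noteq> \<zero>} \<subseteq> A" for f A
    unfolding \<Phi>_def using that free_carrierD(1)[OF that(1)] bc
    by (intro P.M.add.finprod_mono_neutral_cong_left) auto
  have \<Phi>c: "\<Phi> f \<in> carrier Q" if "f \<in> carrier FM" for f
    unfolding \<Phi>_def using free_carrierD(1)[OF that] bc by (intro P.M.finsum_closed) auto
  have \<Phi>add: "\<Phi> (f \<oplus>\<^bsub>FM\<^esub> g) = \<Phi> f \<oplus>\<^bsub>Q\<^esub> \<Phi> g" if fg: "f \<in> carrier FM" "g \<in> carrier FM" for f g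
  proof -
    let ?A = "{z. f z \<noteq> \<zero>} \<union> {z. g z \<noteq> \<zero>}"
    have A: "finite ?A" using free_carrierD(3) fg by auto
    note fgc = free_carrierD(1)[OF fg(1)] free_carrierD(1)[OF fg(2)]
    have "\<Phi> (f \<oplus>\<^bsub>FM\<^esub> g) = (\<Oplus>\<^bsub>Q\<^esub>z\<in>?A. (f \<oplus>\<^bsub>FM\<^esub> g) z \<odot>\<^bsub>Q\<^esub> b z)"
      by (rule \<Phi>[OF F.M.add.m_closed[OF fg] A]) (auto simp: free_simps)
    also have "\<dots> = (\<Oplus>\<^bsub>Q\<^esub>z\<in>?A. f z \<odot>\<^bsub>Q\<^esub> b z \<oplus>\<^bsub>Q\<^esub> g z \<odot>\<^bsub>Q\<^esub> b z)"
      using fgc bc by (simp add: free_simps P.smult_l_distr)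
    also have "\<dots> = (\<Oplus>\<^bsub>Q\<^esub>z\<in>?A. f z \<odot>\<^bsub>Q\<^esub> b z) \<oplus>\<^bsub>Q\<^esub> (\<Oplus>\<^bsub>Q\<^esub>z\<in>?A. g z \<odot>\<^bsub>Q\<^esub> b z)"
      using fgc bc by (intro P.M.finsum_addf) auto
    also have "\<dots> = \<Phi> f \<oplus>\<^bsub>Q\<^esub> \<Phi> g" using \<Phi>[OF fg(1) A] \<Phi>[OF fg(2) A] by simp
    finally show ?thesis .
  qed
  have \<Phi>sm: "\<Phi> (a \<odot>\<^bsub>FM\<^esub> f) = a \<odot>\<^bsub>Q\<^esub> \<Phi> f" if f: "a \<in> carrier R" "f \<in> carrier FM" for a f
  proof -
    let ?A = "{z. f z \<noteq> \<zero>}"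
    note fc = free_carrierD(1)[OF f(2)]
    have "\<Phi> (a \<odot>\<^bsub>FM\<^esub> f) = (\<Oplus>\<^bsub>Q\<^esub>z\<in>?A. (a \<odot>\<^bsub>FM\<^esub> f) z \<odot>\<^bsub>Q\<^esub> b z)"
      by (rule \<Phi>[OF F.smult_closed[OF f] free_carrierD(3)[OF f(2)]]) (use f(1) in \<open>auto simp: free_simps\<close>)
    also have "\<dots> = (\<Oplus>\<^bsub>Q\<^esub>z\<in>?A. a \<odot>\<^bsub>Q\<^esub> (f z \<odot>\<^bsub>Q\<^esub> b z))"
      using fc bc f(1) by (simp add: free_simps P.smult_assoc1)
    also have "\<dots> = a \<odot>\<^bsub>Q\<^esub> (\<Oplus>\<^bsub>Q\<^esub>z\<in>?A. f z \<odot>\<^bsub>Q\<^esub> b z)"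
      using fc bc f(1) by (intro P.finsum_smult_ldistr[symmetric] free_carrierD(3)[OF f(2)]) auto
    finally show ?thesis by (simp add: \<Phi>_def)
  qed
  have \<Phi>g: "\<Phi> (free_gen R z) = b z" if "z \<in> carrier M \<times> carrier N" for z
  proof -
    have "\<Phi> (free_gen R z) = (\<Oplus>\<^bsub>Q\<^esub>w\<in>{z}. free_gen R z w \<odot>\<^bsub>Q\<^esub> b w)"
      using that by (intro \<Phi> M.R.free_gen_carrier) (auto simp: free_gen_def)
    then show ?thesis using bc by (simp add: free_gen_def)
  qed
  have \<Phi>m: "\<Phi> (f \<ominus>\<^bsub>FM\<^esub> g) = \<zero>\<^bsub>Q\<^esub>" if fg: "f \<in> carrier FM" "g \<in> carrier FM" and e: "\<Phi> f = \<Phi> g" for f g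
  proof -
    have "\<Phi> (f \<ominus>\<^bsub>FM\<^esub> g) \<oplus>\<^bsub>Q\<^esub> \<Phi> g = \<Phi> ((f \<ominus>\<^bsub>FM\<^esub> g) \<oplus>\<^bsub>FM\<^esub> g)" using \<Phi>add fg by simp
    also have "(f \<ominus>\<^bsub>FM\<^esub> g) \<oplus>\<^bsub>FM\<^esub> g = f" using fg by (simp add: a_minus_def F.M.a_assoc F.M.l_neg)
    finally have "\<Phi> (f \<ominus>\<^bsub>FM\<^esub> g) \<oplus>\<^bsub>Q\<^esub> \<Phi> g = \<zero>\<^bsub>Q\<^esub> \<oplus>\<^bsub>Q\<^esub> \<Phi> g" using e \<Phi>c fg by simp
    then show ?thesis using \<Phi>c fg P.M.zero_closed P.M.add.right_cancel[of "\<Phi> g" "\<Phi> (f \<ominus>\<^bsub>FM\<^esub> g)" "\<zero>\<^bsub>Q\<^esub>"] by simp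
  qed
  \<comment> \<open>The kernel of \<Phi> is a submodule that contains the generating relations,
    hence all of \<open>K\<close>.\<close>
  define Z where "Z = {f \<in> carrier FM. \<Phi> f = \<zero>\<^bsub>Q\<^esub>}"
  have \<Phi>0: "\<Phi> \<zero>\<^bsub>FM\<^esub> = \<zero>\<^bsub>Q\<^esub>" by (simp add: \<Phi>_def free_simps)
  have "submodule Z R FM"
  proof (rule F.submoduleI)
    show "\<zero>\<^bsub>FM\<^esub> \<in> Z" using \<Phi>0 by (simp add: Z_def)
    show "\<ominus>\<^bsub>FM\<^esub> f \<in> Z" if "f \<in> Z" for f
    proof -
      have "\<Phi> (\<zero>\<^bsub>FM\<^esub> \<ominus>\<^bsub>FM\<^esub> f) = \<zero>\<^bsub>Q\<^esub>" using that \<Phi>0 by (intro \<Phi>m) (auto simp: Z_def)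
      then show ?thesis using that by (simp add: Z_def a_minus_def)
    qed
  qed (auto simp: Z_def \<Phi>add \<Phi>sm)
  moreover have "rel_gens \<subseteq> Z"
    unfolding rel_gens_def Z_def
    by (auto intro!: \<Phi>m F.M.minus_closed F.M.add.m_closed gen_carrier F.smult_closed
        simp: \<Phi>add \<Phi>sm \<Phi>g gen_carrier b_def add1 add2 sm1 sm2)
  ultimately have KZ: "K \<subseteq> Z" unfolding K_eq by (rule F.mod_span_least)
  have "free_gen R (x, y) \<in> K"
    using z F.coset_zero_iff[OF K_sub gen_carrier[OF x]] F.coset_zero[OF K_sub] F.quot_simps(4)[OF K_sub]
    unfolding pt_eq tensor_mod_def by simp
  then have "\<Phi> (free_gen R (x, y)) = \<zero>\<^bsub>Q\<^esub>" using KZ by (auto simp: Z_def)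
  then show ?thesis using \<Phi>g[of "(x, y)"] x by (simp add: b_def)
qed

end

section \<open>Fractions and the tensor product with \<open>\<rat>\<^sub>p/\<int>\<^sub>p\<close>\<close>

lemma (in rmodule) minus_eqI:
  assumes "y \<in> carrier M" "z \<in> carrier M" "x = z \<oplus>\<^bsub>M\<^esub> y" shows "x \<ominus>\<^bsub>M\<^esub> y = z"
  using assms by (simp add: a_minus_def M.a_assoc M.r_neg)

context padic begin

definition unz :: "intseq \<Rightarrow> bool" where "unz y \<longleftrightarrow> coh y \<and> \<not> null y"

lemma unz_mult: "unz x \<Longrightarrow> unz y \<Longrightarrow> unz (x * y)"
  by (simp add: unz_def null_mult_iff)

lemma not_null_one: "\<not> null 1"
  using null_not_unit[of 1] p_gt_1 by auto

lemma unz_one: "unz 1"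
  by (simp add: unz_def not_null_one)

lemma unz_pp: "unz (pp e)"
  using null_pp_mult_iff[of 1 e] not_null_one by (simp add: unz_def del: of_nat_power)

definition fr :: "intseq \<Rightarrow> intseq \<Rightarrow> (padic \<times> padic) set"
  where "fr x y = frac_elt (Zp p) (zc x) (zc y)"

lemma frac_rel_zc:
  assumes "coh x" "unz y" "coh x'" "unz y'"
  shows "((zc x, zc y), (zc x', zc y')) \<in> frac_rel (Zp p) \<longleftrightarrow> null (x * y' - x' * y)"
  using assms zc_carrier by (auto simp: frac_rel_def zc_zero_iff zc_hom(1,2) zc_eq_iff unz_def)

abbreviation "fracs \<equiv> carrier (Zp p) \<times> (carrier (Zp p) - {\<zero>\<^bsub>Zp p\<^esub>})"

lemma fracs_E: assumes "a \<in> fracs" obtains x y where "coh x" "unz y" "a = (zc x, zc y)"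
proof -
  obtain b c where a: "a = (b, c)" "b \<in> carrier (Zp p)" "c \<in> carrier (Zp p)" "c \<noteq> \<zero>\<^bsub>Zp p\<^esub>" using assms by auto
  obtain x where x: "coh x" "b = zc x" using Zp_E[OF a(2)] .
  obtain y where y: "coh y" "c = zc y" using Zp_E[OF a(3)] .
  show ?thesis using that[of x y] x y a(1,4) by (simp add: unz_def zc_zero_iff)
qed

lemma fracs_I: "coh x \<Longrightarrow> unz y \<Longrightarrow> (zc x, zc y) \<in> fracs"
  by (auto simp: zc_carrier unz_def zc_zero_iff)

text \<open>Transitivity cancels the middle denominator, which is where the absence of zero divisors
  enters.\<close>

lemma frac_equiv: "equiv fracs (frac_rel (Zp p))"
proof (rule equivI)
  show "frac_rel (Zp p) \<subseteq> fracs \<times> fracs" by (auto simp: frac_rel_def)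
  show "refl_on fracs (frac_rel (Zp p))"
    by (rule refl_onI) (auto elim!: fracs_E simp: frac_rel_zc)
  show "sym (frac_rel (Zp p))"
    by (rule symI) (auto simp: frac_rel_def)
  show "trans (frac_rel (Zp p))"
  proof (rule transI)
    fix a b c assume r: "(a, b) \<in> frac_rel (Zp p)" "(b, c) \<in> frac_rel (Zp p)"
    then have m: "a \<in> fracs" "b \<in> fracs" "c \<in> fracs" by (auto simp: frac_rel_def)
    obtain x y where a: "coh x" "unz y" "a = (zc x, zc y)" using fracs_E[OF m(1)] .
    obtain x' y' where b: "coh x'" "unz y'" "b = (zc x', zc y')" using fracs_E[OF m(2)] .
    obtain x'' y'' where c: "coh x''" "unz y''" "c = (zc x'', zc y'')" using fracs_E[OF m(3)] .
    have 1: "null (x * y' - x' * y)" using r(1) frac_rel_zc[OF a(1,2) b(1,2)] a(3) b(3) by simp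
    have 2: "null (x' * y'' - x'' * y')" using r(2) frac_rel_zc[OF b(1,2) c(1,2)] b(3) c(3) by simp
    have "null ((x * y' - x' * y) * y'' + (x' * y'' - x'' * y') * y)" using 1 2 by (intro null_add null_mult(1))
    then have "null (y' * (x * y'' - x'' * y))" by (simp add: algebra_simps)
    then have "null (x * y'' - x'' * y)"
      using null_mult_iff[of y' "x * y'' - x'' * y"] a b c by (simp add: unz_def coh_mult coh_diff)
    then show "(a, c) \<in> frac_rel (Zp p)" using frac_rel_zc[OF a(1,2) c(1,2)] a(3) c(3) by simp
  qed
qed

lemma fr_eq_iff: "coh x \<Longrightarrow> unz y \<Longrightarrow> coh x' \<Longrightarrow> unz y' \<Longrightarrow> fr x y = fr x' y' \<longleftrightarrow> null (x * y' - x' * y)"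
  unfolding fr_def frac_elt_def
  by (subst eq_equiv_class_iff[OF frac_equiv fracs_I fracs_I]) (simp_all add: frac_rel_zc)

lemma fr_self: "coh x \<Longrightarrow> unz y \<Longrightarrow> (zc x, zc y) \<in> fr x y"
  unfolding fr_def frac_elt_def using frac_rel_zc[of x y x y] by simp

lemma fr_memE: assumes "a \<in> fr x y" "coh x" "unz y"
  obtains x' y' where "coh x'" "unz y'" "a = (zc x', zc y')" "null (x * y' - x' * y)"
proof -
  have r: "((zc x, zc y), a) \<in> frac_rel (Zp p)" using assms(1) by (simp add: fr_def frac_elt_def)
  then have "a \<in> fracs" by (auto simp: frac_rel_def)
  then obtain x' y' where a: "coh x'" "unz y'" "a = (zc x', zc y')" by (rule fracs_E)
  then show ?thesis using that[OF a] r frac_rel_zc[OF assms(2,3) a(1,2)] by simp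
qed

lemma frac_carrier: "carrier (frac_mod (Zp p)) = {fr x y | x y. coh x \<and> unz y}"
proof -
  have "fracs // frac_rel (Zp p) = {fr x y | x y. coh x \<and> unz y}"
  proof (intro equalityI subsetI)
    fix X assume "X \<in> fracs // frac_rel (Zp p)"
    then obtain a where a: "a \<in> fracs" "X = frac_rel (Zp p) `` {a}" by (rule quotientE)
    obtain x y where "coh x" "unz y" "a = (zc x, zc y)" using fracs_E[OF a(1)] .
    then show "X \<in> {fr x y | x y. coh x \<and> unz y}" using a(2) by (auto simp: fr_def frac_elt_def)
  next
    fix X assume "X \<in> {fr x y | x y. coh x \<and> unz y}"
    then show "X \<in> fracs // frac_rel (Zp p)" unfolding fr_def frac_elt_def using fracs_I by (auto intro: quotientI)
  qed
  then show ?thesis by (simp add: frac_mod_def)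
qed

lemma fr_carrier: "coh x \<Longrightarrow> unz y \<Longrightarrow> fr x y \<in> carrier (frac_mod (Zp p))"
  unfolding frac_carrier by blast

lemma frac_E: assumes "X \<in> carrier (frac_mod (Zp p))" obtains x y where "coh x" "unz y" "X = fr x y"
  using assms unfolding frac_carrier by blast

lemma fr_add:
  assumes x: "coh x" "unz y" and x': "coh x'" "unz y'"
  shows "fr x y \<oplus>\<^bsub>frac_mod (Zp p)\<^esub> fr x' y' = fr (x * y' + x' * y) (y * y')"
proof -
  have *: "frac_elt (Zp p) ((fst a \<otimes>\<^bsub>Zp p\<^esub> snd c) \<oplus>\<^bsub>Zp p\<^esub> (fst c \<otimes>\<^bsub>Zp p\<^esub> snd a)) (snd a \<otimes>\<^bsub>Zp p\<^esub> snd c) =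
      fr (x * y' + x' * y) (y * y')" if ac: "a \<in> fr x y" "c \<in> fr x' y'" for a c
  proof -
    obtain u v where u: "coh u" "unz v" "a = (zc u, zc v)" "null (x * v - u * y)" using fr_memE[OF ac(1) x] .
    obtain u' v' where u': "coh u'" "unz v'" "c = (zc u', zc v')" "null (x' * v' - u' * y')" using fr_memE[OF ac(2) x'] .
    have "null ((u * v' + u' * v) * (y * y') - (x * y' + x' * y) * (v * v'))"
    proof -
      have "(u * v' + u' * v) * (y * y') - (x * y' + x' * y) * (v * v') =
        - ((x * v - u * y) * (v' * y')) - (x' * v' - u' * y') * (v * y)" by (simp add: algebra_simps)
      then show ?thesis by (simp only: null_diff null_uminus null_mult(1)[OF u(4)] null_mult(1)[OF u'(4)])
    qed
    moreover have "coh (u * v' + u' * v)" "coh (x * y' + x' * y)" "unz (v * v')" "unz (y * y')"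
      using u u' x x' unz_mult by (auto simp: unz_def)
    ultimately show ?thesis by (simp add: u(3) u'(3) zc_hom(1,2) fr_def[symmetric] fr_eq_iff)
  qed
  have "fr x y \<oplus>\<^bsub>frac_mod (Zp p)\<^esub> fr x' y' = (\<Union>a\<in>fr x y. \<Union>c\<in>fr x' y'.
     frac_elt (Zp p) ((fst a \<otimes>\<^bsub>Zp p\<^esub> snd c) \<oplus>\<^bsub>Zp p\<^esub> (fst c \<otimes>\<^bsub>Zp p\<^esub> snd a)) (snd a \<otimes>\<^bsub>Zp p\<^esub> snd c))"
    by (simp add: frac_mod_def case_prod_beta')
  also have "\<dots> = (\<Union>a\<in>fr x y. fr (x * y' + x' * y) (y * y'))"
    by (intro SUP_cong refl UN_constant_eq[OF fr_self[OF x']]) (use * in blast)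
  also have "\<dots> = fr (x * y' + x' * y) (y * y')" by (rule UN_constant_eq[OF fr_self[OF x]]) blast
  finally show ?thesis .
qed

lemma fr_smult:
  assumes x: "coh x" "unz y" and r: "coh r"
  shows "zc r \<odot>\<^bsub>frac_mod (Zp p)\<^esub> fr x y = fr (r * x) y"
proof -
  have *: "frac_elt (Zp p) (zc r \<otimes>\<^bsub>Zp p\<^esub> fst a) (snd a) = fr (r * x) y" if a: "a \<in> fr x y" for a
  proof -
    obtain u v where u: "coh u" "unz v" "a = (zc u, zc v)" "null (x * v - u * y)" using fr_memE[OF a x] .
    have "null (r * u * y - r * x * v)"
    proof -
      have "r * u * y - r * x * v = - (r * (x * v - u * y))" by (simp add: algebra_simps)
      then show ?thesis using u(4) by (simp only: null_uminus null_mult(2))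
    qed
    then show ?thesis using u x r by (simp add: u(3) zc_hom(2) fr_def[symmetric] fr_eq_iff coh_mult)
  qed
  have "zc r \<odot>\<^bsub>frac_mod (Zp p)\<^esub> fr x y = (\<Union>a\<in>fr x y. frac_elt (Zp p) (zc r \<otimes>\<^bsub>Zp p\<^esub> fst a) (snd a))"
    by (simp add: frac_mod_def case_prod_beta')
  also have "\<dots> = fr (r * x) y" by (rule UN_constant_eq[OF fr_self[OF x]]) (use * in blast)
  finally show ?thesis .
qed

lemma fr_zero: "\<zero>\<^bsub>frac_mod (Zp p)\<^esub> = fr 0 1"
  by (simp add: frac_mod_def fr_def zc_hom)

lemma unz_coh: "unz y \<Longrightarrow> coh y"
  by (simp add: unz_def)

lemma frac_module: "Module.module (Zp p) (frac_mod (Zp p))"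
proof (rule moduleI[OF Zp_cring])
  note S = fr_add fr_smult fr_zero fr_eq_iff unz_mult unz_one unz_coh coh_mult coh_add fr_carrier zc_hom(1,2)
  show "abelian_group (frac_mod (Zp p))"
  proof (rule abelian_groupI)
    show "\<exists>Y\<in>carrier (frac_mod (Zp p)). Y \<oplus>\<^bsub>frac_mod (Zp p)\<^esub> X = \<zero>\<^bsub>frac_mod (Zp p)\<^esub>"
      if "X \<in> carrier (frac_mod (Zp p))" for X
    proof -
      obtain x y where x: "coh x" "unz y" "X = fr x y" using frac_E[OF \<open>X \<in> carrier (frac_mod (Zp p))\<close>] by metis
      then have "fr (- x) y \<oplus>\<^bsub>frac_mod (Zp p)\<^esub> X = \<zero>\<^bsub>frac_mod (Zp p)\<^esub>"
        by (simp add: S coh_uminus algebra_simps)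
      then show ?thesis using fr_carrier[OF coh_uminus[OF x(1)] x(2)] by blast
    qed
  qed (auto elim!: frac_E simp: S algebra_simps)
  show "(a \<oplus>\<^bsub>Zp p\<^esub> b) \<odot>\<^bsub>frac_mod (Zp p)\<^esub> X =
      a \<odot>\<^bsub>frac_mod (Zp p)\<^esub> X \<oplus>\<^bsub>frac_mod (Zp p)\<^esub> b \<odot>\<^bsub>frac_mod (Zp p)\<^esub> X"
    if abX: "a \<in> carrier (Zp p)" "b \<in> carrier (Zp p)" "X \<in> carrier (frac_mod (Zp p))" for a b X
  proof -
    obtain c where c: "coh c" "a = zc c" using Zp_E[OF abX(1)] .
    obtain d where d: "coh d" "b = zc d" using Zp_E[OF abX(2)] .
    obtain x y where x: "coh x" "unz y" "X = fr x y" using frac_E[OF abX(3)] .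
    have "(c + d) * x * (y * y) - (c * x * y + d * x * y) * y = 0" by (simp add: algebra_simps)
    then have "null ((c + d) * x * (y * y) - (c * x * y + d * x * y) * y)" by (simp only: null_zero)
    then have "fr ((c + d) * x) y = fr (c * x * y + d * x * y) (y * y)"
      using fr_eq_iff[of "(c + d) * x" y "c * x * y + d * x * y" "y * y"] c d x unz_mult unz_coh coh_mult coh_add by blast
    then show ?thesis using c d x by (simp add: S)
  qed
  show "\<one>\<^bsub>Zp p\<^esub> \<odot>\<^bsub>frac_mod (Zp p)\<^esub> x = x" if "x \<in> carrier (frac_mod (Zp p))" for x
    using that by (auto elim!: frac_E simp: zc_hom(4) fr_smult)
qed (auto elim!: frac_E Zp_E simp: fr_add fr_smult fr_zero fr_eq_iff unz_mult unz_one unz_coh coh_mult coh_add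
      fr_carrier zc_hom(1,2) algebra_simps)

sublocale FM: rmodule "Zp p" "frac_mod (Zp p)"
  by (rule rmodule.intro[OF frac_module])

definition N1 :: "(padic \<times> padic) set set"
  where "N1 = (\<lambda>x. frac_elt (Zp p) x \<one>\<^bsub>Zp p\<^esub>) ` carrier (Zp p)"

lemma N1_eq: "N1 = {fr x 1 | x. coh x}"
  unfolding N1_def fr_def using zc_carrier by (auto elim!: Zp_E simp: zc_hom(4))

lemma N1_submodule: "submodule N1 (Zp p) (frac_mod (Zp p))"
proof (rule FM.submoduleI)
  note S = fr_add fr_smult fr_zero fr_eq_iff unz_one coh_mult coh_add
  show "N1 \<subseteq> carrier (frac_mod (Zp p))" using fr_carrier unz_one by (auto simp: N1_eq)
  show "\<zero>\<^bsub>frac_mod (Zp p)\<^esub> \<in> N1" by (auto simp: N1_eq fr_zero)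
  show "x \<oplus>\<^bsub>frac_mod (Zp p)\<^esub> y \<in> N1" if "x \<in> N1" "y \<in> N1" for x y
    using that coh_add by (fastforce simp: N1_eq S)
  show sm: "a \<odot>\<^bsub>frac_mod (Zp p)\<^esub> x \<in> N1" if "a \<in> carrier (Zp p)" "x \<in> N1" for a x
    using that coh_mult by (fastforce simp: N1_eq S elim!: Zp_E)
  show "\<ominus>\<^bsub>frac_mod (Zp p)\<^esub> x \<in> N1" if x: "x \<in> N1" for x
  proof -
    have xc: "x \<in> carrier (frac_mod (Zp p))" using x fr_carrier unz_one by (auto simp: N1_eq)
    have "\<ominus>\<^bsub>frac_mod (Zp p)\<^esub> x = (\<ominus>\<^bsub>Zp p\<^esub> \<one>\<^bsub>Zp p\<^esub>) \<odot>\<^bsub>frac_mod (Zp p)\<^esub> x"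
      using FM.smult_l_minus[OF FM.R.one_closed xc] xc by simp
    then show ?thesis using sm[of "\<ominus>\<^bsub>Zp p\<^esub> \<one>\<^bsub>Zp p\<^esub>", OF _ x] by simp
  qed
qed

lemma Q_eq: "Qp_mod_Zp p = quot_mod (frac_mod (Zp p)) N1"
  by (simp add: Qp_mod_Zp_def N1_def)

sublocale QZ: rmodule "Zp p" "Qp_mod_Zp p"
  unfolding Q_eq by (rule rmodule.intro[OF FM.quot_module[OF N1_submodule]])

text \<open>The class of x / p^e in Q_p/Z_p.\<close>

definition kap :: "intseq \<Rightarrow> nat \<Rightarrow> (padic \<times> padic) set set"
  where "kap x e = N1 +>\<^bsub>frac_mod (Zp p)\<^esub> fr x (pp e)"

lemma kap_carrier: "coh x \<Longrightarrow> kap x e \<in> carrier (Qp_mod_Zp p)"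
  unfolding Q_eq kap_def FM.quot_simps(1)[OF N1_submodule] using fr_carrier[OF _ unz_pp] by blast

text \<open>A denominator is a power of p times a unit, and the inverse of the unit is absorbed into
  the numerator.\<close>

lemma kap_E: assumes "q \<in> carrier (Qp_mod_Zp p)" obtains x e where "coh x" "q = kap x e"
proof -
  obtain X where X: "X \<in> carrier (frac_mod (Zp p))" "q = N1 +>\<^bsub>frac_mod (Zp p)\<^esub> X"
    using assms unfolding Q_eq FM.quot_simps(1)[OF N1_submodule] by blast
  obtain x y where x: "coh x" "unz y" "X = fr x y" using frac_E[OF X(1)] .
  obtain a u where u: "coh u" "null (y - pp a * u)" "\<not> int p dvd lev u 1"
    using coh_valuation[of y] x(2) unfolding unz_def by metis
  obtain v where v: "coh v" "null (u * v - 1)" using coh_inverse[OF u(1,3)] .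
  have "null (x * pp a - (x * v) * y)"
  proof -
    have "x * pp a - (x * v) * y = - (x * pp a * (u * v - 1)) - x * v * (y - pp a * u)" by (simp add: algebra_simps)
    then show ?thesis by (simp only: null_diff null_uminus null_mult(2)[OF u(2)] null_mult(2)[OF v(2)])
  qed
  then have "X = fr (x * v) (pp a)" unfolding x(3)
    by (subst fr_eq_iff[OF x(1,2) coh_mult[OF x(1) v(1)] unz_pp])
  then show ?thesis using that[of "x * v" a] X(2) x(1) v(1) by (simp add: kap_def coh_mult)
qed

lemma kap_eq_iff:
  assumes "coh x" "coh y" shows "kap x e = kap y e \<longleftrightarrow> P e dvd lev x e - lev y e"
proof -
  note c = fr_carrier[OF _ unz_pp]
  have "fr x (pp e) \<ominus>\<^bsub>frac_mod (Zp p)\<^esub> fr y (pp e) = fr (x - y) (pp e)"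
  proof (rule FM.minus_eqI[OF c[OF assms(2)] c[OF coh_diff[OF assms]]])
    have "null (x * (pp e * pp e) - ((x - y) * pp e + y * pp e) * pp e)"
    proof -
      have "x * (pp e * pp e) - ((x - y) * pp e + y * pp e) * pp e = 0" by (simp add: algebra_simps del: of_nat_power)
      then show ?thesis by (simp only: null_zero)
    qed
    then show "fr x (pp e) = fr (x - y) (pp e) \<oplus>\<^bsub>frac_mod (Zp p)\<^esub> fr y (pp e)"
      unfolding fr_add[OF coh_diff[OF assms] unz_pp assms(2) unz_pp]
      using fr_eq_iff[OF assms(1) unz_pp coh_add[OF coh_mult[OF coh_diff[OF assms] coh_const(3)] coh_mult[OF assms(2) coh_const(3)]]
          unz_mult[OF unz_pp unz_pp], of e "p ^ e" "p ^ e" e e] by blast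
  qed
  then have "kap x e = kap y e \<longleftrightarrow> fr (x - y) (pp e) \<in> N1"
    unfolding kap_def using FM.coset_eq_iff[OF N1_submodule c[OF assms(1)] c[OF assms(2)]] by simp
  also have "\<dots> \<longleftrightarrow> (\<exists>z. coh z \<and> null ((x - y) * 1 - z * pp e))"
    unfolding N1_eq using fr_eq_iff[OF coh_diff[OF assms] unz_pp _ unz_one] by (auto simp del: of_nat_power)
  also have "\<dots> \<longleftrightarrow> P e dvd lev x e - lev y e"
  proof
    assume "\<exists>z. coh z \<and> null ((x - y) * 1 - z * pp e)"
    then obtain z where "null ((x - y) * 1 - z * pp e)" by blast
    then have "P e dvd lev ((x - y) * 1 - z * pp e) e" unfolding null_def by blast
    then have "P e dvd (lev x e - lev y e) - lev z e * P e" by simp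
    then have "P e dvd (lev x e - lev y e) - lev z e * P e + lev z e * P e" by (rule dvd_add) simp
    then show "P e dvd lev x e - lev y e" by simp
  next
    assume "P e dvd lev x e - lev y e"
    then have "P e dvd lev (x - y) e" by simp
    then obtain z where "coh z" "null ((x - y) - pp e * z)" using coh_divide[OF coh_diff[OF assms]] by blast
    then show "\<exists>z. coh z \<and> null ((x - y) * 1 - z * pp e)" by (auto simp: mult.commute simp del: of_nat_power)
  qed
  finally show ?thesis .
qed

lemma kap_add:
  assumes "coh x" "coh y" shows "kap x e \<oplus>\<^bsub>Qp_mod_Zp p\<^esub> kap y e = kap (x + y) e"
proof -
  note c = fr_carrier[OF _ unz_pp]
  have "fr x (pp e) \<oplus>\<^bsub>frac_mod (Zp p)\<^esub> fr y (pp e) = fr (x + y) (pp e)"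
  proof -
    have "(x * pp e + y * pp e) * pp e - (x + y) * (pp e * pp e) = 0" by (simp add: algebra_simps del: of_nat_power)
    then have "null ((x * pp e + y * pp e) * pp e - (x + y) * (pp e * pp e))" by (simp only: null_zero)
    then show ?thesis unfolding fr_add[OF assms(1) unz_pp assms(2) unz_pp]
      using fr_eq_iff[OF coh_add[OF coh_mult[OF assms(1) coh_const(3)] coh_mult[OF assms(2) coh_const(3)]]
          unz_mult[OF unz_pp unz_pp] coh_add[OF assms] unz_pp, of "p ^ e" "p ^ e" e e e] by blast
  qed
  then show ?thesis unfolding kap_def Q_eq FM.quot_simps(2)[OF N1_submodule c[OF assms(1)] c[OF assms(2)]] by simp
qed

lemma kap_smult: assumes "coh r" "coh x" shows "zc r \<odot>\<^bsub>Qp_mod_Zp p\<^esub> kap x e = kap (r * x) e"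
  unfolding kap_def Q_eq FM.quot_simps(3)[OF N1_submodule zc_carrier[OF assms(1)] fr_carrier[OF assms(2) unz_pp]]
    fr_smult[OF assms(2) unz_pp assms(1)] ..

lemma kap_level: assumes "coh x" shows "kap x e = kap (pp f * x) (e + f)"
proof -
  have "x * pp (e + f) - pp f * x * pp e = 0" by (simp add: power_add)
  then have "null (x * pp (e + f) - pp f * x * pp e)" by (simp only: null_zero)
  then show ?thesis unfolding kap_def
    using fr_eq_iff[OF assms unz_pp coh_mult[OF coh_const(3) assms] unz_pp, of e "p ^ f" "e + f"] by simp
qed

lemma kap_zero: "\<zero>\<^bsub>Qp_mod_Zp p\<^esub> = kap 0 e"
proof -
  have "fr 0 1 = fr 0 (pp e)" using fr_eq_iff[OF coh_const(1) unz_one coh_const(1) unz_pp, of e] by simp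
  then show ?thesis unfolding kap_def Q_eq FM.quot_simps(4)[OF N1_submodule] fr_zero by simp
qed

lemma kap_zero_iff: "coh x \<Longrightarrow> kap x e = \<zero>\<^bsub>Qp_mod_Zp p\<^esub> \<longleftrightarrow> P e dvd lev x e"
  using kap_eq_iff[of x 0 e] kap_zero[of e] by simp

sublocale TS: tensor_setting "Zp p" "hyp_mod p n" "Qp_mod_Zp p" for n
  by (intro tensor_setting.intro rmodule.intro hyp_module QZ.module_axioms)

text \<open>The tensor of u with 1 / p^e. Multiplying u and the denominator by the same power of p
  changes nothing (\<open>tau_level\<close>), so finitely many such tensors can be brought to a
  common e.\<close>

definition tau :: "nat \<Rightarrow> nat \<Rightarrow> vec \<Rightarrow> tensor_elt"
  where "tau n e u = pure_tensor (Zp p) (hyp_mod p n) (Qp_mod_Zp p) (ofr n u) (kap 1 e)"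

lemma tensor_QZ_eq: "tensor_QZ p n = tensor_mod (Zp p) (hyp_mod p n) (Qp_mod_Zp p)"
  by (simp add: tensor_QZ_def)

sublocale TQ: rmodule "Zp p" "tensor_QZ p n" for n
  unfolding tensor_QZ_eq by (rule TS.T.rmodule_axioms)

lemma tau_carrier: "u \<in> V n \<Longrightarrow> tau n e u \<in> carrier (tensor_QZ p n)"
  unfolding tau_def tensor_QZ_eq by (intro TS.pt_carrier ofr_carrier kap_carrier) auto

lemma tau_add: "u \<in> V n \<Longrightarrow> v \<in> V n \<Longrightarrow> tau n e u \<oplus>\<^bsub>tensor_QZ p n\<^esub> tau n e v = tau n e (u + v)"
  unfolding tau_def tensor_QZ_eq ofr_hom(1)[symmetric] by (intro TS.pt_add_left[symmetric] ofr_carrier kap_carrier) auto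

lemma tau_smult: "coh c \<Longrightarrow> u \<in> V n \<Longrightarrow> zc c \<odot>\<^bsub>tensor_QZ p n\<^esub> tau n e u = tau n e (c \<triangleright> u)"
  unfolding tau_def tensor_QZ_eq ofr_hom(2)[symmetric] by (intro TS.pt_smult_left[symmetric] ofr_carrier kap_carrier zc_carrier) auto

lemma pt_kap:
  assumes "u \<in> V n" "coh x"
  shows "pure_tensor (Zp p) (hyp_mod p n) (Qp_mod_Zp p) (ofr n u) (kap x e) = tau n e (x \<triangleright> u)"
proof -
  have "kap x e = zc x \<odot>\<^bsub>Qp_mod_Zp p\<^esub> kap 1 e" using kap_smult[OF assms(2), of 1 e] by simp
  then show ?thesis unfolding tau_smult[OF assms(2,1), symmetric]
    using TS.pt_smult_right[OF zc_carrier[OF assms(2)] ofr_carrier[OF assms(1)] kap_carrier[of 1 e]]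
    by (simp add: tau_def tensor_QZ_eq)
qed

lemma tau_level: assumes "u \<in> V n" shows "tau n e u = tau n (e + f) (pp f \<triangleright> u)"
proof -
  have "kap 1 e = kap (pp f) (e + f)" using kap_level[of 1 e f] by simp
  then show ?thesis using pt_kap[OF assms coh_const(3)[of "p ^ f"], of "e + f"] by (simp add: tau_def)
qed

lemma tau_zero: "tau n e 0 = \<zero>\<^bsub>tensor_QZ p n\<^esub>"
proof -
  have "tau n e 0 \<oplus>\<^bsub>tensor_QZ p n\<^esub> tau n e 0 = tau n e 0" using tau_add[of 0 n 0 e] by simp
  then show ?thesis using tau_carrier[of 0 n e] by (metis TQ.M.add.r_cancel_one V_zero)
qed

text \<open>Each coordinate j gives a bilinear map sending x and y to \<open>x j\<close> times y, so
  a vanishing tensor has all coordinates of u divided by p^e zero in Q_p/Z_p. Conversely, a factor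
  p^e of u moves to the right, where it kills 1 / p^e.\<close>

lemma tau_zero_iff: assumes u: "u \<in> V n" shows "tau n e u = \<zero>\<^bsub>tensor_QZ p n\<^esub> \<longleftrightarrow> near e u 0"
proof
  assume "near e u 0"
  then obtain w where w: "w \<in> V n" "eqv u (pp e \<triangleright> w)" using V_divide[OF u] by blast
  have "ofr n u = ofr n (pp e \<triangleright> w)" using ofr_eq_iff[OF u V_smul[OF coh_const(3) w(1)]] w(2) by blast
  then have "tau n e u = pure_tensor (Zp p) (hyp_mod p n) (Qp_mod_Zp p) (ofr n w) (kap (pp e) e)"
    using pt_kap[OF w(1) coh_const(3)[of "p ^ e"], of e] by (simp add: tau_def)
  also have "kap (pp e) e = kap 0 e" by (subst kap_eq_iff) auto
  also have "pure_tensor (Zp p) (hyp_mod p n) (Qp_mod_Zp p) (ofr n w) (kap 0 e) = tau n e (0 \<triangleright> w)" by (rule pt_kap[OF w(1)]) simp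
  also have "0 \<triangleright> w = 0" by (rule ext) simp
  also note tau_zero
  finally show "tau n e u = \<zero>\<^bsub>tensor_QZ p n\<^esub>" .
next
  assume z: "tau n e u = \<zero>\<^bsub>tensor_QZ p n\<^esub>"
  have j: "P e dvd lev (u (idx n j)) e" if j: "j < 2*n" for j
  proof -
    have hc: "x j \<in> carrier (Zp p)" if "x \<in> carrier (hyp_mod p n)" for x using that j by (auto simp: hyp_simps)
    have "ofr n u j \<odot>\<^bsub>Qp_mod_Zp p\<^esub> kap 1 e = \<zero>\<^bsub>Qp_mod_Zp p\<^esub>"
    proof (rule TS.bilinear_vanish[where \<beta> = "\<lambda>x y. x j \<odot>\<^bsub>Qp_mod_Zp p\<^esub> y" and n = n])
      show "Module.module (Zp p) (Qp_mod_Zp p)" by (rule QZ.module_axioms)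
      show "pure_tensor (Zp p) (hyp_mod p n) (Qp_mod_Zp p) (ofr n u) (kap 1 e) =
          \<zero>\<^bsub>tensor_mod (Zp p) (hyp_mod p n) (Qp_mod_Zp p)\<^esub>" using z by (simp add: tau_def tensor_QZ_eq)
      fix a x y assume a: "a \<in> carrier (Zp p)" "x \<in> carrier (hyp_mod p n)" "y \<in> carrier (Qp_mod_Zp p)"
      have "a \<otimes>\<^bsub>Zp p\<^esub> x j = x j \<otimes>\<^bsub>Zp p\<^esub> a" using a hc by (simp add: FM.R.m_comm)
      then show "x j \<odot>\<^bsub>Qp_mod_Zp p\<^esub> (a \<odot>\<^bsub>Qp_mod_Zp p\<^esub> y) = a \<odot>\<^bsub>Qp_mod_Zp p\<^esub> (x j \<odot>\<^bsub>Qp_mod_Zp p\<^esub> y)"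
        using a hc by (simp add: QZ.smult_assoc1[symmetric])
    qed (use j hc u in \<open>auto simp: hyp_simps(2,3) QZ.smult_l_distr QZ.smult_r_distr QZ.smult_assoc1 ofr_carrier kap_carrier\<close>)
    then have "kap (u (idx n j)) e = \<zero>\<^bsub>Qp_mod_Zp p\<^esub>"
      using kap_smult[OF V_coh[OF u], of 1 "idx n j" e] j by (simp add: ofr_def)
    then show ?thesis using kap_zero_iff[OF V_coh[OF u]] by blast
  qed
  show "near e u 0" unfolding near_def
  proof
    fix i show "P e dvd lev (u i) e - lev (0 i) e"
    proof (cases "i < 2*n")
      case True
      then obtain k where "k < 2*n" "i = idx n k" using idx_bij[of n] unfolding bij_betw_def by auto
      then show ?thesis using j by simp
    qed (use V_out[OF u] in simp)
  qed
qed

lemma tau_eq_iff: assumes "u \<in> V n" "v \<in> V n" shows "tau n e u = tau n e v \<longleftrightarrow> near e u v"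
proof -
  have uv: "u - v \<in> V n" using assms by simp
  have "tau n e u = tau n e (u - v) \<oplus>\<^bsub>tensor_QZ p n\<^esub> tau n e v" using tau_add[OF uv assms(2)] by simp
  then have "tau n e u = tau n e v \<longleftrightarrow> tau n e (u - v) = \<zero>\<^bsub>tensor_QZ p n\<^esub>"
    using tau_carrier[OF uv, of e] tau_carrier[OF assms(2), of e] by simp
  also have "\<dots> \<longleftrightarrow> near e u v" unfolding tau_zero_iff[OF uv] by (simp add: near_def)
  finally show ?thesis .
qed

lemma tau_eq_iff2:
  assumes "u \<in> V n" "v \<in> V n" shows "tau n e u = tau n f v \<longleftrightarrow> near (e + f) (pp f \<triangleright> u) (pp e \<triangleright> v)"
  using tau_level[OF assms(1), of e f] tau_level[OF assms(2), of f e]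
    tau_eq_iff[OF V_smul[OF coh_const(3) assms(1)] V_smul[OF coh_const(3) assms(2)], of "e + f" "p ^ f" "p ^ e"]
  by (simp add: add.commute del: of_nat_power)

text \<open>Common denominators make the tensors \<open>tau n e z\<close> with z in L closed under
  addition, so the span consists of them alone.\<close>

lemma sub_QZ_eq: assumes L: "subm n L" shows "sub_QZ p n (ofr n ` L) = {tau n e z | e z. z \<in> L}"
proof -
  note S = submD[OF L]
  let ?A = "{pure_tensor (Zp p) (hyp_mod p n) (Qp_mod_Zp p) z y | z y. z \<in> ofr n ` L \<and> y \<in> carrier (Qp_mod_Zp p)}"
  have q: "sub_QZ p n (ofr n ` L) = mod_span (Zp p) (tensor_QZ p n) ?A"
    by (simp add: sub_QZ_def tensor_sub_def tensor_QZ_eq)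
  show ?thesis
  proof (intro equalityI)
    have "submodule {tau n e z | e z. z \<in> L} (Zp p) (tensor_QZ p n)"
    proof (rule TQ.submoduleI)
      show "{tau n e z | e z. z \<in> L} \<subseteq> carrier (tensor_QZ p n)" using tau_carrier S(1) by blast
      show "\<zero>\<^bsub>tensor_QZ p n\<^esub> \<in> {tau n e z | e z. z \<in> L}" using tau_zero[of n 0] S(2) by (metis (mono_tags, lifting) mem_Collect_eq)
      show sm: "a \<odot>\<^bsub>tensor_QZ p n\<^esub> x \<in> {tau n e z | e z. z \<in> L}"
        if a: "a \<in> carrier (Zp p)" "x \<in> {tau n e z | e z. z \<in> L}" for a x
      proof -
        obtain c where c: "coh c" "a = zc c" using Zp_E[OF a(1)] .
        obtain e z where z: "z \<in> L" "x = tau n e z" using a(2) by blast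
        show ?thesis using tau_smult[OF c(1) S(1)[OF z(1)], of e] S(4)[OF z(1) c(1)] c(2) z(2) by auto
      qed
      show "\<ominus>\<^bsub>tensor_QZ p n\<^esub> x \<in> {tau n e z | e z. z \<in> L}" if x: "x \<in> {tau n e z | e z. z \<in> L}" for x
      proof -
        have xc: "x \<in> carrier (tensor_QZ p n)" using x tau_carrier S(1) by blast
        have "\<ominus>\<^bsub>tensor_QZ p n\<^esub> x = (\<ominus>\<^bsub>Zp p\<^esub> \<one>\<^bsub>Zp p\<^esub>) \<odot>\<^bsub>tensor_QZ p n\<^esub> x"
          using TQ.smult_l_minus[OF FM.R.one_closed xc] xc by simp
        then show ?thesis using sm[of "\<ominus>\<^bsub>Zp p\<^esub> \<one>\<^bsub>Zp p\<^esub>", OF _ x] by simp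
      qed
      show "x \<oplus>\<^bsub>tensor_QZ p n\<^esub> y \<in> {tau n e z | e z. z \<in> L}"
        if xy: "x \<in> {tau n e z | e z. z \<in> L}" "y \<in> {tau n e z | e z. z \<in> L}" for x y
      proof -
        obtain e z f w where z: "z \<in> L" "x = tau n e z" "w \<in> L" "y = tau n f w" using xy by blast
        have zw: "pp f \<triangleright> z \<in> L" "pp e \<triangleright> w \<in> L" using S(4) z(1,3) coh_const(3) by blast+
        have "x = tau n (e + f) (pp f \<triangleright> z)" "y = tau n (e + f) (pp e \<triangleright> w)"
          using tau_level[OF S(1)[OF z(1)], of e f] tau_level[OF S(1)[OF z(3)], of f e] z(2,4)
          by (simp_all add: add.commute)
        then have "x \<oplus>\<^bsub>tensor_QZ p n\<^esub> y = tau n (e + f) (pp f \<triangleright> z + pp e \<triangleright> w)"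
          using tau_add[OF S(1)[OF zw(1)] S(1)[OF zw(2)]] by simp
        then show ?thesis using S(3)[OF zw] by blast
      qed
    qed
    moreover have "?A \<subseteq> {tau n e z | e z. z \<in> L}"
    proof
      fix x assume "x \<in> ?A"
      then obtain z q where z: "z \<in> L" "q \<in> carrier (Qp_mod_Zp p)"
        "x = pure_tensor (Zp p) (hyp_mod p n) (Qp_mod_Zp p) (ofr n z) q" by blast
      obtain c e where c: "coh c" "q = kap c e" using kap_E[OF z(2)] .
      have "x = tau n e (c \<triangleright> z)" using pt_kap[OF S(1)[OF z(1)] c(1)] z(3) c(2) by simp
      then show "x \<in> {tau n e z | e z. z \<in> L}" using S(4)[OF z(1) c(1)] by blast
    qed
    ultimately show "sub_QZ p n (ofr n ` L) \<subseteq> {tau n e z | e z. z \<in> L}" unfolding q by (rule TQ.mod_span_least)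
    show "{tau n e z | e z. z \<in> L} \<subseteq> sub_QZ p n (ofr n ` L)"
      unfolding q tau_def using kap_carrier[of 1] by (intro subset_trans[OF _ TQ.mod_span_incl]) auto
  qed
qed

lemma sub_QZ_submodule: assumes "subm n L" shows "submodule (sub_QZ p n (ofr n ` L)) (Zp p) (tensor_QZ p n)"
proof -
  have "ofr n ` L \<subseteq> carrier (hyp_mod p n)" using ofr_carrier submD(1)[OF assms] by blast
  then show ?thesis unfolding sub_QZ_def tensor_sub_def tensor_QZ_eq[symmetric]
    by (intro TQ.mod_span_submodule) (auto intro: TS.pt_carrier simp: tensor_QZ_eq)
qed

end

section \<open>Elementary divisors of the pairing of two Lagrangians\<close>

context padic begin

definition lc :: "nat \<Rightarrow> (nat \<Rightarrow> intseq) \<Rightarrow> (nat \<Rightarrow> vec) \<Rightarrow> vec"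
  where "lc n c w = (\<Sum>i<n. c i \<triangleright> w i)"

lemma lc_apply: "lc n c w j = (\<Sum>i<n. c i * w i j)"
  by (simp add: lc_def)

lemma lc_0: "lc 0 c w = 0"
  by (rule ext) (simp add: lc_apply)

lemma bf_sum_left: "bf m (sum f A) v = (\<Sum>i\<in>A. bf m (f i) v)"
proof (induction A rule: infinite_finite_induct)
  case (insert x F)
  then show ?case by (simp only: sum.insert[OF insert(1,2)] bf_add_left insert(3))
qed (simp_all add: bf_def)

lemma bf_lc_left: "bf m (lc n c w) v = (\<Sum>i<n. c i * bf m (w i) v)"
  unfolding lc_def bf_sum_left by (simp add: bf_smul_left)

lemma bf_lc_right: "bf m v (lc n c w) = (\<Sum>i<n. c i * bf m v (w i))"
  using bf_lc_left[of m n c w v] by (simp add: bf_commute[of m v])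

lemma lc_subm:
  assumes "subm m L" "\<And>i. i < n \<Longrightarrow> w i \<in> L" "\<And>i. i < n \<Longrightarrow> coh (c i)" shows "lc n c w \<in> L"
  using assms(2,3)
proof (induction n)
  case 0
  then show ?case using submD(2)[OF assms(1)] by (simp only: lc_0)
next
  case (Suc n)
  have "lc (Suc n) c w = lc n c w + c n \<triangleright> w n" by (simp add: lc_def)
  moreover have "lc n c w \<in> L" "w n \<in> L" "coh (c n)" using Suc by auto
  ultimately show ?case using submD(3)[OF assms(1)] submD(4)[OF assms(1)] by metis
qed

lemma isom1_lc:
  assumes "isom1 m h" "\<And>i. i < n \<Longrightarrow> w i \<in> V m" "\<And>i. i < n \<Longrightarrow> coh (c i)" shows "h (lc n c w) = lc n c (\<lambda>i. h (w i)) \<and> lc n c w \<in> V m"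
  using assms(2,3)
proof (induction n)
  case 0
  then show ?case using isom1_zero[OF assms(1)] V_zero by (simp only: lc_0)
next
  case (Suc n)
  have e: "lc (Suc n) c w = lc n c w + c n \<triangleright> w n" for w by (simp add: lc_def)
  have "lc n c w \<in> V m" "h (lc n c w) = lc n c (\<lambda>i. h (w i))" using Suc by auto
  moreover have "w n \<in> V m" "coh (c n)" using Suc.prems by auto
  ultimately show ?case unfolding e using isom1D(2,3)[OF assms(1)] V_add V_smul by metis
qed

lemma near_lc: "(\<And>i. i < n \<Longrightarrow> P e dvd lev (c i) e - lev (d i) e) \<Longrightarrow> near e (lc n c w) (lc n d w)"
  unfolding near_def lc_apply by (auto simp: sum_subtractf[symmetric] left_diff_distrib[symmetric] intro!: dvd_sum)

text \<open>Independence is demanded modulo every p^e, so that the reductions of the vectors are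
  independent too, as for a basis of a direct summand.\<close>

definition basis :: "nat \<Rightarrow> (nat \<Rightarrow> vec) \<Rightarrow> vec set \<Rightarrow> bool"
  where "basis n w L \<longleftrightarrow> (\<forall>i<n. w i \<in> L) \<and> (\<forall>v\<in>L. \<exists>c. (\<forall>i. coh (c i)) \<and> eqv v (lc n c w)) \<and>
    (\<forall>e c. (\<forall>i. coh (c i)) \<longrightarrow> near e (lc n c w) 0 \<longrightarrow> (\<forall>i<n. P e dvd lev (c i) e))"

lemma basisD:
  assumes "basis n w L" shows "i < n \<Longrightarrow> w i \<in> L" "v \<in> L \<Longrightarrow> \<exists>c. (\<forall>i. coh (c i)) \<and> eqv v (lc n c w)"
    "(\<And>i. coh (c i)) \<Longrightarrow> near e (lc n c w) 0 \<Longrightarrow> i < n \<Longrightarrow> P e dvd lev (c i) e"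
  using assms by (auto simp: basis_def)

lemma basisI:
  assumes "\<And>i. i < n \<Longrightarrow> w i \<in> L" "\<And>v. v \<in> L \<Longrightarrow> \<exists>c. (\<forall>i. coh (c i)) \<and> eqv v (lc n c w)"
    "\<And>e c i. (\<And>i. coh (c i)) \<Longrightarrow> near e (lc n c w) 0 \<Longrightarrow> i < n \<Longrightarrow> P e dvd lev (c i) e"
  shows "basis n w L"
  unfolding basis_def using assms by blast

lemma Lag_basis: assumes "Lag n Z" shows "\<exists>w. basis n w Z"
proof -
  obtain g h where g: "isop n g h" "Z = img n g (E n)" using Lag_isop[OF assms] by blast
  note D = isom1D[OF isopD(1)[OF g(1)]] and D' = isom1D[OF isopD(2)[OF g(1)]]
  define b where "b i = (bas (2*i) :: vec)" for i
  have bV: "b i \<in> V n" if "i < n" for i using that by (auto simp: b_def intro: V_bas)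
  have bE: "b i \<in> E n" if "i < n" for i
  proof -
    have "2 * j + 1 \<noteq> 2 * i" for j by presburger
    then show ?thesis using bV[OF that] by (simp add: E_def b_def bas_apply)
  qed
  have lb: "lc n c b j = (if even j \<and> j < 2*n then c (j div 2) else 0)" for c j
  proof -
    have "lc n c b j = (\<Sum>i<n. if i = j div 2 then (if even j then c i else 0) else 0)"
      unfolding lc_apply by (rule sum.cong) (auto simp: b_def bas_apply)
    then show ?thesis by auto
  qed
  define w where "w i = h (b i)" for i
  have wf: "w = (\<lambda>i. h (b i))" by (rule ext) (rule w_def)
  have wV: "w i \<in> V n" if "i < n" for i using D'(1)[OF bV[OF that]] by (simp add: w_def)
  have gw: "eqv (g (w i)) (b i)" if "i < n" for i using isopD(4)[OF g(1) bV[OF that]] by (simp add: w_def)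
  have "basis n w Z"
  proof (rule basisI)
    show "w i \<in> Z" if i: "i < n" for i
      using submD(5)[OF iso_satD(1)[OF E_iso_sat] D(1)[OF wV[OF i]] bE[OF i] gw[OF i]] wV[OF i] by (simp add: g(2) img_def)
    show "\<exists>c. (\<forall>i. coh (c i)) \<and> eqv v (lc n c w)" if v: "v \<in> Z" for v
    proof (intro exI conjI allI)
      have vV: "v \<in> V n" "g v \<in> E n" using v by (auto simp: g(2) img_def)
      let ?c = "\<lambda>i. g v (2*i)"
      show c: "coh (?c i)" for i using V_coh[OF D(1)[OF vV(1)]] .
      have l: "h (lc n ?c b) = lc n ?c w" "lc n ?c b \<in> V n" 
        unfolding wf using isom1_lc[of n h n b ?c, OF isopD(2)[OF g(1)] bV c] by blast+
      have "eqv (g v) (lc n ?c b)" unfolding eqv_def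
      proof
        fix j show "null (g v j - lc n ?c b j)"
          using vV(2) V_out[OF D(1)[OF vV(1)], of j] unfolding lb E_eq_Ek Ek_def by (cases "j < 2*n") auto
      qed
      then have "eqv (h (g v)) (h (lc n ?c b))" by (rule D'(5)[OF D(1)[OF vV(1)] l(2)])
      then show "eqv v (lc n ?c w)" using eqv_trans[OF eqv_sym[OF isopD(3)[OF g(1) vV(1)]]] l(1) by simp
    qed
    fix e c i assume c: "\<And>i. coh (c i)" and nr: "near e (lc n c w) 0" and i: "i < n"
    have l: "g (lc n c w) = lc n c (\<lambda>i. g (w i))" "lc n c w \<in> V n" 
      using isom1_lc[of n g n w c, OF isopD(1)[OF g(1)] wV c] by blast+
    have "near e (g (lc n c w)) (g 0)" by (rule D(4)[OF l(2) V_zero nr])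
    then have "near e (lc n c (\<lambda>i. g (w i))) 0" using l(1) isom1_zero[OF isopD(1)[OF g(1)]] by simp
    moreover have "near e (lc n c (\<lambda>i. g (w i))) (lc n c b)"
      unfolding near_def lc_apply using eqv_near[OF gw, unfolded near_def]
      by (auto simp: sum_subtractf[symmetric] right_diff_distrib[symmetric] intro!: dvd_sum dvd_mult)
    ultimately have "near e (lc n c b) 0" using near_trans near_sym by blast
    then have "P e dvd lev (lc n c b (2*i)) e" unfolding near_def by simp
    then show "P e dvd lev (c i) e" unfolding lb using i by simp
  qed
  then show ?thesis by blast
qed

lemma basis_swap:
  assumes b: "basis n w L" and ij: "i < n" "j < n" shows "basis n (w \<circ> Transposition.transpose i j) L"
proof -
  let ?t = "Transposition.transpose i j"
  have tn: "?t l < n \<longleftrightarrow> l < n" for l using ij by (auto simp: Transposition.transpose_def)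
  have bij: "bij_betw ?t {..<n} {..<n}"
    by (rule bij_betw_byWitness[where f' = ?t]) (auto simp: tn)
  have l: "lc n c (w \<circ> ?t) = lc n (c \<circ> ?t) w" for c
    unfolding lc_def using sum.reindex_bij_betw[OF bij, of "\<lambda>l. (c \<circ> ?t) l \<triangleright> w l"] by (simp add: comp_def)
  show ?thesis
  proof (rule basisI)
    show "(w \<circ> ?t) l \<in> L" if "l < n" for l using basisD(1)[OF b] tn that by simp
    show "\<exists>c. (\<forall>i. coh (c i)) \<and> eqv v (lc n c (w \<circ> ?t))" if v: "v \<in> L" for v
    proof -
      obtain c where c: "\<forall>i. coh (c i)" "eqv v (lc n c w)" using basisD(2)[OF b v] by blast
      have "lc n (c \<circ> ?t) (w \<circ> ?t) = lc n c w" unfolding l by (simp add: comp_def)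
      then show ?thesis using c by (intro exI[of _ "c \<circ> ?t"]) simp
    qed
    show "P e dvd lev (c l) e" if "\<And>i. coh (c i)" "near e (lc n c (w \<circ> ?t)) 0" "l < n" for e c l
      using basisD(3)[OF b, of "c \<circ> ?t" e "?t l"] that tn unfolding l by simp
  qed
qed

text \<open>The elementary operations of elimination with pivot k: the pivot vector is scaled by a
  unit, and multiples of the old pivot vector are subtracted from the others.\<close>

lemma basis_pivot:
  assumes b: "basis n w L" and L: "subm m L" and k: "k < n"
    and u: "coh u" "coh u'" "null (u * u' - 1)" and a: "\<And>i. coh (a i)"
  shows "basis n (\<lambda>i. if i = k then u \<triangleright> w k else w i - a i \<triangleright> w k) L" (is "basis n ?w L")
proof -
  define s where "s c = (\<Sum>i\<in>{..<n} - {k}. c i * a i)" for c :: "nat \<Rightarrow> intseq"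
  have sc: "coh (s c)" if "\<And>i. coh (c i)" for c unfolding s_def using that a by (auto intro!: coh_sum)
  have l: "lc n c ?w = lc n (c(k := u * c k - s c)) w" for c
  proof
    fix j
    have "lc n c ?w j = c k * (u * w k j) + (\<Sum>i\<in>{..<n} - {k}. c i * (w i j - a i * w k j))"
      unfolding lc_apply using k by (subst sum.remove[of _ k]) (auto intro!: sum.cong)
    also have "\<dots> = (u * c k - s c) * w k j + (\<Sum>i\<in>{..<n} - {k}. c i * w i j)"
      by (simp add: s_def algebra_simps sum_subtractf sum_distrib_left)
    also have "\<dots> = lc n (c(k := u * c k - s c)) w j"
      unfolding lc_apply using k by (subst (2) sum.remove[of _ k]) (auto intro!: sum.cong)
    finally show "lc n c ?w j = lc n (c(k := u * c k - s c)) w j" .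
  qed
  note S = submD[OF L]
  show ?thesis
  proof (rule basisI)
    show "?w i \<in> L" if "i < n" for i
      using basisD(1)[OF b] that k u a S(4,6) by simp
    show "\<exists>c. (\<forall>i. coh (c i)) \<and> eqv v (lc n c ?w)" if v: "v \<in> L" for v
    proof -
      obtain c where c: "\<forall>i. coh (c i)" "eqv v (lc n c w)" using basisD(2)[OF b v] by blast
      \<comment> \<open>The coefficient at k makes up for the multiples \<open>s c\<close>
        subtracted elsewhere and undoes the scaling by u.\<close>
      define d where "d = c(k := u' * (c k + s c))"
      have dc: "\<forall>i. coh (d i)" using c(1) u sc[of c] by (simp add: d_def coh_mult coh_add)
      have sd: "s d = s c" unfolding s_def d_def by (rule sum.cong) auto
      have "eqv (lc n c w) (lc n d ?w)" unfolding eqv_iff_near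
      proof
        fix e show "near e (lc n c w) (lc n d ?w)" unfolding l
        proof (rule near_lc)
          fix i assume "i < n"
          have "P e dvd lev ((u * u' - 1) * (c k + s c)) e" using null_mult(1)[OF u(3)] unfolding null_def by blast
          then have "P e dvd lev (u * d k - s d - c k) e" unfolding sd by (simp add: d_def algebra_simps)
          then show "P e dvd lev (c i) e - lev ((d(k := u * d k - s d)) i) e"
            by (auto simp: d_def dvd_diff_commute)
        qed
      qed
      then show ?thesis using c(2) dc eqv_trans by blast
    qed
    fix e c i assume c: "\<And>i. coh (c i)" and nr: "near e (lc n c ?w) 0" and i: "i < n"
    let ?d = "c(k := u * c k - s c)"
    have "coh (?d i)" for i using c u sc[OF c] by (simp add: coh_mult coh_diff)
    from basisD(3)[OF b this nr[unfolded l]] have d: "P e dvd lev (?d i) e" if "i < n" for i using that by blast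
    have o: "P e dvd lev (c i) e" if "i < n" "i \<noteq> k" for i using d[OF that(1)] that(2) by simp
    show "P e dvd lev (c i) e"
    proof (cases "i = k")
      case True
      have "P e dvd lev (s c) e" unfolding s_def by (simp, intro dvd_sum) (auto intro: dvd_mult2 o)
      moreover have "P e dvd lev u e * lev (c k) e - lev (s c) e" using d[OF k] by simp
      ultimately have "P e dvd lev u e * lev (c k) e - lev (s c) e + lev (s c) e" by (intro dvd_add)
      then have "P e dvd lev u' e * (lev u e * lev (c k) e)" by simp
      moreover have "P e dvd lev ((u * u' - 1) * c k) e" using null_mult(1)[OF u(3)] unfolding null_def by blast
      ultimately have "P e dvd lev u' e * (lev u e * lev (c k) e) - lev ((u * u' - 1) * c k) e" by (rule dvd_diff)
      then show ?thesis using True by (simp add: algebra_simps)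
    qed (use o i in blast)
  qed
qed

definition diag_upto :: "nat \<Rightarrow> nat \<Rightarrow> (nat \<Rightarrow> vec) \<Rightarrow> (nat \<Rightarrow> vec) \<Rightarrow> (nat \<Rightarrow> nat) \<Rightarrow> bool"
  where "diag_upto n k w z a \<longleftrightarrow>
    (\<forall>i<n. \<forall>j<n. i < k \<or> j < k \<longrightarrow> null (bf n (w i) (z j) - (if i = j then pp (a i) else 0)))"

text \<open>One step towards the Smith normal form: an entry of least valuation a0 in the remaining
  block is brought to position (k, k), scaled to p^a0 and used to clear its row and column.\<close>

lemma diag_step:
  assumes bw: "basis n w W" and bz: "basis n z Z" and LW: "subm n W" and LZ: "subm n Z"
    and D: "diag_upto n k w z a" and k: "k < n"
    and nn: "\<exists>i j. k \<le> i \<and> i < n \<and> k \<le> j \<and> j < n \<and> \<not> null (bf n (w i) (z j))"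
  shows "\<exists>w z a. basis n w W \<and> basis n z Z \<and> diag_upto n (Suc k) w z a"
proof -
  let ?B = "\<lambda>i j. bf n (w i) (z j)"
  have cB: "coh (?B i j)" if "i < n" "j < n" for i j
    using coh_bf[OF submD(1)[OF LW basisD(1)[OF bw that(1)]] submD(1)[OF LZ basisD(1)[OF bz that(2)]]] .
  \<comment> \<open>The least level at which some entry of the block fails to be divisible is one
    more than the minimal valuation a0; level 0 never fails.\<close>
  define Q where "Q e \<longleftrightarrow> (\<exists>i j. k \<le> i \<and> i < n \<and> k \<le> j \<and> j < n \<and> \<not> P e dvd lev (?B i j) e)" for e
  have "\<exists>e. Q e" using nn unfolding Q_def null_def by blast
  then have lq: "Q (LEAST e. Q e)" "\<And>e. e < (LEAST e. Q e) \<Longrightarrow> \<not> Q e" using LeastI_ex not_less_Least by blast+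
  obtain a0 where a0: "(LEAST e. Q e) = Suc a0" using lq(1) by (cases "LEAST e. Q e") (auto simp: Q_def)
  obtain i0 j0 where ij: "k \<le> i0" "i0 < n" "k \<le> j0" "j0 < n" "\<not> P (Suc a0) dvd lev (?B i0 j0) (Suc a0)"
    using lq(1)[unfolded a0] unfolding Q_def by blast
  have dv: "P a0 dvd lev (?B i j) a0" if "k \<le> i" "i < n" "k \<le> j" "j < n" for i j
    using lq(2)[unfolded a0, of a0] that unfolding Q_def by blast
  let ?s = "Transposition.transpose k i0" and ?t = "Transposition.transpose k j0"
  define w1 where "w1 = w \<circ> ?s"
  define z1 where "z1 = z \<circ> ?t"
  have b1: "basis n w1 W" "basis n z1 Z"
    unfolding w1_def z1_def using basis_swap[OF bw k ij(2)] basis_swap[OF bz k ij(4)] by blast+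
  have st: "k \<le> i \<Longrightarrow> i < n \<Longrightarrow> k \<le> ?s i \<and> ?s i < n" "k \<le> i \<Longrightarrow> i < n \<Longrightarrow> k \<le> ?t i \<and> ?t i < n"
    "i < k \<Longrightarrow> ?s i = i" "i < k \<Longrightarrow> ?t i = i" for i
    using ij k by (auto simp: Transposition.transpose_def)
  let ?B1 = "\<lambda>i j. bf n (w1 i) (z1 j)"
  have cB1: "coh (?B1 i j)" if "i < n" "j < n" for i j
    using coh_bf[OF submD(1)[OF LW basisD(1)[OF b1(1) that(1)]] submD(1)[OF LZ basisD(1)[OF b1(2) that(2)]]] .
  have D1: "null (?B1 i j - (if i = j then pp (a i) else 0))" if "i < n" "j < n" "i < k \<or> j < k" for i j
  proof -
    have "?s i < n" "?t j < n" using st that by (metis not_le order_less_trans k)+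
    moreover have "?s i < k \<or> ?t j < k" using that(3) st(3,4) by auto
    ultimately have n: "null (?B (?s i) (?t j) - (if ?s i = ?t j then pp (a (?s i)) else 0))"
      using D unfolding diag_upto_def by blast
    have "?s i = ?t j \<longleftrightarrow> i = j" "i = j \<Longrightarrow> ?s i = i"
      using that st(1)[of i] st(2)[of j] st(3)[of i] st(4)[of j] by (cases "i < k"; cases "j < k"; force)+
    then show ?thesis using n by (auto simp: w1_def z1_def split: if_splits)
  qed
  have "\<exists>y. coh y \<and> null (?B1 i j - pp a0 * y)" if "k \<le> i" "i < n" "k \<le> j" "j < n" for i j
    using coh_divide[OF cB1[OF that(2,4)], of a0] dv[of "?s i" "?t j"] st that by (metis comp_apply w1_def z1_def)
  then have "\<exists>y. \<forall>i j. k \<le> i \<and> i < n \<and> k \<le> j \<and> j < n \<longrightarrow> coh (y i j) \<and> null (?B1 i j - pp a0 * y i j)"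
    by metis
  then obtain y where y: "\<And>i j. k \<le> i \<Longrightarrow> i < n \<Longrightarrow> k \<le> j \<Longrightarrow> j < n \<Longrightarrow> coh (y i j) \<and> null (?B1 i j - pp a0 * y i j)" by blast
  have ykk: "coh (y k k)" "null (?B1 k k - pp a0 * y k k)" using y k by auto
  have "\<not> int p dvd lev (y k k) 1"
  proof
    assume "int p dvd lev (y k k) 1"
    then have "int p dvd lev (y k k) (Suc a0)" using coh_unit_iff[OF ykk(1), of "Suc a0"] by simp
    then have "P (Suc a0) dvd P a0 * lev (y k k) (Suc a0)" by simp
    moreover have "P (Suc a0) dvd lev (?B1 k k - pp a0 * y k k) (Suc a0)" using ykk(2) unfolding null_def by blast
    then have "P (Suc a0) dvd lev (?B1 k k) (Suc a0) - P a0 * lev (y k k) (Suc a0)" by simp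
    ultimately have "P (Suc a0) dvd lev (?B1 k k) (Suc a0)" by (metis diff_add_cancel dvd_add)
    then show False using ij(5) by (simp add: w1_def z1_def)
  qed
  then obtain y' where y': "coh y'" "null (y k k * y' - 1)" using coh_inverse[OF ykk(1)] by metis
  then have y'2: "null (y' * y k k - 1)" by (simp add: mult.commute)
  \<comment> \<open>The entry (i, k) divided by the pivot: the factor p^a0 is common to both, and y'
    inverts the unit part of the pivot. The value 0 for i < k leaves the finished rows
    untouched.\<close>
  define aw where "aw i = (if k < i \<and> i < n then y i k * y' else 0)" for i
  define az where "az j = (if k < j \<and> j < n then y k j * y' else 0)" for j
  have cw: "coh (aw i)" for i using y[of i k] y'(1) k by (auto simp: aw_def)
  have cz: "coh (az i)" for i using y[of k i] y'(1) k by (auto simp: az_def)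
  define w2 where "w2 = (\<lambda>i. if i = k then y' \<triangleright> w1 k else w1 i - aw i \<triangleright> w1 k)"
  \<comment> \<open>Only the w side is rescaled by y'; the factor 1 brings the z side into the form
    of \<open>basis_pivot\<close>.\<close>
  define z2 where "z2 = (\<lambda>i. if i = k then 1 \<triangleright> z1 k else z1 i - az i \<triangleright> z1 k)"
  have b2: "basis n w2 W" "basis n z2 Z"
    unfolding w2_def z2_def
    by (rule basis_pivot[OF b1(1) LW k y'(1) ykk(1) y'2 cw], rule basis_pivot[OF b1(2) LZ k _ _ _ cz, of 1 1]) auto
  have B2: "bf n (w2 i) (z2 j) = (if i = k then y' else 1) * ?B1 i j
      - (if i = k then 0 else aw i * ?B1 k j) - (if j = k then 0 else (if i = k then y' else 1) * az j * ?B1 i k)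
      + (if i = k \<or> j = k then 0 else aw i * az j * ?B1 k k)" for i j
    by (auto simp: w2_def z2_def bf_simps smul_simps(4) algebra_simps)
  have ik: "null (?B1 i k - aw i * ?B1 k k)" if "k < i" "i < n" for i
  proof -
    have "null (?B1 i k - pp a0 * y i k)" using y[of i k] that k by simp
    then have "null ((?B1 i k - pp a0 * y i k) - (y i k * y') * (?B1 k k - pp a0 * y k k) - pp a0 * y i k * (y k k * y' - 1))"
      by (rule null_diff[OF null_diff[OF _ null_mult(2)[OF ykk(2)]] null_mult(2)[OF y'(2)]])
    moreover have "(?B1 i k - pp a0 * y i k) - (y i k * y') * (?B1 k k - pp a0 * y k k) - pp a0 * y i k * (y k k * y' - 1) = ?B1 i k - aw i * ?B1 k k"
      using that by (simp add: aw_def algebra_simps)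
    ultimately show ?thesis by (simp only:)
  qed
  have kj: "null (?B1 k j - az j * ?B1 k k)" if "k < j" "j < n" for j
  proof -
    have "null (?B1 k j - pp a0 * y k j)" using y[of k j] that k by simp
    then have "null ((?B1 k j - pp a0 * y k j) - (y k j * y') * (?B1 k k - pp a0 * y k k) - pp a0 * y k j * (y k k * y' - 1))"
      by (rule null_diff[OF null_diff[OF _ null_mult(2)[OF ykk(2)]] null_mult(2)[OF y'(2)]])
    moreover have "(?B1 k j - pp a0 * y k j) - (y k j * y') * (?B1 k k - pp a0 * y k k) - pp a0 * y k j * (y k k * y' - 1) = ?B1 k j - az j * ?B1 k k"
      using that by (simp add: az_def algebra_simps)
    ultimately show ?thesis by (simp only:)
  qed
  have "diag_upto n (Suc k) w2 z2 (a(k := a0))"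
    unfolding diag_upto_def
  proof (intro allI impI)
    fix i j assume i: "i < n" and j: "j < n" and ijk: "i < Suc k \<or> j < Suc k"
    have Dkj: "null (?B1 k j)" if "j < k" using D1[OF k j] that by auto
    have Dik: "null (?B1 i k)" if "i < k" using D1[OF i k] that by auto
    consider "i < k" | "j < k" "k \<le> i" | "i = k" "j = k" | "i = k" "k < j" | "k < i" "j = k" using ijk by linarith
    then show "null (bf n (w2 i) (z2 j) - (if i = j then pp ((a(k := a0)) i) else 0))"
    proof cases
      case 1
      then have e: "aw i = 0" by (simp add: aw_def)
      have "bf n (w2 i) (z2 j) - (if i = j then pp ((a(k := a0)) i) else 0)
          = ?B1 i j - (if i = j then pp (a i) else 0) - (if j = k then 0 else az j * ?B1 i k)" using 1 e unfolding B2 by simp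
      moreover have "null (?B1 i j - (if i = j then pp (a i) else 0) - (if j = k then 0 else az j * ?B1 i k))"
        by (rule null_diff) (use D1[OF i j] Dik[OF 1] 1 in \<open>auto intro: null_mult(2)\<close>)
      ultimately show ?thesis by (simp only:)
    next
      case 2
      then have e: "az j = 0" by (simp add: az_def)
      have "null (?B1 i j)" using D1[OF i j] 2 by auto
      then show ?thesis using Dkj 2 e unfolding B2 by (auto intro!: null_diff null_mult(2))
    next
      case 3
      have "null (y' * (?B1 k k - pp a0 * y k k) + pp a0 * (y k k * y' - 1))" using ykk(2) y'(2) by (intro null_add null_mult(2))
      moreover have "y' * (?B1 k k - pp a0 * y k k) + pp a0 * (y k k * y' - 1) = y' * ?B1 k k - pp a0" by (simp add: algebra_simps)
      ultimately show ?thesis using 3 unfolding B2 by simp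
    next
      case 4
      have "null (y' * (?B1 k j - az j * ?B1 k k))" using kj[OF 4(2) j] by (rule null_mult(2))
      then show ?thesis using 4 unfolding B2 by (simp add: algebra_simps)
    next
      case 5
      then show ?thesis using ik[OF 5(1) i] unfolding B2 by simp
    qed
  qed
  then show ?thesis using b2 by blast
qed

text \<open>Iterate \<open>diag_step\<close> until the remaining block is null. Then k counts the
  nonzero elementary divisors, units (exponent 0) included.\<close>

lemma elementary_divisors:
  assumes Z: "Lag n Z" and W: "Lag n W"
  obtains w z k a where "basis n w W" "basis n z Z" "k \<le> n"
    "\<And>i j. i < n \<Longrightarrow> j < n \<Longrightarrow> null (bf n (w i) (z j) - (if i = j \<and> i < k then pp (a i) else 0))"
proof -
  have LW: "subm n W" and LZ: "subm n Z" using Lag_iso_sat[OF W] Lag_iso_sat[OF Z] iso_satD(1) by blast+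
  have "\<exists>w z k a. basis n w W \<and> basis n z Z \<and> k \<le> n \<and> diag_upto n k w z a \<and>
      (\<forall>i j. k \<le> i \<longrightarrow> i < n \<longrightarrow> k \<le> j \<longrightarrow> j < n \<longrightarrow> null (bf n (w i) (z j)))"
    if "basis n w W" "basis n z Z" "diag_upto n k w z a" "k \<le> n" for k w z a
    using that
  proof (induction "n - k" arbitrary: k w z a)
    case 0
    then have "k = n" by simp
    then show ?case using 0 by (intro exI[of _ w] exI[of _ z] exI[of _ k] exI[of _ a]) auto
  next
    case (Suc m)
    then have k: "k < n" by simp
    show ?case
    proof (cases "\<exists>i j. k \<le> i \<and> i < n \<and> k \<le> j \<and> j < n \<and> \<not> null (bf n (w i) (z j))")
      case True
      obtain w' z' a' where n: "basis n w' W" "basis n z' Z" "diag_upto n (Suc k) w' z' a'"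
        using diag_step[OF Suc.prems(1,2) LW LZ Suc.prems(3) k True] by blast
      show ?thesis by (rule Suc.hyps(1)[OF _ n]) (use Suc.hyps(2) k in auto)
    next
      case False
      then show ?thesis using Suc.prems by (intro exI[of _ w] exI[of _ z] exI[of _ k] exI[of _ a]) auto
    qed
  qed
  moreover obtain w z where "basis n w W" "basis n z Z" using Lag_basis[OF W] Lag_basis[OF Z] by blast
  moreover have "diag_upto n 0 w z (\<lambda>_. 0)" by (simp add: diag_upto_def)
  ultimately obtain w z k a where r: "basis n w W" "basis n z Z" "k \<le> n" "diag_upto n k w z a"
    "\<forall>i j. k \<le> i \<longrightarrow> i < n \<longrightarrow> k \<le> j \<longrightarrow> j < n \<longrightarrow> null (bf n (w i) (z j))" by blast
  show ?thesis
  proof (rule that[OF r(1,2,3), of a])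
    fix i j assume ij: "i < n" "j < n"
    show "null (bf n (w i) (z j) - (if i = j \<and> i < k then pp (a i) else 0))"
    proof (cases "i < k \<or> j < k")
      case True
      then have "null (bf n (w i) (z j) - (if i = j then pp (a i) else 0))" using r(4) ij unfolding diag_upto_def by blast
      moreover have "(if i = j then pp (a i) else 0) = (if i = j \<and> i < k then pp (a i) else 0)" using True by auto
      ultimately show ?thesis by simp
    next
      case False
      then show ?thesis using r(5) ij by auto
    qed
  qed
qed

end

section \<open>Presentations of modules of co-finite type\<close>

text \<open>Transport of structure along an injection into the natural numbers, to meet the element
  type fixed in \<open>cofinite_type\<close>.\<close>

lemma finite_module_nat_copy:
  fixes M :: "('r, 'm) module"
  assumes M: "Module.module R M" and fin: "finite (carrier M)"
  obtains F :: "('r, nat) module" and h where "Module.module R F" "card (carrier F) = card (carrier M)"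
    "h \<in> mod_iso R M F"
proof -
  interpret M: Module.module R M by (rule M)
  obtain h :: "'m \<Rightarrow> nat" where h: "inj_on h (carrier M)" using finite_imp_inj_to_nat_seg[OF fin] by blast
  define g where "g = inv_into (carrier M) h"
  have g: "g (h x) = x" if "x \<in> carrier M" for x using h that by (simp add: g_def)
  define F :: "('r, nat) module" where "F = \<lparr>carrier = h ` carrier M, mult = undefined, one = undefined,
    zero = h \<zero>\<^bsub>M\<^esub>, add = (\<lambda>x y. h (g x \<oplus>\<^bsub>M\<^esub> g y)), smult = (\<lambda>a x. h (a \<odot>\<^bsub>M\<^esub> g x))\<rparr>"
  have F: "carrier F = h ` carrier M" "\<zero>\<^bsub>F\<^esub> = h \<zero>\<^bsub>M\<^esub>" "x \<oplus>\<^bsub>F\<^esub> y = h (g x \<oplus>\<^bsub>M\<^esub> g y)" "a \<odot>\<^bsub>F\<^esub> x = h (a \<odot>\<^bsub>M\<^esub> g x)"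
    for x y a by (simp_all add: F_def)
  have "Module.module R F"
  proof (rule moduleI[OF M.R.cring_axioms])
    show "abelian_group F"
    proof (rule abelian_groupI)
      show "\<exists>y\<in>carrier F. y \<oplus>\<^bsub>F\<^esub> x = \<zero>\<^bsub>F\<^esub>" if x: "x \<in> carrier F" for x
      proof -
        obtain u where u: "u \<in> carrier M" "x = h u" using x by (auto simp: F)
        have "h (\<ominus>\<^bsub>M\<^esub> u) \<oplus>\<^bsub>F\<^esub> x = \<zero>\<^bsub>F\<^esub>" using u by (simp add: F g M.M.l_neg)
        then show ?thesis using u by (auto simp: F(1))
      qed
    qed (auto simp: F g M.M.a_assoc M.M.a_comm M.M.a_lcomm)
  qed (auto simp: F g M.smult_l_distr M.smult_r_distr M.smult_assoc1)
  moreover have "h \<in> mod_iso R M F" using h by (auto simp: mod_iso_def mod_hom_def F g bij_betw_def)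
  moreover have "card (carrier F) = card (carrier M)" using h by (simp add: F card_image)
  ultimately show ?thesis using that by blast
qed

context padic begin

lemma P_add: "P (e + f) = P e * P f"
  by (simp add: power_add)

text \<open>Integer numerators are enough, because only the residue of the numerator at level e
  counts.\<close>

abbreviation kq :: "int \<Rightarrow> nat \<Rightarrow> (padic \<times> padic) set set" where "kq x e \<equiv> kap (of_int x) e"

lemma kq_level: "kq x e = kq (P f * x) (e + f)"
  using kap_level[of "of_int x" e f] by simp

lemma kq_eq_iff: "kq x e = kq y f \<longleftrightarrow> P (e + f) dvd P f * x - P e * y"
  using kap_eq_iff[of "of_int (P f * x)" "of_int (P e * y)" "e + f"] kq_level[of x e f] kq_level[of y f e]
  by (simp add: add.commute del: of_int_mult)

lemma kq_add: "kq x e \<oplus>\<^bsub>Qp_mod_Zp p\<^esub> kq y f = kq (P f * x + P e * y) (e + f)"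
  using kap_add[of "of_int (P f * x)" "of_int (P e * y)" "e + f"] kq_level[of x e f] kq_level[of y f e]
  by (simp add: add.commute del: of_int_mult)

lemma kq_smult: "coh c \<Longrightarrow> zc c \<odot>\<^bsub>Qp_mod_Zp p\<^esub> kq x e = kq (lev c e * x) e"
  using kap_smult[of c "of_int x" e] kap_eq_iff[of "c * of_int x" "of_int (lev c e * x)" e] by (simp del: of_int_mult)

lemma kq_E: assumes "q \<in> carrier (Qp_mod_Zp p)" obtains x e where "q = kq x e"
proof -
  obtain c e where c: "coh c" "q = kap c e" using kap_E[OF assms] .
  then show ?thesis using that[of "lev c e" e] kap_eq_iff[of c "of_int (lev c e)" e] by simp
qed

text \<open>A pair (e, x) names the tuple of fractions \<open>x i / p ^ e\<close>; the condition
  says that p^(d i) kills the entry at a slot with d i nonzero.\<close>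

definition Idx :: "nat set \<Rightarrow> (nat \<Rightarrow> nat) \<Rightarrow> (nat \<times> (nat \<Rightarrow> int)) set"
  where "Idx A d = {(e, x). \<forall>i\<in>A. d i \<noteq> 0 \<longrightarrow> P e dvd P (d i) * x i}"

lemma Idx_iff: "(e, x) \<in> Idx A d \<longleftrightarrow> (\<forall>i\<in>A. d i \<noteq> 0 \<longrightarrow> P e dvd P (d i) * x i)"
  by (simp add: Idx_def)

lemma Idx_add: assumes "(e, x) \<in> Idx A d" "(f, y) \<in> Idx A d" shows "(e + f, \<lambda>i. P f * x i + P e * y i) \<in> Idx A d"
  unfolding Idx_iff
proof (intro ballI impI)
  fix i assume i: "i \<in> A" "d i \<noteq> 0"
  have "P e dvd P (d i) * x i" "P f dvd P (d i) * y i" using assms i unfolding Idx_iff by blast+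
  then have "P e * P f dvd P (d i) * x i * P f" "P e * P f dvd P e * (P (d i) * y i)" by (auto intro: mult_dvd_mono)
  then have "P e * P f dvd P (d i) * x i * P f + P e * (P (d i) * y i)" by (rule dvd_add)
  then show "P (e + f) dvd P (d i) * (P f * x i + P e * y i)" by (simp add: P_add algebra_simps)
qed

lemma Idx_smult: "(e, x) \<in> Idx A d \<Longrightarrow> (e, \<lambda>i. c * x i) \<in> Idx A d"
  unfolding Idx_iff by (auto simp: mult.left_commute)

end

text \<open>The element \<open>\<alpha> e x\<close> has coordinates \<open>x i / p ^ e\<close>.  A slot \<open>i\<close> with \<open>d i = 0\<close> stands for a summand
  \<open>\<rat>\<^sub>p/\<int>\<^sub>p\<close>, any other slot for the subgroup of \<open>\<rat>\<^sub>p/\<int>\<^sub>p\<close> of order \<open>p ^ d i\<close>.\<close>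

locale presentation = padic p + M: rmodule "Zp p" M
  for p :: nat and M :: "(padic, 'm) module" +
  fixes A :: "nat set" and d :: "nat \<Rightarrow> nat" and \<alpha> :: "nat \<Rightarrow> (nat \<Rightarrow> int) \<Rightarrow> 'm"
  assumes fin: "finite A"
    and sur: "(\<lambda>(e, x). \<alpha> e x) ` Idx A d = carrier M"
    and eq: "(e, x) \<in> Idx A d \<Longrightarrow> (f, y) \<in> Idx A d \<Longrightarrow> \<alpha> e x = \<alpha> f y \<longleftrightarrow> (\<forall>i\<in>A. P (e + f) dvd P f * x i - P e * y i)"
    and add: "(e, x) \<in> Idx A d \<Longrightarrow> (f, y) \<in> Idx A d \<Longrightarrow> \<alpha> e x \<oplus>\<^bsub>M\<^esub> \<alpha> f y = \<alpha> (e + f) (\<lambda>i. P f * x i + P e * y i)"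
    and smult: "coh c \<Longrightarrow> (e, x) \<in> Idx A d \<Longrightarrow> zc c \<odot>\<^bsub>M\<^esub> \<alpha> e x = \<alpha> e (\<lambda>i. lev c e * x i)"
begin

lemma carrierI: "(e, x) \<in> Idx A d \<Longrightarrow> \<alpha> e x \<in> carrier M"
  unfolding sur[symmetric] by force

lemma carrierE: assumes "u \<in> carrier M" obtains e x where "(e, x) \<in> Idx A d" "u = \<alpha> e x"
  using assms unfolding sur[symmetric] by auto

lemma eqI: "(e, x) \<in> Idx A d \<Longrightarrow> (f, y) \<in> Idx A d \<Longrightarrow> (\<And>i. i \<in> A \<Longrightarrow> P f * x i = P e * y i) \<Longrightarrow> \<alpha> e x = \<alpha> f y"
  using eq by simp

definition "Fin = {\<alpha> e x | e x. (e, x) \<in> Idx A d \<and> (\<forall>i\<in>A. d i = 0 \<longrightarrow> x i = 0)}"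

lemma Fin_submodule: "submodule Fin (Zp p) M"
proof (rule M.submoduleI)
  show sub: "Fin \<subseteq> carrier M" using carrierI by (auto simp: Fin_def)
  have z: "\<zero>\<^bsub>M\<^esub> = \<alpha> 0 (\<lambda>_. 0)"
  proof -
    obtain e x where x: "(e, x) \<in> Idx A d" "\<zero>\<^bsub>M\<^esub> = \<alpha> e x" using carrierE[OF M.M.zero_closed] by metis
    have "\<zero>\<^bsub>M\<^esub> = zc 0 \<odot>\<^bsub>M\<^esub> \<alpha> e x" using carrierI[OF x(1)] M.smult_l_null by (simp add: zc_hom(3)[symmetric])
    also have "\<dots> = \<alpha> e (\<lambda>_. 0)" using smult[OF _ x(1), of 0] by simp
    also have "\<dots> = \<alpha> 0 (\<lambda>_. 0)" by (rule eqI) (auto simp: Idx_iff)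
    finally show ?thesis .
  qed
  show "\<zero>\<^bsub>M\<^esub> \<in> Fin" unfolding z Fin_def
    by (intro CollectI exI[of _ 0] exI[of _ "\<lambda>_. 0"]) (simp add: Idx_iff)
  show sm: "a \<odot>\<^bsub>M\<^esub> u \<in> Fin" if a: "a \<in> carrier (Zp p)" "u \<in> Fin" for a u
  proof -
    obtain c where c: "coh c" "a = zc c" using Zp_E[OF a(1)] .
    obtain e x where x: "(e, x) \<in> Idx A d" "\<forall>i\<in>A. d i = 0 \<longrightarrow> x i = 0" "u = \<alpha> e x" using a(2) by (auto simp: Fin_def)
    show ?thesis unfolding c(2) x(3) smult[OF c(1) x(1)] Fin_def
      using Idx_smult[OF x(1), of "lev c e"] x(2) by (intro CollectI exI[of _ e] exI[of _ "\<lambda>i. lev c e * x i"]) simp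
  qed
  show "u \<oplus>\<^bsub>M\<^esub> v \<in> Fin" if uv: "u \<in> Fin" "v \<in> Fin" for u v
  proof -
    obtain e x where x: "(e, x) \<in> Idx A d" "\<forall>i\<in>A. d i = 0 \<longrightarrow> x i = 0" "u = \<alpha> e x" using uv(1) by (auto simp: Fin_def)
    obtain f y where y: "(f, y) \<in> Idx A d" "\<forall>i\<in>A. d i = 0 \<longrightarrow> y i = 0" "v = \<alpha> f y" using uv(2) by (auto simp: Fin_def)
    have "\<forall>i\<in>A. d i = 0 \<longrightarrow> P f * x i + P e * y i = 0" using x(2) y(2) by simp
    then show ?thesis unfolding x(3) y(3) add[OF x(1) y(1)] Fin_def using Idx_add[OF x(1) y(1)] by blast
  qed
  show "\<ominus>\<^bsub>M\<^esub> u \<in> Fin" if u: "u \<in> Fin" for u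
  proof -
    have uc: "u \<in> carrier M" using u sub by blast
    have "\<ominus>\<^bsub>M\<^esub> u = (\<ominus>\<^bsub>Zp p\<^esub> \<one>\<^bsub>Zp p\<^esub>) \<odot>\<^bsub>M\<^esub> u" using M.smult_l_minus[OF FM.R.one_closed uc] uc by simp
    then show ?thesis using sm[of "\<ominus>\<^bsub>Zp p\<^esub> \<one>\<^bsub>Zp p\<^esub>", OF _ u] by simp
  qed
qed

text \<open>Over the common denominator p^E, where E is at least every \<open>d i\<close>, the
  entries killed by p^(d i) have the numerators \<open>p ^ (E - d i) * f i\<close> with
  \<open>f i\<close> running modulo p^(d i).\<close>

lemma card_Fin: "finite Fin" "\<exists>k. card Fin = p ^ k"
proof -
  let ?J = "{i\<in>A. d i \<noteq> 0}" and ?G = "\<lambda>i. {0..<P (d i)}"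
  have J: "finite ?J" using fin by simp
  define E where "E = sum d ?J"
  have le: "d i \<le> E" if "i \<in> ?J" for i unfolding E_def by (rule member_le_sum[OF that _ J]) simp
  define X where "X f = (\<lambda>i. if i \<in> ?J then P (E - d i) * f i else 0)" for f :: "nat \<Rightarrow> int"
  have PE: "P E = P (E - d i) * P (d i)" if "i \<in> ?J" for i using le[OF that] by (simp add: power_add[symmetric])
  have XI: "(E, X f) \<in> Idx A d" for f unfolding Idx_iff X_def using PE by (auto simp: mult.commute mult.left_commute)
  have bij: "bij_betw (\<lambda>f. \<alpha> E (X f)) (Pi\<^sub>E ?J ?G) Fin"
  proof (rule bij_betw_imageI)
    show "inj_on (\<lambda>f. \<alpha> E (X f)) (Pi\<^sub>E ?J ?G)"
    proof (rule inj_onI)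
      fix f g assume f: "f \<in> Pi\<^sub>E ?J ?G" and g: "g \<in> Pi\<^sub>E ?J ?G" and a: "\<alpha> E (X f) = \<alpha> E (X g)"
      show "f = g"
      proof (rule PiE_ext[OF f g])
        fix i assume i: "i \<in> ?J"
        have "P (E + E) dvd P E * X f i - P E * X g i" using a eq[OF XI XI, of f g] i by blast
        then have "P E * (P (E - d i) * P (d i)) dvd P E * (P (E - d i) * (f i - g i))"
          unfolding P_add PE[OF i, symmetric] using i by (simp add: X_def algebra_simps)
        then have "P (d i) dvd f i - g i" by simp
        then have "f i mod P (d i) = g i mod P (d i)" by (simp add: mod_eq_dvd_iff)
        moreover have "f i \<in> ?G i" "g i \<in> ?G i" using PiE_mem[OF f i] PiE_mem[OF g i] by auto
        ultimately show "f i = g i" by simp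
      qed
    qed
    show "(\<lambda>f. \<alpha> E (X f)) ` Pi\<^sub>E ?J ?G = Fin"
    proof (intro equalityI subsetI)
      fix u assume "u \<in> (\<lambda>f. \<alpha> E (X f)) ` Pi\<^sub>E ?J ?G"
      then obtain f where u: "u = \<alpha> E (X f)" by blast
      have "\<forall>i\<in>A. d i = 0 \<longrightarrow> X f i = 0" by (simp add: X_def)
      then show "u \<in> Fin" unfolding u Fin_def using XI by blast
    next
      fix u assume "u \<in> Fin"
      then obtain e x where x: "(e, x) \<in> Idx A d" "\<forall>i\<in>A. d i = 0 \<longrightarrow> x i = 0" "u = \<alpha> e x" by (auto simp: Fin_def)
      define y where "y i = P (d i) * x i div P e" for i
      have y: "P (d i) * x i = P e * y i" if "i \<in> ?J" for i using x(1) that unfolding Idx_iff y_def by auto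
      define f where "f = (\<lambda>i\<in>?J. y i mod P (d i))"
      have "u = \<alpha> E (X f)" unfolding x(3) eq[OF x(1) XI]
      proof
        fix i assume i: "i \<in> A"
        show "P (e + E) dvd P E * x i - P e * X f i"
        proof (cases "d i = 0")
          case True
          then show ?thesis using x(2) i by (simp add: X_def)
        next
          case False
          then have iJ: "i \<in> ?J" using i by simp
          have "P E * x i - P e * X f i = P (E - d i) * (P (d i) * x i) - P e * (P (E - d i) * f i)"
            unfolding PE[OF iJ] using iJ by (simp add: X_def)
          also have "\<dots> = P e * (P (E - d i) * (y i - y i mod P (d i)))"
            unfolding y[OF iJ] using iJ by (simp add: f_def algebra_simps)
          finally show ?thesis unfolding P_add PE[OF iJ] by (simp add: minus_mod_eq_mult_div)
        qed
      qed
      moreover have "f \<in> Pi\<^sub>E ?J ?G" by (auto simp: f_def)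
      ultimately show "u \<in> (\<lambda>f. \<alpha> E (X f)) ` Pi\<^sub>E ?J ?G" by blast
    qed
  qed
  have "card Fin = p ^ E"
  proof -
    have "card Fin = (\<Prod>i\<in>?J. card (?G i))" unfolding bij_betw_same_card[OF bij, symmetric] by (rule card_PiE[OF J])
    also have "\<dots> = (\<Prod>i\<in>?J. p ^ d i)" by (rule prod.cong) (simp_all add: nat_power_eq)
    finally show ?thesis by (simp add: E_def power_sum)
  qed
  then show "\<exists>k. card Fin = p ^ k" ..
  have "finite (Pi\<^sub>E ?J ?G)" by (rule finite_PiE[OF J]) simp
  then show "finite Fin" using bij_betw_finite[OF bij] by blast
qed

text \<open>The slots with \<open>d i = 0\<close>, numbered by \<epsilon>, give the divisible part;
  the others give \<open>Fin\<close>, replaced by a copy on natural numbers. The isomorphism is set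
  up on the names in \<open>Idx A d\<close>.\<close>

lemma cofinite: "cofinite_type p M"
proof -
  let ?T = "{i\<in>A. d i = 0}"
  define s where "s = card ?T"
  obtain \<epsilon> where eb: "bij_betw \<epsilon> {..<s} ?T"
    using ex_bij_betw_nat_finite[of ?T] fin by (auto simp: s_def atLeast0LessThan)
  define \<eta> where "\<eta> = inv_into {..<s} \<epsilon>"
  have ee: "\<eta> (\<epsilon> j) = j" "\<epsilon> j \<in> ?T" if "j < s" for j
    using that bij_betw_inv_into_left[OF eb] bij_betwE[OF eb] by (auto simp: \<eta>_def)
  have ee': "\<epsilon> (\<eta> i) = i" "\<eta> i < s" if "i \<in> ?T" for i
    using that bij_betw_inv_into_right[OF eb] bij_betwE[OF bij_betw_inv_into[OF eb]] by (auto simp: \<eta>_def)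
  have Tim: "(\<forall>i\<in>?T. Q i) \<longleftrightarrow> (\<forall>j<s. Q (\<epsilon> j))" for Q using ee ee' by metis
  let ?N = "M\<lparr>carrier := Fin\<rparr>"
  obtain K :: "(padic, nat) module" and h where K: "Module.module (Zp p) K" "card (carrier K) = card (carrier ?N)"
      and h: "h \<in> mod_iso (Zp p) ?N K"
    using finite_module_nat_copy[OF submodule_module[OF M.module_axioms Fin_submodule]] card_Fin(1) by auto
  have h': "h u \<in> carrier K" "h ` Fin = carrier K" "inj_on h Fin" "v \<in> Fin \<Longrightarrow> h (u \<oplus>\<^bsub>M\<^esub> v) = h u \<oplus>\<^bsub>K\<^esub> h v"
    "a \<in> carrier (Zp p) \<Longrightarrow> h (a \<odot>\<^bsub>M\<^esub> u) = a \<odot>\<^bsub>K\<^esub> h u" if "u \<in> Fin" for u v a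
    using mod_isoD[OF h] that by auto
  define z where "z x = (\<lambda>i. if d i = 0 then 0 else x i)" for x :: "nat \<Rightarrow> int"
  have zI: "(e, z x) \<in> Idx A d" "\<alpha> e (z x) \<in> Fin" if "(e, x) \<in> Idx A d" for e x
  proof -
    show i: "(e, z x) \<in> Idx A d" using that by (auto simp: Idx_iff z_def)
    have "\<forall>i\<in>A. d i = 0 \<longrightarrow> z x i = 0" by (simp add: z_def)
    then show "\<alpha> e (z x) \<in> Fin" unfolding Fin_def using i by blast
  qed
  let ?S = "sum_mod (power_mod (Qp_mod_Zp p) s) K"
  have Ss: "carrier ?S = ({..<s} \<rightarrow>\<^sub>E carrier (Qp_mod_Zp p)) \<times> carrier K"
    "(q, u) \<oplus>\<^bsub>?S\<^esub> (q', u') = ((\<lambda>i\<in>{..<s}. q i \<oplus>\<^bsub>Qp_mod_Zp p\<^esub> q' i), u \<oplus>\<^bsub>K\<^esub> u')"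
    "a \<odot>\<^bsub>?S\<^esub> (q, u) = ((\<lambda>i\<in>{..<s}. a \<odot>\<^bsub>Qp_mod_Zp p\<^esub> q i), a \<odot>\<^bsub>K\<^esub> u)" for q q' u u' a
    by (simp_all add: sum_mod_def power_mod_def)
  define \<beta> where "\<beta> e x = ((\<lambda>j\<in>{..<s}. kq (x (\<epsilon> j)) e), h (\<alpha> e (z x)))" for e x
  have res: "(\<lambda>j\<in>{..<s}. g j) = (\<lambda>j\<in>{..<s}. g' j) \<longleftrightarrow> (\<forall>j<s. g j = g' j)" for g g' :: "nat \<Rightarrow> (padic \<times> padic) set set"
    by (auto simp: fun_eq_iff restrict_def)
  obtain g where "g \<in> mod_iso (Zp p) M ?S"
  proof (rule mod_isoI_reps[of "\<lambda>(e, x). \<alpha> e x" "Idx A d" M "\<lambda>(e, x). \<beta> e x" ?S "Zp p", OF sur])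
    show "(\<lambda>(e, x). \<beta> e x) ` Idx A d = carrier ?S"
    proof (intro equalityI subsetI)
      fix u assume "u \<in> (\<lambda>(e, x). \<beta> e x) ` Idx A d"
      then obtain e x where x: "(e, x) \<in> Idx A d" "u = \<beta> e x" by auto
      show "u \<in> carrier ?S" unfolding x(2) \<beta>_def Ss(1) using h'(1)[OF zI(2)[OF x(1)]] kap_carrier by auto
    next
      fix u assume "u \<in> carrier ?S"
      then obtain q v where u: "u = (q, v)" "q \<in> {..<s} \<rightarrow>\<^sub>E carrier (Qp_mod_Zp p)" "v \<in> carrier K" unfolding Ss(1) by blast
      have "\<exists>y l. q j = kq y l" if "j < s" for j using u(2) that by (metis PiE_mem kq_E lessThan_iff)
      then obtain y l where yl: "\<And>j. j < s \<Longrightarrow> q j = kq (y j) (l j)" by metis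
      obtain w where w: "w \<in> Fin" "v = h w" using u(3) mod_isoD(2)[OF h] by auto
      obtain f t where t: "(f, t) \<in> Idx A d" "\<forall>i\<in>A. d i = 0 \<longrightarrow> t i = 0" "w = \<alpha> f t" using w(1) by (auto simp: Fin_def)
      \<comment> \<open>For a common denominator: \<open>E + f\<close> is at least the exponent in
        the denominator of each entry of q and of w.\<close>
      define E where "E = sum l {..<s}"
      have le: "l j \<le> E" if "j < s" for j unfolding E_def using that by (intro member_le_sum) auto
      define x where "x i = (if d i = 0 then P (E + f - l (\<eta> i)) * y (\<eta> i) else P E * t i)" for i
      have xI: "(E + f, x) \<in> Idx A d"
        unfolding Idx_iff
      proof (intro ballI impI)
        fix i assume i: "i \<in> A" "d i \<noteq> 0"
        have "P f dvd P (d i) * t i" using t(1) i unfolding Idx_iff by blast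
        then have "P E * P f dvd P E * (P (d i) * t i)" by simp
        then show "P (E + f) dvd P (d i) * x i" using i by (simp add: x_def P_add algebra_simps)
      qed
      have "\<alpha> (E + f) (z x) = \<alpha> f t"
        by (rule eqI[OF zI(1)[OF xI] t(1)]) (use t(2) in \<open>auto simp: z_def x_def P_add\<close>)
      moreover have "(\<lambda>j\<in>{..<s}. kq (x (\<epsilon> j)) (E + f)) = q"
      proof (rule PiE_ext[OF _ u(2)])
        show "(\<lambda>j\<in>{..<s}. kq (x (\<epsilon> j)) (E + f)) \<in> {..<s} \<rightarrow>\<^sub>E carrier (Qp_mod_Zp p)" using kap_carrier by auto
        fix j assume "j \<in> {..<s}"
        then have j: "j < s" by simp
        have "kq (P (E + f - l j) * y j) (E + f) = kq (y j) (l j)"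
          using kq_level[of "y j" "l j" "E + f - l j"] le[OF j] by simp
        then show "(\<lambda>j\<in>{..<s}. kq (x (\<epsilon> j)) (E + f)) j = q j" using j ee[OF j] yl[OF j] by (simp add: x_def)
      qed
      ultimately have "u = \<beta> (E + f) x" unfolding u(1) \<beta>_def w(2) t(3) by simp
      then show "u \<in> (\<lambda>(e, x). \<beta> e x) ` Idx A d" using xI by force
    qed
    fix i j assume "i \<in> Idx A d" "j \<in> Idx A d"
    moreover obtain e x f y where ij: "i = (e, x)" "j = (f, y)" by fastforce
    ultimately have I: "(e, x) \<in> Idx A d" "(f, y) \<in> Idx A d" by auto
    note zz = zI[OF I(1)] zI[OF I(2)]
    have "\<beta> e x = \<beta> f y \<longleftrightarrow> (\<forall>i\<in>?T. P (e + f) dvd P f * x i - P e * y i) \<and> \<alpha> e (z x) = \<alpha> f (z y)"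
      unfolding \<beta>_def prod.inject res kq_eq_iff Tim using inj_on_eq_iff[OF h'(3)[OF zz(2)] zz(2,4)] by simp
    also have "\<dots> \<longleftrightarrow> \<alpha> e x = \<alpha> f y"
      unfolding eq[OF zz(1,3)] eq[OF I] by (auto simp: z_def)
    finally show "(case i of (e, x) \<Rightarrow> \<alpha> e x) = (case j of (e, x) \<Rightarrow> \<alpha> e x) \<longleftrightarrow>
        (case i of (e, x) \<Rightarrow> \<beta> e x) = (case j of (e, x) \<Rightarrow> \<beta> e x)" by (simp add: ij)
    have zadd: "z (\<lambda>i. P f * x i + P e * y i) = (\<lambda>i. P f * z x i + P e * z y i)" by (auto simp: z_def)
    have "\<beta> (e + f) (\<lambda>i. P f * x i + P e * y i) = \<beta> e x \<oplus>\<^bsub>?S\<^esub> \<beta> f y"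
      unfolding \<beta>_def Ss(2) prod.inject zadd add[OF zz(1,3), symmetric] h'(4)[OF zz(2,4)] by (simp add: kq_add restrict_def fun_eq_iff del: of_int_mult of_int_add)
    then show "\<exists>k\<in>Idx A d. (case k of (e, x) \<Rightarrow> \<alpha> e x) = (case i of (e, x) \<Rightarrow> \<alpha> e x) \<oplus>\<^bsub>M\<^esub> (case j of (e, x) \<Rightarrow> \<alpha> e x)
        \<and> (case k of (e, x) \<Rightarrow> \<beta> e x) = (case i of (e, x) \<Rightarrow> \<beta> e x) \<oplus>\<^bsub>?S\<^esub> (case j of (e, x) \<Rightarrow> \<beta> e x)"
      using add[OF I] by (intro bexI[OF _ Idx_add[OF I]]) (simp add: ij)
  next
    fix a i assume a: "a \<in> carrier (Zp p)" "i \<in> Idx A d"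
    obtain c where c: "coh c" "a = zc c" using Zp_E[OF a(1)] .
    obtain e x where i: "i = (e, x)" by fastforce
    have I: "(e, x) \<in> Idx A d" using a(2) i by simp
    have zsm: "z (\<lambda>i. lev c e * x i) = (\<lambda>i. lev c e * z x i)" by (auto simp: z_def)
    have "\<beta> e (\<lambda>i. lev c e * x i) = zc c \<odot>\<^bsub>?S\<^esub> \<beta> e x"
      unfolding \<beta>_def Ss(3) prod.inject zsm smult[OF c(1) zI(1)[OF I], symmetric] h'(5)[OF zI(2)[OF I] zc_carrier[OF c(1)]]
      by (simp add: kq_smult[OF c(1), symmetric] restrict_def fun_eq_iff del: of_int_mult)
    then show "\<exists>k\<in>Idx A d. (case k of (e, x) \<Rightarrow> \<alpha> e x) = a \<odot>\<^bsub>M\<^esub> (case i of (e, x) \<Rightarrow> \<alpha> e x)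
        \<and> (case k of (e, x) \<Rightarrow> \<beta> e x) = a \<odot>\<^bsub>?S\<^esub> (case i of (e, x) \<Rightarrow> \<beta> e x)"
      using smult[OF c(1) I] by (intro bexI[OF _ Idx_smult[OF I, of "lev c e"]]) (simp add: i c(2))
  qed
  moreover have "\<exists>k. card (carrier K) = p ^ k" using K(2) card_Fin(2) by simp
  ultimately show ?thesis unfolding cofinite_type_def using M.module_axioms K(1) by blast
qed

text \<open>Names are pulled back along \<sigma>, so that the one set \<open>Idx A' d'\<close> names
  both modules; an entry keeps its fraction and only changes its slot.\<close>

lemma iso_along_bij:
  assumes pr: "presentation p M' A' d' \<alpha>'" and \<sigma>: "bij_betw \<sigma> A A'" "\<And>i. i \<in> A \<Longrightarrow> d' (\<sigma> i) = d i"
  obtains h where "h \<in> mod_iso (Zp p) M M'" "\<And>e y. (e, y) \<in> Idx A' d' \<Longrightarrow> h (\<alpha> e (y \<circ> \<sigma>)) = \<alpha>' e y"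
proof -
  interpret N: presentation p M' A' d' \<alpha>' by (rule pr)
  have IA: "(e, y \<circ> \<sigma>) \<in> Idx A d \<longleftrightarrow> (e, y) \<in> Idx A' d'" for e y
    unfolding Idx_iff bij_betw_imp_surj_on[OF \<sigma>(1), symmetric] using \<sigma>(2) by simp
  obtain h where h: "h \<in> mod_iso (Zp p) M M'"
    "\<And>i. i \<in> Idx A' d' \<Longrightarrow> h (case i of (e, y) \<Rightarrow> \<alpha> e (y \<circ> \<sigma>)) = (case i of (e, y) \<Rightarrow> \<alpha>' e y)"
  proof (rule mod_isoI_reps[of "\<lambda>(e, y). \<alpha> e (y \<circ> \<sigma>)" "Idx A' d'" M "\<lambda>(e, y). \<alpha>' e y" M' "Zp p", OF _ N.sur])
    show "(\<lambda>(e, y). \<alpha> e (y \<circ> \<sigma>)) ` Idx A' d' = carrier M"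
    proof (intro equalityI subsetI)
      fix u assume "u \<in> (\<lambda>(e, y). \<alpha> e (y \<circ> \<sigma>)) ` Idx A' d'"
      then show "u \<in> carrier M" using carrierI IA by auto
    next
      fix u assume "u \<in> carrier M"
      then obtain e x where x: "(e, x) \<in> Idx A d" "u = \<alpha> e x" by (rule carrierE)
      define y where "y = x \<circ> inv_into A \<sigma>"
      have xy: "(y \<circ> \<sigma>) i = x i" if "i \<in> A" for i using bij_betw_inv_into_left[OF \<sigma>(1) that] by (simp add: y_def)
      have y: "(e, y \<circ> \<sigma>) \<in> Idx A d" using x(1) xy by (simp add: Idx_iff)
      have "u = \<alpha> e (y \<circ> \<sigma>)" unfolding x(2) by (rule eqI[OF x(1) y]) (simp only: xy)
      then show "u \<in> (\<lambda>(e, y). \<alpha> e (y \<circ> \<sigma>)) ` Idx A' d'" using y unfolding IA by force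
    qed
    fix i j assume "i \<in> Idx A' d'" "j \<in> Idx A' d'"
    moreover obtain e x f y where ij: "i = (e, x)" "j = (f, y)" by fastforce
    ultimately have I: "(e, x) \<in> Idx A' d'" "(f, y) \<in> Idx A' d'" by auto
    then have I': "(e, x \<circ> \<sigma>) \<in> Idx A d" "(f, y \<circ> \<sigma>) \<in> Idx A d" using IA by auto
    show "(case i of (e, y) \<Rightarrow> \<alpha> e (y \<circ> \<sigma>)) = (case j of (e, y) \<Rightarrow> \<alpha> e (y \<circ> \<sigma>)) \<longleftrightarrow>
        (case i of (e, y) \<Rightarrow> \<alpha>' e y) = (case j of (e, y) \<Rightarrow> \<alpha>' e y)"
      unfolding ij prod.case eq[OF I'] N.eq[OF I] bij_betw_imp_surj_on[OF \<sigma>(1), symmetric] by simp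
    show "\<exists>k\<in>Idx A' d'. (case k of (e, y) \<Rightarrow> \<alpha> e (y \<circ> \<sigma>)) = (case i of (e, y) \<Rightarrow> \<alpha> e (y \<circ> \<sigma>)) \<oplus>\<^bsub>M\<^esub> (case j of (e, y) \<Rightarrow> \<alpha> e (y \<circ> \<sigma>))
        \<and> (case k of (e, y) \<Rightarrow> \<alpha>' e y) = (case i of (e, y) \<Rightarrow> \<alpha>' e y) \<oplus>\<^bsub>M'\<^esub> (case j of (e, y) \<Rightarrow> \<alpha>' e y)"
      using add[OF I'] N.add[OF I] by (intro bexI[OF _ Idx_add[OF I]]) (simp add: ij comp_def)
  next
    fix a i assume a: "a \<in> carrier (Zp p)" "i \<in> Idx A' d'"
    obtain c where c: "coh c" "a = zc c" using Zp_E[OF a(1)] .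
    obtain e x where i: "i = (e, x)" by fastforce
    have I: "(e, x) \<in> Idx A' d'" "(e, x \<circ> \<sigma>) \<in> Idx A d" using a(2) i IA by auto
    show "\<exists>k\<in>Idx A' d'. (case k of (e, y) \<Rightarrow> \<alpha> e (y \<circ> \<sigma>)) = a \<odot>\<^bsub>M\<^esub> (case i of (e, y) \<Rightarrow> \<alpha> e (y \<circ> \<sigma>))
        \<and> (case k of (e, y) \<Rightarrow> \<alpha>' e y) = a \<odot>\<^bsub>M'\<^esub> (case i of (e, y) \<Rightarrow> \<alpha>' e y)"
      using smult[OF c(1) I(2)] N.smult[OF c(1) I(1)] by (intro bexI[OF _ Idx_smult[OF I(1), of "lev c e"]]) (simp add: i c(2) comp_def)
  next
    fix h assume h: "h \<in> mod_iso (Zp p) M M'"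
      "\<And>i. i \<in> Idx A' d' \<Longrightarrow> h (case i of (e, y) \<Rightarrow> \<alpha> e (y \<circ> \<sigma>)) = (case i of (e, y) \<Rightarrow> \<alpha>' e y)"
    show thesis by (rule that[OF h])
  qed
  show ?thesis
  proof (rule that[OF h(1)])
    show "h (\<alpha> e (y \<circ> \<sigma>)) = \<alpha>' e y" if "(e, y) \<in> Idx A' d'" for e y using h(2)[OF that] by simp
  qed
qed

end

section \<open>The exact sequence attached to two Lagrangians\<close>

lemma mod_iso_restrict:
  assumes "h \<in> mod_iso R M M'" "N \<subseteq> carrier M" "h ` N = N'"
  shows "h \<in> mod_iso R (M\<lparr>carrier := N\<rparr>) (M'\<lparr>carrier := N'\<rparr>)"
  using mod_isoD[OF assms(1)] assms(2,3)
  by (auto simp: mod_iso_def mod_hom_def bij_betw_def subset_iff inj_on_def)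

lemma (in rmodule) submoduleI_no_inv:
  assumes "N \<subseteq> carrier M" "\<zero>\<^bsub>M\<^esub> \<in> N" "\<And>x y. x \<in> N \<Longrightarrow> y \<in> N \<Longrightarrow> x \<oplus>\<^bsub>M\<^esub> y \<in> N"
    "\<And>a x. a \<in> carrier R \<Longrightarrow> x \<in> N \<Longrightarrow> a \<odot>\<^bsub>M\<^esub> x \<in> N"
  shows "submodule N R M"
proof (rule submoduleI[OF assms(1,2) _ assms(3,4)])
  show "\<ominus>\<^bsub>M\<^esub> x \<in> N" if x: "x \<in> N" for x
  proof -
    have xc: "x \<in> carrier M" using x assms(1) by blast
    have "\<ominus>\<^bsub>M\<^esub> x = (\<ominus> \<one>) \<odot>\<^bsub>M\<^esub> x" using smult_l_minus[OF R.one_closed xc] xc by simp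
    then show ?thesis using assms(4)[of "\<ominus> \<one>", OF _ x] by simp
  qed
qed

lemma quotient_iso:
  assumes M: "rmodule R M" "submodule N R M" and M': "rmodule R M'" "submodule N' R M'"
    and h: "h \<in> mod_iso R M M'" "h ` N = N'"
  obtains g where "g \<in> mod_iso R (quot_mod M N) (quot_mod M' N')"
    "\<And>x. x \<in> carrier M \<Longrightarrow> g (N +>\<^bsub>M\<^esub> x) = N' +>\<^bsub>M'\<^esub> h x"
proof (rule mod_isoI_reps[of "\<lambda>x. N +>\<^bsub>M\<^esub> x" "carrier M" "quot_mod M N" "\<lambda>x. N' +>\<^bsub>M'\<^esub> h x" "quot_mod M' N'" R])
  interpret M: rmodule R M by (rule M(1))
  interpret M': rmodule R M' by (rule M'(1))
  note D = mod_isoD[OF h(1)]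
  note Q = M.quot_simps[OF M(2)] and Q' = M'.quot_simps[OF M'(2)]
  show "(\<lambda>x. N +>\<^bsub>M\<^esub> x) ` carrier M = carrier (quot_mod M N)" by (rule Q(1)[symmetric])
  show "(\<lambda>x. N' +>\<^bsub>M'\<^esub> h x) ` carrier M = carrier (quot_mod M' N')" unfolding Q'(1) D(2)[symmetric] by (simp add: image_image)
  show "N +>\<^bsub>M\<^esub> x = N +>\<^bsub>M\<^esub> y \<longleftrightarrow> N' +>\<^bsub>M'\<^esub> h x = N' +>\<^bsub>M'\<^esub> h y" if xy: "x \<in> carrier M" "y \<in> carrier M" for x y
  proof -
    have c: "x \<ominus>\<^bsub>M\<^esub> y \<in> carrier M" using xy by simp
    have "x = (x \<ominus>\<^bsub>M\<^esub> y) \<oplus>\<^bsub>M\<^esub> y" using xy by (simp add: a_minus_def M.M.a_assoc M.M.l_neg)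
    then have "h x \<ominus>\<^bsub>M'\<^esub> h y = h (x \<ominus>\<^bsub>M\<^esub> y)" using M'.minus_eqI[OF D(1)[OF xy(2)] D(1)[OF c], of "h x"] D(4)[OF c xy(2)] by simp
    then show ?thesis
      unfolding M.coset_eq_iff[OF M(2) xy] M'.coset_eq_iff[OF M'(2) D(1)[OF xy(1)] D(1)[OF xy(2)]]
      using h(2) inj_on_image_mem_iff[OF D(3) c M.submodule_subset[OF M(2)]] by simp
  qed
  show "\<exists>k\<in>carrier M. N +>\<^bsub>M\<^esub> k = (N +>\<^bsub>M\<^esub> x) \<oplus>\<^bsub>quot_mod M N\<^esub> (N +>\<^bsub>M\<^esub> y) \<and>
      N' +>\<^bsub>M'\<^esub> h k = (N' +>\<^bsub>M'\<^esub> h x) \<oplus>\<^bsub>quot_mod M' N'\<^esub> (N' +>\<^bsub>M'\<^esub> h y)" if xy: "x \<in> carrier M" "y \<in> carrier M" for x y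
    using Q(2)[OF xy] Q'(2)[OF D(1)[OF xy(1)] D(1)[OF xy(2)]] D(4)[OF xy] xy by (intro bexI[of _ "x \<oplus>\<^bsub>M\<^esub> y"]) simp_all
  show "\<exists>k\<in>carrier M. N +>\<^bsub>M\<^esub> k = r \<odot>\<^bsub>quot_mod M N\<^esub> (N +>\<^bsub>M\<^esub> x) \<and>
      N' +>\<^bsub>M'\<^esub> h k = r \<odot>\<^bsub>quot_mod M' N'\<^esub> (N' +>\<^bsub>M'\<^esub> h x)" if x: "r \<in> carrier R" "x \<in> carrier M" for r x
    using Q(3)[OF x] Q'(3)[OF x(1) D(1)[OF x(2)]] D(5)[OF x] x by (intro bexI[of _ "r \<odot>\<^bsub>M\<^esub> x"]) simp_all
next
  fix g assume g: "g \<in> mod_iso R (quot_mod M N) (quot_mod M' N')"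
    "\<And>i. i \<in> carrier M \<Longrightarrow> g (N +>\<^bsub>M\<^esub> i) = N' +>\<^bsub>M'\<^esub> h i"
  show thesis by (rule that[OF g])
qed

locale diag_pair = padic p for p :: nat +
  fixes n :: nat and Z W :: "vec set" and w z :: "nat \<Rightarrow> vec" and k :: nat and a :: "nat \<Rightarrow> nat"
  assumes Z: "Lag n Z" and W: "Lag n W" and bw: "basis n w W" and bz: "basis n z Z" and k: "k \<le> n"
    and B: "i < n \<Longrightarrow> j < n \<Longrightarrow> null (bf n (w i) (z j) - (if i = j \<and> i < k then pp (a i) else 0))"
begin

text \<open>Integer combinations reach every element of Z up to \<open>near e\<close>, which is all
  that remains after tensoring with 1 / p^e.\<close>

definition zeta :: "(nat \<Rightarrow> int) \<Rightarrow> vec"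
  where "zeta x = lc n (\<lambda>i. of_int (x i)) z"

lemmas subm_Z = iso_satD(1)[OF Lag_iso_sat[OF Z]] and subm_W = iso_satD(1)[OF Lag_iso_sat[OF W]]

lemma zeta_Z: "zeta x \<in> Z"
  unfolding zeta_def by (rule lc_subm[OF subm_Z basisD(1)[OF bz]]) simp_all

lemma zeta_V: "zeta x \<in> V n"
  by (rule LagD(1)[OF Z zeta_Z])

lemma zeta_combination: "of_int b \<triangleright> zeta x + of_int c \<triangleright> zeta y = zeta (\<lambda>i. b * x i + c * y i)"
  by (rule ext) (simp add: zeta_def lc_apply sum_distrib_left sum.distrib algebra_simps)

lemma zeta_smul: "of_int b \<triangleright> zeta x = zeta (\<lambda>i. b * x i)"
  by (rule ext) (simp add: zeta_def lc_apply sum_distrib_left algebra_simps)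

lemma near_zeta_iff: "near e (zeta x) (zeta y) \<longleftrightarrow> (\<forall>i<n. P e dvd x i - y i)"
proof
  assume "near e (zeta x) (zeta y)"
  then have "near e (lc n (\<lambda>i. of_int (x i - y i)) z) 0"
    unfolding near_def zeta_def lc_apply by (simp add: sum_subtractf algebra_simps)
  then show "\<forall>i<n. P e dvd x i - y i" using basisD(3)[OF bz, of "\<lambda>i. of_int (x i - y i)" e] by simp
next
  assume "\<forall>i<n. P e dvd x i - y i"
  then show "near e (zeta x) (zeta y)" unfolding zeta_def by (intro near_lc) simp
qed

lemma Z_near_zeta: assumes "u \<in> Z" shows "\<exists>x. near e u (zeta x)"
proof -
  obtain c where c: "\<forall>i. coh (c i)" "eqv u (lc n c z)" using basisD(2)[OF bz assms] by blast
  have "near e (lc n c z) (zeta (\<lambda>i. lev (c i) e))" unfolding zeta_def by (rule near_lc) simp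
  then show ?thesis using near_trans[OF eqv_near[OF c(2)]] by blast
qed

lemma bf_w_lc:
  assumes i: "i < n" and c: "\<And>j. coh (c j)"
  shows "null (bf n (w i) (lc n c z) - (if i < k then pp (a i) * c i else 0))"
proof -
  have "bf n (w i) (lc n c z) - (if i < k then pp (a i) * c i else 0)
      = (\<Sum>j<n. c j * (bf n (w i) (z j) - (if i = j \<and> i < k then pp (a i) else 0)))"
  proof -
    have "(\<Sum>j<n. c j * (if i = j \<and> i < k then pp (a i) else 0)) = (\<Sum>j<n. if i = j then (if i < k then pp (a i) * c i else 0) else 0)"
      by (rule sum.cong) auto
    also have "\<dots> = (if i < k then pp (a i) * c i else 0)" using i by simp
    finally show ?thesis by (simp only: bf_lc_right right_diff_distrib sum_subtractf)
  qed
  also have "null \<dots>" using B[OF i] by (intro null_sum null_mult(2)) auto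
  finally show ?thesis .
qed

text \<open>Membership in W modulo p^e is orthogonality to W modulo p^e (\<open>Lag_level\<close>),
  and the pairings with the basis w are \<open>p ^ a i * x i\<close> for i < k and 0 from k
  on.\<close>

lemma zeta_near_W_iff: "(\<exists>u\<in>W. near e (zeta x) u) \<longleftrightarrow> (\<forall>i<k. P e dvd P (a i) * x i)"
proof
  assume "\<exists>u\<in>W. near e (zeta x) u"
  then obtain u where u: "u \<in> W" "near e (zeta x) u" by blast
  show "\<forall>i<k. P e dvd P (a i) * x i"
  proof (intro allI impI)
    fix i assume i: "i < k"
    then have i': "i < n" using k by simp
    have "P e dvd lev (bf n (w i) (zeta x)) e - lev (bf n (w i) u) e" by (rule near_bf[OF near_refl u(2)])
    moreover have "P e dvd lev (bf n (w i) u) e" using LagD(3)[OF W basisD(1)[OF bw i'] u(1)] unfolding null_def by blast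
    ultimately have 1: "P e dvd lev (bf n (w i) (zeta x)) e" by (metis diff_add_cancel dvd_add)
    have "P e dvd lev (bf n (w i) (zeta x) - (if i < k then pp (a i) * of_int (x i) else 0)) e"
      using bf_w_lc[OF i', of "\<lambda>i. of_int (x i)"] unfolding null_def zeta_def by simp
    then have "P e dvd lev (bf n (w i) (zeta x)) e - P (a i) * x i" using i by simp
    then show "P e dvd P (a i) * x i" using 1 by (metis dvd_diff diff_diff_eq2 add_diff_cancel_left')
  qed
next
  assume r: "\<forall>i<k. P e dvd P (a i) * x i"
  show "\<exists>u\<in>W. near e (zeta x) u"
  proof (rule Lag_level[OF W zeta_V])
    fix u assume "u \<in> W"
    then obtain c where c: "\<forall>i. coh (c i)" "eqv u (lc n c w)" using basisD(2)[OF bw] by blast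
    have "P e dvd lev (bf n (zeta x) u) e - lev (bf n (zeta x) (lc n c w)) e" by (rule near_bf[OF near_refl eqv_near[OF c(2)]])
    moreover have "P e dvd lev (bf n (zeta x) (lc n c w)) e"
    proof -
      have "P e dvd lev (bf n (zeta x) (w i)) e" if i: "i < n" for i
      proof -
        have "P e dvd lev (bf n (w i) (zeta x) - (if i < k then pp (a i) * of_int (x i) else 0)) e"
          using bf_w_lc[OF i, of "\<lambda>i. of_int (x i)"] unfolding null_def zeta_def by simp
        then have "P e dvd lev (bf n (w i) (zeta x)) e - (if i < k then P (a i) * x i else 0)" by (auto split: if_splits)
        moreover have "P e dvd (if i < k then P (a i) * x i else 0)" using r by simp
        ultimately show ?thesis unfolding bf_commute[of n "zeta x"] by (metis diff_add_cancel dvd_add)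
      qed
      then show ?thesis unfolding bf_lc_right by (simp, intro dvd_sum) auto
    qed
    ultimately show "P e dvd lev (bf n (zeta x) u) e" by (metis diff_add_cancel dvd_add)
  qed
qed

text \<open>Pairing a true common vector with \<open>w i\<close> gives
  \<open>p ^ a i * c i = 0\<close>, hence \<open>c i = 0\<close> for i < k: the intersection is
  spanned by the \<open>z i\<close> with i \<ge> k. In \<open>zeta_near_W_iff\<close> the pairing
  vanishes only modulo p^e, and T measures the difference.\<close>

lemma zeta_near_inter_iff: "(\<exists>u\<in>Z \<inter> W. near e (zeta x) u) \<longleftrightarrow> (\<forall>i<k. P e dvd x i)"
proof
  assume "\<exists>u\<in>Z \<inter> W. near e (zeta x) u"
  then obtain u where u: "u \<in> Z" "u \<in> W" "near e (zeta x) u" by blast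
  obtain c where c: "\<forall>i. coh (c i)" "eqv u (lc n c z)" using basisD(2)[OF bz u(1)] by blast
  show "\<forall>i<k. P e dvd x i"
  proof (intro allI impI)
    fix i assume i: "i < k"
    then have i': "i < n" using k by simp
    have "null (bf n (w i) u - bf n (w i) (lc n c z))" by (rule eqv_bf[OF eqv_refl c(2)])
    moreover have "null (bf n (w i) u)" by (rule LagD(3)[OF W basisD(1)[OF bw i'] u(2)])
    moreover have "null (bf n (w i) (lc n c z) - pp (a i) * c i)" using bf_w_lc[OF i', of c] c(1) i by simp
    ultimately have "null (pp (a i) * c i)" using null_cong by blast
    then have "null (c i)" using null_pp_mult_iff c(1) by blast
    then have ci: "P e dvd lev (c i) e" unfolding null_def by blast
    have "near e (zeta x) (zeta (\<lambda>i. lev (c i) e))"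
      using near_trans[OF near_trans[OF u(3) eqv_near[OF c(2)]], of "zeta (\<lambda>i. lev (c i) e)"] unfolding zeta_def
      by (simp add: near_lc)
    then have "P e dvd x i - lev (c i) e" unfolding near_zeta_iff using i' by blast
    then show "P e dvd x i" using ci by (metis diff_add_cancel dvd_add)
  qed
next
  assume r: "\<forall>i<k. P e dvd x i"
  define y where "y i = (if i < k then 0 else x i)" for i
  have "zeta y \<in> W"
  proof (rule LagD(4)[OF W zeta_V LagD(2)[OF Z zeta_Z]])
    fix u assume "u \<in> W"
    then obtain c where c: "\<forall>i. coh (c i)" "eqv u (lc n c w)" using basisD(2)[OF bw] by blast
    have "null (bf n (zeta y) (w i))" if i: "i < n" for i
    proof -
      have "(if i < k then pp (a i) * of_int (y i) else 0) = 0" by (simp add: y_def)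
      then have "null (bf n (w i) (zeta y))" using bf_w_lc[OF i, of "\<lambda>i. of_int (y i)"] unfolding zeta_def by simp
      then show ?thesis by (simp add: bf_commute)
    qed
    then have "null (bf n (zeta y) (lc n c w))" unfolding bf_lc_right by (intro null_sum null_mult(2)) auto
    moreover have "null (bf n (zeta y) u - bf n (zeta y) (lc n c w))" by (rule eqv_bf[OF eqv_refl c(2)])
    ultimately show "null (bf n (zeta y) u)" using null_cong by blast
  qed
  moreover have "near e (zeta x) (zeta y)" unfolding near_zeta_iff using r by (simp add: y_def)
  ultimately show "\<exists>u\<in>Z \<inter> W. near e (zeta x) u" using zeta_Z by blast
qed

definition tz :: "nat \<Rightarrow> (nat \<Rightarrow> int) \<Rightarrow> tensor_elt"
  where "tz e x = tau n e (zeta x)"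

lemma tz_carrier: "tz e x \<in> carrier (tensor_QZ p n)"
  unfolding tz_def by (rule tau_carrier[OF zeta_V])

lemma tz_level: "tz e x = tz (e + f) (\<lambda>i. P f * x i)"
  unfolding tz_def using tau_level[OF zeta_V, of e x f] zeta_smul[of "P f" x] by simp

lemma tz_eq_iff: "tz e x = tz f y \<longleftrightarrow> (\<forall>i<n. P (e + f) dvd P f * x i - P e * y i)"
  using tz_level[of e x f] tz_level[of f y e] unfolding tz_def
  by (simp add: tau_eq_iff[OF zeta_V zeta_V] near_zeta_iff add.commute)

lemma tz_add: "tz e x \<oplus>\<^bsub>tensor_QZ p n\<^esub> tz f y = tz (e + f) (\<lambda>i. P f * x i + P e * y i)"
proof -
  have "zeta (\<lambda>i. P f * x i) + zeta (\<lambda>i. P e * y i) = zeta (\<lambda>i. P f * x i + P e * y i)"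
    unfolding zeta_smul[symmetric] by (rule zeta_combination)
  then show ?thesis using tz_level[of e x f] tz_level[of f y e] unfolding tz_def
    by (simp add: tau_add[OF zeta_V zeta_V] add.commute)
qed

lemma tz_smult: assumes "coh c" shows "zc c \<odot>\<^bsub>tensor_QZ p n\<^esub> tz e x = tz e (\<lambda>i. lev c e * x i)"
proof -
  have "near e (c \<triangleright> zeta x) (of_int (lev c e) \<triangleright> zeta x)" unfolding near_def by simp
  then show ?thesis unfolding tz_def tau_smult[OF assms zeta_V] zeta_smul[symmetric]
    using tau_eq_iff[OF V_smul[OF assms zeta_V] V_smul[OF coh_const(4) zeta_V]] by blast
qed

text \<open>Count coordinate by coordinate: for i < k exactly \<open>p ^ min (a i) e\<close>
  residues x satisfy that p^e divides \<open>p ^ a i * x\<close>, and the coordinates from k on are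
  free.\<close>

lemma sg_eq: "sg Z W e = p ^ ((\<Sum>i<k. min (a i) e) + (n - k) * e)"
proof -
  define G where "G i = {y\<in>{0..<P e}. i < k \<longrightarrow> P e dvd P (a i) * y}" for i
  have cG: "card (G i) = p ^ (if i < k then min (a i) e else e)" for i
  proof (cases "i < k \<and> a i < e")
    case True
    have Pe: "P e = P (e - a i) * P (a i)" using True by (simp add: power_add[symmetric])
    have "G i = (\<lambda>q. P (e - a i) * q) ` {0..<P (a i)}"
    proof (intro equalityI subsetI)
      fix y assume y: "y \<in> G i"
      then have "P (a i) * P (e - a i) dvd P (a i) * y" using True by (simp add: G_def Pe mult.commute)
      then obtain q where q: "y = P (e - a i) * q" by auto
      have "0 \<le> P (e - a i) * q" "P (e - a i) * q < P (e - a i) * P (a i)" using y unfolding G_def q Pe by auto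
      then have "0 \<le> q \<and> q < P (a i)"
        using mult_less_cancel_left_pos[OF P_pos] mult_le_cancel_left_pos[OF P_pos, of "e - a i" 0 q] by simp
      then show "y \<in> (\<lambda>q. P (e - a i) * q) ` {0..<P (a i)}" using q by auto
    qed (auto simp: G_def Pe)
    moreover have "inj_on (\<lambda>q. P (e - a i) * q) {0..<P (a i)}" by (rule inj_onI) simp
    ultimately show ?thesis using True by (simp add: card_image nat_power_eq)
  next
    case False
    then have "G i = {0..<P e}" using P_dvd[of e "a i"] by (auto simp: G_def)
    then show ?thesis using False by (auto simp: nat_power_eq)
  qed
  have red: "red e (zeta x) \<in> red e ` W \<longleftrightarrow> (\<forall>i<k. P e dvd P (a i) * x i)" for x
    using zeta_near_W_iff red_in_image by blast
  have "bij_betw (\<lambda>f. red e (zeta f)) (Pi\<^sub>E {..<n} G) (red e ` Z \<inter> red e ` W)"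
  proof (rule bij_betw_imageI)
    show "inj_on (\<lambda>f. red e (zeta f)) (Pi\<^sub>E {..<n} G)"
    proof (rule inj_onI, rule PiE_ext)
      fix f g i assume f: "f \<in> Pi\<^sub>E {..<n} G" and g: "g \<in> Pi\<^sub>E {..<n} G" and fg: "red e (zeta f) = red e (zeta g)" and i: "i \<in> {..<n}"
      have "P e dvd f i - g i" using fg i unfolding near_iff_red[symmetric] near_zeta_iff by blast
      then have "f i mod P e = g i mod P e" by (simp add: mod_eq_dvd_iff)
      moreover have "f i \<in> G i" "g i \<in> G i" using PiE_mem[OF f i] PiE_mem[OF g i] by auto
      ultimately show "f i = g i" by (simp add: G_def)
    qed
    show "(\<lambda>f. red e (zeta f)) ` Pi\<^sub>E {..<n} G = red e ` Z \<inter> red e ` W"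
    proof (intro equalityI subsetI)
      fix r assume "r \<in> (\<lambda>f. red e (zeta f)) ` Pi\<^sub>E {..<n} G"
      then obtain f where f: "f \<in> Pi\<^sub>E {..<n} G" "r = red e (zeta f)" by blast
      have "\<forall>i<k. P e dvd P (a i) * f i" using PiE_mem[OF f(1)] k by (auto simp: G_def)
      then show "r \<in> red e ` Z \<inter> red e ` W" unfolding f(2) using red zeta_Z by blast
    next
      fix r assume r: "r \<in> red e ` Z \<inter> red e ` W"
      then obtain u where u: "u \<in> Z" "r = red e u" by blast
      obtain x where "near e u (zeta x)" using Z_near_zeta[OF u(1)] by blast
      then have x: "r = red e (zeta x)" using u(2) by (simp add: near_iff_red)
      define f where "f = (\<lambda>i\<in>{..<n}. x i mod P e)"
      have "near e (zeta x) (zeta f)" unfolding near_zeta_iff by (simp add: f_def minus_mod_eq_mult_div)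
      then have rf: "r = red e (zeta f)" using x by (simp add: near_iff_red)
      then have "\<forall>i<k. P e dvd P (a i) * f i" using red r by blast
      then have "f \<in> Pi\<^sub>E {..<n} G" by (auto simp: f_def G_def)
      then show "r \<in> (\<lambda>f. red e (zeta f)) ` Pi\<^sub>E {..<n} G" using rf by blast
    qed
  qed
  then have "sg Z W e = card (Pi\<^sub>E {..<n} G)" unfolding sg_def using bij_betw_same_card by metis
  also have "\<dots> = (\<Prod>i<n. p ^ (if i < k then min (a i) e else e))" by (simp add: card_PiE cG)
  also have "\<dots> = p ^ (\<Sum>i<n. if i < k then min (a i) e else e)" by (rule power_sum[symmetric])
  also have "(\<Sum>i<n. if i < k then min (a i) e else e) = (\<Sum>i<k. min (a i) e) + (n - k) * e"
  proof -
    have "{..<n} = {..<k} \<union> {k..<n}" using k by auto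
    then have "(\<Sum>i<n. if i < k then min (a i) e else e)
        = (\<Sum>i<k. if i < k then min (a i) e else e) + (\<Sum>i\<in>{k..<n}. if i < k then min (a i) e else e)"
      by (simp add: sum.union_disjoint ivl_disj_int)
    then show ?thesis by simp
  qed
  finally show ?thesis .
qed

end

section \<open>The modules R, S and T in coordinates\<close>

context diag_pair begin

abbreviation "Smod \<equiv> S_mod p n (ofr n ` Z) (ofr n ` W)"
abbreviation "Rmod \<equiv> R_mod p n (ofr n ` Z) (ofr n ` W)"
abbreviation "Tmod \<equiv> T_mod p n (ofr n ` Z) (ofr n ` W)"
abbreviation "RST \<equiv> RST_seq p n (ofr n ` Z) (ofr n ` W)"

lemma S_simps [simp]: "add Smod = add (tensor_QZ p n)" "smult Smod = smult (tensor_QZ p n)" "zero Smod = zero (tensor_QZ p n)"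
  and R_simps [simp]: "add Rmod = add (tensor_QZ p n)" "smult Rmod = smult (tensor_QZ p n)" "zero Rmod = zero (tensor_QZ p n)"
  by (simp_all add: S_mod_def R_mod_def)

lemma inter_ofr: "ofr n ` Z \<inter> ofr n ` W = ofr n ` (Z \<inter> W)"
proof (intro equalityI subsetI)
  fix u assume "u \<in> ofr n ` Z \<inter> ofr n ` W"
  then obtain x y where x: "x \<in> Z" "y \<in> W" "u = ofr n x" "u = ofr n y" by blast
  have "eqv x y" using ofr_eq_iff[OF LagD(1)[OF Z x(1)] LagD(1)[OF W x(2)]] x(3,4) by simp
  then have "x \<in> W" using subm_eqv_iff[OF subm_W LagD(1)[OF Z x(1)] LagD(1)[OF W x(2)]] x(2) by blast
  then show "u \<in> ofr n ` (Z \<inter> W)" using x(1,3) by blast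
qed auto

lemma subm_inter: "subm n (Z \<inter> W)"
proof (intro submI)
  show "u \<in> V n" if "u \<in> Z \<inter> W" for u using that submD(1)[OF subm_Z] by blast
  show "0 \<in> Z \<inter> W" using submD(2)[OF subm_Z] submD(2)[OF subm_W] by blast
  show "u + v \<in> Z \<inter> W" if "u \<in> Z \<inter> W" "v \<in> Z \<inter> W" for u v
    using that submD(3)[OF subm_Z] submD(3)[OF subm_W] by blast
  show "c \<triangleright> u \<in> Z \<inter> W" if "u \<in> Z \<inter> W" "coh c" for u c
    using that submD(4)[OF subm_Z] submD(4)[OF subm_W] by blast
  show "u \<in> Z \<inter> W" if "u \<in> V n" "v \<in> Z \<inter> W" "eqv u v" for u v
    using that submD(5)[OF subm_Z that(1)] submD(5)[OF subm_W that(1)] by blast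
qed

lemma sub_QZ_Z: "sub_QZ p n (ofr n ` Z) = range (\<lambda>(e, x). tz e x)"
proof (intro equalityI subsetI)
  fix u assume "u \<in> sub_QZ p n (ofr n ` Z)"
  then obtain e v where v: "v \<in> Z" "u = tau n e v" unfolding sub_QZ_eq[OF subm_Z] by blast
  obtain x where "near e v (zeta x)" using Z_near_zeta[OF v(1)] by blast
  then have "u = tz e x" using tau_eq_iff[OF LagD(1)[OF Z v(1)] zeta_V] v(2) by (simp add: tz_def)
  then show "u \<in> range (\<lambda>(e, x). tz e x)" by force
next
  fix u assume "u \<in> range (\<lambda>(e, x). tz e x)"
  then show "u \<in> sub_QZ p n (ofr n ` Z)" unfolding sub_QZ_eq[OF subm_Z] tz_def using zeta_Z by auto
qed

text \<open>The factor \<open>Q i\<close> will be \<open>p ^ a i\<close> for L = W and 1 for the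
  intersection. Tensors of different levels are compared at level \<open>e + f\<close>, where p^f
  cancels from the divisibility.\<close>

lemma tz_sub_QZ:
  assumes L: "subm n L" and lev: "\<And>e x. (\<exists>u\<in>L. near e (zeta x) u) \<longleftrightarrow> (\<forall>i<k. P e dvd Q i * x i)"
  shows "tz e x \<in> sub_QZ p n (ofr n ` L) \<longleftrightarrow> (\<forall>i<k. P e dvd Q i * x i)"
proof
  assume "tz e x \<in> sub_QZ p n (ofr n ` L)"
  then obtain f v where v: "v \<in> L" "tau n e (zeta x) = tau n f v" unfolding sub_QZ_eq[OF L] tz_def by blast
  have "near (e + f) (pp f \<triangleright> zeta x) (pp e \<triangleright> v)" using v(2) tau_eq_iff2[OF zeta_V submD(1)[OF L v(1)]] by blast
  moreover have "pp f \<triangleright> zeta x = zeta (\<lambda>i. P f * x i)" using zeta_smul[of "P f" x] by simp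
  moreover have "pp e \<triangleright> v \<in> L" by (rule submD(4)[OF L v(1) coh_const(3)])
  ultimately have "\<exists>u\<in>L. near (e + f) (zeta (\<lambda>i. P f * x i)) u" by auto
  then have "\<forall>i<k. P f * P e dvd P f * (Q i * x i)" unfolding lev by (simp add: P_add ac_simps)
  then show "\<forall>i<k. P e dvd Q i * x i" by simp
next
  assume "\<forall>i<k. P e dvd Q i * x i"
  then obtain u where u: "u \<in> L" "near e (zeta x) u" using lev by blast
  then have "tz e x = tau n e u" using tau_eq_iff[OF zeta_V submD(1)[OF L u(1)]] by (simp add: tz_def)
  then show "tz e x \<in> sub_QZ p n (ofr n ` L)" unfolding sub_QZ_eq[OF L] using u(1) by blast
qed

lemma S_carrier: "carrier Smod = {tz e x | e x. \<forall>i<k. P e dvd P (a i) * x i}"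
proof -
  have "carrier Smod = {u \<in> range (\<lambda>(e, x). tz e x). u \<in> sub_QZ p n (ofr n ` W)}"
    unfolding S_mod_def sub_QZ_Z by auto
  also have "\<dots> = {tz e x | e x. \<forall>i<k. P e dvd P (a i) * x i}"
  proof (intro equalityI subsetI)
    fix u assume "u \<in> {u \<in> range (\<lambda>(e, x). tz e x). u \<in> sub_QZ p n (ofr n ` W)}"
    then obtain e x where u: "u = tz e x" "tz e x \<in> sub_QZ p n (ofr n ` W)" by auto
    then show "u \<in> {tz e x | e x. \<forall>i<k. P e dvd P (a i) * x i}" unfolding tz_sub_QZ[OF subm_W zeta_near_W_iff] by blast
  next
    fix u assume "u \<in> {tz e x | e x. \<forall>i<k. P e dvd P (a i) * x i}"
    then obtain e x where u: "u = tz e x" "\<forall>i<k. P e dvd P (a i) * x i" by blast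
    then show "u \<in> {u \<in> range (\<lambda>(e, x). tz e x). u \<in> sub_QZ p n (ofr n ` W)}"
      unfolding tz_sub_QZ[OF subm_W zeta_near_W_iff, symmetric] by auto
  qed
  finally show ?thesis .
qed

lemma R_carrier_iff: "tz e x \<in> carrier Rmod \<longleftrightarrow> (\<forall>i<k. P e dvd x i)"
  using tz_sub_QZ[OF subm_inter, of "\<lambda>_. 1"] zeta_near_inter_iff by (simp add: R_mod_def inter_ofr)

lemma R_subset_S: "carrier Rmod \<subseteq> carrier Smod"
  using sub_QZ_eq[OF subm_inter] sub_QZ_eq[OF subm_Z] sub_QZ_eq[OF subm_W] by (auto simp: R_mod_def S_mod_def inter_ofr)

lemma R_carrier: "carrier Rmod = {tz e x | e x. \<forall>i<k. P e dvd x i}"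
proof (intro equalityI subsetI)
  fix u assume u: "u \<in> carrier Rmod"
  then obtain e x where "u = tz e x" using R_subset_S unfolding S_carrier by blast
  then show "u \<in> {tz e x | e x. \<forall>i<k. P e dvd x i}" using u R_carrier_iff by blast
qed (use R_carrier_iff in blast)

lemma S_submodule: "submodule (carrier Smod) (Zp p) (tensor_QZ p n)"
  using TQ.submodule_inter[of "{sub_QZ p n (ofr n ` Z), sub_QZ p n (ofr n ` W)}"]
    sub_QZ_submodule[OF subm_Z] sub_QZ_submodule[OF subm_W] by (auto simp: S_mod_def)

lemma R_submodule_tensor: "submodule (carrier Rmod) (Zp p) (tensor_QZ p n)"
  using sub_QZ_submodule[OF subm_inter] by (simp add: R_mod_def inter_ofr)

lemma S_module: "rmodule (Zp p) Smod" and R_module: "rmodule (Zp p) Rmod"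
  using submodule_module[OF TQ.module_axioms S_submodule] submodule_module[OF TQ.module_axioms R_submodule_tensor]
  by (simp_all add: S_mod_def R_mod_def rmodule.intro)

lemma R_submodule: "submodule (carrier Rmod) (Zp p) Smod"
  using rmodule.submoduleI_no_inv[OF S_module R_subset_S] TQ.submodule_facts[OF R_submodule_tensor] by simp

lemma T_module: "rmodule (Zp p) Tmod"
  unfolding T_mod_def by (rule rmodule.intro[OF rmodule.quot_module[OF S_module R_submodule]])

lemmas T_simps = rmodule.quot_simps[OF S_module R_submodule, folded T_mod_def]

lemma short_exact_RST: "short_exact (Zp p) RST"
proof -
  interpret S: rmodule "Zp p" Smod by (rule S_module)
  have "carrier Rmod = a_kernel Smod Tmod (\<lambda>x. carrier Rmod +>\<^bsub>Smod\<^esub> x)"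
    unfolding a_kernel_def' T_simps(4) S.coset_zero[OF R_submodule]
    using R_subset_S S.coset_zero_iff[OF R_submodule] by auto
  moreover have "(\<lambda>x. carrier Rmod +>\<^bsub>Smod\<^esub> x) \<in> mod_hom (Zp p) Smod Tmod"
    using T_simps(1,2,3) by (auto simp: mod_hom_def simp del: S_simps)
  moreover have "(\<lambda>x. x) \<in> mod_hom (Zp p) Rmod Smod" using R_subset_S by (auto simp: mod_hom_def)
  ultimately show ?thesis unfolding short_exact_def RST_seq_def
    using S_module R_module T_module T_simps(1) by (auto simp: rmodule_def)
qed

definition rs :: "nat set \<Rightarrow> (nat \<Rightarrow> int) \<Rightarrow> nat \<Rightarrow> int"
  where "rs A x = (\<lambda>i. if i \<in> A then x i else 0)"

lemma tz_rs_eq_iff: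
  "A \<subseteq> {..<n} \<Longrightarrow> tz e (rs A x) = tz f (rs A y) \<longleftrightarrow> (\<forall>i\<in>A. P (e + f) dvd P f * x i - P e * y i)"
  unfolding tz_eq_iff by (auto simp: rs_def)

lemma tz_rs_add: "tz e (rs A x) \<oplus>\<^bsub>tensor_QZ p n\<^esub> tz f (rs A y) = tz (e + f) (rs A (\<lambda>i. P f * x i + P e * y i))"
proof -
  have "rs A (\<lambda>i. P f * x i + P e * y i) = (\<lambda>i. P f * rs A x i + P e * rs A y i)" by (auto simp: rs_def)
  then show ?thesis by (simp add: tz_add)
qed

lemma tz_rs_smult: "coh c \<Longrightarrow> zc c \<odot>\<^bsub>tensor_QZ p n\<^esub> tz e (rs A x) = tz e (rs A (\<lambda>i. lev c e * x i))"
proof -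
  have "rs A (\<lambda>i. lev c e * x i) = (\<lambda>i. lev c e * rs A x i)" by (auto simp: rs_def)
  then show "coh c \<Longrightarrow> ?thesis" by (simp add: tz_smult)
qed

text \<open>An index i < k with \<open>a i = 0\<close> contributes nothing to S. It has to be left
  out because the value 0 of \<open>code\<close> marks a summand Q_p/Z_p, as at the indices from k
  on.\<close>

definition "slots = {i. i < n \<and> (k \<le> i \<or> a i \<noteq> 0)}"
definition "code i = (if i < k then a i else 0)"

lemma slots_subset: "slots \<subseteq> {..<n}"
  by (auto simp: slots_def)

lemma Idx_slots: "(e, x) \<in> Idx slots code \<longleftrightarrow> (\<forall>i<k. P e dvd P (a i) * rs slots x i)"
  unfolding Idx_iff using k by (force simp: slots_def code_def rs_def)

lemma tz_rs_slots: assumes "\<forall>i<k. P e dvd P (a i) * x i" shows "tz e x = tz e (rs slots x)"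
  unfolding tz_eq_iff
proof (intro allI impI)
  fix i assume i: "i < n"
  show "P (e + e) dvd P e * x i - P e * rs slots x i"
  proof (cases "i \<in> slots")
    case False
    then have "P e dvd x i" using assms[rule_format, of i] i by (auto simp: slots_def)
    then show ?thesis using False by (simp add: rs_def P_add)
  qed (simp add: rs_def)
qed

lemma S_presentation: "presentation p Smod slots code (\<lambda>e x. tz e (rs slots x))"
proof (intro presentation.intro presentation_axioms.intro padic_axioms S_module)
  show "finite slots" by (rule finite_subset[OF slots_subset]) simp
  show "(\<lambda>(e, x). tz e (rs slots x)) ` Idx slots code = carrier Smod"
  proof (intro equalityI subsetI)
    fix u assume "u \<in> carrier Smod"
    then obtain e x where x: "u = tz e x" "\<forall>i<k. P e dvd P (a i) * x i" unfolding S_carrier by blast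
    have "(e, x) \<in> Idx slots code" unfolding Idx_slots using x(2) by (simp add: rs_def)
    then show "u \<in> (\<lambda>(e, x). tz e (rs slots x)) ` Idx slots code" using tz_rs_slots[OF x(2)] x(1) by force
  next
    fix u assume "u \<in> (\<lambda>(e, x). tz e (rs slots x)) ` Idx slots code"
    then obtain e x where "(e, x) \<in> Idx slots code" "u = tz e (rs slots x)" by auto
    then show "u \<in> carrier Smod" unfolding S_carrier Idx_slots by blast
  qed
qed (simp_all add: tz_rs_eq_iff[OF slots_subset] tz_rs_add tz_rs_smult)

lemma R_presentation: "presentation p Rmod {k..<n} (\<lambda>_. 0) (\<lambda>e x. tz e (rs {k..<n} x))"
proof (intro presentation.intro presentation_axioms.intro padic_axioms R_module)
  have s: "{k..<n} \<subseteq> {..<n}" by auto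
  show "(\<lambda>(e, x). tz e (rs {k..<n} x)) ` Idx {k..<n} (\<lambda>_. 0) = carrier Rmod"
  proof (intro equalityI subsetI)
    fix u assume "u \<in> carrier Rmod"
    then obtain e x where x: "u = tz e x" "\<forall>i<k. P e dvd x i" unfolding R_carrier by blast
    have "tz e x = tz e (rs {k..<n} x)" unfolding tz_eq_iff using x(2) by (auto simp: rs_def P_add)
    moreover have "(e, x) \<in> Idx {k..<n} (\<lambda>_. 0)" by (simp add: Idx_iff)
    ultimately show "u \<in> (\<lambda>(e, x). tz e (rs {k..<n} x)) ` Idx {k..<n} (\<lambda>_. 0)" using x(1) by force
  qed (auto simp: R_carrier_iff rs_def)
  fix e f x y show "tz e (rs {k..<n} x) = tz f (rs {k..<n} y) \<longleftrightarrow> (\<forall>i\<in>{k..<n}. P (e + f) dvd P f * x i - P e * y i)"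
    by (rule tz_rs_eq_iff[OF s])
qed (simp_all add: tz_rs_add tz_rs_smult)

text \<open>R is everything in the coordinates from k on and zero in those below k, so exactly the
  latter survive in the quotient.\<close>

lemma tz_coset_eq_iff:
  assumes "tz e x \<in> carrier Smod" "tz f y \<in> carrier Smod"
  shows "carrier Rmod +>\<^bsub>Smod\<^esub> tz e x = carrier Rmod +>\<^bsub>Smod\<^esub> tz f y \<longleftrightarrow> (\<forall>i<k. P (e + f) dvd P f * x i - P e * y i)"
proof -
  interpret S: rmodule "Zp p" Smod by (rule S_module)
  have eq: "tz e x = tz (e + f) (\<lambda>i. P f * x i - P e * y i) \<oplus>\<^bsub>tensor_QZ p n\<^esub> tz f y"
    unfolding tz_add tz_eq_iff by (simp add: P_add algebra_simps)
  have t: "tz e x \<ominus>\<^bsub>tensor_QZ p n\<^esub> tz f y = tz (e + f) (\<lambda>i. P f * x i - P e * y i)"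
    by (rule TQ.minus_eqI[OF tz_carrier tz_carrier eq])
  have "tz (e + f) (\<lambda>i. P f * x i - P e * y i) \<in> carrier Smod"
    using TQ.submodule_facts(5)[OF S_submodule assms] unfolding t .
  then have "tz e x \<ominus>\<^bsub>Smod\<^esub> tz f y = tz (e + f) (\<lambda>i. P f * x i - P e * y i)"
    by (rule S.minus_eqI[OF assms(2)]) (use eq in simp)
  then show ?thesis using S.coset_eq_iff[OF R_submodule assms] R_carrier_iff by simp
qed

lemma T_presentation:
  "presentation p Tmod {i. i < k \<and> a i \<noteq> 0} a (\<lambda>e x. carrier Rmod +>\<^bsub>Smod\<^esub> tz e (rs {i. i < k \<and> a i \<noteq> 0} x))"
  (is "presentation p Tmod ?A a ?\<alpha>")
proof (intro presentation.intro presentation_axioms.intro padic_axioms T_module)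
  show "finite ?A" by simp
  have S: "tz e (rs ?A x) \<in> carrier Smod" if "(e, x) \<in> Idx ?A a" for e x
    using that unfolding S_carrier Idx_iff by (force simp: rs_def)
  have eq: "?\<alpha> e x = ?\<alpha> f y \<longleftrightarrow> (\<forall>i\<in>?A. P (e + f) dvd P f * x i - P e * y i)" if "(e, x) \<in> Idx ?A a" "(f, y) \<in> Idx ?A a" for e f x y
    unfolding tz_coset_eq_iff[OF S[OF that(1)] S[OF that(2)]] by (auto simp: rs_def)
  then show "(e, x) \<in> Idx ?A a \<Longrightarrow> (f, y) \<in> Idx ?A a \<Longrightarrow> ?\<alpha> e x = ?\<alpha> f y \<longleftrightarrow> (\<forall>i\<in>?A. P (e + f) dvd P f * x i - P e * y i)" for e f x y
    by blast
  show "(\<lambda>(e, x). ?\<alpha> e x) ` Idx ?A a = carrier Tmod"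
  proof (intro equalityI subsetI)
    fix u assume "u \<in> (\<lambda>(e, x). ?\<alpha> e x) ` Idx ?A a"
    then show "u \<in> carrier Tmod" unfolding T_simps(1) using S by auto
  next
    fix u assume "u \<in> carrier Tmod"
    then obtain v where v: "v \<in> carrier Smod" "u = carrier Rmod +>\<^bsub>Smod\<^esub> v" unfolding T_simps(1) by blast
    obtain e x where x: "v = tz e x" "\<forall>i<k. P e dvd P (a i) * x i" using v(1) unfolding S_carrier by blast
    have I: "(e, x) \<in> Idx ?A a" using x(2) by (simp add: Idx_iff)
    have "u = ?\<alpha> e x" unfolding v(2) x(1) tz_coset_eq_iff[OF v(1)[unfolded x(1)] S[OF I]]
      using x(2) by (auto simp: rs_def P_add)
    then show "u \<in> (\<lambda>(e, x). ?\<alpha> e x) ` Idx ?A a" using I by force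
  qed
  show "?\<alpha> e x \<oplus>\<^bsub>Tmod\<^esub> ?\<alpha> f y = ?\<alpha> (e + f) (\<lambda>i. P f * x i + P e * y i)" if "(e, x) \<in> Idx ?A a" "(f, y) \<in> Idx ?A a" for e f x y
    unfolding T_simps(2)[OF S[OF that(1)] S[OF that(2)]] by (simp add: tz_rs_add)
  show "zc c \<odot>\<^bsub>Tmod\<^esub> ?\<alpha> e x = ?\<alpha> e (\<lambda>i. lev c e * x i)" if "coh c" "(e, x) \<in> Idx ?A a" for c e x
    unfolding T_simps(3)[OF zc_carrier[OF that(1)] S[OF that(2)]] by (simp add: tz_rs_smult[OF that(1)])
qed

lemma RST_cofinite: "RST \<in> cofinite_ses p"
  using short_exact_RST presentation.cofinite[OF R_presentation] presentation.cofinite[OF S_presentation]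
    presentation.cofinite[OF T_presentation] by (simp add: cofinite_ses_def RST_seq_def)

text \<open>Describes R inside S by \<open>slots\<close> and \<open>code\<close> alone, so that a
  bijection of slots respecting codes carries R to R and hence T to T.\<close>

lemma R_image: "carrier Rmod = {tz e (rs slots x) | e x. (e, x) \<in> Idx slots code \<and> (\<forall>i\<in>slots. code i \<noteq> 0 \<longrightarrow> P e dvd x i)}"
proof (intro equalityI subsetI)
  fix u assume "u \<in> carrier Rmod"
  then obtain e x where x: "u = tz e x" "\<forall>i<k. P e dvd x i" unfolding R_carrier by blast
  have c: "\<forall>i<k. P e dvd P (a i) * x i" using x(2) by simp
  have "(e, x) \<in> Idx slots code" unfolding Idx_slots using c by (simp add: rs_def)
  moreover have "\<forall>i\<in>slots. code i \<noteq> 0 \<longrightarrow> P e dvd x i" using x(2) by (auto simp: code_def split: if_splits)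
  ultimately show "u \<in> {tz e (rs slots x) | e x. (e, x) \<in> Idx slots code \<and> (\<forall>i\<in>slots. code i \<noteq> 0 \<longrightarrow> P e dvd x i)}"
    using tz_rs_slots[OF c] x(1) by blast
next
  fix u assume "u \<in> {tz e (rs slots x) | e x. (e, x) \<in> Idx slots code \<and> (\<forall>i\<in>slots. code i \<noteq> 0 \<longrightarrow> P e dvd x i)}"
  then obtain e x where x: "u = tz e (rs slots x)" "\<forall>i\<in>slots. code i \<noteq> 0 \<longrightarrow> P e dvd x i" by blast
  show "u \<in> carrier Rmod" unfolding x(1) R_carrier_iff using x(2) k by (auto simp: rs_def slots_def code_def)
qed

end

context padic begin

lemma RST_iso_of_bij:
  assumes D: "diag_pair p n Z W w z k a" and D': "diag_pair p n' Z' W' w' z' k' a'"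
    and \<sigma>: "bij_betw \<sigma> (diag_pair.slots n k a) (diag_pair.slots n' k' a')"
      "\<And>i. i \<in> diag_pair.slots n k a \<Longrightarrow> diag_pair.code k' a' (\<sigma> i) = diag_pair.code k a i"
  shows "seq_iso (Zp p) (RST_seq p n (ofr n ` Z) (ofr n ` W)) (RST_seq p n' (ofr n' ` Z') (ofr n' ` W'))"
proof -
  interpret A: diag_pair p n Z W w z k a by (rule D)
  interpret B: diag_pair p n' Z' W' w' z' k' a' by (rule D')
  interpret PA: presentation p A.Smod A.slots A.code "\<lambda>e x. A.tz e (A.rs A.slots x)" by (rule A.S_presentation)
  obtain h where h: "h \<in> mod_iso (Zp p) A.Smod B.Smod"
    "\<And>e y. (e, y) \<in> Idx B.slots B.code \<Longrightarrow> h (A.tz e (A.rs A.slots (y \<circ> \<sigma>))) = B.tz e (B.rs B.slots y)"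
    using PA.iso_along_bij[OF B.S_presentation \<sigma>] by blast
  have IA: "(e, y \<circ> \<sigma>) \<in> Idx A.slots A.code \<longleftrightarrow> (e, y) \<in> Idx B.slots B.code" for e y
    unfolding Idx_iff bij_betw_imp_surj_on[OF \<sigma>(1), symmetric] using \<sigma>(2) by simp
  have RA: "(\<forall>i\<in>A.slots. A.code i \<noteq> 0 \<longrightarrow> P e dvd (y \<circ> \<sigma>) i) \<longleftrightarrow> (\<forall>i\<in>B.slots. B.code i \<noteq> 0 \<longrightarrow> P e dvd y i)" for e y
    unfolding bij_betw_imp_surj_on[OF \<sigma>(1), symmetric] using \<sigma>(2) by simp
  have R: "h ` carrier A.Rmod = carrier B.Rmod"
  proof (intro equalityI subsetI)
    fix v assume "v \<in> h ` carrier A.Rmod"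
    then obtain e x where x: "v = h (A.tz e (A.rs A.slots x))" "(e, x) \<in> Idx A.slots A.code"
      "\<forall>i\<in>A.slots. A.code i \<noteq> 0 \<longrightarrow> P e dvd x i" unfolding A.R_image by blast
    define y where "y = x \<circ> inv_into A.slots \<sigma>"
    have xy: "(y \<circ> \<sigma>) i = x i" if "i \<in> A.slots" for i using bij_betw_inv_into_left[OF \<sigma>(1) that] by (simp add: y_def)
    have rs: "A.rs A.slots x = A.rs A.slots (y \<circ> \<sigma>)" using xy by (auto simp: A.rs_def)
    have y: "(e, y) \<in> Idx B.slots B.code" unfolding IA[symmetric] using x(2) xy by (simp add: Idx_iff)
    moreover have "\<forall>i\<in>B.slots. B.code i \<noteq> 0 \<longrightarrow> P e dvd y i" unfolding RA[symmetric] using x(3) xy by simp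
    ultimately show "v \<in> carrier B.Rmod" unfolding x(1) rs h(2)[OF y] B.R_image by blast
  next
    fix v assume "v \<in> carrier B.Rmod"
    then obtain e y where y: "v = B.tz e (B.rs B.slots y)" "(e, y) \<in> Idx B.slots B.code"
      "\<forall>i\<in>B.slots. B.code i \<noteq> 0 \<longrightarrow> P e dvd y i" unfolding B.R_image by blast
    have "A.tz e (A.rs A.slots (y \<circ> \<sigma>)) \<in> carrier A.Rmod" unfolding A.R_image using y(2,3) IA RA by blast
    then show "v \<in> h ` carrier A.Rmod" using h(2)[OF y(2)] y(1) by (metis image_eqI)
  qed
  have f: "h \<in> mod_iso (Zp p) A.Rmod B.Rmod"
    using mod_iso_restrict[OF h(1) A.R_subset_S R] by (simp add: R_mod_def S_mod_def)
  obtain g where g: "g \<in> mod_iso (Zp p) A.Tmod B.Tmod"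
    "\<And>x. x \<in> carrier A.Smod \<Longrightarrow> g (carrier A.Rmod +>\<^bsub>A.Smod\<^esub> x) = carrier B.Rmod +>\<^bsub>B.Smod\<^esub> h x"
    using quotient_iso[OF A.S_module A.R_submodule B.S_module B.R_submodule h(1) R] unfolding T_mod_def by blast
  show ?thesis unfolding seq_iso_def RST_seq_def
    using f g h(1) by (intro bexI[of _ h] bexI[of _ g] conjI) simp_all
qed

end

section \<open>The law of the exact sequence\<close>

lemma (in prob_space) has_sum_partition:
  assumes S: "countable S" and A: "\<And>s. s \<in> S \<Longrightarrow> A s \<in> events" and dj: "disjoint_family_on A S"
  shows "((\<lambda>s. prob (A s)) has_sum prob (\<Union>s\<in>S. A s)) S"
proof -
  let ?f = "to_nat_on S" and ?g = "from_nat_into S"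
  have inj: "inj_on ?f S" by (rule inj_on_to_nat_on[OF S])
  define D where "D m = (if m \<in> ?f ` S then A (?g m) else {})" for m
  have g: "?g (?f s) = s" if "s \<in> S" for s by (rule from_nat_into_to_nat_on[OF S that])
  have D: "D (?f s) = A s" if "s \<in> S" for s using that g by (simp add: D_def)
  have U: "(\<Union>m. D m) = (\<Union>s\<in>S. A s)" using g by (auto simp: D_def split: if_splits)
  have "disjoint_family D" unfolding disjoint_family_on_def
  proof (intro ballI impI)
    fix m l :: nat assume ml: "m \<noteq> l"
    show "D m \<inter> D l = {}"
    proof (cases "m \<in> ?f ` S \<and> l \<in> ?f ` S")
      case True
      then obtain s t where "s \<in> S" "t \<in> S" "m = ?f s" "l = ?f t" by blast
      then show ?thesis using disjoint_family_onD[OF dj, of s t] ml D by auto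
    qed (auto simp: D_def)
  qed
  moreover have "range D \<subseteq> events" using A g by (auto simp: D_def)
  ultimately have s: "(\<lambda>m. prob (D m)) sums prob (\<Union>s\<in>S. A s)" using finite_measure_UNION[of D] U by simp
  then have "((\<lambda>m. prob (D m)) has_sum prob (\<Union>s\<in>S. A s)) UNIV"
    by (intro norm_summable_imp_has_sum) (auto simp: sums_iff)
  then have "((\<lambda>m. prob (D m)) has_sum prob (\<Union>s\<in>S. A s)) (?f ` S)"
    by (rule has_sum_cong_neutral[THEN iffD1, rotated -1]) (auto simp: D_def)
  then have "((\<lambda>m. prob (D m)) \<circ> ?f has_sum prob (\<Union>s\<in>S. A s)) S" unfolding has_sum_reindex[OF inj] .
  then show ?thesis by (rule has_sum_cong[THEN iffD1, rotated]) (simp add: D)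
qed

text \<open>Disjointness makes the second projection injective on \<open>Sigma Q B\<close>, which
  turns regrouping into iterated summation.\<close>

lemma has_sum_group:
  fixes f :: "'a \<Rightarrow> real"
  assumes f: "(f has_sum x) S" and B: "disjoint_family_on B Q" "(\<Union>C\<in>Q. B C) = S"
  shows "((\<lambda>C. infsum f (B C)) has_sum x) Q"
proof -
  have inj: "inj_on snd (Sigma Q B)"
    using B(1) unfolding disjoint_family_on_def by (intro inj_onI) (auto, blast+)
  have S: "snd ` Sigma Q B = S" unfolding B(2)[symmetric] by force
  have "((f \<circ> snd) has_sum x) (Sigma Q B)" using f unfolding S[symmetric] has_sum_reindex[OF inj] .
  moreover have "((\<lambda>s. (f \<circ> snd) (C, s)) has_sum infsum f (B C)) (B C)" if "C \<in> Q" for C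
  proof -
    have "B C \<subseteq> S" using that B(2) by blast
    then have "f summable_on B C" using f has_sum_imp_summable summable_on_subset_banach by blast
    then show ?thesis by simp
  qed
  ultimately show ?thesis by (rule has_sum_SigmaD)
qed

lemma bij_of_fibre_cards:
  fixes d :: "'a \<Rightarrow> nat" and d' :: "'b \<Rightarrow> nat"
  assumes "finite A" "finite A'" and c: "\<And>v. card {i \<in> A. d i = v} = card {i \<in> A'. d' i = v}"
  obtains \<sigma> where "bij_betw \<sigma> A A'" "\<And>i. i \<in> A \<Longrightarrow> d' (\<sigma> i) = d i"
proof -
  have "\<exists>h. bij_betw h {i \<in> A. d i = v} {i \<in> A'. d' i = v}" for v
    using assms by (intro finite_same_card_bij) auto
  then obtain h where h: "\<And>v. bij_betw (h v) {i \<in> A. d i = v} {i \<in> A'. d' i = v}" by metis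
  define \<sigma> where "\<sigma> i = h (d i) i" for i
  have m: "\<sigma> i \<in> A' \<and> d' (\<sigma> i) = d i" if "i \<in> A" for i using bij_betwE[OF h[of "d i"]] that by (auto simp: \<sigma>_def)
  have "bij_betw \<sigma> A A'"
  proof (rule bij_betw_imageI)
    show "inj_on \<sigma> A"
    proof (rule inj_onI)
      fix i j assume ij: "i \<in> A" "j \<in> A" "\<sigma> i = \<sigma> j"
      then have "d i = d j" using m by metis
      then show "i = j" using bij_betw_imp_inj_on[OF h[of "d i"]] ij by (auto simp: \<sigma>_def inj_on_def)
    qed
    show "\<sigma> ` A = A'"
    proof (intro equalityI subsetI)
      fix j assume j: "j \<in> A'"
      then obtain i where i: "j = h (d' j) i" "i \<in> A" "d i = d' j" using bij_betw_imp_surj_on[OF h[of "d' j"]] by blast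
      then have "j = \<sigma> i" by (simp add: \<sigma>_def)
      then show "j \<in> \<sigma> ` A" using i(2) by blast
    qed (use m in blast)
  qed
  then show ?thesis using that m by blast
qed

text \<open>The differences in \<open>e\<close> of the exponent count the \<open>a i\<close> above \<open>e\<close>, and for large \<open>e\<close> only \<open>n - k\<close> is left.\<close>
lemma type_of_exponents:
  fixes a a' :: "nat \<Rightarrow> nat"
  assumes eq: "\<And>e. (\<Sum>i<k. min (a i) e) + r * e = (\<Sum>i<k'. min (a' i) e) + r' * e"
  shows "r = r'" "v > 0 \<Longrightarrow> card {i. i < k \<and> a i = v} = card {i. i < k' \<and> a' i = v}"
proof -
  define N where "N k a e = card {i. i < k \<and> e < a i}" for k e :: nat and a :: "nat \<Rightarrow> nat"
  have step: "(\<Sum>i<k. min (a i) (Suc e)) = (\<Sum>i<k. min (a i) e) + N k a e" for k e and a :: "nat \<Rightarrow> nat"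
  proof -
    have "(\<Sum>i<k. min (a i) (Suc e)) = (\<Sum>i<k. min (a i) e + (if e < a i then 1 else 0))"
      by (rule sum.cong) auto
    also have "\<dots> = (\<Sum>i<k. min (a i) e) + card {i \<in> {..<k}. e < a i}"
      by (simp add: sum.distrib sum.If_cases Int_def)
    finally show ?thesis by (simp add: N_def)
  qed
  have 1: "N k a e + r = N k' a' e + r'" for e using eq[of e] eq[of "Suc e"] unfolding step by simp
  have big: "N k a e = 0" if "sum a {..<k} \<le> e" for k e and a :: "nat \<Rightarrow> nat"
  proof -
    have "\<not> e < a i" if "i < k" for i using member_le_sum[of i "{..<k}" a] \<open>sum a {..<k} \<le> e\<close> that by simp
    then have "{i. i < k \<and> e < a i} = {}" by blast
    then show ?thesis by (simp add: N_def)
  qed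
  show rr: "r = r'" using 1[of "sum a {..<k} + sum a' {..<k'}"] big[of a k] big[of a' k'] by simp
  have split: "N k a e = N k a (Suc e) + card {i. i < k \<and> a i = Suc e}" for k e and a :: "nat \<Rightarrow> nat"
  proof -
    have "{i. i < k \<and> e < a i} = {i. i < k \<and> Suc e < a i} \<union> {i. i < k \<and> a i = Suc e}" by auto
    then show ?thesis unfolding N_def by (simp add: card_Un_disjoint disjoint_iff)
  qed
  show "card {i. i < k \<and> a i = v} = card {i. i < k' \<and> a' i = v}" if v: "v > 0"
  proof -
    obtain e where e: "v = Suc e" using v by (cases v) auto
    show ?thesis using 1[of e] 1[of "Suc e"] rr unfolding e split[of k a e] split[of k' a' e] by simp
  qed
qed

context padic begin

lemma diag_pair_exists: assumes "Lag n Z" "Lag n W" shows "\<exists>w z k a. diag_pair p n Z W w z k a"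
proof -
  obtain w z k a where "basis n w W" "basis n z Z" "k \<le> n"
    "\<And>i j. i < n \<Longrightarrow> j < n \<Longrightarrow> null (bf n (w i) (z j) - (if i = j \<and> i < k then pp (a i) else 0))"
    using elementary_divisors[OF assms] by metis
  then have "diag_pair p n Z W w z k a"
    using assms by (intro diag_pair.intro diag_pair_axioms.intro padic_axioms) auto
  then show ?thesis by blast
qed

text \<open>By \<open>sg_eq\<close> the exponents of the powers of p in s determine the number n - k
  of divisible slots and the multiset of nonzero \<open>a i\<close>; so the slots of the two pairs
  correspond, even across different ranks.\<close>

lemma RST_iso:
  assumes "Lag n Z" "Lag n W" "Lag n' Z'" "Lag n' W'" and sg: "sg Z W = sg Z' W'"
  shows "seq_iso (Zp p) (RST_seq p n (ofr n ` Z) (ofr n ` W)) (RST_seq p n' (ofr n' ` Z') (ofr n' ` W'))"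
proof -
  obtain w z k a where D: "diag_pair p n Z W w z k a" using diag_pair_exists[OF assms(1,2)] by blast
  obtain w' z' k' a' where D': "diag_pair p n' Z' W' w' z' k' a'" using diag_pair_exists[OF assms(3,4)] by blast
  interpret A: diag_pair p n Z W w z k a by (rule D)
  interpret B: diag_pair p n' Z' W' w' z' k' a' by (rule D')
  have "(\<Sum>i<k. min (a i) e) + (n - k) * e = (\<Sum>i<k'. min (a' i) e) + (n' - k') * e" for e
    using A.sg_eq[of e] B.sg_eq[of e] sg p_gt_1 by simp
  note T = type_of_exponents[OF this]
  have slots: "diag_pair.slots n k a = {i. i < k \<and> a i \<noteq> 0} \<union> {k..<n}" if "k \<le> n" "diag_pair p n Z W w z k a" for n Z W w z k a
    unfolding diag_pair.slots_def[OF that(2)] by (rule Set.set_eqI) (use that(1) in auto)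
  have c0: "card {i \<in> diag_pair.slots n k a. diag_pair.code k a i = v} = (if v = 0 then n - k else card {i. i < k \<and> a i = v})"
    if d: "diag_pair p n Z W w z k a" "k \<le> n" for n Z W w z k a v
  proof (cases "v = 0")
    case True
    have "{i \<in> diag_pair.slots n k a. diag_pair.code k a i = v} = {k..<n}"
      unfolding slots[OF d(2,1)] diag_pair.code_def[OF d(1)] True by auto
    then show ?thesis using True by simp
  next
    case False
    have "{i \<in> diag_pair.slots n k a. diag_pair.code k a i = v} = {i. i < k \<and> a i = v}"
      unfolding slots[OF d(2,1)] diag_pair.code_def[OF d(1)] using False by auto
    then show ?thesis using False by simp
  qed
  have f: "finite A.slots" "finite B.slots" using finite_subset[OF A.slots_subset] finite_subset[OF B.slots_subset] by auto
  have "card {i \<in> A.slots. A.code i = v} = card {i \<in> B.slots. B.code i = v}" for v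
    unfolding c0[OF D A.k] c0[OF D' B.k] using T by simp
  then obtain \<sigma> where "bij_betw \<sigma> A.slots B.slots" "\<And>i. i \<in> A.slots \<Longrightarrow> B.code (\<sigma> i) = A.code i"
    using bij_of_fibre_cards[OF f, of A.code B.code] by blast
  then show ?thesis by (rule RST_iso_of_bij[OF D D'])
qed

lemma RST_in_cofinite: assumes "Lag n Z" "Lag n W" shows "RST_seq p n (ofr n ` Z) (ofr n ` W) \<in> cofinite_ses p"
  using diag_pair_exists[OF assms] diag_pair.RST_cofinite by blast

text \<open>All ranks together, so that the laws for varying n live on one countable set.\<close>

definition sgs :: "(nat \<Rightarrow> nat) set"
  where "sgs = {sg Z W | n Z W. Lag n Z \<and> Lag n W}"

text \<open>By \<open>sg_eq\<close> such a function is coded by n, k and the finite list of the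
  \<open>a i\<close>.\<close>

lemma countable_sgs: "countable sgs"
proof (rule countable_subset)
  let ?f = "\<lambda>(n, k, as). \<lambda>e. p ^ ((\<Sum>i<k. min (as ! i) e) + (n - k) * e)"
  show "sgs \<subseteq> range ?f"
  proof
    fix s assume "s \<in> sgs"
    then obtain n Z W where s: "s = sg Z W" "Lag n Z" "Lag n W" unfolding sgs_def by blast
    obtain w z k a where "diag_pair p n Z W w z k a" using diag_pair_exists[OF s(2,3)] by blast
    then interpret diag_pair p n Z W w z k a .
    have "s = ?f (n, k, map a [0..<k])" unfolding s(1) by (rule ext) (simp add: sg_eq)
    then show "s \<in> range ?f" by blast
  qed
qed simp

lemma Law_has_sum: assumes "B \<subseteq> sgs" shows "(Law n has_sum measure (mu n) {W. Lag n W \<and> sg (E n) W \<in> B}) B"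
proof -
  have "{W. Lag n W \<and> sg (E n) W \<in> B} = (\<Union>s\<in>B. {W. Lag n W \<and> sg (E n) W = s})" by blast
  moreover have "Law n = (\<lambda>s. measure (mu n) {W. Lag n W \<and> sg (E n) W = s})" by (rule ext) (rule Law_def)
  ultimately show ?thesis
    using muP.has_sum_partition[OF countable_subset[OF assms countable_sgs], of "\<lambda>s. {W. Lag n W \<and> sg (E n) W = s}" n] sg_event
    by (simp add: disjoint_family_on_def disjoint_iff)
qed

lemma Law_has_sum_one: "(Law n has_sum 1) sgs"
proof -
  have "{W. Lag n W \<and> sg (E n) W \<in> sgs} = space (mu n)" using Lag_E by (auto simp: mu_D(2) sgs_def)
  then show ?thesis using Law_has_sum[of sgs n] by (simp add: muP.prob_space)
qed

sublocale LC: law_chain Law beta "real p" "\<lambda>s. s 1" sgs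
proof
  show "real p \<ge> 2" using p_gt_1 by simp
  show "0 \<le> beta n" "beta n \<le> 1" "1 - beta n \<le> real p / real p ^ n" for n
    using beta_pos[of n] beta_le_1 beta_bound by simp_all
  show "0 \<le> Law n s" for n s by (simp add: Law_def)
  show "(Law n has_sum 1) sgs" for n by (rule Law_has_sum_one)
  show "(real p ^ Suc n - s 1) * Law (Suc n) s = (real p ^ Suc n - 1) * beta n * Law n s" for n s by (rule law_rec)
  show "infsum (Law (Suc n)) {s \<in> sgs. K \<le> s 1} \<le> real p ^ 2 / (real K - 1)" if "K > 1" for n K
  proof -
    have "{W. Lag (Suc n) W \<and> sg (E (Suc n)) W \<in> {s \<in> sgs. K \<le> s 1}} = {W. Lag (Suc n) W \<and> K \<le> sg (E (Suc n)) W 1}"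
      using Lag_E by (auto simp: sgs_def)
    then show ?thesis using infsumI[OF Law_has_sum[of "{s \<in> sgs. K \<le> s 1}" "Suc n"]] tail_bound[OF that, of n] by simp
  qed
qed

sublocale NP: prob_space "natural_measure p n" for n
  by (rule OT.unifD(1)[OF natural_measure_unif])

lemmas NM = OT.unifD(2,3)[OF natural_measure_unif]

sublocale PP: pair_prob_space "natural_measure p n" "natural_measure p n" for n
  by unfold_locales

definition sg_pair_event :: "nat \<Rightarrow> (nat \<Rightarrow> nat) \<Rightarrow> ((nat \<Rightarrow> padic) set \<times> (nat \<Rightarrow> padic) set) set"
  where "sg_pair_event n s = {(Z, W). Z \<in> OGr p n \<and> W \<in> OGr p n \<and> sg (rawz n Z) (rawz n W) = s}"

lemma red_rawz_cong:
  assumes "Z \<in> OGr p n" "Z' \<in> OGr p n" "reduction p n e Z = reduction p n e Z'" shows "red e ` rawz n Z = red e ` rawz n Z'"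
  using reduction_eq_iff[OF Lag_subset[OF OGr_Lag(1)[OF assms(1)]] Lag_subset[OF OGr_Lag(1)[OF assms(2)]], of e] assms
  by (simp add: OGr_Lag(2))

text \<open>For each e the condition is decided by the reductions at level e, so its event is the
  union of the countably many rectangles of cells inside it; then intersect over e.\<close>

lemma sg_pair_event_sets: "sg_pair_event n s \<in> sets (pair_measure_OGr p n)"
proof -
  let ?P = "pair_measure_OGr p n"
  have sp: "space ?P = OGr p n \<times> OGr p n" by (simp add: pair_measure_OGr_def space_pair_measure NM)
  define L where "L e = {u \<in> space ?P. card (red e ` rawz n (fst u) \<inter> red e ` rawz n (snd u)) = s e}" for e
  have "L e \<in> sets ?P" for e
  proof -
    define K where "K = {c. c \<in> OT.cells n \<times> OT.cells n \<and> fst c \<times> snd c \<subseteq> L e}"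
    have "countable K" unfolding K_def
      by (rule countable_subset[of _ "OT.cells n \<times> OT.cells n"]) (auto intro: OT.countable_cells)
    moreover have "fst c \<times> snd c \<in> sets ?P" if "c \<in> K" for c
      using that unfolding K_def pair_measure_OGr_def by (intro pair_measureI) (auto simp: NM)
    moreover have "L e = (\<Union>c\<in>K. fst c \<times> snd c)"
    proof (intro equalityI subsetI)
      fix u assume u: "u \<in> L e"
      obtain Z W where ZW: "u = (Z, W)" by fastforce
      have O: "Z \<in> OGr p n" "W \<in> OGr p n" using u by (auto simp: L_def sp ZW)
      have "OT.cell n e Z \<times> OT.cell n e W \<subseteq> L e"
      proof
        fix v assume "v \<in> OT.cell n e Z \<times> OT.cell n e W"
        then obtain Z' W' where v: "v = (Z', W')" "Z' \<in> OGr p n" "W' \<in> OGr p n" "reduction p n e Z' = reduction p n e Z"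
          "reduction p n e W' = reduction p n e W" by (auto simp: OT.cell_def)
        show "v \<in> L e" using u red_rawz_cong[OF v(2) O(1) v(4)] red_rawz_cong[OF v(3) O(2) v(5)] v(1-3)
          by (simp add: L_def sp ZW)
      qed
      then have "(OT.cell n e Z, OT.cell n e W) \<in> K" using OT.cell_in_cells O by (simp add: K_def)
      moreover have "u \<in> OT.cell n e Z \<times> OT.cell n e W" using O by (simp add: ZW OT.cell_def)
      ultimately show "u \<in> (\<Union>c\<in>K. fst c \<times> snd c)" by force
    qed (auto simp: K_def)
    ultimately show ?thesis by auto
  qed
  then have "(\<Inter>e. L e) \<in> sets ?P" by blast
  moreover have "sg_pair_event n s = (\<Inter>e. L e)" by (auto simp: sg_pair_event_def L_def sp sg_def fun_eq_iff)
  ultimately show ?thesis by simp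
qed

text \<open>Integrate over Z: by \<open>Law_any\<close> the section at every fixed Z has the same
  probability.\<close>

lemma measure_sg_pair_event: "measure (pair_measure_OGr p n) (sg_pair_event n s) = Law n s"
proof -
  let ?N = "natural_measure p n"
  note ev = sg_pair_event_sets[of n s, unfolded pair_measure_OGr_def]
  have sec: "emeasure ?N (Pair Z -` sg_pair_event n s) = ennreal (Law n s)" if Z: "Z \<in> OGr p n" for Z
  proof -
    have S: "Pair Z -` sg_pair_event n s \<in> sets ?N" by (rule sets_Pair1[OF ev])
    have m: "(\<lambda>L. ofr n ` L) \<in> measurable (mu n) (sigma (OGr p n) (OT.cells n))" by (rule ofr_image_measurable(1))
    have "emeasure ?N (Pair Z -` sg_pair_event n s) = emeasure (mu n) ((\<lambda>L. ofr n ` L) -` (Pair Z -` sg_pair_event n s) \<inter> space (mu n))"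
      using S unfolding natural_measure_eq by (intro emeasure_distr[OF m]) simp
    also have "(\<lambda>L. ofr n ` L) -` (Pair Z -` sg_pair_event n s) \<inter> space (mu n) = {W. Lag n W \<and> sg (rawz n Z) W = s}"
      using Z by (auto simp: sg_pair_event_def mu_D(2) Lag_OGr rawz_Lag)
    also have "emeasure (mu n) \<dots> = ennreal (Law n s)"
      using Law_any[OF OGr_Lag(1)[OF Z]] by (simp add: muP.emeasure_eq_measure)
    finally show ?thesis .
  qed
  have "emeasure (?N \<Otimes>\<^sub>M ?N) (sg_pair_event n s) = (\<integral>\<^sup>+Z. emeasure ?N (Pair Z -` sg_pair_event n s) \<partial>?N)"
    by (rule NP.emeasure_pair_measure_alt[OF ev])
  also have "\<dots> = (\<integral>\<^sup>+Z. ennreal (Law n s) \<partial>?N)" by (rule nn_integral_cong) (simp add: sec NM)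
  also have "\<dots> = ennreal (Law n s)" by (simp add: NP.emeasure_space_1)
  finally show ?thesis unfolding pair_measure_OGr_def by (simp add: measure_def Law_def)
qed

text \<open>The fibre over \<open>C\<close> of the map from functions s to isomorphism classes; the
  probability of the class is the sum of \<open>Law n\<close> over this fibre.\<close>

definition class_sgs :: "(padic, tensor_elt, tensor_elt, tensor_elt set) mod_seq set \<Rightarrow> (nat \<Rightarrow> nat) set"
  where "class_sgs C = {sg Z W | n Z W. Lag n Z \<and> Lag n W \<and> RST_seq p n (ofr n ` Z) (ofr n ` W) \<in> C}"

abbreviation ses_rel :: "((padic, tensor_elt, tensor_elt, tensor_elt set) mod_seq \<times> (padic, tensor_elt, tensor_elt, tensor_elt set) mod_seq) set"
  where "ses_rel \<equiv> {(X, Y). X \<in> cofinite_ses p \<and> Y \<in> cofinite_ses p \<and> seq_iso (Zp p) X Y}"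

lemma equiv_ses: "equiv (cofinite_ses p) ses_rel"
proof (rule equivI)
  show "refl_on (cofinite_ses p) ses_rel" by (auto simp: refl_on_def seq_iso_refl)
  show "sym ses_rel" by (auto simp: sym_def cofinite_ses_def intro: seq_iso_sym)
  show "trans ses_rel" by (rule transI) (auto intro: seq_iso_trans)
qed auto

lemma ses_classes_eq: "ses_classes p = cofinite_ses p // ses_rel"
  by (simp add: ses_classes_def)

text \<open>Equal s gives isomorphic sequences by \<open>RST_iso\<close>, and classes are closed
  under isomorphism within \<open>cofinite_ses p\<close>.\<close>

lemma RST_in_class_iff:
  assumes C: "C \<in> ses_classes p" and L: "Lag n Z" "Lag n W"
  shows "RST_seq p n (ofr n ` Z) (ofr n ` W) \<in> C \<longleftrightarrow> sg Z W \<in> class_sgs C"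
proof
  assume "sg Z W \<in> class_sgs C"
  then obtain n' Z' W' where L': "Lag n' Z'" "Lag n' W'" "sg Z' W' = sg Z W" "RST_seq p n' (ofr n' ` Z') (ofr n' ` W') \<in> C"
    unfolding class_sgs_def by auto
  obtain X where X: "C = ses_rel `` {X}" using C unfolding ses_classes_eq by (rule quotientE)
  have "seq_iso (Zp p) X (RST_seq p n (ofr n ` Z) (ofr n ` W))" "X \<in> cofinite_ses p"
    using L'(4) seq_iso_trans[OF _ RST_iso[OF L'(1,2) L L'(3)]] unfolding X by auto
  then show "RST_seq p n (ofr n ` Z) (ofr n ` W) \<in> C" unfolding X using RST_in_cofinite[OF L] by simp
qed (use L in \<open>auto simp: class_sgs_def\<close>)

lemma class_sgs_partition: "disjoint_family_on class_sgs (ses_classes p)" "(\<Union>C\<in>ses_classes p. class_sgs C) = sgs"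
proof -
  show "disjoint_family_on class_sgs (ses_classes p)" unfolding disjoint_family_on_def
  proof (intro ballI impI)
    fix C C' :: "(padic, tensor_elt, tensor_elt, tensor_elt set) mod_seq set"
    assume C: "C \<in> ses_classes p" "C' \<in> ses_classes p" "C \<noteq> C'"
    have "s \<notin> class_sgs C'" if s: "s \<in> class_sgs C" for s
    proof
      assume s': "s \<in> class_sgs C'"
      obtain n Z W where "s = sg Z W" "Lag n Z" "Lag n W" using s unfolding class_sgs_def by blast
      then have "RST_seq p n (ofr n ` Z) (ofr n ` W) \<in> C \<inter> C'" using RST_in_class_iff C(1,2) s s' by blast
      then show False using quotient_disj[OF equiv_ses, of C C'] C unfolding ses_classes_eq by blast
    qed
    then show "class_sgs C \<inter> class_sgs C' = {}" by blast
  qed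
  show "(\<Union>C\<in>ses_classes p. class_sgs C) = sgs"
  proof (intro equalityI subsetI)
    fix s assume "s \<in> sgs"
    then obtain n Z W where s: "s = sg Z W" "Lag n Z" "Lag n W" unfolding sgs_def by blast
    have "RST_seq p n (ofr n ` Z) (ofr n ` W) \<in> \<Union>(ses_classes p)"
      unfolding ses_classes_eq Union_quotient[OF equiv_ses] by (rule RST_in_cofinite[OF s(2,3)])
    then show "s \<in> (\<Union>C\<in>ses_classes p. class_sgs C)" using s RST_in_class_iff by blast
  qed (auto simp: sgs_def class_sgs_def)
qed

lemma class_event_eq:
  assumes "C \<in> ses_classes p" shows "class_event p n C = (\<Union>s\<in>class_sgs C. sg_pair_event n s)"
proof -
  have "RST_seq p n Z W \<in> C \<longleftrightarrow> sg (rawz n Z) (rawz n W) \<in> class_sgs C" if "Z \<in> OGr p n" "W \<in> OGr p n" for Z W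
    using RST_in_class_iff[OF assms OGr_Lag(1)[OF that(1)] OGr_Lag(1)[OF that(2)]] OGr_Lag(2) that by simp
  then show ?thesis by (auto simp: class_event_def sg_pair_event_def)
qed

lemma class_sgs_subset: "class_sgs C \<subseteq> sgs"
  by (auto simp: class_sgs_def sgs_def)

lemmas countable_class_sgs = countable_subset[OF class_sgs_subset countable_sgs]

lemma class_event_sets: assumes "C \<in> ses_classes p" shows "class_event p n C \<in> sets (pair_measure_OGr p n)"
  unfolding class_event_eq[OF assms] by (rule sets.countable_UN''[OF countable_class_sgs sg_pair_event_sets])

lemma Q_dist_eq: assumes "C \<in> ses_classes p" shows "Q_dist p n C = infsum (Law n) (class_sgs C)"
proof -
  have "((\<lambda>s. measure (pair_measure_OGr p n) (sg_pair_event n s)) has_sum Q_dist p n C) (class_sgs C)"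
    unfolding Q_dist_def class_event_eq[OF assms] pair_measure_OGr_def
    by (rule PP.has_sum_partition[OF countable_class_sgs])
      (use sg_pair_event_sets in \<open>auto simp: pair_measure_OGr_def sg_pair_event_def disjoint_family_on_def\<close>)
  then show ?thesis unfolding measure_sg_pair_event by (simp add: infsumI)
qed

text \<open>The sets \<open>class_sgs C\<close> partition \<open>sgs\<close>, so the results on the
  laws of s, both for fixed n and in the limit, regroup into results on classes.\<close>

lemma limit_distribution:
  "\<forall>n. (\<forall>Z\<in>OGr p n. \<forall>W\<in>OGr p n. RST_seq p n Z W \<in> cofinite_ses p) \<and>
      (\<forall>C\<in>ses_classes p. class_event p n C \<in> sets (pair_measure_OGr p n)) \<and>
      discrete_distribution (ses_classes p) (Q_dist p n)"
  "\<exists>L. (\<forall>C\<in>ses_classes p. (\<lambda>n. Q_dist p n C) \<longlonglongrightarrow> L C) \<and> discrete_distribution (ses_classes p) L"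
proof -
  have "RST_seq p n Z W \<in> cofinite_ses p" if "Z \<in> OGr p n" "W \<in> OGr p n" for n Z W
    using RST_in_cofinite[OF OGr_Lag(1)[OF that(1)] OGr_Lag(1)[OF that(2)]] OGr_Lag(2) that by simp
  moreover have "(Q_dist p n has_sum 1) (ses_classes p)" for n
    using has_sum_group[OF Law_has_sum_one class_sgs_partition, of n]
    by (rule has_sum_cong[THEN iffD1, rotated]) (simp add: Q_dist_eq)
  ultimately show "\<forall>n. (\<forall>Z\<in>OGr p n. \<forall>W\<in>OGr p n. RST_seq p n Z W \<in> cofinite_ses p) \<and>
      (\<forall>C\<in>ses_classes p. class_event p n C \<in> sets (pair_measure_OGr p n)) \<and>
      discrete_distribution (ses_classes p) (Q_dist p n)"
    using class_event_sets by (simp add: discrete_distribution_def Q_dist_def)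
  define L where "L C = infsum (\<lambda>s. lim (\<lambda>n. Law n s)) (class_sgs C)" for C
  have "(\<lambda>n. Q_dist p n C) \<longlonglongrightarrow> L C" if "C \<in> ses_classes p" for C
    using LC.limit_law(2)[OF class_sgs_subset[of C]] by (simp add: Q_dist_eq[OF that] L_def)
  moreover have "(L has_sum 1) (ses_classes p)"
    unfolding L_def by (rule has_sum_group[OF LC.limit_law(1) class_sgs_partition])
  moreover have "0 \<le> L C" if "C \<in> ses_classes p" for C
    using calculation(1)[OF that] by (rule LIMSEQ_le_const) (simp add: Q_dist_def)
  ultimately show "\<exists>L. (\<forall>C\<in>ses_classes p. (\<lambda>n. Q_dist p n C) \<longlonglongrightarrow> L C) \<and> discrete_distribution (ses_classes p) L"
    unfolding discrete_distribution_def by blast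
qed

end

theorem theorem1p2:
  fixes p :: nat
  assumes "prime p"
  shows "(\<forall>n.
      (\<forall>Z\<in>OGr p n. \<forall>W\<in>OGr p n. RST_seq p n Z W \<in> cofinite_ses p) \<and>
      (\<forall>C\<in>ses_classes p. class_event p n C \<in> sets (pair_measure_OGr p n)) \<and>
      discrete_distribution (ses_classes p) (Q_dist p n)) \<and>
    (\<exists>L. (\<forall>C\<in>ses_classes p. (\<lambda>n. Q_dist p n C) \<longlonglongrightarrow> L C) \<and>
      discrete_distribution (ses_classes p) L)"
  using padic.limit_distribution[OF padic.intro[OF assms]] by (intro conjI)

end
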